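(* Let $p\in(1,\infty)$ and assume that $f_k\rightharpoonup f$ weakly in $L^p(\mathbb{R}^n)$ as $k\to\infty$. Let $t\in(0,1)$ and let $(s_k)_{k\in\mathbb{N}}\subset(0,t)$ be such that $s_k\uparrow t$. Assume that $$\Lambda:=\sup_{k\in\mathbb{N}}\Big(\|f_k\|_{L^p(\mathbb{R}^n)}+(t-s_k)^{\frac1p}\|f_k\|_{\dot W^{s_k,p}(\mathbb{R}^n),t}\Big)<\infty .$$ Then $f\in H^{t,p}(\mathbb{R}^n)$ and there exists a constant $C=C(n,p,t)>0$ such that $$\lim_{\bar t\uparrow t}\ \limsup_{k\to\infty}\ \|(-\Delta)^{\frac{\bar t}{2}}f_k\|_{L^p(\mathbb{R}^n)}\le C\Lambda .$$
   Context: For $t>0$ and $h\in\mathbb{R}^n$ the fractional difference of order $t$ is $$\Delta_h^t f(x)=\sum_{j=0}^\infty(-1)^j\binom{t}{j}f(x+(t-j)h),\qquad \binom{t}{j}=\frac{t(t-1)\cdots(t-j+1)}{j!},\quad \binom t0=1$$ (the series converges in $L^p(\mathbb{R}^n)$ for $f\in L^p(\mathbb{R}^n)$). For $0<s<t$ and $p<\infty$ the Butzer seminorm is $$\|f\|_{\dot W^{s,p}(\mathbb{R}^n),t}=\Big(\int_{\mathbb{R}^n}\int_{\mathbb{R}^n}\frac{|\Delta_h^tf(x)|^p}{|h|^{sp+n}}\,dx\,dh\Big)^{1/p}.$$ $(-\Delta)^{s/2}$ is the Fourier multiplier operator with symbol $|\xi|^s$, and $H^{t,p}(\mathbb{R}^n)$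 is the space of $f\in L^p(\mathbb{R}^n)$ with $(-\Delta)^{t/2}f\in L^p(\mathbb{R}^n)$. *)

theory Defs
  imports "HOL-Analysis.Analysis"
begin

section \<open>Lebesgue spaces and weak convergence\<close>

text \<open>
  Elements of \<open>L\<^sup>p\<close> are represented by Borel functions with values in the complex numbers;
  every class has such a representative, and all notions below respect equality almost everywhere.
  Norms and seminorms take values in \<^typ>\<open>ennreal\<close>, so that they may be infinite.
\<close>

definition ennroot :: "real \<Rightarrow> ennreal \<Rightarrow> ennreal" where
  "ennroot p y = (if y = \<infinity> then \<infinity> else ennreal (enn2real y powr (1 / p)))"

definition Lp_norm :: "real \<Rightarrow> ('a::euclidean_space \<Rightarrow> complex) \<Rightarrow> ennreal" where
  "Lp_norm p f = ennroot p (\<integral>\<^sup>+x. ennreal (norm (f x) powr p) \<partial>lborel)"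

definition Lp :: "real \<Rightarrow> ('a::euclidean_space \<Rightarrow> complex) set" where
  "Lp p = {f \<in> borel_measurable borel. Lp_norm p f < \<infinity>}"

text \<open>
  The boundedness condition makes such a functional constant on classes of functions
  that agree almost everywhere.
\<close>

definition Lp_functional ::
  "real \<Rightarrow> (('a::euclidean_space \<Rightarrow> complex) \<Rightarrow> complex) \<Rightarrow> bool" where
  "Lp_functional p \<Phi> \<longleftrightarrow>
     (\<forall>f\<in>Lp p. \<forall>g\<in>Lp p. \<Phi> (\<lambda>x. f x + g x) = \<Phi> f + \<Phi> g) \<and>
     (\<forall>c. \<forall>f\<in>Lp p. \<Phi> (\<lambda>x. c * f x) = c * \<Phi> f) \<and>
     (\<exists>K::real. \<forall>f\<in>Lp p. ennreal (norm (\<Phi> f)) \<le> ennreal K * Lp_norm p f)"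

definition Lp_weakly_converges ::
  "real \<Rightarrow> (nat \<Rightarrow> 'a::euclidean_space \<Rightarrow> complex) \<Rightarrow> ('a \<Rightarrow> complex) \<Rightarrow> bool" where
  "Lp_weakly_converges p F f \<longleftrightarrow>
     (\<forall>k. F k \<in> Lp p) \<and> f \<in> Lp p \<and>
     (\<forall>\<Phi>. Lp_functional p \<Phi> \<longrightarrow> (\<lambda>k. \<Phi> (F k)) \<longlonglongrightarrow> \<Phi> f)"


section \<open>Fractional differences and the Butzer seminorm\<close>

text \<open>
  For \<open>t > 0\<close> the coefficients are absolutely summable. Hence, for \<open>f\<close> in \<open>L\<^sup>p\<close> and each \<open>h\<close>,
  the series below converges absolutely at almost every \<open>x\<close>, and its pointwise sum is the
  limit of the partial sums in \<open>L\<^sup>p\<close>. The values on the exceptional null set are irrelevant.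
\<close>

definition frac_diff ::
  "real \<Rightarrow> 'a::euclidean_space \<Rightarrow> ('a \<Rightarrow> complex) \<Rightarrow> 'a \<Rightarrow> complex" where
  "frac_diff t h f x =
     (\<Sum>j. (-1) ^ j * of_real (t gchoose j) * f (x + (t - real j) *\<^sub>R h))"

definition Butzer_seminorm ::
  "real \<Rightarrow> real \<Rightarrow> real \<Rightarrow> ('a::euclidean_space \<Rightarrow> complex) \<Rightarrow> ennreal" where
  "Butzer_seminorm s p t f =
     ennroot p (\<integral>\<^sup>+h. (\<integral>\<^sup>+x.
        ennreal (norm (frac_diff t h f x) powr p / norm h powr (s * p + real DIM('a)))
          \<partial>lborel) \<partial>lborel)"


section \<open>Schwartz functions and the Fourier transform\<close>

primrec iter_partial ::
  "'a::euclidean_space list \<Rightarrow> ('a \<Rightarrow> complex) \<Rightarrow> 'a \<Rightarrow> complex" where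
  "iter_partial [] f = f"
| "iter_partial (b # bs) f = (\<lambda>x. frechet_derivative (iter_partial bs f) (at x) b)"

definition schwartz :: "('a::euclidean_space \<Rightarrow> complex) set" where
  "schwartz = {\<phi>. \<forall>bs\<in>lists Basis.
     iter_partial bs \<phi> differentiable_on UNIV \<and>
     (\<forall>m::nat. bounded (range (\<lambda>x. norm x ^ m *\<^sub>R iter_partial bs \<phi> x)))}"

text \<open>
  With this normalisation \<open>- \<Delta>\<close> has the symbol \<open>|\<xi>|\<^sup>2\<close>, without factors of \<open>2 \<pi>\<close>.
\<close>

definition fourier :: "('a::euclidean_space \<Rightarrow> complex) \<Rightarrow> 'a \<Rightarrow> complex" where
  "fourier \<phi> \<xi> = (\<integral>x. cis (- (x \<bullet> \<xi>)) * \<phi> x \<partial>lborel)"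

definition inv_fourier :: "('a::euclidean_space \<Rightarrow> complex) \<Rightarrow> 'a \<Rightarrow> complex" where
  "inv_fourier \<psi> x = (\<integral>\<xi>. cis (x \<bullet> \<xi>) * \<psi> \<xi> \<partial>lborel) / of_real ((2 * pi) ^ DIM('a))"


section \<open>The fractional Laplacian and the space \<open>H\<^sup>t\<^sup>,\<^sup>p\<close>\<close>

definition frac_laplacian_schwartz ::
  "real \<Rightarrow> ('a::euclidean_space \<Rightarrow> complex) \<Rightarrow> 'a \<Rightarrow> complex" where
  "frac_laplacian_schwartz s \<phi> =
     inv_fourier (\<lambda>\<xi>. of_real (norm \<xi> powr s) * fourier \<phi> \<xi>)"

text \<open>
  \<open>frac_laplacian s f\<close> is the tempered distribution \<open>(-\<Delta>)\<^sup>s\<^sup>/\<^sup>2 f\<close>, for \<open>s > 0\<close> and \<open>f\<close> in \<open>L\<^sup>p\<close>,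
  in the bilinear pairing. The symbol \<open>|\<xi>|\<^sup>s\<close> is not smooth at \<open>0\<close>, so it cannot multiply an
  arbitrary tempered distribution. Since the symbol is even, the multiplier operator is its own
  transpose. It maps Schwartz functions \<open>\<phi>\<close> to continuous functions of size
  \<open>O(|x| powr (- n - s))\<close> at infinity, which lie in every \<open>L\<^sup>q\<close>, so the integral converges.
\<close>

definition frac_laplacian ::
  "real \<Rightarrow> ('a::euclidean_space \<Rightarrow> complex) \<Rightarrow> ('a \<Rightarrow> complex) \<Rightarrow> complex" where
  "frac_laplacian s f \<phi> = (\<integral>x. f x * frac_laplacian_schwartz s \<phi> x \<partial>lborel)"

definition represents ::
  "('a::euclidean_space \<Rightarrow> complex) \<Rightarrow> (('a \<Rightarrow> complex) \<Rightarrow> complex) \<Rightarrow> bool" where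
  "represents g T \<longleftrightarrow> (\<forall>\<phi>\<in>schwartz. T \<phi> = (\<integral>x. g x * \<phi> x \<partial>lborel))"

text \<open>
  A representing function in \<open>L\<^sup>p\<close> is unique up to null sets, so the infimum is the norm of that
  function; it is \<open>\<infinity>\<close> if the distribution does not belong to \<open>L\<^sup>p\<close>.
\<close>

definition dist_Lp_norm ::
  "real \<Rightarrow> (('a::euclidean_space \<Rightarrow> complex) \<Rightarrow> complex) \<Rightarrow> ennreal" where
  "dist_Lp_norm p T = (INF g\<in>{g \<in> Lp p. represents g T}. Lp_norm p g)"

definition H_space :: "real \<Rightarrow> real \<Rightarrow> ('a::euclidean_space \<Rightarrow> complex) set" where
  "H_space t p = {f \<in> Lp p. \<exists>g\<in>Lp p. represents g (frac_laplacian t f)}"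

end

theory Submission
  imports Defs "HOL-Probability.Probability"
begin

text \<open>
  Write \<open>A\<^sup>r\<close> for the operator with symbol \<open>|\<xi>| powr r\<close> and \<open>n\<close> for the dimension. The proof has three
  parts: a singular integral, a way to lower the order, and weak compactness.

  The difference of order \<open>t\<close> and step \<open>h\<close> multiplies the Fourier transform by a function \<open>m\<close> of
  \<open>h \<bullet> \<xi>\<close> alone. The integral of \<open>m (h \<bullet> \<xi>) * |h| powr (- r - n)\<close> over all \<open>h\<close> is invariant under
  rotations of \<open>\<xi>\<close> and homogeneous of degree \<open>r\<close>, so for \<open>0 < r < t \<le> 1\<close> it equals \<open>c * |\<xi>| powr r\<close> with a
  constant \<open>c\<close>. Consequently \<open>c * A\<^sup>r f\<close> is the integral of the differences of \<open>f\<close> against the kernel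
  \<open>|h| powr (- r - n)\<close> (\<open>frac_laplacian_kernel\<close>, \<open>frac_laplacian_represented\<close>). For \<open>t < 1\<close> the real part
  of \<open>m u\<close> is at least a multiple of \<open>|u| powr t\<close> for small \<open>u\<close>. As \<open>r\<close> increases to \<open>t\<close>, this makes
  \<open>|c|\<close> at least a multiple of \<open>1 / (t - r)\<close> (\<open>kernel_const_lower\<close>). Now split the singular integral at
  \<open>|h| = 1\<close>. The outer part is controlled by the norm of \<open>f\<close>. On the unit ball Hoelder's inequality
  bounds it by the seminorm of order \<open>s\<close> times a multiple of \<open>(s - r) powr (- (p - 1) / p)\<close>. For
  \<open>r = 2 * s - t\<close> the differences \<open>s - r\<close>, \<open>t - s\<close> and \<open>t - r\<close> agree up to a factor of two. The
  factor \<open>(t - s) powr (1 / p)\<close> in \<open>\<Lambda>\<close> is the one for which all powers of \<open>t - s\<close> then cancel, so the norm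
  of \<open>A\<^sup>r f\<close> is at most \<open>C * \<Lambda>\<close> (\<open>reflected_order_estimate\<close>).

  These orders depend on \<open>k\<close>, but they tend to \<open>t\<close>. A fixed order \<open>r < t\<close> is reached from them by
  \<open>frac_laplacian_lower_order\<close>: for \<open>r < r' < 1\<close> and \<open>\<epsilon> > 0\<close>, the norm of \<open>A\<^sup>r f\<close> is at most
  \<open>\<epsilon> powr (- (r' - r) / 2)\<close> times that of \<open>A\<^bsup>r'\<^esup> f\<close> plus \<open>2 * \<epsilon> powr (r / 2)\<close> times that of \<open>f\<close>. Indeed
  \<open>|\<xi>| powr r\<close> differs from \<open>\<epsilon> powr (- (r' - r) / 2) * (1 + |\<xi>|\<^sup>2 / \<epsilon>) powr (- (r' - r) / 2) * |\<xi>| powr r'\<close>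
  by the Fourier transform of a measure of mass at most \<open>2 * \<epsilon> powr (r / 2)\<close>, and the second factor is
  the transform of a probability measure, a Bessel potential. With \<open>\<epsilon> = 1\<close> this bounds each order
  \<open>r < t\<close> for all large \<open>k\<close>. With small \<open>\<epsilon>\<close> it says that the upper limit over \<open>k\<close> is monotone in \<open>r\<close>
  up to a factor that tends to \<open>1\<close> and a small error, which gives the limit as \<open>r\<close> increases to \<open>t\<close>
  (\<open>tendsto_at_left_of_almost_mono\<close>).

  Finally, a bounded sequence in \<open>L\<^sup>p\<close> whose pairings with test functions converge has a limit in
  \<open>L\<^sup>p\<close> with the same bound (\<open>Lp_weak_limit\<close>); this follows from the uniform convexity of the norm.
  It is applied to the functions representing \<open>A\<^sup>r f\<^sub>k\<close>, as \<open>k\<close> tends to infinity, and then to those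
  representing \<open>A\<^sup>r f\<close>, as \<open>r\<close> increases to \<open>t\<close>. Hence \<open>A\<^sup>t f\<close> is in \<open>L\<^sup>p\<close>.
\<close>

section \<open>Weighted averages in \<open>L\<^sup>p\<close>\<close>

text \<open>
  A convex function lies above its tangents; this is the tangent of the \<open>p\<close>-th
  power at \<open>l\<close>.
\<close>

lemma young_tangent:
  fixes a l p :: real
  assumes "1 < p" "0 \<le> a" "0 \<le> l"
  shows "p * l powr (p - 1) * a \<le> a powr p + (p - 1) * l powr p"
proof -
  define q where "q = p / (p - 1)"
  have q: "q > 1" "1 / p + 1 / q = 1" using assms by (auto simp: q_def field_simps)
  have "a * l powr (p - 1) \<le> a powr p / p + (l powr (p - 1)) powr q / q"
    using Youngs_inequality[of p q a "l powr (p-1)"] assms q by auto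
  also have "(l powr (p - 1)) powr q = l powr p"
    using assms by (simp add: powr_powr q_def)
  finally have "p * (a * l powr (p - 1)) \<le> p * (a powr p / p + l powr p / q)"
    using assms by (intro mult_left_mono) auto
  also have "\<dots> = a powr p + (p - 1) * l powr p"
    using assms by (simp add: q_def field_simps)
  finally show ?thesis by (simp add: mult_ac)
qed

lemma ennreal_le_realE:
  assumes "x \<le> ennreal r"
  obtains J where "x = ennreal J" "0 \<le> J"
  using assms by (cases x) (auto simp: top_unique)

text \<open>
  Integrating the tangent inequality against the weight \<open>a\<close>, with the tangent taken
  at the mean \<open>I / W\<close>, gives Jensen's inequality for a measure of mass at most
  \<open>W\<close>. It takes the place of Hoelder's inequality, and of Minkowski's inequality
  for integrals.
\<close>

lemma weighted_jensen_nn: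
  fixes a u :: "'b \<Rightarrow> real"
  assumes p: "1 < p" and [measurable]: "a \<in> borel_measurable M" "u \<in> borel_measurable M"
    and a: "\<And>x. 0 \<le> a x" and u: "\<And>x. 0 \<le> u x"
    and W: "(\<integral>\<^sup>+x. ennreal (a x) \<partial>M) \<le> ennreal W" and W0: "0 \<le> W"
    and J: "(\<integral>\<^sup>+x. ennreal (a x * u x powr p) \<partial>M) = ennreal J" and J0: "0 \<le> J"
  shows "\<exists>I\<ge>0. (\<integral>\<^sup>+x. ennreal (a x * u x) \<partial>M) = ennreal I \<and> I powr p \<le> W powr (p - 1) * J"
proof -
  define I' where "I' = (\<integral>\<^sup>+x. ennreal (a x * u x) \<partial>M)"
  have key: "ennreal (p * l powr (p - 1)) * I' \<le> ennreal (J + (p - 1) * l powr p * W)" if l: "l \<ge> 0" for l :: real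
  proof -
    have "ennreal (p * l powr (p - 1)) * I' = (\<integral>\<^sup>+x. ennreal (p * l powr (p - 1)) * ennreal (a x * u x) \<partial>M)"
      unfolding I'_def by (rule nn_integral_cmult[symmetric]) simp
    also have "\<dots> = (\<integral>\<^sup>+x. ennreal (p * l powr (p - 1) * (a x * u x)) \<partial>M)"
      by (intro nn_integral_cong ennreal_mult[symmetric]) (use p a u in auto)
    also have "\<dots> \<le> (\<integral>\<^sup>+x. ennreal (a x * u x powr p) + ennreal ((p - 1) * l powr p) * ennreal (a x) \<partial>M)"
    proof (rule nn_integral_mono)
      fix x
      have "p * l powr (p - 1) * (a x * u x) = a x * (p * l powr (p - 1) * u x)" by simp
      also have "\<dots> \<le> a x * (u x powr p + (p - 1) * l powr p)"
        using young_tangent[OF p u l] a by (intro mult_left_mono) auto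
      also have "\<dots> = a x * u x powr p + ((p - 1) * l powr p) * a x" by (simp add: algebra_simps)
      finally show "ennreal (p * l powr (p - 1) * (a x * u x)) \<le> ennreal (a x * u x powr p) + ennreal ((p - 1) * l powr p) * ennreal (a x)"
        using p a u by (simp flip: ennreal_plus ennreal_mult add: ennreal_leI)
    qed
    also have "\<dots> = ennreal J + ennreal ((p - 1) * l powr p) * (\<integral>\<^sup>+x. ennreal (a x) \<partial>M)"
      by (simp add: nn_integral_add nn_integral_cmult J)
    also have "\<dots> \<le> ennreal J + ennreal ((p - 1) * l powr p) * ennreal W"
      by (intro add_left_mono mult_left_mono W) auto
    also have "\<dots> = ennreal (J + (p - 1) * l powr p * W)"
      using p J0 W0 by (simp flip: ennreal_plus ennreal_mult)
    finally show ?thesis .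
  qed
  have "ennreal p * I' < \<infinity>" using key[of 1] by (simp add: le_less_trans)
  then have "I' < \<infinity>" using p by (auto simp: ennreal_mult_less_top)
  then obtain I where I: "I' = ennreal I" "I \<ge> 0" by (cases I') auto
  have key': "p * l powr (p - 1) * I \<le> J + (p - 1) * l powr p * W" if "l \<ge> 0" for l
    using key[OF that] p I J0 W0 by (simp flip: ennreal_mult del: ennreal_plus)
  show ?thesis
  proof (cases "W = 0")
    case True
    then have "AE x in M. ennreal (a x) = 0" using W by (simp add: nn_integral_0_iff_AE)
    then have "AE x in M. ennreal (a x * u x) = 0"
    proof eventually_elim
      case (elim x)
      then have "a x = 0" using a[of x] by (simp add: ennreal_eq_0_iff)
      then show ?case by simp
    qed
    then have "I' = 0" unfolding I'_def by (subst nn_integral_0_iff_AE) auto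
    then show ?thesis using J0 unfolding I'_def by (intro exI[of _ 0]) auto
  next
    case False
    then have W1: "W > 0" using W0 by simp
    \<comment> \<open>The tangent at the weighted mean gives the best bound.\<close>
    have "p * (I / W) powr (p - 1) * I \<le> J + (p - 1) * (I / W) powr p * W"
      using key'[of "I / W"] I W1 by (simp only: divide_nonneg_pos)
    moreover have e1: "(I / W) powr p * W = I powr p / W powr (p - 1)"
      using I W1 by (simp add: powr_divide powr_diff)
    moreover have "(I / W) powr (p - 1) * I = I powr p / W powr (p - 1)"
      using I W1 p by (cases "I = 0") (auto simp: powr_divide powr_diff)
    ultimately have "p * (I powr p / W powr (p - 1)) \<le> J + (p - 1) * (I powr p / W powr (p - 1))"
      by (metis mult.assoc)
    then have "I powr p / W powr (p - 1) \<le> J" by (simp only: left_diff_distrib)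
    then have "I powr p \<le> W powr (p - 1) * J"
      using W1 by (simp add: divide_le_eq mult.commute)
    then show ?thesis using I unfolding I'_def by auto
  qed
qed

lemma weighted_jensen:
  fixes w u :: "'b \<Rightarrow> complex"
  assumes p: "1 < p" and [measurable]: "w \<in> borel_measurable M" "u \<in> borel_measurable M"
    and W: "(\<integral>\<^sup>+x. ennreal (norm (w x)) \<partial>M) \<le> ennreal W" and W0: "0 < W"
  shows "ennreal (norm (\<integral>x. w x * u x \<partial>M) powr p)
     \<le> ennreal (W powr (p - 1)) * (\<integral>\<^sup>+x. ennreal (norm (w x) * norm (u x) powr p) \<partial>M)"
proof (cases "(\<integral>\<^sup>+x. ennreal (norm (w x) * norm (u x) powr p) \<partial>M) = \<infinity>")
  case True
  then show ?thesis using W0 by (auto simp: ennreal_mult_top)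
next
  case False
  then obtain J where J: "(\<integral>\<^sup>+x. ennreal (norm (w x) * norm (u x) powr p) \<partial>M) = ennreal J" "J \<ge> 0"
    by (cases "(\<integral>\<^sup>+x. ennreal (norm (w x) * norm (u x) powr p) \<partial>M)") auto
  obtain I where I: "I \<ge> 0" "(\<integral>\<^sup>+x. ennreal (norm (w x) * norm (u x)) \<partial>M) = ennreal I"
     "I powr p \<le> W powr (p - 1) * J"
    using weighted_jensen_nn[of p "\<lambda>x. norm (w x)" M "\<lambda>x. norm (u x)" W J] p W W0 J by auto
  have int: "integrable M (\<lambda>x. w x * u x)"
    by (rule integrableI_bounded) (auto simp: norm_mult I)
  have "ennreal (norm (\<integral>x. w x * u x \<partial>M)) \<le> ennreal I"
    using integral_norm_bound_ennreal[OF int] I by (simp add: norm_mult)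
  then have "norm (\<integral>x. w x * u x \<partial>M) powr p \<le> W powr (p - 1) * J"
    using I p by (meson ennreal_le_iff norm_ge_zero order_trans powr_mono2 less_imp_le zero_less_one)
  then show ?thesis using J by (simp flip: ennreal_mult)
qed

lemma ennroot_ennreal: "0 < p \<Longrightarrow> 0 \<le> x \<Longrightarrow> ennroot p (ennreal (x powr p)) = ennreal x"
  by (simp add: ennroot_def powr_powr)

lemma ennroot_mono: "0 < p \<Longrightarrow> a \<le> b \<Longrightarrow> ennroot p a \<le> ennroot p b"
  unfolding ennroot_def
  by (auto simp: top_unique intro!: ennreal_leI powr_mono2 enn2real_mono simp: less_top)

lemma ennroot_finite_iff [simp]: "ennroot p y < \<infinity> \<longleftrightarrow> y < \<infinity>"
  by (simp add: ennroot_def less_top)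

lemma ennroot_cases:
  assumes "0 < p" "y < \<infinity>"
  obtains N where "N \<ge> 0" "y = ennreal (N powr p)" "ennroot p y = ennreal N"
proof -
  obtain Y where Y: "y = ennreal Y" "Y \<ge> 0" using assms by (cases y) auto
  show thesis
    using assms Y by (intro that[of "Y powr (1 / p)"]) (auto simp: powr_powr ennroot_def)
qed

definition power_integral :: "real \<Rightarrow> ('a::euclidean_space \<Rightarrow> complex) \<Rightarrow> ennreal" where
  "power_integral p f = (\<integral>\<^sup>+x. ennreal (norm (f x) powr p) \<partial>lborel)"

lemma Lp_norm_power_integral: "Lp_norm p f = ennroot p (power_integral p f)"
  by (simp add: Lp_norm_def power_integral_def)

lemma Lp_iff: "f \<in> Lp p \<longleftrightarrow> f \<in> borel_measurable borel \<and> power_integral p f < \<infinity>"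
  unfolding Lp_def Lp_norm_power_integral by (simp only: mem_Collect_eq ennroot_finite_iff)

lemma Lp_measurable [measurable_dest]: "f \<in> Lp p \<Longrightarrow> f \<in> borel_measurable borel"
  by (simp add: Lp_def)

lemma Lp_cases:
  assumes "0 < p" "f \<in> Lp p"
  obtains N where "N \<ge> 0" "power_integral p f = ennreal (N powr p)" "Lp_norm p f = ennreal N"
  using ennroot_cases[of p "power_integral p f"] assms by (auto simp: Lp_iff Lp_norm_power_integral)

lemma Lp_norm_leI:
  assumes "0 < p" "0 \<le> K" "power_integral p f \<le> ennreal (K powr p)"
  shows "Lp_norm p f \<le> ennreal K"
  using ennroot_mono[OF assms(1,3)] assms by (simp add: Lp_norm_power_integral ennroot_ennreal)

lemma power_integral_leI:
  assumes "0 < p" "0 \<le> K" "Lp_norm p f \<le> ennreal K"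
  shows "power_integral p f \<le> ennreal (K powr p)"
proof -
  have "power_integral p f < \<infinity>" using assms(3) by (metis Lp_norm_power_integral ennroot_finite_iff le_less_trans ennreal_less_top infinity_ennreal_def)
  then obtain N where N: "N \<ge> 0" "power_integral p f = ennreal (N powr p)" "ennroot p (power_integral p f) = ennreal N"
    using ennroot_cases assms(1) by blast
  then have "N \<le> K" using assms by (simp add: Lp_norm_power_integral)
  then show ?thesis using N assms by (simp add: powr_mono2 ennreal_leI)
qed

lemma nn_integral_translate:
  fixes f :: "'a::euclidean_space \<Rightarrow> ennreal"
  assumes [measurable]: "f \<in> borel_measurable borel"
  shows "(\<integral>\<^sup>+x. f (x + y) \<partial>lborel) = (\<integral>\<^sup>+x. f x \<partial>lborel)"
proof -
  have "(\<integral>\<^sup>+x. f x \<partial>lborel) = (\<integral>\<^sup>+x. f x \<partial>(distr lborel borel ((+) y)))"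
    by (simp add: lborel_distr_plus)
  also have "\<dots> = (\<integral>\<^sup>+x. f (y + x) \<partial>lborel)" by (subst nn_integral_distr) auto
  finally show ?thesis by (simp add: add.commute)
qed

lemma integral_translate:
  fixes f :: "'a::euclidean_space \<Rightarrow> complex"
  assumes [measurable]: "f \<in> borel_measurable borel"
  shows "(\<integral>x. f (x + y) \<partial>lborel) = (\<integral>x. f x \<partial>lborel)"
proof -
  have "(\<integral>x. f x \<partial>lborel) = (\<integral>x. f x \<partial>(distr lborel borel ((+) y)))"
    by (simp add: lborel_distr_plus)
  also have "\<dots> = (\<integral>x. f (y + x) \<partial>lborel)" by (subst integral_distr) auto
  finally show ?thesis by (simp add: add.commute)
qed

lemma integrable_translate:
  fixes f :: "'a::euclidean_space \<Rightarrow> complex"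
  assumes "integrable lborel f"
  shows "integrable lborel (\<lambda>x. f (x + y))"
proof -
  have [measurable]: "f \<in> borel_measurable borel" using assms by auto
  show ?thesis using assms nn_integral_translate[of "\<lambda>x. ennreal (norm (f x))" y]
    by (simp add: integrable_iff_bounded)
qed

lemma power_integral_translate:
  assumes [measurable]: "f \<in> borel_measurable borel"
  shows "power_integral p (\<lambda>x. f (x + y)) = power_integral p f"
  unfolding power_integral_def by (rule nn_integral_translate) simp

lemma powr_convex_comb:
  fixes \<theta> u v p :: real
  assumes p: "1 < p" and uv: "0 \<le> u" "0 \<le> v" and \<theta>: "0 \<le> \<theta>" "\<theta> \<le> 1"
  shows "(\<theta> * u + (1 - \<theta>) * v) powr p \<le> \<theta> * u powr p + (1 - \<theta>) * v powr p"
proof -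
  define x where "x = \<theta> * u + (1 - \<theta>) * v"
  have x: "x \<ge> 0" using assms by (simp add: x_def)
  have e: "p * x powr (p - 1) * x = p * x powr p"
    using x by (cases "x = 0") (auto simp: powr_diff)
  have "\<theta> * (p * x powr (p - 1) * u) + (1 - \<theta>) * (p * x powr (p - 1) * v)
      \<le> \<theta> * (u powr p + (p - 1) * x powr p) + (1 - \<theta>) * (v powr p + (p - 1) * x powr p)"
    using young_tangent[OF p uv(1) x] young_tangent[OF p uv(2) x] \<theta>
    by (intro add_mono mult_left_mono) auto
  also have "\<theta> * (p * x powr (p - 1) * u) + (1 - \<theta>) * (p * x powr (p - 1) * v) = p * x powr (p - 1) * x"
    by (simp add: x_def algebra_simps)
  finally show ?thesis unfolding e x_def[symmetric] by (simp add: algebra_simps)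
qed

text \<open>
  With \<open>\<theta> = a / (a + b)\<close>, the sum \<open>|f| + |g|\<close> is \<open>a +
  b\<close> times the convex combination of \<open>|f| / a\<close> and \<open>|g| / b\<close>,
  to which convexity of the \<open>p\<close>-th power applies.
\<close>

lemma Lp_norm_triangle:
  assumes p: "1 < p" and [measurable]: "f \<in> borel_measurable borel" "g \<in> borel_measurable borel"
    and A: "0 \<le> A" "Lp_norm p f \<le> ennreal A" and B: "0 \<le> B" "Lp_norm p g \<le> ennreal B"
  shows "Lp_norm p (\<lambda>x. f x + g x) \<le> ennreal (A + B)"
proof (rule ennreal_le_epsilon)
  fix e :: real assume e: "e > 0"
  \<comment> \<open>The summands \<open>e / 2\<close> make the denominators positive when a norm vanishes.\<close>
  define a where "a = A + e / 2"
  define b where "b = B + e / 2"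
  have ab: "a > 0" "b > 0" using e A B by (auto simp: a_def b_def)
  define \<theta> where "\<theta> = a / (a + b)"
  have \<theta>: "0 \<le> \<theta>" "\<theta> \<le> 1" "1 - \<theta> = b / (a + b)" using ab by (auto simp: \<theta>_def field_simps)
  have fa: "power_integral p f \<le> ennreal (a powr p)" 
    using A e p by (intro power_integral_leI order_trans[OF A(2)]) (auto simp: a_def intro!: ennreal_leI)
  have gb: "power_integral p g \<le> ennreal (b powr p)" 
    using B e p by (intro power_integral_leI order_trans[OF B(2)]) (auto simp: b_def intro!: ennreal_leI)
  define cf where "cf = (a + b) powr p * \<theta> / a powr p"
  define cg where "cg = (a + b) powr p * (1 - \<theta>) / b powr p"
  have cfg: "cf \<ge> 0" "cg \<ge> 0" using \<theta> ab by (auto simp: cf_def cg_def)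
  have pw: "norm (f x + g x) powr p \<le> cf * norm (f x) powr p + cg * norm (g x) powr p" for x
  proof -
    have "norm (f x + g x) powr p \<le> (norm (f x) + norm (g x)) powr p"
      using p by (intro powr_mono2 norm_triangle_ineq) auto
    also have "norm (f x) + norm (g x) = (a + b) * (\<theta> * (norm (f x) / a) + (1 - \<theta>) * (norm (g x) / b))"
    proof -
      have "(a + b) * (a / (a + b) * (norm (f x) / a)) = norm (f x)" "(a + b) * (b / (a + b) * (norm (g x) / b)) = norm (g x)"
        using ab by simp_all
      then show ?thesis unfolding \<theta>(3) unfolding \<theta>_def by (simp only: distrib_left)
    qed
    also have "\<dots> powr p = (a + b) powr p * (\<theta> * (norm (f x) / a) + (1 - \<theta>) * (norm (g x) / b)) powr p"
      by (rule powr_mult)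
    also have "\<dots> \<le> (a + b) powr p * (\<theta> * (norm (f x) / a) powr p + (1 - \<theta>) * (norm (g x) / b) powr p)"
      using ab \<theta> p by (intro mult_left_mono powr_convex_comb) auto
    also have "\<dots> = cf * norm (f x) powr p + cg * norm (g x) powr p"
      using ab by (simp add: cf_def cg_def powr_divide algebra_simps)
    finally show ?thesis .
  qed
  have "power_integral p (\<lambda>x. f x + g x) \<le> (\<integral>\<^sup>+x. ennreal cf * ennreal (norm (f x) powr p) + ennreal cg * ennreal (norm (g x) powr p) \<partial>lborel)"
    unfolding power_integral_def
    by (intro nn_integral_mono) (use pw cfg in \<open>auto simp flip: ennreal_mult ennreal_plus intro!: ennreal_leI\<close>)
  also have "\<dots> = ennreal cf * power_integral p f + ennreal cg * power_integral p g"
    by (simp add: nn_integral_add nn_integral_cmult power_integral_def)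
  also have "\<dots> \<le> ennreal cf * ennreal (a powr p) + ennreal cg * ennreal (b powr p)"
    by (intro add_mono mult_left_mono fa gb) auto
  also have "\<dots> = ennreal ((a + b) powr p)"
    using cfg ab by (simp flip: ennreal_mult ennreal_plus add: cf_def cg_def field_simps)
  finally have "Lp_norm p (\<lambda>x. f x + g x) \<le> ennreal (a + b)"
    using ab p by (intro Lp_norm_leI) auto
  also have "a + b = (A + B) + e" by (simp add: a_def b_def)
  finally show "Lp_norm p (\<lambda>x. f x + g x) \<le> ennreal (A + B) + ennreal e"
    using A B e by simp
qed

lemma power_integral_cmult:
  assumes "0 < p" "f \<in> borel_measurable borel"
  shows "power_integral p (\<lambda>x. c * f x) = ennreal (norm c powr p) * power_integral p f"
  unfolding power_integral_def using assms
  by (subst nn_integral_cmult[symmetric]) (auto simp: norm_mult powr_mult ennreal_mult)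

text \<open>
  A bounded integrable \<open>\<phi>\<close> is a weight of finite mass against which \<open>|f|
  powr p\<close> is integrable, so Jensen's inequality suffices. The bound is uniform in
  \<open>f\<close> and in the translation \<open>y\<close>.
\<close>

lemma pairing_bound:
  fixes \<phi> :: "'a::euclidean_space \<Rightarrow> complex"
  assumes p: "1 < p" and int: "integrable lborel \<phi>" and bd: "\<And>x. norm (\<phi> x) \<le> B"
  shows "\<exists>K\<ge>0. \<forall>f\<in>Lp p. \<forall>y. (\<integral>\<^sup>+x. ennreal (norm (f (x + y)) * norm (\<phi> x)) \<partial>lborel) \<le> ennreal K * Lp_norm p f"
proof -
  have [measurable]: "\<phi> \<in> borel_measurable borel" using int by auto
  define W where "W = (\<integral>x. norm (\<phi> x) \<partial>lborel)"
  have W0: "W \<ge> 0" by (simp add: W_def)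
  have W: "(\<integral>\<^sup>+x. ennreal (norm (\<phi> x)) \<partial>lborel) = ennreal W"
    unfolding W_def using int by (intro nn_integral_eq_integral) auto
  have B0: "B \<ge> 0" using bd[of 0] norm_ge_zero order_trans by blast
  define K where "K = (W powr (p - 1) * B) powr (1 / p)"
  have "(\<integral>\<^sup>+x. ennreal (norm (f (x + y)) * norm (\<phi> x)) \<partial>lborel) \<le> ennreal K * Lp_norm p f" if f: "f \<in> Lp p" for f y
  proof -
    have [measurable]: "f \<in> borel_measurable borel" using f by (simp add: Lp_iff)
    obtain N where N: "N \<ge> 0" "power_integral p f = ennreal (N powr p)" "Lp_norm p f = ennreal N"
      using Lp_cases f p by (metis less_trans zero_less_one)
    have le: "(\<integral>\<^sup>+x. ennreal (norm (\<phi> x) * norm (f (x + y)) powr p) \<partial>lborel) \<le> ennreal (B * N powr p)"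
    proof -
      have "(\<integral>\<^sup>+x. ennreal (norm (\<phi> x) * norm (f (x + y)) powr p) \<partial>lborel) \<le> (\<integral>\<^sup>+x. ennreal B * ennreal (norm (f (x + y)) powr p) \<partial>lborel)"
        by (intro nn_integral_mono) (use bd B0 in \<open>auto simp flip: ennreal_mult intro!: ennreal_leI mult_right_mono\<close>)
      also have "\<dots> = ennreal B * power_integral p (\<lambda>x. f (x + y))"
        by (simp add: nn_integral_cmult power_integral_def)
      also have "\<dots> = ennreal (B * N powr p)"
        using power_integral_translate[of f p y] N B0 by (simp add: ennreal_mult)
      finally show ?thesis .
    qed
    then obtain J where J: "(\<integral>\<^sup>+x. ennreal (norm (\<phi> x) * norm (f (x + y)) powr p) \<partial>lborel) = ennreal J" "J \<ge> 0"
      by (rule ennreal_le_realE)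
    have J2: "J \<le> B * N powr p" using le J B0 by simp
    obtain I where I: "I \<ge> 0" "(\<integral>\<^sup>+x. ennreal (norm (\<phi> x) * norm (f (x + y))) \<partial>lborel) = ennreal I" "I powr p \<le> W powr (p - 1) * J"
      using weighted_jensen_nn[of p "\<lambda>x. norm (\<phi> x)" lborel "\<lambda>x. norm (f (x + y))" W J] p W W0 J by auto
    have "I powr p \<le> W powr (p - 1) * (B * N powr p)"
      using I J2 by (meson mult_left_mono order_trans powr_ge_zero)
    also have "\<dots> = (K * N) powr p"
      using p N B0 by (simp add: K_def powr_mult powr_powr)
    finally have "I \<le> K * N"
      using p by (smt (verit) K_def N(1) mult_nonneg_nonneg powr_ge_zero powr_less_mono2)
    then show ?thesis using I N by (simp add: mult.commute K_def flip: ennreal_mult)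
  qed
  then show ?thesis by (intro exI[of _ K]) (auto simp: K_def)
qed

lemma integrable_pairing:
  fixes \<phi> :: "'a::euclidean_space \<Rightarrow> complex"
  assumes p: "1 < p" and int: "integrable lborel \<phi>" and bd: "\<And>x. norm (\<phi> x) \<le> B" and f: "f \<in> Lp p"
  shows "integrable lborel (\<lambda>x. f x * \<phi> x)"
proof -
  have [measurable]: "\<phi> \<in> borel_measurable borel" "f \<in> borel_measurable borel" using int f by (auto simp: Lp_iff)
  obtain N where N: "N \<ge> 0" "Lp_norm p f = ennreal N" using Lp_cases f p by (metis less_trans zero_less_one)
  obtain K where "K \<ge> 0" "(\<integral>\<^sup>+x. ennreal (norm (f (x + 0)) * norm (\<phi> x)) \<partial>lborel) \<le> ennreal K * Lp_norm p f"
    using pairing_bound[OF p int bd] f by blast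
  then show ?thesis using N
    by (intro integrableI_bounded) (auto simp: norm_mult ennreal_mult_less_top elim!: le_less_trans simp flip: ennreal_mult)
qed

section \<open>Mixtures of translations\<close>

text \<open>
  The convolution of \<open>f\<close> with a finite complex measure, where the measure is given
  as the image under \<open>Y\<close> of the weight \<open>w\<close> on an arbitrary space
  \<open>M\<close>. Fractional differences (with \<open>M\<close> the natural numbers) and
  Bessel potentials (with \<open>M\<close> a product of Lebesgue measures) both have this form.
\<close>

definition wtrans :: "'b measure \<Rightarrow> ('b \<Rightarrow> complex) \<Rightarrow> ('b \<Rightarrow> 'a::euclidean_space) \<Rightarrow> ('a \<Rightarrow> complex) \<Rightarrow> 'a \<Rightarrow> complex" where
  "wtrans M w Y f x = (\<integral>\<omega>. w \<omega> * f (x + Y \<omega>) \<partial>M)"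

text \<open>
  The factor by which such a convolution multiplies the Fourier transform.
\<close>

definition wtrans_symbol :: "'b measure \<Rightarrow> ('b \<Rightarrow> complex) \<Rightarrow> ('b \<Rightarrow> 'a::euclidean_space) \<Rightarrow> 'a \<Rightarrow> complex" where
  "wtrans_symbol M w Y \<xi> = (\<integral>\<omega>. w \<omega> * cis (Y \<omega> \<bullet> \<xi>) \<partial>M)"

locale translation_mixture = sigma_finite_measure M for M :: "'b measure" +
  fixes w :: "'b \<Rightarrow> complex" and Y :: "'b \<Rightarrow> 'a::euclidean_space"
  assumes w_int: "integrable M w" and Y_meas [measurable]: "Y \<in> borel_measurable M"
begin

lemma w_meas [measurable]: "w \<in> borel_measurable M" using w_int by auto

lemma pair_lborel: "pair_sigma_finite lborel M" "pair_sigma_finite M lborel"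
  by (simp_all add: pair_sigma_finite_def lborel.sigma_finite_measure_axioms sigma_finite_measure_axioms)

lemma wtrans_meas [measurable]:
  assumes [measurable]: "f \<in> borel_measurable borel"
  shows "wtrans M w Y f \<in> borel_measurable borel"
  unfolding wtrans_def by measurable

lemma mass_nn:
  assumes "(\<integral>\<omega>. norm (w \<omega>) \<partial>M) \<le> W"
  shows "(\<integral>\<^sup>+\<omega>. ennreal (norm (w \<omega>)) \<partial>M) \<le> ennreal W"
  using assms w_int by (subst nn_integral_eq_integral) (auto intro!: ennreal_leI)

text \<open>
  Young's inequality for the convolution with a measure: Jensen's inequality in
  \<open>\<omega>\<close>, then Fubini's theorem and translation invariance.
\<close>

lemma power_integral_wtrans_le:
  assumes p: "1 < p" and f [measurable]: "f \<in> borel_measurable borel"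
    and W: "0 < W" "(\<integral>\<omega>. norm (w \<omega>) \<partial>M) \<le> W"
  shows "power_integral p (wtrans M w Y f) \<le> ennreal (W powr p) * power_integral p f"
proof -
  interpret pair_sigma_finite M lborel by (rule pair_lborel)
  have "power_integral p (wtrans M w Y f)
    \<le> (\<integral>\<^sup>+x. ennreal (W powr (p - 1)) * (\<integral>\<^sup>+\<omega>. ennreal (norm (w \<omega>) * norm (f (x + Y \<omega>)) powr p) \<partial>M) \<partial>lborel)"
    unfolding power_integral_def wtrans_def
    by (intro nn_integral_mono weighted_jensen) (use p W mass_nn in auto)
  also have "\<dots> = ennreal (W powr (p - 1)) * (\<integral>\<^sup>+x. (\<integral>\<^sup>+\<omega>. ennreal (norm (w \<omega>) * norm (f (x + Y \<omega>)) powr p) \<partial>M) \<partial>lborel)"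
    by (rule nn_integral_cmult) measurable
  also have "(\<integral>\<^sup>+x. (\<integral>\<^sup>+\<omega>. ennreal (norm (w \<omega>) * norm (f (x + Y \<omega>)) powr p) \<partial>M) \<partial>lborel)
     = (\<integral>\<^sup>+\<omega>. (\<integral>\<^sup>+x. ennreal (norm (w \<omega>) * norm (f (x + Y \<omega>)) powr p) \<partial>lborel) \<partial>M)"
    by (rule Fubini') measurable
  also have "\<dots> = (\<integral>\<^sup>+\<omega>. ennreal (norm (w \<omega>)) * power_integral p f \<partial>M)"
    using power_integral_translate[OF f, of p] by (simp add: ennreal_mult power_integral_def nn_integral_cmult)
  also have "\<dots> = (\<integral>\<^sup>+\<omega>. ennreal (norm (w \<omega>)) \<partial>M) * power_integral p f"
    by (rule nn_integral_multc) measurable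
  also have "ennreal (W powr (p - 1)) * \<dots> \<le> ennreal (W powr (p - 1)) * (ennreal W * power_integral p f)"
    by (intro mult_left_mono mult_right_mono mass_nn W) auto
  also have "\<dots> = ennreal (W powr p) * power_integral p f"
    using W by (simp add: mult.assoc[symmetric] powr_diff flip: ennreal_mult)
  finally show ?thesis .
qed

lemma wtrans_Lp:
  assumes p: "1 < p" and f: "f \<in> Lp p"
  shows "wtrans M w Y f \<in> Lp p"
proof -
  define W where "W = 1 + (\<integral>\<omega>. norm (w \<omega>) \<partial>M)"
  have "W > 0" by (simp add: W_def add_pos_nonneg)
  then have "power_integral p (wtrans M w Y f) \<le> ennreal (W powr p) * power_integral p f"
    using f p by (intro power_integral_wtrans_le) (auto simp: Lp_iff W_def)
  also have "\<dots> < \<infinity>" using f by (auto simp: Lp_iff ennreal_mult_less_top)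
  finally show ?thesis using f by (auto simp: Lp_iff)
qed

lemma Lp_norm_wtrans_le:
  assumes p: "1 < p" and f: "f \<in> Lp p" and W: "0 < W" "(\<integral>\<omega>. norm (w \<omega>) \<partial>M) \<le> W"
  shows "Lp_norm p (wtrans M w Y f) \<le> ennreal W * Lp_norm p f"
proof -
  obtain N where N: "N \<ge> 0" "power_integral p f = ennreal (N powr p)" "Lp_norm p f = ennreal N"
    using Lp_cases f p by (metis less_trans zero_less_one)
  have "power_integral p (wtrans M w Y f) \<le> ennreal (W powr p) * power_integral p f"
    using f p W by (intro power_integral_wtrans_le) (auto simp: Lp_iff)
  also have "\<dots> = ennreal ((W * N) powr p)" using N W by (simp add: powr_mult flip: ennreal_mult)
  finally have "Lp_norm p (wtrans M w Y f) \<le> ennreal (W * N)"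
    using N W p by (intro Lp_norm_leI) auto
  then show ?thesis using N W by (simp add: ennreal_mult)
qed

text \<open>
  Substituting \<open>x - Y \<omega>\<close> for \<open>x\<close> moves each translation, with
  the opposite sign, to the other factor.
\<close>

lemma wtrans_duality:
  assumes p: "1 < p" and f: "f \<in> Lp p"
    and int: "integrable lborel \<phi>" and bd: "\<And>x. norm (\<phi> x) \<le> B"
  shows "(\<integral>x. wtrans M w Y f x * \<phi> x \<partial>lborel) = (\<integral>x. f x * wtrans M w (\<lambda>\<omega>. - Y \<omega>) \<phi> x \<partial>lborel)"
proof -
  interpret pair_sigma_finite M lborel by (rule pair_lborel)
  have [measurable]: "\<phi> \<in> borel_measurable borel" "f \<in> borel_measurable borel" using int f by (auto simp: Lp_iff)
  obtain N where N: "N \<ge> 0" "Lp_norm p f = ennreal N"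
    using Lp_cases f p by (metis less_trans zero_less_one)
  obtain K where K: "K \<ge> 0" "\<And>y. (\<integral>\<^sup>+x. ennreal (norm (f (x + y)) * norm (\<phi> x)) \<partial>lborel) \<le> ennreal K * Lp_norm p f"
    using pairing_bound[OF p int bd] f by blast
  have fin: "(\<integral>\<^sup>+\<omega>. (\<integral>\<^sup>+x. ennreal (norm (w \<omega>) * (norm (f (x + Y \<omega>)) * norm (\<phi> x))) \<partial>lborel) \<partial>M) < \<infinity>"
  proof -
    have "(\<integral>\<^sup>+\<omega>. (\<integral>\<^sup>+x. ennreal (norm (w \<omega>) * (norm (f (x + Y \<omega>)) * norm (\<phi> x))) \<partial>lborel) \<partial>M)
      \<le> (\<integral>\<^sup>+\<omega>. ennreal (norm (w \<omega>)) * (ennreal K * ennreal N) \<partial>M)"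
      by (intro nn_integral_mono) (use K(2) N in \<open>simp add: ennreal_mult nn_integral_cmult mult_left_mono\<close>)
    also have "\<dots> = (\<integral>\<^sup>+\<omega>. ennreal (norm (w \<omega>)) \<partial>M) * (ennreal K * ennreal N)"
      by (rule nn_integral_multc) measurable
    also have "\<dots> < \<infinity>"
      using w_int by (auto simp: integrable_iff_bounded ennreal_mult_less_top)
    finally show ?thesis .
  qed
  have I1: "integrable (M \<Otimes>\<^sub>M lborel) (\<lambda>(\<omega>, x). w \<omega> * f (x + Y \<omega>) * \<phi> x)"
    by (rule integrableI_bounded)
       (use fin in \<open>auto simp: lborel.nn_integral_fst[symmetric] split_beta' norm_mult mult.assoc\<close>)
  have "(\<integral>x. wtrans M w Y f x * \<phi> x \<partial>lborel) = (\<integral>x. (\<integral>\<omega>. w \<omega> * f (x + Y \<omega>) * \<phi> x \<partial>M) \<partial>lborel)"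
    unfolding wtrans_def by simp
  also have "\<dots> = (\<integral>\<omega>. (\<integral>x. w \<omega> * f (x + Y \<omega>) * \<phi> x \<partial>lborel) \<partial>M)"
    using Fubini_integral[of "\<lambda>\<omega> x. w \<omega> * f (x + Y \<omega>) * \<phi> x"] I1 by simp
  also have "\<dots> = (\<integral>\<omega>. (\<integral>x. w \<omega> * f x * \<phi> (x - Y \<omega>) \<partial>lborel) \<partial>M)"
  proof (rule Bochner_Integration.integral_cong[OF refl])
    fix \<omega>
    show "(\<integral>x. w \<omega> * f (x + Y \<omega>) * \<phi> x \<partial>lborel) = (\<integral>x. w \<omega> * f x * \<phi> (x - Y \<omega>) \<partial>lborel)"
      using integral_translate[of "\<lambda>x. w \<omega> * f x * \<phi> (x - Y \<omega>)" "Y \<omega>"] by simp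
  qed
  also have "\<dots> = (\<integral>x. (\<integral>\<omega>. w \<omega> * f x * \<phi> (x - Y \<omega>) \<partial>M) \<partial>lborel)"
  proof (rule Fubini_integral[symmetric])
    have "(\<integral>\<^sup>+\<omega>. (\<integral>\<^sup>+x. ennreal (norm (w \<omega>) * (norm (f x) * norm (\<phi> (x - Y \<omega>)))) \<partial>lborel) \<partial>M) < \<infinity>"
    proof -
      have "(\<integral>\<^sup>+x. ennreal (norm (w \<omega>) * (norm (f x) * norm (\<phi> (x - Y \<omega>)))) \<partial>lborel)
         = (\<integral>\<^sup>+x. ennreal (norm (w \<omega>) * (norm (f (x + Y \<omega>)) * norm (\<phi> x))) \<partial>lborel)" for \<omega>
        using nn_integral_translate[of "\<lambda>x. ennreal (norm (w \<omega>) * (norm (f x) * norm (\<phi> (x - Y \<omega>))))" "Y \<omega>"] by simp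
      then show ?thesis using fin by simp
    qed
    then show "integrable (M \<Otimes>\<^sub>M lborel) (\<lambda>(\<omega>, x). w \<omega> * f x * \<phi> (x - Y \<omega>))"
      by (intro integrableI_bounded)
         (auto simp: lborel.nn_integral_fst[symmetric] split_beta' norm_mult mult.assoc)
  qed
  also have "\<dots> = (\<integral>x. f x * wtrans M w (\<lambda>\<omega>. - Y \<omega>) \<phi> x \<partial>lborel)"
    unfolding wtrans_def
    by (intro Bochner_Integration.integral_cong refl, subst integral_mult_right_zero[symmetric],
        intro Bochner_Integration.integral_cong refl) (simp add: mult_ac)
  finally show ?thesis .
qed

text \<open>
  Each translation only adds a factor \<open>cis (Y \<omega> \<bullet> \<xi>)\<close> under the
  Fourier integral, and averaging these factors gives the symbol. The hypothesis on
  \<open>\<phi>\<close> is Fourier inversion with \<open>\<psi>\<close> the transform of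
  \<open>\<phi>\<close>.
\<close>

lemma inv_fourier_wtrans:
  assumes \<psi>: "integrable lborel \<psi>" and \<phi>: "\<And>x. \<phi> x = inv_fourier \<psi> x"
  shows "wtrans M w Y \<phi> x = inv_fourier (\<lambda>\<xi>. wtrans_symbol M w Y \<xi> * \<psi> \<xi>) x"
proof -
  interpret pair_sigma_finite M lborel by (rule pair_lborel)
  have [measurable]: "\<psi> \<in> borel_measurable borel" using \<psi> by auto
  define c where "c = complex_of_real ((2 * pi) ^ DIM('a))"
  have I: "integrable (M \<Otimes>\<^sub>M lborel) (\<lambda>(\<omega>, \<xi>). w \<omega> * (cis ((x + Y \<omega>) \<bullet> \<xi>) * \<psi> \<xi>))"
  proof (rule integrableI_bounded)
    have "(\<integral>\<^sup>+ z. ennreal (norm (case z of (\<omega>, \<xi>) \<Rightarrow> w \<omega> * (cis ((x + Y \<omega>) \<bullet> \<xi>) * \<psi> \<xi>))) \<partial>(M \<Otimes>\<^sub>M lborel))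
       = (\<integral>\<^sup>+ \<omega>. ennreal (norm (w \<omega>)) * (\<integral>\<^sup>+\<xi>. ennreal (norm (\<psi> \<xi>)) \<partial>lborel) \<partial>M)"
      by (subst lborel.nn_integral_fst[symmetric])
         (auto simp: norm_mult ennreal_mult nn_integral_cmult cis_conv_exp)
    also have "\<dots> = (\<integral>\<^sup>+ \<omega>. ennreal (norm (w \<omega>)) \<partial>M) * (\<integral>\<^sup>+\<xi>. ennreal (norm (\<psi> \<xi>)) \<partial>lborel)"
      by (rule nn_integral_multc) measurable
    also have "\<dots> < \<infinity>"
      using w_int \<psi> by (auto simp: integrable_iff_bounded ennreal_mult_less_top)
    finally show "(\<integral>\<^sup>+ z. ennreal (norm (case z of (\<omega>, \<xi>) \<Rightarrow> w \<omega> * (cis ((x + Y \<omega>) \<bullet> \<xi>) * \<psi> \<xi>))) \<partial>(M \<Otimes>\<^sub>M lborel)) < \<infinity>" .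
  qed (simp add: cis_conv_exp)
  have "wtrans M w Y \<phi> x = (\<integral>\<omega>. (\<integral>\<xi>. w \<omega> * (cis ((x + Y \<omega>) \<bullet> \<xi>) * \<psi> \<xi>) \<partial>lborel) \<partial>M) / c"
    unfolding wtrans_def \<phi> inv_fourier_def c_def[symmetric] by simp
  also have "\<dots> = (\<integral>\<xi>. (\<integral>\<omega>. w \<omega> * (cis ((x + Y \<omega>) \<bullet> \<xi>) * \<psi> \<xi>) \<partial>M) \<partial>lborel) / c"
    using Fubini_integral[OF I] by simp
  also have "\<dots> = (\<integral>\<xi>. cis (x \<bullet> \<xi>) * (wtrans_symbol M w Y \<xi> * \<psi> \<xi>) \<partial>lborel) / c"
    unfolding wtrans_symbol_def
    by (intro arg_cong2[where f="(/)"] Bochner_Integration.integral_cong refl,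
        subst mult.left_commute, subst integral_mult_left_zero[symmetric],
        intro Bochner_Integration.integral_cong refl)
       (simp add: mult_ac inner_add_left flip: cis_mult)
  finally show ?thesis by (simp add: inv_fourier_def c_def)
qed

lemma fourier_wtrans:
  assumes \<phi>: "integrable lborel \<phi>"
  shows "fourier (wtrans M w Y \<phi>) \<xi> = wtrans_symbol M w Y \<xi> * fourier \<phi> \<xi>"
proof -
  interpret pair_sigma_finite M lborel by (rule pair_lborel)
  have [measurable]: "\<phi> \<in> borel_measurable borel" using \<phi> by auto
  have I: "integrable (M \<Otimes>\<^sub>M lborel) (\<lambda>(\<omega>, x). cis (- (x \<bullet> \<xi>)) * (w \<omega> * \<phi> (x + Y \<omega>)))"
  proof (rule integrableI_bounded)
    have "(\<integral>\<^sup>+ z. ennreal (norm (case z of (\<omega>, x) \<Rightarrow> cis (- (x \<bullet> \<xi>)) * (w \<omega> * \<phi> (x + Y \<omega>)))) \<partial>(M \<Otimes>\<^sub>M lborel))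
       = (\<integral>\<^sup>+ \<omega>. ennreal (norm (w \<omega>)) * (\<integral>\<^sup>+x. ennreal (norm (\<phi> (x + Y \<omega>))) \<partial>lborel) \<partial>M)"
      by (subst lborel.nn_integral_fst[symmetric])
         (auto simp: norm_mult ennreal_mult nn_integral_cmult cis_conv_exp)
    also have "\<dots> = (\<integral>\<^sup>+ \<omega>. ennreal (norm (w \<omega>)) * (\<integral>\<^sup>+x. ennreal (norm (\<phi> x)) \<partial>lborel) \<partial>M)"
      by (subst nn_integral_translate) auto
    also have "\<dots> = (\<integral>\<^sup>+ \<omega>. ennreal (norm (w \<omega>)) \<partial>M) * (\<integral>\<^sup>+x. ennreal (norm (\<phi> x)) \<partial>lborel)"
      by (rule nn_integral_multc) measurable
    also have "\<dots> < \<infinity>"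
      using w_int \<phi> by (auto simp: integrable_iff_bounded ennreal_mult_less_top)
    finally show "(\<integral>\<^sup>+ z. ennreal (norm (case z of (\<omega>, x) \<Rightarrow> cis (- (x \<bullet> \<xi>)) * (w \<omega> * \<phi> (x + Y \<omega>)))) \<partial>(M \<Otimes>\<^sub>M lborel)) < \<infinity>" .
  qed (simp add: cis_conv_exp)
  have "fourier (wtrans M w Y \<phi>) \<xi> = (\<integral>x. (\<integral>\<omega>. cis (- (x \<bullet> \<xi>)) * (w \<omega> * \<phi> (x + Y \<omega>)) \<partial>M) \<partial>lborel)"
    unfolding fourier_def wtrans_def by simp
  also have "\<dots> = (\<integral>\<omega>. (\<integral>x. cis (- (x \<bullet> \<xi>)) * (w \<omega> * \<phi> (x + Y \<omega>)) \<partial>lborel) \<partial>M)"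
    using Fubini_integral[OF I] by simp
  also have "\<dots> = (\<integral>\<omega>. (\<integral>x. cis (- ((x - Y \<omega>) \<bullet> \<xi>)) * (w \<omega> * \<phi> x) \<partial>lborel) \<partial>M)"
  proof (rule Bochner_Integration.integral_cong[OF refl])
    fix \<omega>
    have [measurable]: "(\<lambda>x. cis (- ((x - Y \<omega>) \<bullet> \<xi>))) \<in> borel_measurable borel" by (simp add: cis_conv_exp)
    show "(\<integral>x. cis (- (x \<bullet> \<xi>)) * (w \<omega> * \<phi> (x + Y \<omega>)) \<partial>lborel) = (\<integral>x. cis (- ((x - Y \<omega>) \<bullet> \<xi>)) * (w \<omega> * \<phi> x) \<partial>lborel)"
      using integral_translate[of "\<lambda>x. cis (- ((x - Y \<omega>) \<bullet> \<xi>)) * (w \<omega> * \<phi> x)" "Y \<omega>"] by simp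
  qed
  also have "\<dots> = (\<integral>\<omega>. w \<omega> * cis (Y \<omega> \<bullet> \<xi>) * fourier \<phi> \<xi> \<partial>M)"
    unfolding fourier_def
    by (intro Bochner_Integration.integral_cong refl, subst integral_mult_right_zero[symmetric],
        intro Bochner_Integration.integral_cong refl)
       (simp add: mult_ac inner_diff_left cis_mult)
  also have "\<dots> = wtrans_symbol M w Y \<xi> * fourier \<phi> \<xi>"
    unfolding wtrans_symbol_def by simp
  finally show ?thesis .
qed

lemma translation_mixture_reflect: "translation_mixture M w (\<lambda>\<omega>. - Y \<omega>)"
  by unfold_locales (use w_int in auto)

end

section \<open>Radial integrals and scaling\<close>

text \<open>
  The area of the unit sphere, as the derivative at \<open>1\<close> of the volume of balls in
  the radius.
\<close>

definition sphere_area :: "'a::euclidean_space itself \<Rightarrow> real" where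
  "sphere_area _ = real DIM('a) * unit_ball_vol (real DIM('a))"

lemma sphere_area_pos: "sphere_area TYPE('a::euclidean_space) > 0"
  by (simp add: sphere_area_def)

text \<open>
  Polar coordinates for radial functions: the image measure is determined by the volumes of
  balls, whose derivative in the radius is the density on the right.
\<close>

lemma distr_norm_lborel:
  "distr lborel borel (norm :: 'a::euclidean_space \<Rightarrow> real) =
     density lborel (\<lambda>v. ennreal (sphere_area TYPE('a) * v ^ (DIM('a) - 1)) * indicator {0..} v)"
  (is "?M = ?N")
proof -
  have em: "emeasure ?M {..a} = ennreal (unit_ball_vol (real DIM('a)) * a ^ DIM('a))" if "a \<ge> 0" for a
  proof -
    have "emeasure ?M {..a} = emeasure lborel (cball (0::'a) a)"
      by (subst emeasure_distr) (auto intro!: arg_cong[where f="emeasure lborel"])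
    also have "\<dots> = ennreal (unit_ball_vol (real DIM('a)) * a ^ DIM('a))"
      using emeasure_cball[OF that, of "0::'a"] by simp
    finally show ?thesis .
  qed
  have eq: "emeasure ?M X = emeasure ?N X" if "X \<in> range atMost" for X
  proof -
    from that obtain a where X: "X = {..a}" by auto
    show ?thesis
    proof (cases "a \<ge> 0")
      case True
      have "emeasure ?N X = (\<integral>\<^sup>+v. ennreal (sphere_area TYPE('a) * v ^ (DIM('a) - 1)) * indicator {0..a} v \<partial>lborel)"
        unfolding X by (subst emeasure_density) (auto intro!: nn_integral_cong simp: indicator_def)
      also have "\<dots> = ennreal (unit_ball_vol (real DIM('a)) * a ^ DIM('a) - unit_ball_vol (real DIM('a)) * 0 ^ DIM('a))"
      proof (rule nn_integral_FTC_Icc)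
        show "((\<lambda>v. unit_ball_vol (real DIM('a)) * v ^ DIM('a)) has_real_derivative sphere_area TYPE('a) * x ^ (DIM('a) - 1)) (at x)" for x
          by (auto intro!: derivative_eq_intros simp: sphere_area_def)
      qed (use True sphere_area_pos[where 'a='a] in auto)
      also have "\<dots> = emeasure ?M X" using em[OF True] X by (simp add: zero_power)
      finally show ?thesis by simp
    next
      case False
      have e: "(norm :: 'a \<Rightarrow> real) -` {..a} = {}"
        using False by (auto simp: not_le) (smt (verit) norm_ge_zero)
      have "emeasure ?M X = 0"
        unfolding X by (subst emeasure_distr) (auto simp: e)
      moreover have "emeasure ?N X = 0"
        unfolding X using False
        by (subst emeasure_density, simp, simp, subst nn_integral_0_iff_AE) (auto simp: indicator_def)
      ultimately show ?thesis by simp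
    qed
  qed
  show ?thesis
  proof (rule measure_eqI_generator_eq[OF _ _ eq])
    show "Int_stable (range (atMost :: real \<Rightarrow> real set))" by (auto simp: Int_stable_def)
    show "range (\<lambda>i::nat. {..real i}) \<subseteq> range atMost" by auto
    show "(\<Union>i::nat. {..real i}) = UNIV" by (auto intro: real_arch_simple)
    show "emeasure ?M {..real i} \<noteq> \<infinity>" for i :: nat using em[of "real i"] by simp
  qed (auto simp: borel_eq_atMost)
qed

lemma nn_integral_radial:
  fixes F :: "real \<Rightarrow> ennreal"
  assumes [measurable]: "F \<in> borel_measurable borel"
  shows "(\<integral>\<^sup>+x. F (norm (x::'a::euclidean_space)) \<partial>lborel)
     = (\<integral>\<^sup>+v. ennreal (sphere_area TYPE('a) * v ^ (DIM('a) - 1)) * indicator {0..} v * F v \<partial>lborel)"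
proof -
  have "(\<integral>\<^sup>+x. F (norm (x::'a)) \<partial>lborel) = (\<integral>\<^sup>+v. F v \<partial>(distr lborel borel (norm :: 'a \<Rightarrow> real)))"
    by (subst nn_integral_distr) auto
  also have "\<dots> = (\<integral>\<^sup>+v. ennreal (sphere_area TYPE('a) * v ^ (DIM('a) - 1)) * indicator {0..} v * F v \<partial>lborel)"
    unfolding distr_norm_lborel by (subst nn_integral_density) auto
  finally show ?thesis .
qed

lemma AE_lborel_nz: "AE v::real in lborel. v \<noteq> 0"
  by (rule AE_lborel_singleton)

lemma powr_radial:
  fixes v :: real
  assumes "v > 0"
  shows "v ^ (DIM('a::euclidean_space) - 1) * v powr (b - real DIM('a)) = v powr (b - 1)"
proof -
  have "v ^ (DIM('a) - 1) = v powr (real DIM('a) - 1)"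
    using assms by (subst powr_realpow[symmetric]) (auto simp: of_nat_diff Suc_leI)
  then show ?thesis using assms by (simp flip: powr_add)
qed

lemma nn_integral_norm_powr_cball:
  assumes "a > 0" "\<delta> \<ge> 0"
  shows "(\<integral>\<^sup>+x. ennreal (indicator {x. norm x \<le> \<delta>} x * norm (x::'a::euclidean_space) powr (a - real DIM('a))) \<partial>lborel)
     = ennreal (sphere_area TYPE('a) * \<delta> powr a / a)"
proof -
  have "(\<integral>\<^sup>+x. ennreal (indicator {x. norm x \<le> \<delta>} x * norm (x::'a) powr (a - real DIM('a))) \<partial>lborel)
     = (\<integral>\<^sup>+x. (\<lambda>v. ennreal (indicator {..\<delta>} v * v powr (a - real DIM('a)))) (norm (x::'a)) \<partial>lborel)"
    by (intro nn_integral_cong) (auto simp: indicator_def)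
  also have "\<dots> = (\<integral>\<^sup>+v. ennreal (sphere_area TYPE('a) * v ^ (DIM('a) - 1)) * indicator {0..} v * ennreal (indicator {..\<delta>} v * v powr (a - real DIM('a))) \<partial>lborel)"
    by (rule nn_integral_radial) measurable
  also have "\<dots> = (\<integral>\<^sup>+v. ennreal (sphere_area TYPE('a)) * ennreal (indicator {0..\<delta>} v * v powr (a - 1)) \<partial>lborel)"
    using AE_lborel_nz
  proof (intro nn_integral_cong_AE, eventually_elim)
    case (elim v)
    show ?case
      using elim sphere_area_pos[where 'a='a] powr_radial[where 'a='a and b=a and v=v]
      by (cases "v > 0") (auto simp: indicator_def mult.assoc simp flip: ennreal_mult)
  qed
  also have "\<dots> = ennreal (sphere_area TYPE('a)) * (\<integral>\<^sup>+v. ennreal (indicator {0..\<delta>} v * v powr (a - 1)) \<partial>lborel)"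
    by (rule nn_integral_cmult) measurable
  also have "(\<integral>\<^sup>+v. ennreal (indicator {0..\<delta>} v * v powr (a - 1)) \<partial>lborel) = ennreal (\<delta> powr a / a)"
    using nn_integral_has_integral_lebesgue[OF _ has_integral_powr_from_0[of "a - 1" \<delta>]] assms by simp
  finally show ?thesis using sphere_area_pos[where 'a='a] assms by (simp flip: ennreal_mult)
qed

lemma nn_integral_norm_powr_outside:
  assumes "a > 0" "\<delta> > 0"
  shows "(\<integral>\<^sup>+x. ennreal (indicator {x. norm x > \<delta>} x * norm (x::'a::euclidean_space) powr (- a - real DIM('a))) \<partial>lborel)
     = ennreal (sphere_area TYPE('a) * \<delta> powr (- a) / a)"
proof -
  have "(\<integral>\<^sup>+x. ennreal (indicator {x. norm x > \<delta>} x * norm (x::'a) powr (- a - real DIM('a))) \<partial>lborel)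
     = (\<integral>\<^sup>+x. (\<lambda>v. ennreal (indicator {\<delta><..} v * v powr (- a - real DIM('a)))) (norm (x::'a)) \<partial>lborel)"
    by (intro nn_integral_cong) (auto simp: indicator_def)
  also have "\<dots> = (\<integral>\<^sup>+v. ennreal (sphere_area TYPE('a) * v ^ (DIM('a) - 1)) * indicator {0..} v * ennreal (indicator {\<delta><..} v * v powr (- a - real DIM('a))) \<partial>lborel)"
    by (rule nn_integral_radial) measurable
  also have "\<dots> = (\<integral>\<^sup>+v. ennreal (sphere_area TYPE('a)) * ennreal (indicator {\<delta>..} v * v powr (- a - 1)) \<partial>lborel)"
    using AE_lborel_singleton[of \<delta>]
  proof (intro nn_integral_cong_AE, eventually_elim)
    case (elim v)
    show ?case
      using elim assms sphere_area_pos[where 'a='a] powr_radial[where 'a='a and b="-a" and v=v]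
      by (cases "v > \<delta>") (auto simp: indicator_def mult.assoc simp flip: ennreal_mult)
  qed
  also have "\<dots> = ennreal (sphere_area TYPE('a)) * (\<integral>\<^sup>+v. ennreal (indicator {\<delta>..} v * v powr (- a - 1)) \<partial>lborel)"
    by (rule nn_integral_cmult) measurable
  also have "(\<integral>\<^sup>+v. ennreal (indicator {\<delta>..} v * v powr (- a - 1)) \<partial>lborel) = ennreal (\<delta> powr (- a) / a)"
    using nn_integral_has_integral_lebesgue[OF _ has_integral_powr_to_inf[of "- a - 1" \<delta>]] assms by simp
  finally show ?thesis using sphere_area_pos[where 'a='a] assms by (simp flip: ennreal_mult)
qed

text \<open>
  An integrable majorant: the exponent exceeds the dimension by one.
\<close>

definition decay :: "'a::euclidean_space \<Rightarrow> real" where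
  "decay x = 1 / (1 + norm x) ^ (DIM('a) + 1)"

lemma decay_pos: "decay x > 0" and decay_le_1: "decay (x::'a::euclidean_space) \<le> 1"
proof -
  have "(1 + norm x) ^ (DIM('a) + 1) \<ge> 1" by (rule one_le_power) simp
  then show "decay x > 0" "decay x \<le> 1" unfolding decay_def by auto
qed

lemma decay_measurable [measurable]: "decay \<in> borel_measurable borel"
  unfolding decay_def[abs_def] by measurable

lemma decay_integrable: "integrable lborel (decay :: 'a::euclidean_space \<Rightarrow> real)"
proof (rule integrableI_bounded)
  have "(\<integral>\<^sup>+x. ennreal (norm (decay (x::'a))) \<partial>lborel) \<le>
     (\<integral>\<^sup>+x. ennreal (indicator {x. norm x \<le> 1} x * norm (x::'a) powr (real DIM('a) - real DIM('a))) +
           ennreal (indicator {x. norm x > 1} x * norm (x::'a) powr (- 1 - real DIM('a))) \<partial>lborel)"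
  proof (intro nn_integral_mono_AE)
    show "AE x::'a in lborel. ennreal (norm (decay (x::'a))) \<le> ennreal (indicator {x. norm x \<le> 1} x * norm (x::'a) powr (real DIM('a) - real DIM('a))) +
           ennreal (indicator {x. norm x > 1} x * norm (x::'a) powr (- 1 - real DIM('a)))"
      using AE_lborel_singleton[of "0::'a"]
    proof eventually_elim
      case (elim x)
      show ?case
      proof (cases "norm x \<le> 1")
        case True
        then show ?thesis using elim decay_pos[of x] decay_le_1[of x] by (simp add: ennreal_leI)
      next
        case False
        have "decay x \<le> 1 / norm x ^ (DIM('a) + 1)"
          unfolding decay_def using False by (intro divide_left_mono power_mono mult_pos_pos zero_less_power) auto
        also have "\<dots> = norm x powr (- 1 - real DIM('a))"
        proof -
          have "norm x powr (- 1 - real DIM('a)) = inverse (norm x powr real (DIM('a) + 1))"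
            by (subst powr_minus[symmetric]) (simp add: algebra_simps)
          also have "norm x powr real (DIM('a) + 1) = norm x ^ (DIM('a) + 1)"
            using False by (intro powr_realpow) auto
          finally show ?thesis by (simp add: divide_inverse)
        qed
        finally show ?thesis using False decay_pos[of x] by (simp add: ennreal_leI)
      qed
    qed
  qed
  also have "\<dots> = ennreal (sphere_area TYPE('a) * 1 powr real DIM('a) / real DIM('a)) + ennreal (sphere_area TYPE('a) * 1 powr (- 1) / 1)"
    by (subst nn_integral_add, measurable)
       (simp only: nn_integral_norm_powr_cball[where a="real DIM('a)" and \<delta>=1 and 'a='a] nn_integral_norm_powr_outside[where a=1 and \<delta>=1 and 'a='a]
          DIM_positive of_nat_0_less_iff zero_less_one zero_le_one)
  also have "\<dots> < \<infinity>" by simp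
  finally show "(\<integral>\<^sup>+x. ennreal (norm (decay (x::'a))) \<partial>lborel) < \<infinity>" .
qed measurable

lemma integrable_decay_bound:
  fixes f :: "'a::euclidean_space \<Rightarrow> complex"
  assumes [measurable]: "f \<in> borel_measurable borel" and bd: "\<And>x. norm (f x) \<le> C * decay x"
  shows "integrable lborel f"
proof (rule Bochner_Integration.integrable_bound[of _ "\<lambda>x. C * decay x"])
  show "integrable lborel (\<lambda>x::'a. C * decay x)" by (intro integrable_mult_right decay_integrable)
  show "AE x in lborel. norm (f x) \<le> norm (C * decay x)" using bd abs_ge_self order_trans by (intro AE_I2) (simp, blast)
qed measurable

lemma decay_shift:
  fixes x a :: "'a::euclidean_space"
  assumes "norm a \<le> 1"
  shows "decay (x + a) \<le> 2 ^ (DIM('a) + 1) * decay x"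
proof -
  have "1 + norm x \<le> 2 * (1 + norm (x + a))"
    using norm_triangle_ineq4[of "x + a" a] assms norm_ge_zero[of "x + a"] unfolding add_diff_cancel_right' by argo
  then have "(1 + norm x) ^ (DIM('a) + 1) \<le> (2 * (1 + norm (x + a))) ^ (DIM('a) + 1)"
    by (intro power_mono) auto
  then show ?thesis unfolding decay_def power_mult_distrib
    using add_pos_nonneg[of 1 "norm x"] add_pos_nonneg[of 1 "norm (x + a)"]
    by (simp add: field_simps del: power_Suc)
qed

lemma nn_integral_scale:
  fixes f :: "'a::euclidean_space \<Rightarrow> ennreal"
  assumes [measurable]: "f \<in> borel_measurable borel" and c: "c \<noteq> 0"
  shows "(\<integral>\<^sup>+x. f x \<partial>lborel) = ennreal (\<bar>c\<bar> ^ DIM('a)) * (\<integral>\<^sup>+x. f (c *\<^sub>R x) \<partial>lborel)"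
proof -
  have "(\<integral>\<^sup>+x. f x \<partial>lborel) = (\<integral>\<^sup>+x. f x \<partial>density (distr lborel borel (\<lambda>x::'a. 0 + c *\<^sub>R x)) (\<lambda>_. ennreal (\<bar>c\<bar>^DIM('a))))"
    using lborel_affine[OF c, of "0::'a"] by simp
  also have "\<dots> = ennreal (\<bar>c\<bar> ^ DIM('a)) * (\<integral>\<^sup>+x. f (c *\<^sub>R x) \<partial>lborel)"
    by (subst nn_integral_density) (auto simp: nn_integral_distr nn_integral_cmult)
  finally show ?thesis .
qed

lemma integral_scale:
  fixes f :: "'a::euclidean_space \<Rightarrow> complex"
  assumes [measurable]: "f \<in> borel_measurable borel" and c: "c \<noteq> 0"
  shows "(\<integral>x. f x \<partial>lborel) = of_real (\<bar>c\<bar> ^ DIM('a)) * (\<integral>x. f (c *\<^sub>R x) \<partial>lborel)"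
proof -
  have "(\<integral>x. f x \<partial>lborel) = (\<integral>x. f x \<partial>density (distr lborel borel (\<lambda>x::'a. 0 + c *\<^sub>R x)) (\<lambda>_. ennreal (\<bar>c\<bar>^DIM('a))))"
    using lborel_affine[OF c, of "0::'a"] by simp
  also have "\<dots> = (\<integral>x. (\<bar>c\<bar>^DIM('a)) *\<^sub>R f x \<partial>distr lborel borel (\<lambda>x::'a. 0 + c *\<^sub>R x))"
    by (rule integral_density) auto
  also have "\<dots> = (\<integral>x. (\<bar>c\<bar>^DIM('a)) *\<^sub>R f (c *\<^sub>R x) \<partial>lborel)"
    by (subst integral_distr) auto
  also have "\<dots> = of_real (\<bar>c\<bar> ^ DIM('a)) * (\<integral>x. f (c *\<^sub>R x) \<partial>lborel)"
    by (simp add: scaleR_conv_of_real)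
  finally show ?thesis .
qed

section \<open>The Gaussian and its Fourier transform\<close>

definition gauss :: "'a::euclidean_space \<Rightarrow> real" where
  "gauss x = (\<Prod>b\<in>Basis. std_normal_density (x \<bullet> b))"

lemma gauss_eq: "gauss (x::'a::euclidean_space) = exp (- (norm x)\<^sup>2 / 2) / sqrt (2 * pi) ^ DIM('a)"
proof -
  have "gauss x = (\<Prod>b\<in>(Basis::'a set). exp (- (x \<bullet> b)\<^sup>2 / 2) / sqrt (2 * pi))"
    unfolding gauss_def normal_density_def by simp
  also have "\<dots> = exp (\<Sum>b\<in>(Basis::'a set). - (x \<bullet> b)\<^sup>2 / 2) / sqrt (2 * pi) ^ DIM('a)"
    by (simp add: prod_dividef exp_sum)
  also have "(\<Sum>b\<in>(Basis::'a set). - (x \<bullet> b)\<^sup>2 / 2) = - (norm x)\<^sup>2 / 2"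
    unfolding power2_norm_eq_inner by (subst euclidean_inner) (simp add: sum_negf sum_divide_distrib power2_eq_square)
  finally show ?thesis .
qed

lemma gauss_nonneg [simp]: "gauss x \<ge> 0" by (simp add: gauss_eq)

lemma gauss_measurable [measurable]: "gauss \<in> borel_measurable borel"
  unfolding gauss_eq[abs_def] by measurable

lemma gauss_decay:
  "\<exists>C::real\<ge>0. \<forall>z::'a::euclidean_space. norm z ^ m * gauss z \<le> C * decay z"
proof -
  \<comment> \<open>The power \<open>(1 + v) ^ N\<close> is at most \<open>fact N\<close> times \<open>exp (1
    + v)\<close>, as one term of the exponential series, and \<open>1 + v - v\<^sup>2 /
    2\<close> is at most \<open>3 / 2\<close>.\<close>
  define N where "N = m + DIM('a) + 1"
  define C :: real where "C = exp (3/2) * fact N"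
  have "norm z ^ m * gauss z \<le> C * decay z" for z :: 'a
  proof -
    define v where "v = norm z"
    have v: "v \<ge> 0" by (simp add: v_def)
    have "(\<Sum>k\<in>{N}. (1 + v) ^ k /\<^sub>R fact k) \<le> exp (1 + v)"
      unfolding exp_def by (rule sum_le_suminf) (use v summable_exp_generic[of "1 + v"] in auto)
    then have "(1 + v) ^ N / fact N \<le> exp (1 + v)" by (simp add: divide_inverse mult.commute)
    then have a: "(1 + v) ^ N \<le> fact N * exp (1 + v)" by (simp add: divide_le_eq mult.commute)
    have "0 \<le> (v - 1)\<^sup>2" by simp
    then have "1 + v + (- v\<^sup>2 / 2) \<le> 3 / 2" by (simp add: power2_eq_square algebra_simps)
    then have b: "exp (1 + v) * exp (- v\<^sup>2 / 2) \<le> exp (3 / 2)" by (simp flip: exp_add)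
    have "(1 + v) ^ N * exp (- v\<^sup>2 / 2) \<le> fact N * exp (1 + v) * exp (- v\<^sup>2 / 2)"
      using a by (intro mult_right_mono) auto
    also have "\<dots> \<le> C" using b by (simp add: C_def mult.assoc)
    finally have c: "(1 + v) ^ N * exp (- v\<^sup>2 / 2) \<le> C" .
    have "gauss z \<le> exp (- v\<^sup>2 / 2)"
    proof -
      have "sqrt (2 * pi) \<ge> 1" using pi_gt3 by simp
      then have "sqrt (2 * pi) ^ DIM('a) \<ge> 1" by (rule one_le_power)
      then show ?thesis unfolding gauss_eq v_def by (simp add: divide_le_eq)
    qed
    then have "norm z ^ m * gauss z \<le> (1 + v) ^ m * exp (- v\<^sup>2 / 2)"
      using v by (intro mult_mono power_mono) (auto simp: v_def)
    also have "\<dots> = ((1 + v) ^ N * exp (- v\<^sup>2 / 2)) * decay z"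
    proof -
      have "(1 + v) ^ N = (1 + v) ^ m * (1 + v) ^ (DIM('a) + 1)"
        unfolding N_def by (simp only: power_add add.assoc)
      moreover have "(1 + v) ^ (DIM('a) + 1) \<noteq> 0" using v by (intro power_not_zero) auto
      ultimately show ?thesis unfolding decay_def v_def[symmetric] by (simp del: power_Suc add: mult.assoc)
    qed
    also have "\<dots> \<le> C * decay z"
      using c decay_pos[of z] by (intro mult_right_mono) auto
    finally show ?thesis .
  qed
  then show ?thesis by (intro exI[of _ C]) (auto simp: C_def)
qed

lemma gauss_moments: "integrable lborel (\<lambda>z::'a::euclidean_space. norm z ^ m * gauss z)"
proof -
  obtain C where "C \<ge> 0" "\<forall>z::'a. norm z ^ m * gauss z \<le> C * decay z" using gauss_decay by blast
  then have "integrable lborel (\<lambda>z::'a. complex_of_real (norm z ^ m * gauss z))"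
    by (intro integrable_decay_bound[of _ C]) (auto simp: norm_mult norm_power)
  then show ?thesis by (simp only: complex_of_real_integrable_eq)
qed

lemma gauss_integrable: "integrable lborel (gauss :: 'a::euclidean_space \<Rightarrow> real)"
  using gauss_moments[of 0] by simp

lemma gauss_fourier:
  "(\<integral>z. gauss (z::'a::euclidean_space) * cis (z \<bullet> \<xi>) \<partial>lborel) = of_real (exp (- (norm \<xi>)\<^sup>2 / 2))"
proof -
  interpret product_sigma_finite "\<lambda>b::'a. lborel :: real measure" ..
  have one: "integrable lborel (\<lambda>x. std_normal_density x * cis (x * s))"
    "(\<integral>x. std_normal_density x * cis (x * s) \<partial>lborel) = of_real (exp (- s\<^sup>2 / 2))" for s :: real
  proof -
    show "integrable lborel (\<lambda>x. std_normal_density x * cis (x * s))"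
      by (rule Bochner_Integration.integrable_bound[of _ std_normal_density])
         (auto simp: integrable_normal_density norm_mult cis_conv_exp)
    have "(\<integral>x. std_normal_density x *\<^sub>R cis (x * s) \<partial>lborel) = char std_normal_distribution s"
      unfolding char_def by (subst integral_density) (auto simp: cis_conv_exp mult_ac)
    then show "(\<integral>x. std_normal_density x * cis (x * s) \<partial>lborel) = of_real (exp (- s\<^sup>2 / 2))"
      by (simp add: char_std_normal_distribution scaleR_conv_of_real)
  qed
  have pr: "gauss (\<Sum>b\<in>Basis. f b *\<^sub>R b) * cis ((\<Sum>b\<in>Basis. f b *\<^sub>R b) \<bullet> \<xi>) =
    (\<Prod>b\<in>Basis. std_normal_density (f b) * cis (f b * (b \<bullet> \<xi>)))" for f :: "'a \<Rightarrow> real"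
  proof -
    have "gauss (\<Sum>b\<in>Basis. f b *\<^sub>R b :: 'a) = (\<Prod>b\<in>(Basis::'a set). std_normal_density (f b))"
      unfolding gauss_def by (intro prod.cong refl arg_cong[where f=std_normal_density]) simp
    moreover have "cis ((\<Sum>b\<in>Basis. f b *\<^sub>R b) \<bullet> \<xi>) = (\<Prod>b\<in>(Basis::'a set). cis (f b * (b \<bullet> \<xi>)))"
      by (simp add: cis_conv_exp inner_sum_left exp_sum sum_distrib_left)
    ultimately show ?thesis by (simp add: prod.distrib)
  qed
  have "(\<integral>z. gauss (z::'a) * cis (z \<bullet> \<xi>) \<partial>lborel)
     = (\<integral>f. gauss (\<Sum>b\<in>(Basis::'a set). f b *\<^sub>R b) * cis ((\<Sum>b\<in>Basis. f b *\<^sub>R b) \<bullet> \<xi>) \<partial>(\<Pi>\<^sub>M b\<in>(Basis::'a set). lborel))"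
    by (subst lborel_eq, subst integral_distr) (auto simp: cis_conv_exp)
  also have "\<dots> = (\<Prod>b\<in>(Basis::'a set). (\<integral>x. std_normal_density x * cis (x * (b \<bullet> \<xi>)) \<partial>lborel))"
    unfolding pr by (rule product_integral_prod) (auto intro: one)
  also have "\<dots> = of_real (\<Prod>b\<in>(Basis::'a set). exp (- (b \<bullet> \<xi>)\<^sup>2 / 2))"
    by (simp add: one)
  also have "(\<Prod>b\<in>(Basis::'a set). exp (- (b \<bullet> \<xi>)\<^sup>2 / 2)) = exp (\<Sum>b\<in>(Basis::'a set). - (b \<bullet> \<xi>)\<^sup>2 / 2)"
    by (simp add: exp_sum)
  also have "(\<Sum>b\<in>(Basis::'a set). - (b \<bullet> \<xi>)\<^sup>2 / 2) = - (norm \<xi>)\<^sup>2 / 2"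
    unfolding power2_norm_eq_inner by (subst euclidean_inner) (simp add: sum_negf sum_divide_distrib power2_eq_square inner_commute)
  finally show ?thesis .
qed

lemma gauss_integral: "(\<integral>z. gauss (z::'a::euclidean_space) \<partial>lborel) = 1"
proof -
  have "complex_of_real (\<integral>z. gauss (z::'a) \<partial>lborel) = 1" using gauss_fourier[of "0::'a"] by simp
  then show ?thesis by simp
qed

section \<open>Schwartz functions\<close>

lemma norm_integral_le:
  fixes f :: "'b \<Rightarrow> complex"
  assumes "integrable M f" "integrable M g" "\<And>x. norm (f x) \<le> g x"
  shows "norm (\<integral>x. f x \<partial>M) \<le> (\<integral>x. g x \<partial>M)"
  using assms by (intro order_trans[OF integral_norm_bound] integral_mono) auto

lemma iter_partial_append: "iter_partial (bs @ cs) \<phi> = iter_partial bs (iter_partial cs \<phi>)"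
  by (induction bs) auto

lemma schwartz_iter_partial:
  assumes "\<phi> \<in> schwartz" "cs \<in> lists Basis"
  shows "iter_partial cs \<phi> \<in> schwartz"
  using assms unfolding schwartz_def by (auto simp flip: iter_partial_append)

lemma schwartz_partial:
  assumes "\<phi> \<in> schwartz" "b \<in> Basis"
  shows "(\<lambda>x. frechet_derivative \<phi> (at x) b) \<in> schwartz"
  using schwartz_iter_partial[OF assms(1), of "[b]"] assms(2) by simp

lemma schwartz_differentiable:
  assumes "\<phi> \<in> schwartz"
  shows "\<phi> differentiable (at x)"
proof -
  have "iter_partial [] \<phi> differentiable_on UNIV" using assms unfolding schwartz_def by blast
  then show ?thesis by (simp add: differentiable_on_def)
qed

lemma schwartz_has_derivative:
  assumes "\<phi> \<in> schwartz"
  shows "(\<phi> has_derivative frechet_derivative \<phi> (at x)) (at x)"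
  using schwartz_differentiable[OF assms] by (simp add: frechet_derivative_works)

lemma schwartz_continuous: "\<phi> \<in> schwartz \<Longrightarrow> continuous_on UNIV \<phi>"
  by (metis schwartz_differentiable differentiable_imp_continuous_within continuous_at_imp_continuous_on)

lemma schwartz_measurable [measurable_dest]: "\<phi> \<in> schwartz \<Longrightarrow> \<phi> \<in> borel_measurable borel"
  by (intro borel_measurable_continuous_onI schwartz_continuous)

lemma schwartz_power_bounded:
  assumes "\<phi> \<in> schwartz"
  shows "\<exists>C. \<forall>x. norm x ^ m * norm (\<phi> x) \<le> C"
proof -
  have "bounded (range (\<lambda>x. norm x ^ m *\<^sub>R iter_partial [] \<phi> x))"
    using assms unfolding schwartz_def by blast
  then show ?thesis unfolding bounded_iff by auto
qed

lemma decay_of_power_bounded: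
  fixes g :: "'a::euclidean_space \<Rightarrow> real"
  assumes g: "\<And>x. 0 \<le> g x" and bd: "\<And>m. \<exists>C. \<forall>x. norm x ^ m * g x \<le> C"
  shows "\<exists>C\<ge>0. \<forall>x. (1 + norm x) ^ k * g x \<le> C * decay x"
proof -
  define N where "N = k + (DIM('a) + 1)"
  obtain C0 where C0: "\<And>x. norm x ^ 0 * g x \<le> C0" using bd[of 0] by blast
  obtain C1 where C1: "\<And>x. norm x ^ N * g x \<le> C1" using bd[of N] by blast
  define C where "C = 2 ^ N * (\<bar>C0\<bar> + \<bar>C1\<bar>)"
  have "(1 + norm x) ^ k * g x \<le> C * decay x" for x
  proof -
    have "(1 + norm x) ^ N \<le> (2 * max 1 (norm x)) ^ N"
      by (intro power_mono) auto
    also have "\<dots> \<le> 2 ^ N * (1 + norm x ^ N)"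
      by (auto simp: power_mult_distrib max_def)
    finally have "(1 + norm x) ^ N * g x \<le> 2 ^ N * (1 + norm x ^ N) * g x"
      using g by (intro mult_right_mono) auto
    also have "\<dots> = 2 ^ N * (g x + norm x ^ N * g x)" by (simp add: algebra_simps)
    also have "\<dots> \<le> C"
      unfolding C_def using C0[of x] C1[of x] by (intro mult_left_mono) auto
    finally have le: "(1 + norm x) ^ N * g x \<le> C" .
    have "(1 + norm x) ^ k * g x = ((1 + norm x) ^ N * g x) * decay x"
    proof -
      have "(1 + norm x) ^ N = (1 + norm x) ^ k * (1 + norm x) ^ (DIM('a) + 1)"
        unfolding N_def by (rule power_add)
      moreover have "(1 + norm x) ^ (DIM('a) + 1) \<noteq> 0"
        using norm_ge_zero[of x] by (intro power_not_zero) linarith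
      ultimately show ?thesis unfolding decay_def by (simp del: power_Suc)
    qed
    also have "\<dots> \<le> C * decay x" using le decay_pos[of x] by (intro mult_right_mono) auto
    finally show ?thesis .
  qed
  then show ?thesis by (intro exI[of _ C]) (auto simp: C_def)
qed

lemma schwartz_decay:
  fixes \<phi> :: "'a::euclidean_space \<Rightarrow> complex"
  assumes "\<phi> \<in> schwartz"
  shows "\<exists>C\<ge>0. \<forall>x. norm (\<phi> x) \<le> C * decay x"
  using decay_of_power_bounded[of "\<lambda>x. norm (\<phi> x)" 0] schwartz_power_bounded[OF assms] by auto

lemma schwartz_bounded:
  fixes \<phi> :: "'a::euclidean_space \<Rightarrow> complex"
  assumes "\<phi> \<in> schwartz"
  shows "\<exists>C. \<forall>x. norm (\<phi> x) \<le> C"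
  using schwartz_power_bounded[OF assms, of 0] by auto

lemma schwartz_integrable:
  fixes \<phi> :: "'a::euclidean_space \<Rightarrow> complex"
  assumes "\<phi> \<in> schwartz"
  shows "integrable lborel \<phi>"
  using schwartz_decay[OF assms] integrable_decay_bound schwartz_measurable[OF assms] by blast

lemma schwartz_derivative_sum:
  fixes \<phi> :: "'a::euclidean_space \<Rightarrow> complex"
  assumes "\<phi> \<in> schwartz"
  shows "frechet_derivative \<phi> (at x) v = (\<Sum>b\<in>Basis. (v \<bullet> b) *\<^sub>R frechet_derivative \<phi> (at x) b)"
proof -
  interpret bounded_linear "frechet_derivative \<phi> (at x)"
    using schwartz_has_derivative[OF assms] by (rule has_derivative_bounded_linear)
  have "frechet_derivative \<phi> (at x) v = frechet_derivative \<phi> (at x) (\<Sum>b\<in>Basis. (v \<bullet> b) *\<^sub>R b)"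
    by (simp add: euclidean_representation)
  then show ?thesis by (simp add: sum scaleR)
qed

lemma schwartz_derivative_decay:
  fixes \<phi> :: "'a::euclidean_space \<Rightarrow> complex"
  assumes "\<phi> \<in> schwartz"
  shows "\<exists>C\<ge>0. \<forall>x v. norm (frechet_derivative \<phi> (at x) v) \<le> norm v * (C * decay x)"
proof -
  have "\<forall>b\<in>(Basis::'a set). \<exists>C\<ge>0. \<forall>x. norm (frechet_derivative \<phi> (at x) b) \<le> C * decay x"
    using schwartz_decay[OF schwartz_partial[OF assms]] by blast
  then obtain C where C: "\<And>b. b \<in> (Basis::'a set) \<Longrightarrow> C b \<ge> 0"
     "\<And>b x. b \<in> (Basis::'a set) \<Longrightarrow> norm (frechet_derivative \<phi> (at x) b) \<le> C b * decay x"
    by metis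
  define D where "D = (\<Sum>b\<in>(Basis::'a set). C b)"
  have "norm (frechet_derivative \<phi> (at x) v) \<le> norm v * (D * decay x)" for x v
  proof -
    have "norm (frechet_derivative \<phi> (at x) v) \<le> (\<Sum>b\<in>Basis. norm ((v \<bullet> b) *\<^sub>R frechet_derivative \<phi> (at x) b))"
      by (subst schwartz_derivative_sum[OF assms]) (rule norm_sum)
    also have "\<dots> \<le> (\<Sum>b\<in>Basis. norm v * (C b * decay x))"
      by (intro sum_mono) (auto intro!: mult_mono C simp: Basis_le_norm)
    also have "\<dots> = norm v * (D * decay x)"
      by (simp add: D_def sum_distrib_left sum_distrib_right)
    finally show ?thesis .
  qed
  moreover have "D \<ge> 0" unfolding D_def by (intro sum_nonneg C)
  ultimately show ?thesis by blast
qed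

text \<open>
  The mean value inequality on the unit ball around \<open>x\<close>, where \<open>decay\<close>
  is comparable to its value at \<open>x\<close>.
\<close>

lemma schwartz_increment_decay:
  fixes \<phi> :: "'a::euclidean_space \<Rightarrow> complex"
  assumes "\<phi> \<in> schwartz"
  shows "\<exists>C\<ge>0. \<forall>x a. norm a \<le> 1 \<longrightarrow> norm (\<phi> (x + a) - \<phi> x) \<le> C * norm a * decay x"
proof -
  obtain C where C: "C \<ge> 0" "\<And>x v. norm (frechet_derivative \<phi> (at x) v) \<le> norm v * (C * decay x)"
    using schwartz_derivative_decay[OF assms] by blast
  define K where "K = C * 2 ^ (DIM('a) + 1)"
  have "norm (\<phi> (x + a) - \<phi> x) \<le> K * norm a * decay x" if a: "norm a \<le> 1" for x a :: 'a
  proof -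
    have "norm (\<phi> (x + a) - \<phi> x) \<le> (K * decay x) * norm (x + a - x)"
    proof (rule differentiable_bound[of "cball x 1" \<phi> "\<lambda>y. frechet_derivative \<phi> (at y)"])
      show "(\<phi> has_derivative frechet_derivative \<phi> (at y)) (at y within cball x 1)" for y
        using schwartz_has_derivative[OF assms] by (rule has_derivative_at_withinI)
      show "onorm (frechet_derivative \<phi> (at y)) \<le> K * decay x" if y: "y \<in> cball x 1" for y
      proof (rule onorm_le)
        fix v :: 'a
        have "decay y \<le> 2 ^ (DIM('a) + 1) * decay x"
          using decay_shift[of "y - x" x] y by (simp add: dist_norm norm_minus_commute)
        then have "norm v * (C * decay y) \<le> norm v * (C * (2 ^ (DIM('a) + 1) * decay x))"
          using C(1) by (intro mult_left_mono) auto
        then show "norm (frechet_derivative \<phi> (at y) v) \<le> K * decay x * norm v"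
          using C(2)[of y v] by (simp add: K_def mult_ac)
      qed
    qed (use a in \<open>auto simp: dist_norm\<close>)
    then show ?thesis by (simp add: mult_ac)
  qed
  moreover have "K \<ge> 0" using C by (simp add: K_def)
  ultimately show ?thesis by blast
qed

lemma schwartz_lipschitz:
  fixes \<phi> :: "'a::euclidean_space \<Rightarrow> complex"
  assumes "\<phi> \<in> schwartz"
  shows "\<exists>C\<ge>0. \<forall>x y. norm (\<phi> x - \<phi> y) \<le> C * norm (x - y)"
proof -
  obtain C where C: "C \<ge> 0" "\<And>x v. norm (frechet_derivative \<phi> (at x) v) \<le> norm v * (C * decay x)"
    using schwartz_derivative_decay[OF assms] by blast
  have "norm (\<phi> x - \<phi> y) \<le> C * norm (x - y)" for x y
  proof (rule differentiable_bound[of UNIV \<phi> "\<lambda>y. frechet_derivative \<phi> (at y)"])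
    show "onorm (frechet_derivative \<phi> (at y)) \<le> C" for y
    proof (rule onorm_le)
      fix v :: 'a
      have "norm v * (C * decay y) \<le> norm v * (C * 1)"
        using C(1) decay_le_1[of y] by (intro mult_left_mono) auto
      then show "norm (frechet_derivative \<phi> (at y) v) \<le> C * norm v"
        using C(2)[of y v] by (simp add: mult_ac)
    qed
  qed (use schwartz_has_derivative[OF assms] in auto)
  then show ?thesis using C by blast
qed

text \<open>
  The partial derivatives are Schwartz functions and so are Lipschitz; the mean value inequality
  for \<open>\<phi>\<close> minus its linear part then gives a quadratic remainder, uniformly in
  \<open>x\<close>.
\<close>

lemma schwartz_taylor:
  fixes \<phi> :: "'a::euclidean_space \<Rightarrow> complex"
  assumes "\<phi> \<in> schwartz"
  shows "\<exists>C\<ge>0. \<forall>x v. norm (\<phi> (x + v) - \<phi> x - frechet_derivative \<phi> (at x) v) \<le> C * norm v ^ 2"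
proof -
  have "\<forall>b\<in>(Basis::'a set). \<exists>C\<ge>0. \<forall>x y. norm (frechet_derivative \<phi> (at x) b - frechet_derivative \<phi> (at y) b) \<le> C * norm (x - y)"
    using schwartz_lipschitz[OF schwartz_partial[OF assms]] by blast
  then obtain C where C: "\<And>b. b \<in> (Basis::'a set) \<Longrightarrow> C b \<ge> 0"
     "\<And>b x y. b \<in> (Basis::'a set) \<Longrightarrow> norm (frechet_derivative \<phi> (at x) b - frechet_derivative \<phi> (at y) b) \<le> C b * norm (x - y)"
    by metis
  define D where "D = (\<Sum>b\<in>(Basis::'a set). C b)"
  have D0: "D \<ge> 0" unfolding D_def by (intro sum_nonneg C)
  have Dl: "norm (frechet_derivative \<phi> (at x) v - frechet_derivative \<phi> (at y) v) \<le> D * norm (x - y) * norm v" for x y v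
  proof -
    have "norm (frechet_derivative \<phi> (at x) v - frechet_derivative \<phi> (at y) v)
      = norm (\<Sum>b\<in>Basis. (v \<bullet> b) *\<^sub>R (frechet_derivative \<phi> (at x) b - frechet_derivative \<phi> (at y) b))"
      using schwartz_derivative_sum[OF assms, of x v] schwartz_derivative_sum[OF assms, of y v]
      by (simp add: sum_subtractf scaleR_diff_right)
    also have "\<dots> \<le> (\<Sum>b\<in>Basis. norm ((v \<bullet> b) *\<^sub>R (frechet_derivative \<phi> (at x) b - frechet_derivative \<phi> (at y) b)))"
      by (rule norm_sum)
    also have "\<dots> \<le> (\<Sum>b\<in>Basis. norm v * (C b * norm (x - y)))"
      by (intro sum_mono) (auto intro!: mult_mono C simp: Basis_le_norm)
    also have "\<dots> = D * norm (x - y) * norm v"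
      by (simp add: D_def sum_distrib_left sum_distrib_right mult_ac)
    finally show ?thesis .
  qed
  have "norm (\<phi> (x + v) - \<phi> x - frechet_derivative \<phi> (at x) v) \<le> D * norm v ^ 2" for x v
  proof -
    have bl: "bounded_linear (frechet_derivative \<phi> (at x))"
      using schwartz_has_derivative[OF assms] by (rule has_derivative_bounded_linear)
    have "norm ((\<phi> (x + v) - frechet_derivative \<phi> (at x) v) - (\<phi> (x + 0) - frechet_derivative \<phi> (at x) 0)) \<le> (D * norm v) * norm (v - 0)"
    proof (rule differentiable_bound[of "cball 0 (norm v)" "\<lambda>a. \<phi> (x + a) - frechet_derivative \<phi> (at x) a"
            "\<lambda>a u. frechet_derivative \<phi> (at (x + a)) u - frechet_derivative \<phi> (at x) u"])
      show "((\<lambda>a. \<phi> (x + a) - frechet_derivative \<phi> (at x) a) has_derivative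
         (\<lambda>u. frechet_derivative \<phi> (at (x + a)) u - frechet_derivative \<phi> (at x) u)) (at a within cball 0 (norm v))" for a
      proof (rule has_derivative_diff)
        have "((\<lambda>a. x + a) has_derivative (\<lambda>u. u)) (at a within cball 0 (norm v))"
          by (auto intro!: derivative_eq_intros)
        from has_derivative_compose[OF this schwartz_has_derivative[OF assms]]
        show "((\<lambda>a. \<phi> (x + a)) has_derivative frechet_derivative \<phi> (at (x + a))) (at a within cball 0 (norm v))"
          by simp
        show "(frechet_derivative \<phi> (at x) has_derivative frechet_derivative \<phi> (at x)) (at a within cball 0 (norm v))"
          using bl by (rule bounded_linear_imp_has_derivative)
      qed
      show "onorm (\<lambda>u. frechet_derivative \<phi> (at (x + a)) u - frechet_derivative \<phi> (at x) u) \<le> D * norm v"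
        if "a \<in> cball 0 (norm v)" for a
      proof (rule onorm_le)
        fix u
        have "norm (frechet_derivative \<phi> (at (x + a)) u - frechet_derivative \<phi> (at x) u) \<le> D * norm (x + a - x) * norm u"
          by (rule Dl)
        also have "\<dots> \<le> D * norm v * norm u"
          using that D0 by (intro mult_right_mono mult_left_mono) auto
        finally show "norm (frechet_derivative \<phi> (at (x + a)) u - frechet_derivative \<phi> (at x) u) \<le> D * norm v * norm u" .
      qed
    qed auto
    then show ?thesis
      using linear_0[OF bounded_linear.linear[OF bl]] by (simp add: power2_eq_square algebra_simps)
  qed
  then show ?thesis using D0 by blast
qed

context translation_mixture
begin

lemma wtrans_integrand_integrable:
  assumes [measurable]: "f \<in> borel_measurable borel" and "\<And>x. norm (f x) \<le> C"
  shows "integrable M (\<lambda>\<omega>. w \<omega> * f (x + Y \<omega>))"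
proof (rule Bochner_Integration.integrable_bound)
  show "integrable M (\<lambda>\<omega>. C * norm (w \<omega>))" using w_int by auto
  show "AE \<omega> in M. norm (w \<omega> * f (x + Y \<omega>)) \<le> norm (C * norm (w \<omega>))"
    using assms(2) by (intro AE_I2)
      (auto simp: norm_mult mult.commute[of C] abs_mult intro!: mult_left_mono order_trans[OF _ abs_ge_self])
qed measurable

text \<open>
  The quadratic remainder of \<open>\<phi>\<close> is uniform in the base point, hence it
  survives averaging over the translations.
\<close>

lemma wtrans_has_derivative:
  assumes \<phi>: "\<phi> \<in> schwartz"
  shows "(wtrans M w Y \<phi> has_derivative (\<lambda>v. wtrans M w Y (\<lambda>x. frechet_derivative \<phi> (at x) v) x)) (at x)"
proof -
  define D where "D x v = frechet_derivative \<phi> (at x) v" for x v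
  define W where "W = (\<integral>\<omega>. norm (w \<omega>) \<partial>M)"
  have [measurable]: "\<phi> \<in> borel_measurable borel" using \<phi> by measurable
  have Dm [measurable]: "(\<lambda>x. D x v) \<in> borel_measurable borel" for v
  proof -
    have [measurable]: "(\<lambda>x. frechet_derivative \<phi> (at x) b) \<in> borel_measurable borel" if "b \<in> Basis" for b
      using schwartz_measurable[OF schwartz_partial[OF \<phi> that]] .
    show ?thesis unfolding D_def by (subst schwartz_derivative_sum[OF \<phi>]) measurable
  qed
  obtain C where C: "C \<ge> 0" "\<And>x v. norm (D x v) \<le> norm v * (C * decay x)"
    using schwartz_derivative_decay[OF \<phi>] unfolding D_def by blast
  have C': "norm (D x v) \<le> norm v * C" for x v
  proof -
    have "norm v * (C * decay x) \<le> norm v * (C * 1)" using C(1) decay_le_1[of x] by (intro mult_left_mono) auto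
    then show ?thesis using C(2)[of x v] by simp
  qed
  obtain B where B: "\<And>x. norm (\<phi> x) \<le> B" using schwartz_bounded[OF \<phi>] by blast
  obtain T where T: "T \<ge> 0" "\<And>x v. norm (\<phi> (x + v) - \<phi> x - D x v) \<le> T * norm v ^ 2"
    using schwartz_taylor[OF \<phi>] unfolding D_def by blast
  have Di: "integrable M (\<lambda>\<omega>. w \<omega> * D (x + Y \<omega>) v)" for x v
    using wtrans_integrand_integrable[of "\<lambda>x. D x v" "norm v * C"] C' by simp
  have \<phi>i: "integrable M (\<lambda>\<omega>. w \<omega> * \<phi> (x + Y \<omega>))" for x
    using wtrans_integrand_integrable[of \<phi> B] B by simp
  have lin: "linear (D y)" for y
    unfolding D_def using schwartz_has_derivative[OF \<phi>] has_derivative_linear by blast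
  have nb: "norm (\<integral>\<omega>. w \<omega> * g \<omega> \<partial>M) \<le> W * K" if "\<And>\<omega>. norm (g \<omega>) \<le> K" "integrable M (\<lambda>\<omega>. w \<omega> * g \<omega>)" for g K
  proof -
    have "norm (\<integral>\<omega>. w \<omega> * g \<omega> \<partial>M) \<le> (\<integral>\<omega>. norm (w \<omega>) * K \<partial>M)"
    proof (rule norm_integral_le[OF that(2)])
      show "integrable M (\<lambda>\<omega>. norm (w \<omega>) * K)" using w_int by (intro integrable_mult_left) auto
      show "norm (w \<omega> * g \<omega>) \<le> norm (w \<omega>) * K" for \<omega> using that(1) by (simp add: norm_mult mult_left_mono)
    qed
    then show ?thesis by (simp add: W_def)
  qed
  have "(wtrans M w Y \<phi> has_derivative (\<lambda>v. wtrans M w Y (\<lambda>x. D x v) x)) (at x)"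
  proof (rule has_derivativeI_sandwich[of 1])
    show "bounded_linear (\<lambda>v. wtrans M w Y (\<lambda>x. D x v) x)"
    proof (rule bounded_linear_intro[where K="W * C"])
      show "wtrans M w Y (\<lambda>x. D x (u + v)) x = wtrans M w Y (\<lambda>x. D x u) x + wtrans M w Y (\<lambda>x. D x v) x" for u v
        unfolding wtrans_def using Di
        by (subst Bochner_Integration.integral_add[symmetric]) (auto simp: linear_add[OF lin] algebra_simps)
      show "wtrans M w Y (\<lambda>x. D x (r *\<^sub>R v)) x = r *\<^sub>R wtrans M w Y (\<lambda>x. D x v) x" for r v
        unfolding wtrans_def
        by (subst integral_scaleR_right[symmetric]) (auto simp: linear_scale[OF lin])
      show "norm (wtrans M w Y (\<lambda>x. D x v) x) \<le> norm v * (W * C)" for v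
        using nb[of "\<lambda>\<omega>. D (x + Y \<omega>) v" "norm v * C"] C' Di unfolding wtrans_def by (simp add: mult_ac)
    qed
    show "norm (wtrans M w Y \<phi> y - wtrans M w Y \<phi> x - wtrans M w Y (\<lambda>z. D z (y - x)) x) / norm (y - x) \<le> W * T * norm (y - x)"
      if "y \<noteq> x" for y
    proof -
      define g where "g \<omega> = \<phi> (y + Y \<omega>) - \<phi> (x + Y \<omega>) - D (x + Y \<omega>) (y - x)" for \<omega>
      have gi: "integrable M (\<lambda>\<omega>. w \<omega> * g \<omega>)"
        unfolding g_def right_diff_distrib using \<phi>i Di by auto
      have "wtrans M w Y \<phi> y - wtrans M w Y \<phi> x - wtrans M w Y (\<lambda>z. D z (y - x)) x = (\<integral>\<omega>. w \<omega> * g \<omega> \<partial>M)"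
        unfolding wtrans_def g_def right_diff_distrib using \<phi>i Di by simp
      moreover have "norm (g \<omega>) \<le> T * norm (y - x) ^ 2" for \<omega>
        using T(2)[of "x + Y \<omega>" "y - x"] unfolding g_def by (simp add: algebra_simps)
      ultimately have "norm (wtrans M w Y \<phi> y - wtrans M w Y \<phi> x - wtrans M w Y (\<lambda>z. D z (y - x)) x) \<le> W * (T * norm (y - x) ^ 2)"
        using nb gi by metis
      then show ?thesis using that by (simp add: divide_le_eq power2_eq_square mult_ac)
    qed
    show "((\<lambda>y. W * T * norm (y - x)) \<longlongrightarrow> 0) (at x)"
      by (auto intro!: tendsto_eq_intros)
  qed auto
  then show ?thesis unfolding D_def .
qed

lemma iter_partial_wtrans:
  assumes \<phi>: "\<phi> \<in> schwartz" and bs: "bs \<in> lists Basis"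
  shows "iter_partial bs (wtrans M w Y \<phi>) = wtrans M w Y (iter_partial bs \<phi>)"
  using bs
proof (induction bs)
  case (Cons b bs)
  then have "bs \<in> lists Basis" by auto
  then have "frechet_derivative (wtrans M w Y (iter_partial bs \<phi>)) (at x) =
      (\<lambda>v. wtrans M w Y (\<lambda>x. frechet_derivative (iter_partial bs \<phi>) (at x) v) x)" for x
    by (rule frechet_derivative_at[OF wtrans_has_derivative[OF schwartz_iter_partial[OF \<phi>]], symmetric])
  moreover have "iter_partial bs (wtrans M w Y \<phi>) = wtrans M w Y (iter_partial bs \<phi>)"
    using Cons by auto
  ultimately show ?case by simp
qed simp

text \<open>
  Derivatives commute with the averaging, so only the weighted bounds matter. There \<open>norm
  x ^ m\<close> is at most \<open>2 ^ m\<close> times the sum of \<open>norm (x + Y \<omega>) ^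
  m\<close>, which the test function absorbs, and of \<open>norm (Y \<omega>) ^ m\<close>, which
  the moments of the weight absorb.
\<close>

lemma wtrans_schwartz:
  assumes \<phi>: "\<phi> \<in> schwartz" and mom: "\<And>m. integrable M (\<lambda>\<omega>. norm (Y \<omega>) ^ m * norm (w \<omega>))"
  shows "wtrans M w Y \<phi> \<in> schwartz"
  unfolding schwartz_def
proof (intro CollectI ballI conjI allI)
  fix bs :: "'a list" assume bs: "bs \<in> lists Basis"
  define \<psi> where "\<psi> = iter_partial bs \<phi>"
  have \<psi>: "\<psi> \<in> schwartz" unfolding \<psi>_def by (rule schwartz_iter_partial[OF \<phi> bs])
  have eq: "iter_partial bs (wtrans M w Y \<phi>) = wtrans M w Y \<psi>"
    unfolding \<psi>_def by (rule iter_partial_wtrans[OF \<phi> bs])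
  show "iter_partial bs (wtrans M w Y \<phi>) differentiable_on UNIV"
    unfolding eq differentiable_on_def differentiable_def using wtrans_has_derivative[OF \<psi>] by auto
  fix m
  obtain B where B: "\<And>x. norm (\<psi> x) \<le> B" using schwartz_bounded[OF \<psi>] by blast
  obtain C where C: "\<And>x. norm x ^ m * norm (\<psi> x) \<le> C" using schwartz_power_bounded[OF \<psi>] by blast
  have B0: "B \<ge> 0" and C0: "C \<ge> 0" using B[of 0] C[of 0] by (auto intro: order_trans[rotated])
  have [measurable]: "\<psi> \<in> borel_measurable borel" using \<psi> by measurable
  show "bounded (range (\<lambda>x. norm x ^ m *\<^sub>R iter_partial bs (wtrans M w Y \<phi>) x))"
    unfolding bounded_iff eq
  proof (intro exI ballI, safe)
    fix x
    define K where "K \<omega> = 2 ^ m * (C * norm (w \<omega>) + B * (norm (Y \<omega>) ^ m * norm (w \<omega>)))" for \<omega>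
    have Ki: "integrable M K" unfolding K_def using w_int mom by auto
    have pw: "norm (norm x ^ m * (w \<omega> * \<psi> (x + Y \<omega>))) \<le> K \<omega>" for \<omega>
    proof -
      have "norm x \<le> 2 * max (norm (x + Y \<omega>)) (norm (Y \<omega>))"
        using norm_triangle_ineq4[of "x + Y \<omega>" "Y \<omega>"] by auto
      then have "norm x ^ m \<le> (2 * max (norm (x + Y \<omega>)) (norm (Y \<omega>))) ^ m"
        by (intro power_mono) auto
      also have "\<dots> \<le> 2 ^ m * (norm (x + Y \<omega>) ^ m + norm (Y \<omega>) ^ m)"
        by (auto simp: power_mult_distrib max_def)
      finally have "norm x ^ m * norm (\<psi> (x + Y \<omega>)) \<le> 2 ^ m * (norm (x + Y \<omega>) ^ m + norm (Y \<omega>) ^ m) * norm (\<psi> (x + Y \<omega>))"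
        by (intro mult_right_mono) auto
      also have "\<dots> = 2 ^ m * (norm (x + Y \<omega>) ^ m * norm (\<psi> (x + Y \<omega>)) + norm (Y \<omega>) ^ m * norm (\<psi> (x + Y \<omega>)))"
        by (simp add: algebra_simps)
      also have "\<dots> \<le> 2 ^ m * (C + norm (Y \<omega>) ^ m * B)"
        by (intro mult_left_mono add_mono B C) auto
      finally have "norm (w \<omega>) * (norm x ^ m * norm (\<psi> (x + Y \<omega>))) \<le> norm (w \<omega>) * (2 ^ m * (C + norm (Y \<omega>) ^ m * B))"
        by (intro mult_left_mono) auto
      then show ?thesis unfolding K_def by (simp add: norm_mult norm_power algebra_simps)
    qed
    have "norm x ^ m *\<^sub>R wtrans M w Y \<psi> x = (\<integral>\<omega>. norm x ^ m * (w \<omega> * \<psi> (x + Y \<omega>)) \<partial>M)"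
      unfolding wtrans_def by (simp add: scaleR_conv_of_real)
    also have "norm \<dots> \<le> (\<integral>\<omega>. K \<omega> \<partial>M)"
    proof (rule norm_integral_le[OF _ Ki pw])
      show "integrable M (\<lambda>\<omega>. complex_of_real (norm x ^ m) * (w \<omega> * \<psi> (x + Y \<omega>)))"
        using wtrans_integrand_integrable[of \<psi> B] B by (intro integrable_mult_right) auto
    qed
    finally show "norm (norm x ^ m *\<^sub>R wtrans M w Y \<psi> x) \<le> (\<integral>\<omega>. 2 ^ m * (C * norm (w \<omega>) + B * (norm (Y \<omega>) ^ m * norm (w \<omega>))) \<partial>M)"
      unfolding K_def .
  qed
qed

end

section \<open>The Fourier transform of Schwartz functions\<close>

lemma difference_quotient_tendsto:
  fixes f :: "real \<Rightarrow> complex"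
  assumes "(f has_vector_derivative D) (at 0)"
  shows "((\<lambda>s. (f s - f 0) / of_real s) \<longlongrightarrow> D) (at 0)"
proof -
  have l: "((\<lambda>s. norm (f s - f 0 - (s - 0) *\<^sub>R D) / norm (s - 0)) \<longlongrightarrow> 0) (at 0)"
    using assms unfolding has_vector_derivative_def has_derivative_iff_norm by simp
  have "((\<lambda>s. norm ((f s - f 0) / of_real s - D)) \<longlongrightarrow> 0) (at 0)"
  proof (rule Lim_transform_eventually[OF l])
    show "\<forall>\<^sub>F s in at 0. norm (f s - f 0 - (s - 0) *\<^sub>R D) / norm (s - 0) = norm ((f s - f 0) / of_real s - D)"
    proof (intro eventually_at_topological[THEN iffD2] exI[of _ UNIV] conjI ballI impI)
      fix s :: real assume "s \<noteq> 0"
      then have "(f s - f 0) / of_real s - D = (f s - f 0 - (s - 0) *\<^sub>R D) / of_real s"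
        by (simp add: scaleR_conv_of_real diff_divide_distrib)
      then show "norm (f s - f 0 - (s - 0) *\<^sub>R D) / norm (s - 0) = norm ((f s - f 0) / of_real s - D)"
        by (simp add: norm_divide)
    qed auto
  qed
  then show ?thesis by (rule LIM_zero_cancel[OF tendsto_norm_zero_cancel])
qed

lemma cis_inner_measurable [measurable]:
  fixes \<xi> :: "'a::euclidean_space"
  shows "(\<lambda>x. cis (x \<bullet> \<xi>)) \<in> borel_measurable borel"
  "(\<lambda>x. cis (\<xi> \<bullet> x)) \<in> borel_measurable borel" "(\<lambda>x. cis (- (x \<bullet> \<xi>))) \<in> borel_measurable borel"
  unfolding cis_conv_exp by measurable

lemma fourier_measurable [measurable]:
  assumes [measurable]: "f \<in> borel_measurable borel"
  shows "fourier f \<in> borel_measurable borel"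
  unfolding fourier_def cis_conv_exp by measurable

lemma integrable_cis_mult:
  fixes f :: "'a::euclidean_space \<Rightarrow> complex"
  assumes "integrable lborel f"
  shows "integrable lborel (\<lambda>x. cis (- (x \<bullet> \<xi>)) * f x)" "integrable lborel (\<lambda>x. cis (x \<bullet> \<xi>) * f x)"
    "integrable lborel (\<lambda>x. cis (\<xi> \<bullet> x) * f x)"
proof -
  have [measurable]: "f \<in> borel_measurable borel" using assms by auto
  show "integrable lborel (\<lambda>x. cis (- (x \<bullet> \<xi>)) * f x)" "integrable lborel (\<lambda>x. cis (x \<bullet> \<xi>) * f x)"
    "integrable lborel (\<lambda>x. cis (\<xi> \<bullet> x) * f x)"
    by (rule Bochner_Integration.integrable_bound[OF assms]; simp add: norm_mult)+
qed

lemma norm_fourier_le: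
  assumes "integrable lborel f"
  shows "norm (fourier f \<xi>) \<le> (\<integral>x. norm (f x) \<partial>lborel)"
  unfolding fourier_def
  by (rule norm_integral_le[OF integrable_cis_mult(1)[OF assms]]) (use assms in \<open>auto simp: norm_mult\<close>)

lemma fourier_translate:
  fixes f :: "'a::euclidean_space \<Rightarrow> complex"
  assumes [measurable]: "f \<in> borel_measurable borel"
  shows "fourier (\<lambda>x. f (x + a)) \<xi> = cis (a \<bullet> \<xi>) * fourier f \<xi>"
proof -
  have "fourier (\<lambda>x. f (x + a)) \<xi> = (\<integral>x. cis (- ((x + a) \<bullet> \<xi> - a \<bullet> \<xi>)) * f (x + a) \<partial>lborel)"
    unfolding fourier_def by (simp add: inner_add_left)
  also have "\<dots> = (\<integral>x. cis (- (x \<bullet> \<xi> - a \<bullet> \<xi>)) * f x \<partial>lborel)"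
    by (rule integral_translate[of "\<lambda>x. cis (- (x \<bullet> \<xi> - a \<bullet> \<xi>)) * f x"]) (simp add: cis_conv_exp)
  also have "\<dots> = (\<integral>x. cis (a \<bullet> \<xi>) * (cis (- (x \<bullet> \<xi>)) * f x) \<partial>lborel)"
  proof -
    have "cis (- (x \<bullet> \<xi> - a \<bullet> \<xi>)) = cis (a \<bullet> \<xi>) * cis (- (x \<bullet> \<xi>))" for x
      by (simp add: cis_mult)
    then show ?thesis by (simp only: mult.assoc)
  qed
  also have "\<dots> = cis (a \<bullet> \<xi>) * fourier f \<xi>"
    unfolding fourier_def by simp
  finally show ?thesis .
qed

text \<open>
  The transform turns a difference quotient in direction \<open>b\<close> into a multiplication
  by the difference quotient of \<open>cis\<close>; both sides converge as the step tends to
  zero.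
\<close>

lemma fourier_partial:
  fixes \<phi> :: "'a::euclidean_space \<Rightarrow> complex"
  assumes \<phi>: "\<phi> \<in> schwartz" and b: "b \<in> Basis"
  shows "fourier (\<lambda>x. frechet_derivative \<phi> (at x) b) \<xi> = \<i> * of_real (b \<bullet> \<xi>) * fourier \<phi> \<xi>"
proof -
  define h :: "nat \<Rightarrow> real" where "h k = inverse (real (Suc k))" for k
  have h: "h k > 0" "h k \<le> 1" for k by (auto simp: h_def field_simps)
  have h0: "h \<longlonglongrightarrow> 0" unfolding h_def by (rule LIMSEQ_inverse_real_of_nat)
  have hat: "filterlim h (at 0) sequentially"
    using h0 h(1) by (auto simp: filterlim_at intro!: always_eventually) (metis less_irrefl)
  have nb: "norm b = 1" using b by simp
  have [measurable]: "\<phi> \<in> borel_measurable borel" using \<phi> by measurable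
  have [measurable]: "(\<lambda>x. frechet_derivative \<phi> (at x) b) \<in> borel_measurable borel"
    using schwartz_partial[OF \<phi> b] by measurable
  obtain C where C: "C \<ge> 0" "\<And>x a. norm a \<le> 1 \<Longrightarrow> norm (\<phi> (x + a) - \<phi> x) \<le> C * norm a * decay x"
    using schwartz_increment_decay[OF \<phi>] by blast
  define q where "q k x = (\<phi> (x + h k *\<^sub>R b) - \<phi> x) / of_real (h k)" for k x
  have qm [measurable]: "q k \<in> borel_measurable borel" for k unfolding q_def[abs_def] by measurable
  have qlim: "(\<lambda>k. q k x) \<longlonglongrightarrow> frechet_derivative \<phi> (at x) b" for x
  proof -
    have "((\<lambda>s. \<phi> (x + s *\<^sub>R b)) has_vector_derivative frechet_derivative \<phi> (at (x + 0 *\<^sub>R b)) b) (at 0)"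
    proof -
      have "((\<lambda>s::real. x + s *\<^sub>R b) has_derivative (\<lambda>s. s *\<^sub>R b)) (at 0)"
        by (auto intro!: derivative_eq_intros)
      from has_derivative_compose[OF this schwartz_has_derivative[OF \<phi>]]
      have "((\<lambda>s. \<phi> (x + s *\<^sub>R b)) has_derivative (\<lambda>s. frechet_derivative \<phi> (at (x + 0 *\<^sub>R b)) (s *\<^sub>R b))) (at 0)" .
      moreover have "linear (frechet_derivative \<phi> (at (x + 0 *\<^sub>R b)))"
        using schwartz_has_derivative[OF \<phi>] has_derivative_linear by blast
      ultimately show ?thesis unfolding has_vector_derivative_def by (simp add: linear_scale)
    qed
    from difference_quotient_tendsto[OF this]
    have "((\<lambda>s. (\<phi> (x + s *\<^sub>R b) - \<phi> x) / of_real s) \<longlongrightarrow> frechet_derivative \<phi> (at x) b) (at 0)"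
      by simp
    from filterlim_compose[OF this hat]
    show ?thesis unfolding q_def .
  qed
  have "(\<lambda>k. \<integral>x. cis (- (x \<bullet> \<xi>)) * q k x \<partial>lborel) \<longlonglongrightarrow> (\<integral>x. cis (- (x \<bullet> \<xi>)) * frechet_derivative \<phi> (at x) b \<partial>lborel)"
  proof (rule integral_dominated_convergence[where w="\<lambda>x. C * decay x"])
    show "integrable lborel (\<lambda>x::'a. C * decay x)" by (intro integrable_mult_right decay_integrable)
    show "AE x in lborel. (\<lambda>k. cis (- (x \<bullet> \<xi>)) * q k x) \<longlonglongrightarrow> cis (- (x \<bullet> \<xi>)) * frechet_derivative \<phi> (at x) b"
      by (intro AE_I2 tendsto_intros qlim)
    show "AE x in lborel. norm (cis (- (x \<bullet> \<xi>)) * q k x) \<le> C * decay x" for k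
    proof (intro AE_I2)
      fix x
      have "norm (\<phi> (x + h k *\<^sub>R b) - \<phi> x) \<le> C * norm (h k *\<^sub>R b) * decay x"
        using h[of k] nb by (intro C) auto
      then show "norm (cis (- (x \<bullet> \<xi>)) * q k x) \<le> C * decay x"
        unfolding q_def using h[of k] nb by (simp add: norm_mult norm_divide divide_le_eq mult_ac)
    qed
  qed measurable
  moreover have "(\<integral>x. cis (- (x \<bullet> \<xi>)) * q k x \<partial>lborel) = (cis (h k * (b \<bullet> \<xi>)) - 1) / of_real (h k) * fourier \<phi> \<xi>" for k
  proof -
    have i1: "integrable lborel (\<lambda>x. cis (- (x \<bullet> \<xi>)) * \<phi> (x + h k *\<^sub>R b))"
      by (intro integrable_cis_mult integrable_translate schwartz_integrable \<phi>)
    have i2: "integrable lborel (\<lambda>x. cis (- (x \<bullet> \<xi>)) * \<phi> x)"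
      by (intro integrable_cis_mult schwartz_integrable \<phi>)
    have "(\<integral>x. cis (- (x \<bullet> \<xi>)) * q k x \<partial>lborel) =
       (\<integral>x. (cis (- (x \<bullet> \<xi>)) * \<phi> (x + h k *\<^sub>R b) - cis (- (x \<bullet> \<xi>)) * \<phi> x) / of_real (h k) \<partial>lborel)"
      by (simp add: q_def right_diff_distrib diff_divide_distrib)
    also have "\<dots> = (fourier (\<lambda>x. \<phi> (x + h k *\<^sub>R b)) \<xi> - fourier \<phi> \<xi>) / of_real (h k)"
      unfolding fourier_def using i1 i2 by simp
    also have "\<dots> = (cis (h k * (b \<bullet> \<xi>)) - 1) / of_real (h k) * fourier \<phi> \<xi>"
      by (subst fourier_translate) (auto simp: algebra_simps diff_divide_distrib)
    finally show ?thesis .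
  qed
  ultimately have "(\<lambda>k. (cis (h k * (b \<bullet> \<xi>)) - 1) / of_real (h k) * fourier \<phi> \<xi>) \<longlonglongrightarrow> fourier (\<lambda>x. frechet_derivative \<phi> (at x) b) \<xi>"
    by (simp add: fourier_def)
  moreover have "(\<lambda>k. (cis (h k * (b \<bullet> \<xi>)) - 1) / of_real (h k) * fourier \<phi> \<xi>) \<longlonglongrightarrow> \<i> * of_real (b \<bullet> \<xi>) * fourier \<phi> \<xi>"
  proof (intro tendsto_mult tendsto_const)
    have "((\<lambda>s. cis (s * (b \<bullet> \<xi>))) has_vector_derivative \<i> * of_real (b \<bullet> \<xi>)) (at 0)"
    proof -
      have "((\<lambda>z. exp (\<i> * (z * of_real (b \<bullet> \<xi>)))) has_field_derivative \<i> * of_real (b \<bullet> \<xi>)) (at (of_real 0))"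
        by (auto intro!: derivative_eq_intros)
      from has_vector_derivative_real_field[OF this]
      show ?thesis by (simp add: cis_conv_exp)
    qed
    from difference_quotient_tendsto[OF this]
    have "((\<lambda>s. (cis (s * (b \<bullet> \<xi>)) - 1) / of_real s) \<longlongrightarrow> \<i> * of_real (b \<bullet> \<xi>)) (at 0)"
      by simp
    from filterlim_compose[OF this hat]
    show "(\<lambda>k. (cis (h k * (b \<bullet> \<xi>)) - 1) / of_real (h k)) \<longlonglongrightarrow> \<i> * of_real (b \<bullet> \<xi>)" .
  qed
  ultimately show ?thesis by (rule LIMSEQ_unique)
qed

text \<open>
  In the direction \<open>b\<close> of the largest coordinate of \<open>\<xi>\<close>, the power
  \<open>norm \<xi> ^ m\<close> is controlled by \<open>\<bar>b \<bullet> \<xi>\<bar> ^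
  m\<close>, which comes from differentiating \<open>m\<close> times in this direction.
\<close>

lemma fourier_power_bounded:
  fixes \<phi> :: "'a::euclidean_space \<Rightarrow> complex"
  assumes \<phi>: "\<phi> \<in> schwartz"
  shows "\<exists>C. \<forall>\<xi>. norm \<xi> ^ m * norm (fourier \<phi> \<xi>) \<le> C"
proof -
  have it: "fourier (iter_partial (replicate m b) \<phi>) \<xi> = (\<i> * of_real (b \<bullet> \<xi>)) ^ m * fourier \<phi> \<xi>"
    if b: "b \<in> Basis" for b \<xi>
  proof (induction m)
    case (Suc m)
    have "iter_partial (replicate m b) \<phi> \<in> schwartz"
      using b by (intro schwartz_iter_partial[OF \<phi>]) auto
    then show ?case using fourier_partial[OF _ b, of "iter_partial (replicate m b) \<phi>" \<xi>] Suc by simp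
  qed simp
  define L where "L b = (\<integral>x. norm (iter_partial (replicate m b) \<phi> x) \<partial>lborel)" for b
  have L: "\<bar>b \<bullet> \<xi>\<bar> ^ m * norm (fourier \<phi> \<xi>) \<le> L b" if b: "b \<in> Basis" for b \<xi>
  proof -
    have "iter_partial (replicate m b) \<phi> \<in> schwartz"
      using b by (intro schwartz_iter_partial[OF \<phi>]) auto
    from norm_fourier_le[OF schwartz_integrable[OF this], of \<xi>]
    show ?thesis unfolding it[OF b] L_def by (simp add: norm_mult norm_power)
  qed
  define n where "n = real DIM('a)"
  have "norm \<xi> ^ m * norm (fourier \<phi> \<xi>) \<le> n ^ m * (\<Sum>b\<in>Basis. L b)" for \<xi>
  proof -
    obtain b where b: "b \<in> Basis" "norm \<xi> \<le> n * \<bar>b \<bullet> \<xi>\<bar>"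
    proof -
      have "\<exists>b\<in>Basis. norm \<xi> \<le> n * \<bar>b \<bullet> \<xi>\<bar>"
      proof (rule ccontr)
        assume "\<not> ?thesis"
        then have "\<And>b. b \<in> Basis \<Longrightarrow> \<bar>\<xi> \<bullet> b\<bar> < norm \<xi> / n"
          by (auto simp: not_le n_def field_simps inner_commute)
        then have "(\<Sum>b\<in>Basis. \<bar>\<xi> \<bullet> b\<bar>) < (\<Sum>b\<in>(Basis::'a set). norm \<xi> / n)"
          by (intro sum_strict_mono) auto
        also have "\<dots> = norm \<xi>" by (simp add: n_def)
        finally show False using norm_le_l1[of \<xi>] by simp
      qed
      then show ?thesis using that by blast
    qed
    have "norm \<xi> ^ m * norm (fourier \<phi> \<xi>) \<le> (n * \<bar>b \<bullet> \<xi>\<bar>) ^ m * norm (fourier \<phi> \<xi>)"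
      using b by (intro mult_right_mono power_mono) auto
    also have "\<dots> = n ^ m * (\<bar>b \<bullet> \<xi>\<bar> ^ m * norm (fourier \<phi> \<xi>))" by (simp add: power_mult_distrib)
    also have "\<dots> \<le> n ^ m * L b" using L[OF b(1)] by (intro mult_left_mono) (auto simp: n_def)
    also have "\<dots> \<le> n ^ m * (\<Sum>b\<in>Basis. L b)"
      using b by (intro mult_left_mono member_le_sum) (auto simp: n_def L_def)
    finally show ?thesis .
  qed
  then show ?thesis by blast
qed

lemma fourier_decay:
  fixes \<phi> :: "'a::euclidean_space \<Rightarrow> complex"
  assumes \<phi>: "\<phi> \<in> schwartz"
  shows "\<exists>C\<ge>0. \<forall>\<xi>. (1 + norm \<xi>) * norm (fourier \<phi> \<xi>) \<le> C * decay \<xi>"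
  using decay_of_power_bounded[of "\<lambda>\<xi>. norm (fourier \<phi> \<xi>)" 1] fourier_power_bounded[OF \<phi>] by simp

lemma norm_powr_le_1plus:
  fixes r v :: real assumes "0 \<le> r" "r \<le> 1" "0 \<le> v"
  shows "v powr r \<le> 1 + v"
proof -
  have "v powr r \<le> (1 + v) powr r" using assms by (intro powr_mono2) auto
  also have "\<dots> \<le> (1 + v) powr 1" using assms by (intro powr_mono) auto
  finally show ?thesis using assms by simp
qed

lemma powr_fourier_integrable:
  fixes \<phi> :: "'a::euclidean_space \<Rightarrow> complex"
  assumes \<phi>: "\<phi> \<in> schwartz" and r: "0 \<le> r" "r \<le> 1"
  shows "integrable lborel (\<lambda>\<xi>. of_real (norm \<xi> powr r) * fourier \<phi> \<xi>)"
proof -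
  have [measurable]: "\<phi> \<in> borel_measurable borel" using \<phi> by measurable
  obtain C where C: "C \<ge> 0" "\<And>\<xi>. (1 + norm \<xi>) * norm (fourier \<phi> \<xi>) \<le> C * decay \<xi>" using fourier_decay[OF \<phi>] by blast
  show ?thesis
  proof (rule integrable_decay_bound)
    show "norm (of_real (norm \<xi> powr r) * fourier \<phi> \<xi>) \<le> C * decay \<xi>" for \<xi>
    proof -
      have "norm (of_real (norm \<xi> powr r) * fourier \<phi> \<xi>) \<le> (1 + norm \<xi>) * norm (fourier \<phi> \<xi>)"
        using norm_powr_le_1plus[OF r, of "norm \<xi>"] by (simp add: norm_mult mult_right_mono)
      then show ?thesis using C(2)[of \<xi>] by simp
    qed
  qed measurable
qed

lemma fourier_integrable:
  fixes \<phi> :: "'a::euclidean_space \<Rightarrow> complex"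
  assumes \<phi>: "\<phi> \<in> schwartz"
  shows "integrable lborel (fourier \<phi>)"
proof -
  have [measurable]: "\<phi> \<in> borel_measurable borel" using \<phi> by measurable
  obtain C where C: "C \<ge> 0" "\<And>\<xi>. (1 + norm \<xi>) * norm (fourier \<phi> \<xi>) \<le> C * decay \<xi>" using fourier_decay[OF \<phi>] by blast
  show ?thesis
  proof (rule integrable_decay_bound)
    fix \<xi>
    have "1 * norm (fourier \<phi> \<xi>) \<le> (1 + norm \<xi>) * norm (fourier \<phi> \<xi>)"
      by (intro mult_right_mono) auto
    then show "norm (fourier \<phi> \<xi>) \<le> C * decay \<xi>" using C(2)[of \<xi>] by simp
  qed measurable
qed

lemma fourier_multiplication_formula:
  fixes f g :: "'a::euclidean_space \<Rightarrow> complex"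
  assumes f: "integrable lborel f" and g: "integrable lborel g"
  shows "(\<integral>\<xi>. fourier f \<xi> * g \<xi> \<partial>lborel) = (\<integral>x. f x * fourier g x \<partial>lborel)"
proof -
  have [measurable]: "f \<in> borel_measurable borel" "g \<in> borel_measurable borel" using f g by auto
  have I: "integrable (lborel \<Otimes>\<^sub>M lborel) (\<lambda>(x, \<xi>). cis (- (x \<bullet> \<xi>)) * f x * g \<xi>)"
  proof (rule integrableI_bounded)
    have "(\<integral>\<^sup>+ z. ennreal (norm (case z of (x, \<xi>) \<Rightarrow> cis (- (x \<bullet> \<xi>)) * f x * g \<xi>)) \<partial>(lborel \<Otimes>\<^sub>M lborel))
       = (\<integral>\<^sup>+ x. ennreal (norm (f x)) * (\<integral>\<^sup>+\<xi>. ennreal (norm (g \<xi>)) \<partial>lborel) \<partial>lborel)"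
      by (subst lborel.nn_integral_fst[symmetric])
         (auto simp: norm_mult ennreal_mult nn_integral_cmult cis_conv_exp)
    also have "\<dots> = (\<integral>\<^sup>+ x. ennreal (norm (f x)) \<partial>lborel) * (\<integral>\<^sup>+\<xi>. ennreal (norm (g \<xi>)) \<partial>lborel)"
      by (rule nn_integral_multc) measurable
    also have "\<dots> < \<infinity>" using f g by (auto simp: integrable_iff_bounded ennreal_mult_less_top)
    finally show "(\<integral>\<^sup>+ z. ennreal (norm (case z of (x, \<xi>) \<Rightarrow> cis (- (x \<bullet> \<xi>)) * f x * g \<xi>)) \<partial>(lborel \<Otimes>\<^sub>M lborel)) < \<infinity>" .
  qed (simp add: cis_conv_exp)
  have "(\<integral>\<xi>. fourier f \<xi> * g \<xi> \<partial>lborel) = (\<integral>\<xi>. (\<integral>x. cis (- (x \<bullet> \<xi>)) * f x * g \<xi> \<partial>lborel) \<partial>lborel)"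
    unfolding fourier_def by simp
  also have "\<dots> = (\<integral>x. (\<integral>\<xi>. cis (- (x \<bullet> \<xi>)) * f x * g \<xi> \<partial>lborel) \<partial>lborel)"
    by (rule lborel_pair.Fubini_integral[OF I])
  also have "\<dots> = (\<integral>x. f x * fourier g x \<partial>lborel)"
    unfolding fourier_def
    by (intro Bochner_Integration.integral_cong refl, subst integral_mult_right_zero[symmetric],
        intro Bochner_Integration.integral_cong refl) (simp add: mult_ac inner_commute)
  finally show ?thesis .
qed

lemma fourier_gauss_window:
  fixes x y :: "'a::euclidean_space"
  assumes e: "e > 0"
  shows "fourier (\<lambda>\<xi>. cis (x \<bullet> \<xi>) * of_real (exp (- (norm (e *\<^sub>R \<xi>))\<^sup>2 / 2))) y =
     of_real ((2 * pi) ^ DIM('a) / e ^ DIM('a) * gauss ((1 / e) *\<^sub>R (y - x)))"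
    and "integrable lborel (\<lambda>\<xi>. cis (x \<bullet> \<xi>) * of_real (exp (- (norm (e *\<^sub>R \<xi>))\<^sup>2 / 2)))"
proof -
  define s where "s = sqrt (2 * pi) ^ DIM('a)"
  have s: "s > 0" by (simp add: s_def)
  have "s * s = (sqrt (2 * pi) * sqrt (2 * pi)) ^ DIM('a)" unfolding s_def by (rule power_mult_distrib[symmetric])
  then have s2: "s * s = (2 * pi) ^ DIM('a)" by simp
  have ex: "exp (- (norm z)\<^sup>2 / 2) = s * gauss z" for z :: 'a
    unfolding gauss_eq s_def by simp
  have g1: "integrable lborel (\<lambda>z::'a. complex_of_real (gauss z))" using gauss_integrable by auto
  have sc: "(\<integral>\<xi>. F (e *\<^sub>R \<xi>) \<partial>lborel) = (\<integral>z. F z \<partial>lborel) / of_real (e ^ DIM('a))"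
    if "F \<in> borel_measurable borel" for F :: "'a \<Rightarrow> complex"
    using integral_scale[of F e] that e by simp
  have "fourier (\<lambda>\<xi>. cis (x \<bullet> \<xi>) * of_real (exp (- (norm (e *\<^sub>R \<xi>))\<^sup>2 / 2))) y
     = (\<integral>\<xi>. (\<lambda>z. of_real s * (gauss z * cis (z \<bullet> ((1 / e) *\<^sub>R (x - y))))) (e *\<^sub>R \<xi>) \<partial>lborel)"
    unfolding fourier_def ex
  proof (intro Bochner_Integration.integral_cong refl)
    fix \<xi> :: 'a
    have c: "cis ((e *\<^sub>R \<xi>) \<bullet> ((1 / e) *\<^sub>R (x - y))) = cis (- (\<xi> \<bullet> y)) * cis (x \<bullet> \<xi>)"
      using e by (simp add: cis_mult inner_diff_right inner_commute)
    show "cis (- (\<xi> \<bullet> y)) * (cis (x \<bullet> \<xi>) * of_real (s * gauss (e *\<^sub>R \<xi>))) =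
        of_real s * (of_real (gauss (e *\<^sub>R \<xi>)) * cis ((e *\<^sub>R \<xi>) \<bullet> ((1 / e) *\<^sub>R (x - y))))"
      unfolding c by (simp add: mult_ac)
  qed
  also have "\<dots> = (\<integral>z. of_real s * (gauss z * cis (z \<bullet> ((1 / e) *\<^sub>R (x - y)))) \<partial>lborel) / of_real (e ^ DIM('a))"
    by (rule sc) (simp add: cis_conv_exp)
  also have "\<dots> = of_real s * of_real (exp (- (norm ((1 / e) *\<^sub>R (x - y)))\<^sup>2 / 2)) / of_real (e ^ DIM('a))"
    by (simp only: integral_mult_right_zero gauss_fourier)
  also have "norm ((1 / e) *\<^sub>R (x - y)) = norm ((1 / e) *\<^sub>R (y - x))"
    by (simp add: norm_minus_commute)
  also have "of_real s * of_real (exp (- (norm ((1 / e) *\<^sub>R (y - x)))\<^sup>2 / 2)) / of_real (e ^ DIM('a)) =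
     complex_of_real ((2 * pi) ^ DIM('a) / e ^ DIM('a) * gauss ((1 / e) *\<^sub>R (y - x)))"
    unfolding ex s2[symmetric] by simp
  finally show "fourier (\<lambda>\<xi>. cis (x \<bullet> \<xi>) * of_real (exp (- (norm (e *\<^sub>R \<xi>))\<^sup>2 / 2))) y =
     of_real ((2 * pi) ^ DIM('a) / e ^ DIM('a) * gauss ((1 / e) *\<^sub>R (y - x)))" .
  have "integrable lborel (\<lambda>\<xi>::'a. complex_of_real (exp (- (norm (e *\<^sub>R \<xi>))\<^sup>2 / 2)))"
  proof (rule integrableI_bounded)
    have "(\<integral>\<^sup>+\<xi>. ennreal (exp (- (norm (\<xi>::'a))\<^sup>2 / 2)) \<partial>lborel)
      = ennreal (e ^ DIM('a)) * (\<integral>\<^sup>+\<xi>. ennreal (exp (- (norm (e *\<^sub>R (\<xi>::'a)))\<^sup>2 / 2)) \<partial>lborel)"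
      using nn_integral_scale[of "\<lambda>\<xi>::'a. ennreal (exp (- (norm \<xi>)\<^sup>2 / 2))" e] e by simp
    moreover have "(\<integral>\<^sup>+\<xi>. ennreal (exp (- (norm (\<xi>::'a))\<^sup>2 / 2)) \<partial>lborel) < \<infinity>"
      unfolding ex using gauss_integrable[where 'a='a] s
      by (auto simp: ennreal_mult nn_integral_cmult ennreal_mult_less_top integrable_iff_bounded)
    ultimately have "(\<integral>\<^sup>+\<xi>. ennreal (exp (- (norm (e *\<^sub>R (\<xi>::'a)))\<^sup>2 / 2)) \<partial>lborel) < \<infinity>"
      using e by (auto simp: ennreal_mult_less_top)
    then show "(\<integral>\<^sup>+\<xi>. ennreal (norm (complex_of_real (exp (- (norm (e *\<^sub>R (\<xi>::'a)))\<^sup>2 / 2)))) \<partial>lborel) < \<infinity>"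
      by simp
  qed measurable
  then show "integrable lborel (\<lambda>\<xi>. cis (x \<bullet> \<xi>) * of_real (exp (- (norm (e *\<^sub>R \<xi>))\<^sup>2 / 2)))"
    by (rule integrable_cis_mult)
qed

text \<open>
  A Gaussian window of width \<open>1 / h\<close> in frequency makes the double integral
  absolutely convergent. In space it becomes an approximate identity of width \<open>h\<close>,
  and both sides converge as \<open>h\<close> tends to zero.
\<close>

theorem fourier_inversion:
  fixes \<phi> :: "'a::euclidean_space \<Rightarrow> complex"
  assumes \<phi>: "\<phi> \<in> schwartz"
  shows "inv_fourier (fourier \<phi>) x = \<phi> x"
proof -
  define h :: "nat \<Rightarrow> real" where "h k = inverse (real (Suc k))" for k
  have h: "h k > 0" "h k \<le> 1" for k by (auto simp: h_def field_simps)
  have h0: "h \<longlonglongrightarrow> 0" unfolding h_def by (rule LIMSEQ_inverse_real_of_nat)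
  have [measurable]: "\<phi> \<in> borel_measurable borel" using \<phi> by measurable
  obtain B where B: "\<And>x. norm (\<phi> x) \<le> B" using schwartz_bounded[OF \<phi>] by blast
  define c where "c = (2 * pi) ^ DIM('a)"
  have c: "c > 0" by (simp add: c_def)
  define win where "win k \<xi> = cis (x \<bullet> \<xi>) * of_real (exp (- (norm (h k *\<^sub>R \<xi>))\<^sup>2 / 2))" for k \<xi>
  have "(\<lambda>k. \<integral>\<xi>. fourier \<phi> \<xi> * win k \<xi> \<partial>lborel) \<longlonglongrightarrow> (\<integral>\<xi>. fourier \<phi> \<xi> * cis (x \<bullet> \<xi>) \<partial>lborel)"
  proof (rule integral_dominated_convergence[where w="\<lambda>\<xi>. norm (fourier \<phi> \<xi>)"])
    show "integrable lborel (\<lambda>\<xi>. norm (fourier \<phi> \<xi>))" using fourier_integrable[OF \<phi>] by auto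
    show "AE \<xi> in lborel. (\<lambda>k. fourier \<phi> \<xi> * win k \<xi>) \<longlonglongrightarrow> fourier \<phi> \<xi> * cis (x \<bullet> \<xi>)"
    proof (intro AE_I2)
      fix \<xi> :: 'a
      have "(\<lambda>k. fourier \<phi> \<xi> * (cis (x \<bullet> \<xi>) * of_real (exp (- (norm (h k *\<^sub>R \<xi>))\<^sup>2 / 2)))) \<longlonglongrightarrow>
         fourier \<phi> \<xi> * (cis (x \<bullet> \<xi>) * of_real (exp (- (norm (0 *\<^sub>R \<xi>))\<^sup>2 / 2)))"
        by (intro tendsto_intros h0) simp_all
      then show "(\<lambda>k. fourier \<phi> \<xi> * win k \<xi>) \<longlonglongrightarrow> fourier \<phi> \<xi> * cis (x \<bullet> \<xi>)" by (simp add: win_def)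
    qed
    show "AE \<xi> in lborel. norm (fourier \<phi> \<xi> * win k \<xi>) \<le> norm (fourier \<phi> \<xi>)" for k
      by (intro AE_I2) (auto simp: win_def norm_mult mult_left_le)
  qed (auto simp: win_def cis_conv_exp)
  moreover have "(\<integral>\<xi>. fourier \<phi> \<xi> * win k \<xi> \<partial>lborel) = of_real c * (\<integral>z. gauss z * \<phi> (x + h k *\<^sub>R z) \<partial>lborel)" for k
  proof -
    have "(\<integral>\<xi>. fourier \<phi> \<xi> * win k \<xi> \<partial>lborel) = (\<integral>y. \<phi> y * fourier (win k) y \<partial>lborel)"
      unfolding win_def[abs_def]
      by (rule fourier_multiplication_formula[OF schwartz_integrable[OF \<phi>] fourier_gauss_window(2)[OF h(1)]])
    also have "\<dots> = (\<integral>y. \<phi> y * of_real (c / h k ^ DIM('a) * gauss ((1 / h k) *\<^sub>R (y - x))) \<partial>lborel)"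
      unfolding win_def[abs_def] fourier_gauss_window(1)[OF h(1)] c_def ..
    also have "\<dots> = (\<integral>y. \<phi> (y + x) * of_real (c / h k ^ DIM('a) * gauss ((1 / h k) *\<^sub>R y)) \<partial>lborel)"
      by (subst integral_translate[symmetric, where y=x]) simp_all
    also have "\<dots> = of_real (h k ^ DIM('a)) * (\<integral>z. \<phi> (h k *\<^sub>R z + x) * of_real (c / h k ^ DIM('a) * gauss z) \<partial>lborel)"
      using integral_scale[of "\<lambda>y. \<phi> (y + x) * of_real (c / h k ^ DIM('a) * gauss ((1 / h k) *\<^sub>R y))" "h k"] h(1)[of k]
      by simp
    also have "\<dots> = (\<integral>z. of_real (h k ^ DIM('a)) * (\<phi> (h k *\<^sub>R z + x) * of_real (c / h k ^ DIM('a) * gauss z)) \<partial>lborel)"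
      by simp
    also have "\<dots> = (\<integral>z. of_real c * (gauss z * \<phi> (x + h k *\<^sub>R z)) \<partial>lborel)"
      using h(1)[of k] by (intro Bochner_Integration.integral_cong refl) (simp add: add.commute)
    finally show ?thesis by simp
  qed
  moreover have "(\<lambda>k. \<integral>z. gauss z * \<phi> (x + h k *\<^sub>R z) \<partial>lborel) \<longlonglongrightarrow> (\<integral>z. gauss (z::'a) * \<phi> x \<partial>lborel)"
  proof (rule integral_dominated_convergence[where w="\<lambda>z::'a. gauss z * B"])
    show "integrable lborel (\<lambda>z::'a. gauss z * B)" using gauss_integrable by (intro integrable_mult_left)
    show "AE z in lborel. (\<lambda>k. gauss z * \<phi> (x + h k *\<^sub>R z)) \<longlonglongrightarrow> gauss z * \<phi> x"
    proof (intro AE_I2 tendsto_mult tendsto_const)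
      fix z :: 'a
      have "(\<lambda>k. x + h k *\<^sub>R z) \<longlonglongrightarrow> x + 0 *\<^sub>R z" by (intro tendsto_intros h0)
      moreover have "isCont \<phi> (x + 0 *\<^sub>R z)" using schwartz_continuous[OF \<phi>] by (simp add: continuous_on_eq_continuous_at)
      ultimately have "(\<lambda>k. \<phi> (x + h k *\<^sub>R z)) \<longlonglongrightarrow> \<phi> (x + 0 *\<^sub>R z)" by (rule isCont_tendsto_compose[rotated])
      then show "(\<lambda>k. \<phi> (x + h k *\<^sub>R z)) \<longlonglongrightarrow> \<phi> x" by simp
    qed
    show "AE z in lborel. norm (gauss z * \<phi> (x + h k *\<^sub>R z)) \<le> gauss z * B" for k
      using B by (intro AE_I2) (auto simp: norm_mult mult_left_mono)
  qed measurable
  moreover have "(\<integral>z. gauss (z::'a) * \<phi> x \<partial>lborel) = \<phi> x"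
    using gauss_integral[where 'a='a] by (simp add: integral_complex_of_real)
  ultimately have "(\<lambda>k. of_real c * (\<integral>z. gauss z * \<phi> (x + h k *\<^sub>R z) \<partial>lborel)) \<longlonglongrightarrow> (\<integral>\<xi>. fourier \<phi> \<xi> * cis (x \<bullet> \<xi>) \<partial>lborel)"
    "(\<lambda>k. of_real c * (\<integral>z. gauss z * \<phi> (x + h k *\<^sub>R z) \<partial>lborel)) \<longlonglongrightarrow> of_real c * \<phi> x"
    by (simp, intro tendsto_mult tendsto_const) (simp add: gauss_integral)
  then have "(\<integral>\<xi>. fourier \<phi> \<xi> * cis (x \<bullet> \<xi>) \<partial>lborel) = of_real c * \<phi> x"
    by (rule LIMSEQ_unique)
  then show ?thesis unfolding inv_fourier_def c_def[symmetric] using c by (simp add: mult.commute)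
qed

section \<open>Fractional binomial coefficients\<close>

text \<open>
  The coefficients of the binomial series of \<open>(1 - z) powr t\<close>.
\<close>

definition bcoef :: "real \<Rightarrow> nat \<Rightarrow> real" where
  "bcoef t j = (- 1) ^ j * (t gchoose j)"

lemma bcoef_0 [simp]: "bcoef t 0 = 1" by (simp add: bcoef_def)

lemma bcoef_Suc: "bcoef t (Suc j) = bcoef t j * ((real j - t) / (real j + 1))"
proof -
  have "(t gchoose Suc j) * (real j + 1) = (t gchoose j) * (t - real j)"
    using gbinomial_absorption[of j t] gbinomial_absorb_comp[of t j] gbinomial_mult_1[of t j]
    by (simp add: algebra_simps)
  then have "(t gchoose Suc j) = (t gchoose j) * (t - real j) / (real j + 1)"
    by (simp add: field_simps)
  moreover have "(real j - t) / (real j + 1) = - ((t - real j) / (real j + 1))"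
    by (simp add: minus_divide_left)
  ultimately show ?thesis by (simp add: bcoef_def)
qed

lemma bcoef_1: "bcoef t (Suc 0) = - t" by (simp add: bcoef_Suc)

lemma bcoef_nonpos:
  assumes "0 < t" "t \<le> 1"
  shows "bcoef t (Suc j) \<le> 0"
proof (induction j)
  case 0 then show ?case using assms by (simp add: bcoef_1)
next
  case (Suc j)
  have "(real (Suc j) - t) / (real (Suc j) + 1) \<ge> 0" using assms by simp
  then show ?case using Suc by (subst bcoef_Suc) (rule mult_nonpos_nonneg)
qed

text \<open>
  By Bernoulli's inequality the ratio of consecutive coefficients is at most the corresponding
  ratio of the powers on the right.
\<close>

lemma bcoef_bound:
  assumes t: "0 < t" "t \<le> 1"
  shows "\<bar>bcoef t (Suc j)\<bar> \<le> t * real (Suc j) powr (- 1 - t)"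
proof (induction j)
  case 0 then show ?case using t by (simp add: bcoef_1)
next
  case (Suc j)
  define a where "a = real (Suc j) / real (Suc (Suc j))"
  have a: "a > 0" by (simp add: a_def)
  have "(real (Suc j) - t) / (real (Suc j) + 1) = 1 + (1 + t) * (a - 1)"
    by (simp add: a_def field_simps)
  also have "\<dots> \<le> a powr (1 + t)"
    using young_tangent[of "1 + t" a 1] t a by (simp add: algebra_simps)
  finally have le: "(real (Suc j) - t) / (real (Suc j) + 1) \<le> a powr (1 + t)" .
  have "\<bar>bcoef t (Suc (Suc j))\<bar> = \<bar>bcoef t (Suc j)\<bar> * ((real (Suc j) - t) / (real (Suc j) + 1))"
    using t by (subst bcoef_Suc) (simp add: abs_mult)
  also have "\<dots> \<le> (t * real (Suc j) powr (- 1 - t)) * a powr (1 + t)"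
    using t by (intro mult_mono Suc le) auto
  also have "\<dots> = t * real (Suc (Suc j)) powr (- 1 - t)"
  proof -
    have m: "y powr (- 1 - t) = 1 / y powr (1 + t)" for y
      using powr_minus_divide[of y "1 + t"] by simp
    have "real (Suc j) powr (- 1 - t) * a powr (1 + t) = real (Suc (Suc j)) powr (- 1 - t)"
      unfolding a_def m powr_divide by simp
    then show ?thesis by simp
  qed
  finally show ?case .
qed

lemma bcoef_moment_summable:
  assumes t: "0 < t" "t \<le> 1" and r: "r < t"
  shows "summable (\<lambda>j. \<bar>bcoef t j\<bar> * real j powr r)"
proof -
  have "summable (\<lambda>j. real (Suc j) powr (- 1 - (t - r)))"
    using r by (intro summable_Suc_iff[of "\<lambda>j. real j powr (- 1 - (t - r))", THEN iffD2]) (simp add: summable_real_powr_iff)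
  then have "summable (\<lambda>j. t * real (Suc j) powr (- 1 - (t - r)))" by (rule summable_mult)
  then have "summable (\<lambda>j. \<bar>bcoef t (Suc j)\<bar> * real (Suc j) powr r)"
  proof (rule summable_comparison_test_ev[rotated], intro always_eventually allI)
    fix j
    have "\<bar>bcoef t (Suc j)\<bar> * real (Suc j) powr r \<le> (t * real (Suc j) powr (- 1 - t)) * real (Suc j) powr r"
      by (intro mult_right_mono bcoef_bound t) auto
    also have "\<dots> = t * real (Suc j) powr (- 1 - (t - r))"
      by (simp add: mult.assoc flip: powr_add) (simp add: algebra_simps)
    finally show "norm (\<bar>bcoef t (Suc j)\<bar> * real (Suc j) powr r) \<le> t * real (Suc j) powr (- 1 - (t - r))"
      by simp
  qed
  then show ?thesis by (subst (asm) summable_Suc_iff)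
qed

lemma bcoef_summable:
  assumes t: "0 < t" "t \<le> 1"
  shows "summable (\<lambda>j. \<bar>bcoef t j\<bar>)"
proof -
  have "summable (\<lambda>j. \<bar>bcoef t (Suc j)\<bar>)"
    using bcoef_moment_summable[OF t, of 0] t summable_Suc_iff[of "\<lambda>j. \<bar>bcoef t j\<bar> * real j powr 0"]
    by simp
  then show ?thesis using summable_Suc_iff[of "\<lambda>j. \<bar>bcoef t j\<bar>"] by simp
qed

lemma bcoef_partial_sum:
  assumes t: "0 < t"
  shows "(\<Sum>j\<le>m. bcoef t j) = - bcoef t (Suc m) * (real m + 1) / t"
proof (induction m)
  case 0 then show ?case using t by (simp add: bcoef_1)
next
  case (Suc m)
  have "bcoef t (Suc (Suc m)) * (real (Suc m) + 1) = bcoef t (Suc m) * (real (Suc m) - t)"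
    by (subst bcoef_Suc) simp
  then show ?case using t Suc by (simp add: field_simps)
qed

lemma bcoef_sums_0:
  assumes t: "0 < t" "t \<le> 1"
  shows "bcoef t sums 0"
proof -
  have "(\<lambda>m. \<Sum>j\<le>m. bcoef t j) \<longlonglongrightarrow> 0"
  proof (rule Lim_null_comparison)
    show "\<forall>\<^sub>F m in sequentially. norm (\<Sum>j\<le>m. bcoef t j) \<le> real (Suc m) powr (- t)"
    proof (intro always_eventually allI)
      fix m
      have "norm (\<Sum>j\<le>m. bcoef t j) = \<bar>bcoef t (Suc m)\<bar> * real (Suc m) / t"
        using t unfolding bcoef_partial_sum[OF t(1)] by (simp add: abs_mult)
      also have "\<dots> \<le> (t * real (Suc m) powr (- 1 - t)) * real (Suc m) / t"
        using t by (intro divide_right_mono mult_right_mono bcoef_bound) auto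
      also have "\<dots> = real (Suc m) powr (- t)"
      proof -
        have "real (Suc m) powr (- 1 - t) * real (Suc m) powr 1 = real (Suc m) powr (- t)"
          unfolding powr_add[symmetric] by (rule arg_cong2[where f="(powr)"]) simp_all
        then show ?thesis using t by (simp del: of_nat_Suc)
      qed
      finally show "norm (\<Sum>j\<le>m. bcoef t j) \<le> real (Suc m) powr (- t)" .
    qed
    show "(\<lambda>m. real (Suc m) powr (- t)) \<longlonglongrightarrow> 0"
      using t by (intro tendsto_neg_powr filterlim_compose[OF filterlim_real_sequentially filterlim_Suc]) auto
  qed
  then show ?thesis unfolding sums_def_le .
qed

text \<open>
  All coefficients with positive index have the same sign, and together they cancel \<open>bcoef
  t 0 = 1\<close>.
\<close>

lemma bcoef_abs_sum:
  assumes t: "0 < t" "t \<le> 1"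
  shows "(\<lambda>j. \<bar>bcoef t (Suc j)\<bar>) sums 1"
proof -
  have "(\<lambda>j. bcoef t (Suc j)) sums (0 - bcoef t 0)"
    using bcoef_sums_0[OF t] by (subst sums_Suc_iff) simp
  then have "(\<lambda>j. - bcoef t (Suc j)) sums 1" using sums_minus by fastforce
  moreover have "(\<lambda>j. - bcoef t (Suc j)) = (\<lambda>j. \<bar>bcoef t (Suc j)\<bar>)"
    using bcoef_nonpos[OF t] by (auto simp: fun_eq_iff abs_of_nonpos)
  ultimately show ?thesis by simp
qed

lemma bcoef_integrable:
  assumes t: "0 < t" "t \<le> 1"
  shows "integrable (count_space UNIV) (\<lambda>j. complex_of_real (bcoef t j))"
  by (simp add: integrable_count_space_nat_iff bcoef_summable[OF t])

lemma bcoef_abs_integrable: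
  assumes t: "0 < t" "t \<le> 1"
  shows "integrable (count_space UNIV) (\<lambda>j. \<bar>bcoef t j\<bar>)"
  by (simp add: integrable_count_space_nat_iff bcoef_summable[OF t])

lemma bcoef_integral_0:
  assumes t: "0 < t" "t \<le> 1"
  shows "(\<integral>j. complex_of_real (bcoef t j) \<partial>count_space UNIV) = 0"
proof -
  have "(\<integral>j. bcoef t j \<partial>count_space UNIV) = (\<Sum>j. bcoef t j)"
    using bcoef_summable[OF t] by (intro integral_count_space_nat) (simp add: integrable_count_space_nat_iff)
  also have "\<dots> = 0"
    using bcoef_sums_0[OF t] by (rule sums_unique[symmetric])
  finally have "(\<integral>j. bcoef t j \<partial>count_space UNIV) = 0" .
  then show ?thesis by (subst integral_complex_of_real) (simp only: of_real_0)
qed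

lemma bcoef_mass:
  assumes t: "0 < t" "t \<le> 1"
  shows "(\<integral>j. norm (complex_of_real (bcoef t j)) \<partial>count_space UNIV) = 2"
proof -
  have "(\<integral>j. norm (complex_of_real (bcoef t j)) \<partial>count_space UNIV) = (\<Sum>j. \<bar>bcoef t j\<bar>)"
    using bcoef_summable[OF t] by (subst integral_count_space_nat) (auto simp: integrable_count_space_nat_iff)
  also have "\<dots> = \<bar>bcoef t 0\<bar> + (\<Sum>j. \<bar>bcoef t (Suc j)\<bar>)"
    using suminf_split_head[OF bcoef_summable[OF t]] by simp
  also have "\<dots> = 2" using sums_unique[OF bcoef_abs_sum[OF t]] by simp
  finally show ?thesis .
qed

section \<open>The symbol of the fractional difference\<close>

text \<open>
  The symbol of the fractional difference, as a function of \<open>u = h \<bullet>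
  \<xi>\<close>.
\<close>

definition difference_symbol :: "real \<Rightarrow> real \<Rightarrow> complex" where
  "difference_symbol t u = (\<integral>j. complex_of_real (bcoef t j) * cis ((t - real j) * u) \<partial>count_space UNIV)"

text \<open>
  The fractional difference as a mixture of translations over the natural numbers. It agrees
  with \<^const>\<open>frac_diff\<close> wherever the series converges absolutely, which for
  functions in \<open>L\<^sup>p\<close> is almost everywhere.
\<close>

definition fdiff :: "real \<Rightarrow> 'a::euclidean_space \<Rightarrow> ('a \<Rightarrow> complex) \<Rightarrow> 'a \<Rightarrow> complex" where
  "fdiff t h = wtrans (count_space UNIV) (\<lambda>j. complex_of_real (bcoef t j)) (\<lambda>j. (t - real j) *\<^sub>R h)"

lemma fdiff_mixture:
  assumes t: "0 < t" "t \<le> 1"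
  shows "translation_mixture (count_space UNIV) (\<lambda>j. complex_of_real (bcoef t j)) (\<lambda>j. (t - real j) *\<^sub>R h)"
  by (intro translation_mixture.intro translation_mixture_axioms.intro bcoef_integrable[OF t]
        sigma_finite_measure_count_space) simp

lemma wtrans_symbol_fdiff:
  "wtrans_symbol (count_space UNIV) (\<lambda>j. complex_of_real (bcoef t j)) (\<lambda>j. (t - real j) *\<^sub>R h) \<xi> = difference_symbol t (h \<bullet> \<xi>)"
  by (simp add: wtrans_symbol_def difference_symbol_def)

lemma difference_symbol_measurable [measurable]: "difference_symbol t \<in> borel_measurable borel"
proof -
  interpret sigma_finite_measure "count_space (UNIV :: nat set)" by (rule sigma_finite_measure_count_space)
  show ?thesis unfolding difference_symbol_def cis_conv_exp by measurable
qed

lemma difference_symbol_integrand: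
  assumes t: "0 < t" "t \<le> 1"
  shows "integrable (count_space UNIV) (\<lambda>j. complex_of_real (bcoef t j) * cis (g j))"
  by (rule Bochner_Integration.integrable_bound[OF bcoef_integrable[OF t]]) (auto simp: norm_mult)

lemma norm_difference_symbol_le_2:
  assumes t: "0 < t" "t \<le> 1"
  shows "norm (difference_symbol t u) \<le> 2"
proof -
  have "norm (difference_symbol t u) \<le> (\<integral>j. norm (complex_of_real (bcoef t j)) \<partial>count_space UNIV)"
    unfolding difference_symbol_def using bcoef_abs_integrable[OF t] by (intro norm_integral_le difference_symbol_integrand t) (auto simp: norm_mult)
  then show ?thesis using bcoef_mass[OF t] by simp
qed

lemma min_1_powr:
  fixes v r :: real assumes "0 \<le> r" "r \<le> 1" "0 \<le> v"
  shows "v \<le> 1 \<Longrightarrow> v \<le> v powr r" "1 \<le> v \<Longrightarrow> 1 \<le> v powr r"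
proof -
  show "v \<le> v powr r" if "v \<le> 1"
  proof (cases "v = 0")
    case False
    then have "v powr 1 \<le> v powr r" using assms that by (intro powr_mono') auto
    then show ?thesis using assms False by simp
  qed simp
  show "1 \<le> v powr r" if "1 \<le> v" using that assms by (simp add: ge_one_powr_ge_zero)
qed

text \<open>
  An interpolation between the Lipschitz bound \<open>\<bar>a - b\<bar>\<close> and the trivial
  bound \<open>2\<close>.
\<close>

lemma norm_cis_diff_le:
  assumes "0 \<le> r" "r \<le> 1"
  shows "norm (cis a - cis b) \<le> 2 * \<bar>a - b\<bar> powr r"
proof -
  have e: "cis a - cis b = cis b * (cis (a - b) - 1)" by (simp add: algebra_simps cis_mult)
  have 1: "norm (cis a - cis b) \<le> \<bar>a - b\<bar>"
    unfolding e norm_mult using iexp_approx1[of "a - b" 0] by (simp add: cis_conv_exp)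
  have 2: "norm (cis a - cis b) \<le> 2" using norm_triangle_ineq4[of "cis a" "cis b"] by simp
  show ?thesis
  proof (cases "\<bar>a - b\<bar> \<le> 1")
    case True
    then have "\<bar>a - b\<bar> \<le> \<bar>a - b\<bar> powr r" by (intro min_1_powr assms) auto
    then show ?thesis using 1 powr_ge_zero[of "\<bar>a - b\<bar>" r] by linarith
  next
    case False
    then have "1 \<le> \<bar>a - b\<bar> powr r" by (intro min_1_powr assms) auto
    then show ?thesis using 2 by linarith
  qed
qed

text \<open>
  For \<open>0 < t < 1\<close> the coefficients decay like \<open>j powr (- 1 - t)\<close>, so
  the series converges exactly for \<open>r < t\<close>.
\<close>

definition bcoef_moment :: "real \<Rightarrow> real \<Rightarrow> real" where
  "bcoef_moment t r = (\<Sum>j. \<bar>bcoef t j\<bar> * real j powr r)"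

lemma bcoef_moment_nonneg: assumes "0 < t" "t \<le> 1" "r < t" shows "bcoef_moment t r \<ge> 0"
  unfolding bcoef_moment_def by (intro suminf_nonneg bcoef_moment_summable assms) auto

lemma bcoef_moment_nn_integral:
  assumes t: "0 < t" "t \<le> 1" and r: "r < t"
  shows "(\<integral>\<^sup>+j. ennreal (\<bar>bcoef t j\<bar> * real j powr r) \<partial>count_space UNIV) = ennreal (bcoef_moment t r)"
  unfolding bcoef_moment_def nn_integral_count_space_nat
  by (intro suminf_ennreal2 bcoef_moment_summable t r) auto

text \<open>
  The coefficients have sum zero, so \<open>cis (t * u)\<close> may be subtracted from every
  exponential.
\<close>

lemma norm_difference_symbol_le_powr:
  assumes t: "0 < t" "t \<le> 1" and r: "0 \<le> r" "r < t"
  shows "norm (difference_symbol t u) \<le> 2 * bcoef_moment t r * \<bar>u\<bar> powr r"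
proof -
  have z: "(\<integral>j. complex_of_real (bcoef t j) * cis (t * u) \<partial>count_space UNIV) = 0"
    by (simp only: integral_mult_left_zero bcoef_integral_0[OF t] mult_zero_left)
  have "difference_symbol t u = difference_symbol t u - (\<integral>j. complex_of_real (bcoef t j) * cis (t * u) \<partial>count_space UNIV)"
    by (simp only: z diff_zero)
  also have "\<dots> = (\<integral>j. complex_of_real (bcoef t j) * cis ((t - real j) * u) - complex_of_real (bcoef t j) * cis (t * u) \<partial>count_space UNIV)"
    unfolding difference_symbol_def by (intro Bochner_Integration.integral_diff[symmetric] difference_symbol_integrand t)
  also have "norm \<dots> \<le> (\<integral>j. 2 * \<bar>u\<bar> powr r * (\<bar>bcoef t j\<bar> * real j powr r) \<partial>count_space UNIV)"
  proof (rule norm_integral_le)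
    show "integrable (count_space UNIV) (\<lambda>j. complex_of_real (bcoef t j) * cis ((t - real j) * u) - complex_of_real (bcoef t j) * cis (t * u))"
      by (intro Bochner_Integration.integrable_diff difference_symbol_integrand t)
    show "integrable (count_space UNIV) (\<lambda>j. 2 * \<bar>u\<bar> powr r * (\<bar>bcoef t j\<bar> * real j powr r))"
      using bcoef_moment_summable[OF t r(2)] by (intro integrable_mult_right) (simp add: integrable_count_space_nat_iff)
    fix j
    have "norm (cis ((t - real j) * u) - cis (t * u)) \<le> 2 * \<bar>(t - real j) * u - t * u\<bar> powr r"
      using r t by (intro norm_cis_diff_le) auto
    also have "(t - real j) * u - t * u = - (real j * u)" by (simp add: algebra_simps)
    finally have "norm (cis ((t - real j) * u) - cis (t * u)) \<le> 2 * (real j powr r * \<bar>u\<bar> powr r)"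
      by (simp add: abs_mult powr_mult)
    then have "\<bar>bcoef t j\<bar> * norm (cis ((t - real j) * u) - cis (t * u)) \<le> \<bar>bcoef t j\<bar> * (2 * (real j powr r * \<bar>u\<bar> powr r))"
      by (rule mult_left_mono) simp
    then show "norm (complex_of_real (bcoef t j) * cis ((t - real j) * u) - complex_of_real (bcoef t j) * cis (t * u))
         \<le> 2 * \<bar>u\<bar> powr r * (\<bar>bcoef t j\<bar> * real j powr r)"
      unfolding right_diff_distrib[symmetric] norm_mult by (simp add: mult_ac)
  qed
  also have "\<dots> = 2 * \<bar>u\<bar> powr r * bcoef_moment t r"
    unfolding bcoef_moment_def using bcoef_moment_summable[OF t r(2)]
    by (subst integral_mult_right_zero, subst integral_count_space_nat) (auto simp: integrable_count_space_nat_iff)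
  finally show ?thesis by (simp add: mult_ac)
qed

text \<open>
  The binomial series is known inside the unit disc. Absolute summability of the coefficients
  carries the identity to the boundary point \<open>cis (- u)\<close>, as the limit along the
  radius.
\<close>

lemma difference_symbol_eq_powr:
  assumes t: "0 < t" "t \<le> 1" and u: "cos u < 1"
  shows "difference_symbol t u = cis (t * u) * (1 - cis (- u)) powr (of_real t)"
proof -
  define \<rho> :: "nat \<Rightarrow> real" where "\<rho> k = 1 - inverse (real (Suc k))" for k
  have \<rho>: "0 \<le> \<rho> k" "\<rho> k < 1" for k by (auto simp: \<rho>_def field_simps)
  have \<rho>1: "\<rho> \<longlonglongrightarrow> 1"
    unfolding \<rho>_def using tendsto_diff[OF tendsto_const LIMSEQ_inverse_real_of_nat, of 1] by simp
  have s: "(\<integral>j. complex_of_real (bcoef t j) * (of_real (\<rho> k) * cis (- u)) ^ j \<partial>count_space UNIV)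
      = (1 - of_real (\<rho> k) * cis (- u)) powr (of_real t)" for k
  proof -
    have i: "integrable (count_space UNIV) (\<lambda>j. complex_of_real (bcoef t j) * (of_real (\<rho> k) * cis (- u)) ^ j)"
      using \<rho>[of k]
      by (intro Bochner_Integration.integrable_bound[OF bcoef_integrable[OF t]])
         (auto simp: norm_mult norm_power intro!: mult_left_le power_le_one)
    have "(\<lambda>j. (complex_of_real t gchoose j) * (- (of_real (\<rho> k) * cis (- u))) ^ j) sums (1 + - (of_real (\<rho> k) * cis (- u))) powr (of_real t)"
      using \<rho>[of k] by (intro gen_binomial_complex) (simp add: norm_mult)
    moreover have "(complex_of_real t gchoose j) * (- (of_real (\<rho> k) * cis (- u))) ^ j =
        complex_of_real (bcoef t j) * (of_real (\<rho> k) * cis (- u)) ^ j" for j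
    proof -
      have "(complex_of_real t gchoose j) = of_real (t gchoose j)" by (simp add: gbinomial_prod_rev)
      then show ?thesis by (subst power_minus) (simp add: bcoef_def mult_ac)
    qed
    ultimately have "(\<lambda>j. complex_of_real (bcoef t j) * (of_real (\<rho> k) * cis (- u)) ^ j) sums (1 - of_real (\<rho> k) * cis (- u)) powr (of_real t)"
      by simp
    then show ?thesis using integral_count_space_nat[OF i] sums_unique by metis
  qed
  have "(\<lambda>k. (\<integral>j. complex_of_real (bcoef t j) * (of_real (\<rho> k) * cis (- u)) ^ j \<partial>count_space UNIV)) \<longlonglongrightarrow>
     (\<integral>j. complex_of_real (bcoef t j) * (of_real 1 * cis (- u)) ^ j \<partial>count_space UNIV)"
  proof (rule integral_dominated_convergence[where w="\<lambda>j. \<bar>bcoef t j\<bar>"])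
    show "integrable (count_space UNIV) (\<lambda>j. \<bar>bcoef t j\<bar>)" using bcoef_summable[OF t] by (simp add: integrable_count_space_nat_iff)
    show "AE j in count_space UNIV. (\<lambda>k. complex_of_real (bcoef t j) * (of_real (\<rho> k) * cis (- u)) ^ j) \<longlonglongrightarrow> complex_of_real (bcoef t j) * (of_real 1 * cis (- u)) ^ j"
      by (intro AE_I2 tendsto_intros \<rho>1)
    show "AE j in count_space UNIV. norm (complex_of_real (bcoef t j) * (of_real (\<rho> k) * cis (- u)) ^ j) \<le> \<bar>bcoef t j\<bar>" for k
      using \<rho>[of k] by (intro AE_I2) (auto simp: norm_mult norm_power intro!: mult_left_le power_le_one)
  qed auto
  moreover have "(\<lambda>k. (1 - of_real (\<rho> k) * cis (- u)) powr (of_real t)) \<longlonglongrightarrow> (1 - of_real 1 * cis (- u)) powr (of_real t)"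
  proof (rule tendsto_powr_complex)
    have "Re (1 - of_real 1 * cis (- u)) > 0" using u by simp
    then show "1 - of_real 1 * cis (- u) \<notin> \<real>\<^sub>\<le>\<^sub>0"
      by (auto simp only: complex_nonpos_Reals_iff not_le)
  qed (intro tendsto_intros \<rho>1)+
  ultimately have lim: "(\<integral>j. complex_of_real (bcoef t j) * cis (- u) ^ j \<partial>count_space UNIV) = (1 - cis (- u)) powr (of_real t)"
    unfolding s using LIMSEQ_unique by fastforce
  have "difference_symbol t u = (\<integral>j. cis (t * u) * (complex_of_real (bcoef t j) * cis (- u) ^ j) \<partial>count_space UNIV)"
    unfolding difference_symbol_def
    by (intro Bochner_Integration.integral_cong refl)
       (simp add: Complex.DeMoivre cis_mult algebra_simps)
  also have "\<dots> = cis (t * u) * (1 - cis (- u)) powr (of_real t)"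
    by (simp add: lim)
  finally show ?thesis .
qed

lemma abs_sin_ge:
  fixes u :: real assumes "\<bar>u\<bar> \<le> 1"
  shows "\<bar>sin u\<bar> \<ge> \<bar>u\<bar> / 2"
proof -
  have pos: "sin v \<ge> v / 2" if v: "0 < v" "v \<le> 1" for v :: real
  proof -
    have "\<exists>z>0. z < v \<and> sin v - sin 0 = (v - 0) * cos z"
      using v by (intro MVT2) (auto intro!: derivative_eq_intros)
    then obtain z where z: "0 < z" "z < v" "sin v = v * cos z" by auto
    have "cos (pi / 3) \<le> cos z"
      using z v pi_gt3 by (intro cos_monotone_0_pi_le) auto
    then have "v * (1 / 2) \<le> v * cos z" using v by (intro mult_left_mono) (auto simp: cos_60)
    then show ?thesis using z by simp
  qed
  show ?thesis
    using pos[of u] pos[of "- u"] assms by (cases "u = 0"; cases "u > 0") auto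
qed

text \<open>
  The number \<open>1 - cis (- u)\<close> lies in the right half-plane, so the argument of its
  \<open>t\<close>-th power is less than \<open>t * pi / 2\<close> in absolute value. Since
  \<open>t < 1\<close>, this leaves room for the factor \<open>cis (t * u)\<close> with
  \<open>u\<close> small, and the product stays in a sector strictly inside the right
  half-plane.
\<close>

lemma Re_difference_symbol_lower:
  assumes t: "0 < t" "t < 1"
  shows "\<exists>\<kappa>>0. \<exists>\<eta>>0. \<eta> \<le> 1 \<and> (\<forall>u. \<bar>u\<bar> \<le> \<eta> \<longrightarrow> Re (difference_symbol t u) \<ge> \<kappa> * \<bar>u\<bar> powr t)"
proof -
  define \<eta> where "\<eta> = min 1 ((1 - t) * pi / 4)"
  \<comment> \<open>The half-angle of the sector, midway between \<open>t * pi / 2\<close> and \<open>pi /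
    2\<close>; the bound \<open>\<eta>\<close> for \<open>u\<close> is at most the difference.\<close>
  define \<theta> where "\<theta> = (1 + t) / 2 * (pi / 2)"
  have \<eta>: "\<eta> > 0" "\<eta> \<le> 1" using t by (auto simp: \<eta>_def)
  have \<theta>: "0 < \<theta>" "\<theta> < pi / 2" using t unfolding \<theta>_def
    using mult_strict_right_mono[of "(1 + t) / 2" 1 "pi / 2"] by (simp_all add: add_pos_pos)
  define \<kappa> where "\<kappa> = cos \<theta> * (1/2) powr t"
  have c0: "cos \<theta> > 0" using \<theta> by (intro cos_gt_zero_pi) auto
  have "Re (difference_symbol t u) \<ge> \<kappa> * \<bar>u\<bar> powr t" if u: "\<bar>u\<bar> \<le> \<eta>" for u
  proof (cases "u = 0")
    case True
    have "norm (difference_symbol t 0) \<le> 0" using norm_difference_symbol_le_powr[of t 0 0] t norm_difference_symbol_le_powr[of t "t/2" 0] by simp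
    then show ?thesis using True t by simp
  next
    case False
    define z where "z = 1 - cis (- u)"
    have su: "\<bar>sin u\<bar> \<ge> \<bar>u\<bar> / 2" using u \<eta> by (intro abs_sin_ge) auto
    have "sin u \<noteq> 0" using su False by auto
    then have "cos u < 1" 
      by (smt (verit) cos_le_one cos_one_sin_zero)
    then have Rz: "Re z > 0" by (simp add: z_def)
    have z0: "z \<noteq> 0" using Rz by auto
    have arg: "\<bar>Im (Ln z)\<bar> < pi / 2" using Re_Ln_pos_lt[OF z0] Rz by simp
    have zn: "norm z \<ge> \<bar>u\<bar> / 2" using abs_Im_le_cmod[of z] su by (simp add: z_def)
    have "difference_symbol t u = cis (t * u) * z powr (of_real t)"
      unfolding z_def using t \<open>cos u < 1\<close> by (intro difference_symbol_eq_powr) auto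
    also have "z powr (of_real t) = of_real (norm z powr t) * cis (t * Im (Ln z))"
      using z0 by (simp add: powr_def exp_eq_polar)
    finally have "difference_symbol t u = of_real (norm z powr t) * cis (t * u + t * Im (Ln z))"
      by (simp add: cis_mult mult_ac)
    then have R: "Re (difference_symbol t u) = norm z powr t * cos (t * u + t * Im (Ln z))" by simp
    have "\<bar>t * u + t * Im (Ln z)\<bar> \<le> t * \<eta> + t * (pi / 2)"
    proof -
      have "\<bar>t * u + t * Im (Ln z)\<bar> \<le> t * \<bar>u\<bar> + t * \<bar>Im (Ln z)\<bar>"
        using t abs_triangle_ineq[of "t * u" "t * Im (Ln z)"] by (simp add: abs_mult)
      also have "\<dots> \<le> t * \<eta> + t * (pi / 2)" using t u arg by (intro add_mono mult_left_mono) auto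
      finally show ?thesis .
    qed
    also have "t * \<eta> \<le> 1 * ((1 - t) * pi / 4)" using t \<eta> by (intro mult_mono) (auto simp: \<eta>_def)
    then have "t * \<eta> + t * (pi / 2) \<le> \<theta>" by (simp add: \<theta>_def field_simps)
    finally have "\<bar>t * u + t * Im (Ln z)\<bar> \<le> \<theta>" by simp
    then have "cos \<theta> \<le> cos \<bar>t * u + t * Im (Ln z)\<bar>"
      using \<theta> by (intro cos_monotone_0_pi_le) auto
    then have cc: "cos \<theta> \<le> cos (t * u + t * Im (Ln z))" by simp
    have "\<kappa> * \<bar>u\<bar> powr t = cos \<theta> * (\<bar>u\<bar> / 2) powr t"
      by (simp add: \<kappa>_def powr_divide)
    also have "\<dots> \<le> cos (t * u + t * Im (Ln z)) * norm z powr t"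
      using cc c0 zn t by (intro mult_mono powr_mono2) auto
    finally show ?thesis unfolding R by (simp add: mult.commute)
  qed
  moreover have "\<kappa> > 0" using c0 by (simp add: \<kappa>_def)
  ultimately show ?thesis using \<eta> by blast
qed

lemma difference_symbol_1: "difference_symbol 1 u = cis u - 1"
proof -
  have z: "bcoef 1 j = 0" if "j \<notin> {0, 1}" for j
  proof -
    have "bcoef 1 (Suc (Suc k)) = 0" for k by (induction k) (simp_all add: bcoef_Suc)
    from this[of "j - 2"] show ?thesis using that by (cases "j < 2") (auto simp: numeral_2_eq_2 less_Suc_eq Suc_diff_Suc)
  qed
  have "difference_symbol 1 u = (\<Sum>j. complex_of_real (bcoef 1 j) * cis ((1 - real j) * u))"
    unfolding difference_symbol_def by (rule integral_count_space_nat[OF difference_symbol_integrand]) auto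
  also have "\<dots> = (\<Sum>j\<in>{0, 1}. complex_of_real (bcoef 1 j) * cis ((1 - real j) * u))"
    using z by (intro suminf_finite) auto
  also have "\<dots> = cis u - 1" by (simp add: bcoef_1)
  finally show ?thesis .
qed

section \<open>Rotation invariance of Lebesgue measure\<close>

lemma orthogonal_measurable:
  fixes f :: "'a::euclidean_space \<Rightarrow> 'a"
  assumes f: "orthogonal_transformation f"
  shows "f \<in> borel_measurable borel"
  using orthogonal_transformation_linear[OF f]
  by (intro borel_measurable_continuous_onI linear_continuous_on) (simp add: linear_conv_bounded_linear)

lemma orthogonal_vimage_ball:
  fixes f :: "'a::euclidean_space \<Rightarrow> 'a"
  assumes f: "orthogonal_transformation f"
  shows "f -` ball a \<rho> = ball (inv f a) \<rho>"
proof -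
  interpret linear f using f by (rule orthogonal_transformation_linear)
  have "dist a (f x) = dist (inv f a) x" for x
  proof -
    have "dist a (f x) = norm (f (inv f a) - f x)"
      using orthogonal_transformation_surj[OF f] by (simp add: surj_f_inv_f dist_norm)
    also have "\<dots> = norm (inv f a - x)" using orthogonal_transformation_norm[OF f] by (simp flip: diff)
    finally show ?thesis by (simp add: dist_norm)
  qed
  then show ?thesis by auto
qed

text \<open>
  An isometry maps balls to balls of the same volume. By Vitali's theorem an open set is, up to
  a null set, a countable disjoint union of balls, so its preimage is at least as large.
\<close>

lemma emeasure_le_orthogonal_vimage:
  fixes f :: "'a::euclidean_space \<Rightarrow> 'a"
  assumes f: "orthogonal_transformation f" and U: "open U"
  shows "emeasure lborel U \<le> emeasure lborel (f -` U)"
proof -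
  define K where "K = {(x, \<rho>). 0 < \<rho> \<and> ball x \<rho> \<subseteq> U}"
  have cov: "\<exists>i. i \<in> K \<and> x \<in> ball (fst i) (snd i) \<and> snd i < d" if "x \<in> U" "0 < d" for x d
  proof -
    obtain e where e: "e > 0" "ball x e \<subseteq> U" using U \<open>x \<in> U\<close> open_contains_ball by blast
    have "ball x (min e (d / 2)) \<subseteq> ball x e" by (intro subset_ball) auto
    then show ?thesis using e that by (intro exI[of _ "(x, min e (d / 2))"]) (auto simp: K_def)
  qed
  obtain C where C: "countable C" "C \<subseteq> K"
     and dj: "pairwise (\<lambda>i j. disjnt (ball (fst i) (snd i)) (ball (fst j) (snd j))) C"
     and neg: "negligible (U - (\<Union>i \<in> C. ball (fst i) (snd i)))"
    using Vitali_covering_theorem_balls[OF cov, of U] by blast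
  define B where "B = (\<Union>i\<in>C. ball (fst i) (snd i))"
  have fm: "f \<in> borel_measurable borel" by (rule orthogonal_measurable[OF f])
  have sb [measurable]: "B \<in> sets borel" "U \<in> sets borel" unfolding B_def using U by (auto intro: borel_open)
  have sf: "f -` X \<in> sets borel" if "X \<in> sets borel" for X using measurable_sets[OF fm that] by simp
  have d1: "disjoint_family_on (\<lambda>i. ball (fst i) (snd i)) C"
    using dj by (auto simp: disjoint_family_on_def pairwise_def disjnt_def)
  then have d2: "disjoint_family_on (\<lambda>i. f -` ball (fst i) (snd i)) C"
    by (auto simp: disjoint_family_on_def simp flip: vimage_Int)
  have "emeasure lborel U \<le> emeasure lborel (B \<union> (U - B))" by (intro emeasure_mono) auto
  also have "\<dots> \<le> emeasure lborel B + emeasure lborel (U - B)" by (intro emeasure_subadditive) auto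
  also have "emeasure lborel (U - B) = 0"
  proof -
    have "emeasure lebesgue (U - B) = 0"
      using neg unfolding B_def[symmetric] negligible_iff_null_sets by (rule null_setsD1)
    then show ?thesis by (subst (asm) emeasure_completion) (auto intro: sb)
  qed
  also have "emeasure lborel B + 0 = (\<integral>\<^sup>+i. emeasure lborel (ball (fst i) (snd i)) \<partial>count_space C)"
    unfolding B_def add_0_right by (intro emeasure_UN_countable d1 C) auto
  also have "\<dots> = (\<integral>\<^sup>+i. emeasure lborel (f -` ball (fst i) (snd i)) \<partial>count_space C)"
  proof (rule nn_integral_cong)
    fix i assume "i \<in> space (count_space C)"
    then have "snd i > 0" using C by (auto simp: K_def)
    then show "emeasure lborel (ball (fst i) (snd i)) = emeasure lborel (f -` ball (fst i) (snd i))"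
      unfolding orthogonal_vimage_ball[OF f] by (simp add: emeasure_ball)
  qed
  also have "\<dots> = emeasure lborel (\<Union>i\<in>C. f -` ball (fst i) (snd i))"
    by (intro emeasure_UN_countable[symmetric] d2 C) (auto intro: sf)
  also have "\<dots> \<le> emeasure lborel (f -` U)"
  proof (rule emeasure_mono)
    have "ball (fst i) (snd i) \<subseteq> U" if "i \<in> C" for i using that C(2) unfolding K_def by force
    then show "(\<Union>i\<in>C. f -` ball (fst i) (snd i)) \<subseteq> f -` U" by blast
    show "f -` U \<in> sets lborel" by (simp add: sf sb)
  qed
  finally show ?thesis .
qed

text \<open>
  Applied to \<open>f\<close> and to its inverse, the inequality for open sets becomes an
  equality on boxes.
\<close>

lemma lborel_distr_orthogonal:
  fixes f :: "'a::euclidean_space \<Rightarrow> 'a"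
  assumes f: "orthogonal_transformation f"
  shows "distr lborel borel f = lborel"
proof (rule lborel_eqI[symmetric])
  have bf: "bij f" using f by (rule orthogonal_transformation_bij)
  have g: "orthogonal_transformation (inv f)" using f by (rule orthogonal_transformation_inv)
  have fm: "f \<in> borel_measurable borel" by (rule orthogonal_measurable[OF f])
  have fc: "continuous_on UNIV f"
    using orthogonal_transformation_linear[OF f] by (intro linear_continuous_on) (simp add: linear_conv_bounded_linear)
  fix l u :: 'a assume le: "\<And>b. b \<in> Basis \<Longrightarrow> l \<bullet> b \<le> u \<bullet> b"
  have o: "open (f -` box l u)" using fc by (rule open_vimage[OF open_box])
  have "emeasure lborel (f -` box l u) \<le> emeasure lborel (inv f -` (f -` box l u))"
    by (rule emeasure_le_orthogonal_vimage[OF g o])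
  also have "inv f -` (f -` box l u) = box l u" using bf by (auto simp: bij_def surj_f_inv_f)
  finally have "emeasure lborel (f -` box l u) = emeasure lborel (box l u)"
    using emeasure_le_orthogonal_vimage[OF f open_box] by (intro antisym) auto
  also have "\<dots> = (\<Prod>b\<in>Basis. (u - l) \<bullet> b)" using le by (rule emeasure_lborel_box)
  finally show "emeasure (distr lborel borel f) (box l u) = (\<Prod>b\<in>Basis. (u - l) \<bullet> b)"
    by (subst emeasure_distr) (auto simp: fm)
qed simp

lemma integral_orthogonal:
  fixes F :: "'a::euclidean_space \<Rightarrow> complex" and f :: "'a \<Rightarrow> 'a"
  assumes f: "orthogonal_transformation f" and [measurable]: "F \<in> borel_measurable borel"
  shows "(\<integral>h. F (f h) \<partial>lborel) = (\<integral>h. F h \<partial>lborel)"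
proof -
  have [measurable]: "f \<in> borel_measurable borel" by (rule orthogonal_measurable[OF f])
  have "(\<integral>h. F h \<partial>lborel) = (\<integral>h. F h \<partial>distr lborel borel f)" by (simp only: lborel_distr_orthogonal[OF f])
  also have "\<dots> = (\<integral>h. F (f h) \<partial>lborel)" by (rule integral_distr) auto
  finally show ?thesis by simp
qed

section \<open>The singular kernel\<close>

definition frac_kernel :: "real \<Rightarrow> 'a::euclidean_space \<Rightarrow> real" where
  "frac_kernel r h = norm h powr (- r - real DIM('a))"

lemma frac_kernel_nonneg [simp]: "frac_kernel r h \<ge> 0" by (simp add: frac_kernel_def)

lemma powr_frac_kernel:
  "norm h powr a * frac_kernel r h = norm h powr ((a - r) - real DIM('a))" for h :: "'a::euclidean_space"
  unfolding frac_kernel_def powr_add[symmetric] by (rule arg_cong2[where f="(powr)"]) simp_all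

lemma frac_kernel_measurable [measurable]: "frac_kernel r \<in> borel_measurable borel"
  unfolding frac_kernel_def[abs_def] by measurable

lemma frac_kernel_minus [simp]: "frac_kernel r (- h) = frac_kernel r h" by (simp add: frac_kernel_def)

lemma frac_kernel_le_sum:
  assumes "r0 \<le> r" "r \<le> t"
  shows "frac_kernel r h \<le> frac_kernel r0 h + frac_kernel t (h :: 'a::euclidean_space)"
proof (cases "h = 0 \<or> norm h \<ge> 1")
  case True
  then have "frac_kernel r h \<le> frac_kernel r0 h" unfolding frac_kernel_def using assms by (auto intro: powr_mono)
  then show ?thesis using frac_kernel_nonneg[of t h] by linarith
next
  case False
  then have "frac_kernel r h \<le> frac_kernel t h" unfolding frac_kernel_def using assms by (auto intro: powr_mono')
  then show ?thesis using frac_kernel_nonneg[of r0 h] by linarith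
qed

text \<open>
  Near the origin the order \<open>\<rho> > r\<close> of vanishing compensates the singularity
  of the kernel; outside the unit ball the kernel itself is integrable.
\<close>

lemma nn_integral_frac_kernel_le:
  fixes g :: "'a::euclidean_space \<Rightarrow> ennreal"
  assumes [measurable]: "g \<in> borel_measurable borel" and r: "0 < r" "r < \<rho>" and K: "0 \<le> K"
    and small: "\<And>h. norm h \<le> 1 \<Longrightarrow> g h \<le> ennreal (K * norm h powr \<rho>)" and large: "\<And>h. g h \<le> ennreal K"
  shows "(\<integral>\<^sup>+h. g h * ennreal (frac_kernel r h) \<partial>lborel) \<le> ennreal (K * (sphere_area TYPE('a) / (\<rho> - r) + sphere_area TYPE('a) / r))"
proof -
  have "(\<integral>\<^sup>+h. g h * ennreal (frac_kernel r h) \<partial>lborel) \<le>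
     (\<integral>\<^sup>+h. ennreal K * ennreal (indicator {h. norm h \<le> 1} h * norm (h::'a) powr ((\<rho> - r) - real DIM('a))) +
           ennreal K * ennreal (indicator {h. norm h > 1} h * norm h powr (- r - real DIM('a))) \<partial>lborel)"
  proof (intro nn_integral_mono)
    fix h :: 'a
    show "g h * ennreal (frac_kernel r h) \<le> ennreal K * ennreal (indicator {h. norm h \<le> 1} h * norm h powr ((\<rho> - r) - real DIM('a))) +
           ennreal K * ennreal (indicator {h. norm h > 1} h * norm h powr (- r - real DIM('a)))"
    proof (cases "norm h \<le> 1")
      case True
      have "g h * ennreal (frac_kernel r h) \<le> ennreal (K * norm h powr \<rho>) * ennreal (frac_kernel r h)"
        by (intro mult_right_mono small True) auto
      also have "\<dots> = ennreal (K * norm h powr ((\<rho> - r) - real DIM('a)))"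
        using K powr_frac_kernel[of h \<rho> r] by (simp add: mult.assoc flip: ennreal_mult)
      finally show ?thesis using True K by (simp add: ennreal_mult)
    next
      case False
      have "g h * ennreal (frac_kernel r h) \<le> ennreal K * ennreal (frac_kernel r h)" by (intro mult_right_mono large) auto
      then show ?thesis using False by (simp add: frac_kernel_def)
    qed
  qed
  also have "\<dots> = ennreal K * ennreal (sphere_area TYPE('a) * 1 powr (\<rho> - r) / (\<rho> - r)) + ennreal K * ennreal (sphere_area TYPE('a) * 1 powr (- r) / r)"
    using nn_integral_norm_powr_cball[where 'a='a and a="\<rho> - r" and \<delta>=1] nn_integral_norm_powr_outside[where 'a='a and a=r and \<delta>=1] r
    by (subst nn_integral_add) (auto simp: nn_integral_cmult)
  also have "\<dots> = ennreal (K * (sphere_area TYPE('a) / (\<rho> - r) + sphere_area TYPE('a) / r))"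
    using K r sphere_area_pos[where 'a='a] by (simp add: algebra_simps flip: ennreal_mult ennreal_plus)
  finally show ?thesis .
qed

lemma difference_symbol_kernel_nn:
  fixes \<xi> :: "'a::euclidean_space"
  assumes r: "0 < r" "r < t" and t: "t \<le> 1"
  shows "\<exists>K\<ge>0. \<forall>\<xi>::'a. (\<integral>\<^sup>+h. ennreal (norm (difference_symbol t (h \<bullet> \<xi>))) * ennreal (frac_kernel r h) \<partial>lborel) \<le> ennreal (K * (1 + norm \<xi>))"
proof -
  \<comment> \<open>Any exponent strictly between \<open>r\<close> and \<open>t\<close> serves.\<close>
  define \<rho> where "\<rho> = (r + t) / 2"
  have \<rho>: "r < \<rho>" "\<rho> < t" "0 \<le> \<rho>" using r by (auto simp: \<rho>_def)
  define B where "B = 2 * bcoef_moment t \<rho>"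
  have B: "B \<ge> 0" using bcoef_moment_nonneg[of t \<rho>] r t \<rho> by (simp add: B_def)
  define K where "K = (B + 2) * (sphere_area TYPE('a) / (\<rho> - r) + sphere_area TYPE('a) / r)"
  have "(\<integral>\<^sup>+h. ennreal (norm (difference_symbol t (h \<bullet> \<xi>))) * ennreal (frac_kernel r h) \<partial>lborel) \<le> ennreal (K * (1 + norm \<xi>))" for \<xi> :: 'a
  proof -
    have "(\<integral>\<^sup>+h. ennreal (norm (difference_symbol t (h \<bullet> \<xi>))) * ennreal (frac_kernel r h) \<partial>lborel)
      \<le> ennreal (((B + 2) * (1 + norm \<xi>)) * (sphere_area TYPE('a) / (\<rho> - r) + sphere_area TYPE('a) / r))"
    proof (rule nn_integral_frac_kernel_le)
      fix h :: 'a
      have "norm (difference_symbol t (h \<bullet> \<xi>)) \<le> B * \<bar>h \<bullet> \<xi>\<bar> powr \<rho>"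
        unfolding B_def using r t \<rho> by (intro norm_difference_symbol_le_powr) auto
      also have "\<dots> \<le> B * (norm h * norm \<xi>) powr \<rho>"
        using B \<rho> by (intro mult_left_mono powr_mono2 Cauchy_Schwarz_ineq2) auto
      also have "\<dots> \<le> B * (norm h powr \<rho> * (1 + norm \<xi>))"
        unfolding powr_mult using B \<rho> t norm_powr_le_1plus[of \<rho> "norm \<xi>"] by (intro mult_left_mono) auto
      also have "\<dots> \<le> (B + 2) * (norm h powr \<rho> * (1 + norm \<xi>))"
        by (intro mult_right_mono) auto
      finally show "ennreal (norm (difference_symbol t (h \<bullet> \<xi>))) \<le> ennreal ((B + 2) * (1 + norm \<xi>) * norm h powr \<rho>)"
        by (intro ennreal_leI) (simp add: mult_ac)
      have "norm (difference_symbol t (h \<bullet> \<xi>)) \<le> 2 * 1" using norm_difference_symbol_le_2[of t] r t by simp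
      also have "\<dots> \<le> (B + 2) * (1 + norm \<xi>)" using B by (intro mult_mono) auto
      finally show "ennreal (norm (difference_symbol t (h \<bullet> \<xi>))) \<le> ennreal ((B + 2) * (1 + norm \<xi>))" by (rule ennreal_leI)
    qed (use r \<rho> B in auto)
    also have "((B + 2) * (1 + norm \<xi>)) * (sphere_area TYPE('a) / (\<rho> - r) + sphere_area TYPE('a) / r) = K * (1 + norm \<xi>)"
      by (simp add: K_def)
    finally show ?thesis .
  qed
  moreover have "K \<ge> 0" using B r \<rho> sphere_area_pos[where 'a='a] by (simp add: K_def)
  ultimately show ?thesis by blast
qed

lemma difference_symbol_kernel_integrable:
  fixes \<xi> :: "'a::euclidean_space"
  assumes "0 < r" "r < t" "t \<le> 1"
  shows "integrable lborel (\<lambda>h. difference_symbol t (h \<bullet> \<xi>) * of_real (frac_kernel r h))"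
proof (rule integrableI_bounded)
  obtain K where "(\<integral>\<^sup>+h. ennreal (norm (difference_symbol t (h \<bullet> \<xi>))) * ennreal (frac_kernel r h) \<partial>lborel) \<le> ennreal (K * (1 + norm \<xi>))"
    using difference_symbol_kernel_nn[OF assms, where 'a='a] by blast
  then show "(\<integral>\<^sup>+h. ennreal (norm (difference_symbol t (h \<bullet> \<xi>) * of_real (frac_kernel r h))) \<partial>lborel) < \<infinity>"
    by (auto simp: norm_mult ennreal_mult elim!: le_less_trans)
qed measurable

definition kernel_symbol :: "real \<Rightarrow> real \<Rightarrow> 'a::euclidean_space \<Rightarrow> complex" where
  "kernel_symbol r t \<xi> = (\<integral>h. difference_symbol t (h \<bullet> \<xi>) * of_real (frac_kernel r h) \<partial>lborel)"

text \<open>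
  The symbol of the singular integral at a unit vector. The choice of the vector is immaterial
  by \<open>kernel_symbol_rotate\<close>.
\<close>

definition kernel_const :: "'n::finite itself \<Rightarrow> real \<Rightarrow> real \<Rightarrow> complex" where
  "kernel_const _ r t = kernel_symbol r t (axis undefined 1 :: real ^ 'n)"

lemma kernel_symbol_rotate:
  fixes a b :: "real ^ 'n"
  assumes "norm a = norm b"
  shows "kernel_symbol r t a = kernel_symbol r t b"
proof -
  obtain f where f: "orthogonal_transformation f" "f a = b"
    using orthogonal_transformation_exists[OF assms] by blast
  have n: "norm (f h) = norm h" for h using f orthogonal_transformation_norm by blast
  have "kernel_symbol r t b = (\<integral>h. (\<lambda>h. difference_symbol t (h \<bullet> b) * of_real (frac_kernel r h)) (f h) \<partial>lborel)"
    unfolding kernel_symbol_def by (rule integral_orthogonal[OF f(1), symmetric]) measurable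
  also have "\<dots> = (\<integral>h. difference_symbol t (h \<bullet> a) * of_real (frac_kernel r h) \<partial>lborel)"
    using f n by (intro Bochner_Integration.integral_cong refl) (auto simp: frac_kernel_def orthogonal_transformation_def)
  finally show ?thesis unfolding kernel_symbol_def ..
qed

lemma kernel_symbol_scale:
  fixes a :: "'a::euclidean_space"
  assumes c: "c > 0"
  shows "kernel_symbol r t (c *\<^sub>R a) = of_real (c powr r) * kernel_symbol r t a"
proof -
  have "kernel_symbol r t a = of_real (\<bar>c\<bar> ^ DIM('a)) * (\<integral>h. difference_symbol t ((c *\<^sub>R h) \<bullet> a) * of_real (frac_kernel r (c *\<^sub>R h)) \<partial>lborel)"
    unfolding kernel_symbol_def using c by (intro integral_scale) auto
  also have "(\<lambda>h. difference_symbol t ((c *\<^sub>R h) \<bullet> a) * of_real (frac_kernel r (c *\<^sub>R h))) =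
      (\<lambda>h. of_real (c powr (- r - real DIM('a))) * (difference_symbol t (h \<bullet> (c *\<^sub>R a)) * of_real (frac_kernel r h)))"
    using c by (auto simp: fun_eq_iff frac_kernel_def powr_mult)
  also have "(\<integral>h. of_real (c powr (- r - real DIM('a))) * (difference_symbol t (h \<bullet> (c *\<^sub>R a)) * of_real (frac_kernel r h)) \<partial>lborel) =
      of_real (c powr (- r - real DIM('a))) * kernel_symbol r t (c *\<^sub>R a)"
    unfolding kernel_symbol_def by (rule integral_mult_right_zero)
  finally have e: "kernel_symbol r t a = of_real (c ^ DIM('a) * c powr (- r - real DIM('a))) * kernel_symbol r t (c *\<^sub>R a)"
    using c by simp
  have "c ^ DIM('a) * c powr (- r - real DIM('a)) = c powr (- r)"
    using c by (simp add: powr_realpow[symmetric] flip: powr_add)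
  then have "kernel_symbol r t a = of_real (c powr (- r)) * kernel_symbol r t (c *\<^sub>R a)" using e by simp
  then show ?thesis using c by (simp add: powr_minus field_simps)
qed

lemma kernel_symbol_eq:
  fixes \<xi> :: "real ^ 'n"
  assumes r: "0 < r" "r < t" "t \<le> 1"
  shows "kernel_symbol r t \<xi> = kernel_const TYPE('n) r t * of_real (norm \<xi> powr r)"
proof (cases "\<xi> = 0")
  case True
  have "norm (difference_symbol t 0) \<le> 0" using norm_difference_symbol_le_powr[of t r 0] r by simp
  then show ?thesis using True by (simp add: kernel_symbol_def)
next
  case False
  define e where "e = (axis undefined 1 :: real ^ 'n)"
  have "kernel_symbol r t \<xi> = kernel_symbol r t (norm \<xi> *\<^sub>R e)" by (rule kernel_symbol_rotate) (simp add: e_def)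
  also have "\<dots> = of_real (norm \<xi> powr r) * kernel_symbol r t e" using False by (intro kernel_symbol_scale) simp
  finally show ?thesis by (simp add: kernel_const_def e_def mult.commute)
qed

text \<open>
  For a single unit vector \<open>b\<close> the number \<open>h \<bullet> b\<close> may be small
  although \<open>h\<close> is not. Summing over the basis makes the integrand comparable to a
  radial function.
\<close>

lemma kernel_const_sum:
  assumes r: "0 < r" "r < t" "t \<le> 1"
  shows "of_nat CARD('n) * kernel_const TYPE('n::finite) r t =
    (\<integral>h. (\<Sum>b\<in>Basis. difference_symbol t (h \<bullet> b)) * of_real (frac_kernel r (h :: real ^ 'n)) \<partial>lborel)"
    "integrable lborel (\<lambda>h. (\<Sum>b\<in>Basis. difference_symbol t (h \<bullet> b)) * of_real (frac_kernel r (h :: real ^ 'n)))"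
proof -
  have "(\<Sum>b\<in>(Basis :: (real ^ 'n) set). kernel_symbol r t b) = (\<Sum>b\<in>(Basis :: (real ^ 'n) set). kernel_const TYPE('n) r t)"
    by (intro sum.cong refl) (use r in \<open>simp add: kernel_symbol_eq\<close>)
  also have "\<dots> = of_nat CARD('n) * kernel_const TYPE('n) r t" by simp
  finally have "of_nat CARD('n) * kernel_const TYPE('n) r t = (\<Sum>b\<in>(Basis :: (real ^ 'n) set). kernel_symbol r t b)" by simp
  also have "\<dots> = (\<integral>h. (\<Sum>b\<in>Basis. difference_symbol t (h \<bullet> b) * of_real (frac_kernel r (h :: real ^ 'n))) \<partial>lborel)"
    unfolding kernel_symbol_def by (intro Bochner_Integration.integral_sum[symmetric] difference_symbol_kernel_integrable r)
  finally show "of_nat CARD('n) * kernel_const TYPE('n) r t =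
    (\<integral>h. (\<Sum>b\<in>Basis. difference_symbol t (h \<bullet> b)) * of_real (frac_kernel r (h :: real ^ 'n)) \<partial>lborel)"
    by (simp add: sum_distrib_right)
  show "integrable lborel (\<lambda>h. (\<Sum>b\<in>Basis. difference_symbol t (h \<bullet> b)) * of_real (frac_kernel r (h :: real ^ 'n)))"
    unfolding sum_distrib_right by (intro Bochner_Integration.integrable_sum difference_symbol_kernel_integrable r)
qed

lemma kernel_const_Re_sum:
  assumes r: "0 < r" "r < t" "t \<le> 1"
  shows "real CARD('n) * Re (kernel_const TYPE('n::finite) r t) =
    (\<integral>h. (\<Sum>b\<in>Basis. Re (difference_symbol t (h \<bullet> b))) * frac_kernel r (h :: real ^ 'n) \<partial>lborel)"
    "integrable lborel (\<lambda>h. (\<Sum>b\<in>Basis. Re (difference_symbol t (h \<bullet> b))) * frac_kernel r (h :: real ^ 'n))"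
proof -
  have e: "Re ((\<Sum>b\<in>Basis. difference_symbol t (h \<bullet> b)) * of_real (frac_kernel r (h :: real ^ 'n))) = (\<Sum>b\<in>Basis. Re (difference_symbol t (h \<bullet> b))) * frac_kernel r h" for h
    by simp
  have "real CARD('n) * Re (kernel_const TYPE('n) r t) = Re (of_nat CARD('n) * kernel_const TYPE('n) r t)" by simp
  also have "\<dots> = (\<integral>h. Re ((\<Sum>b\<in>Basis. difference_symbol t (h \<bullet> b)) * of_real (frac_kernel r (h :: real ^ 'n))) \<partial>lborel)"
    unfolding kernel_const_sum(1)[OF r] by (rule integral_Re[symmetric, OF kernel_const_sum(2)[OF r]])
  finally show "real CARD('n) * Re (kernel_const TYPE('n) r t) =
    (\<integral>h. (\<Sum>b\<in>Basis. Re (difference_symbol t (h \<bullet> b))) * frac_kernel r (h :: real ^ 'n) \<partial>lborel)" unfolding e .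
  show "integrable lborel (\<lambda>h. (\<Sum>b\<in>Basis. Re (difference_symbol t (h \<bullet> b))) * frac_kernel r (h :: real ^ 'n))"
    using integrable_Re[OF kernel_const_sum(2)[OF r, where 'n='n]] unfolding e .
qed

lemma norm_powr_le_sum:
  fixes h :: "'a::euclidean_space"
  assumes "t > 0"
  shows "(norm h / real DIM('a)) powr t \<le> (\<Sum>b\<in>Basis. \<bar>h \<bullet> b\<bar> powr t)"
proof -
  have "\<exists>b\<in>Basis. norm h / real DIM('a) \<le> \<bar>h \<bullet> b\<bar>"
  proof (rule ccontr)
    assume "\<not> ?thesis"
    then have "(\<Sum>b\<in>Basis. \<bar>h \<bullet> b\<bar>) < (\<Sum>b\<in>(Basis::'a set). norm h / real DIM('a))"
      by (intro sum_strict_mono) auto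
    also have "\<dots> = norm h" by simp
    finally show False using norm_le_l1[of h] by simp
  qed
  then obtain b where b: "b \<in> Basis" "norm h / real DIM('a) \<le> \<bar>h \<bullet> b\<bar>" by blast
  have "(norm h / real DIM('a)) powr t \<le> \<bar>h \<bullet> b\<bar> powr t" using b assms by (intro powr_mono2) auto
  also have "\<dots> \<le> (\<Sum>b\<in>Basis. \<bar>h \<bullet> b\<bar> powr t)" using b by (intro member_le_sum) auto
  finally show ?thesis .
qed

lemma integral_norm_powr_cball:
  assumes "a > 0" "\<delta> \<ge> 0"
  shows "integrable lborel (\<lambda>x. indicator {x. norm x \<le> \<delta>} x * norm (x::'a::euclidean_space) powr (a - real DIM('a)))"
    "(\<integral>x. indicator {x. norm x \<le> \<delta>} x * norm (x::'a::euclidean_space) powr (a - real DIM('a)) \<partial>lborel) = sphere_area TYPE('a) * \<delta> powr a / a"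
  using nn_integral_norm_powr_cball[OF assms, where 'a='a] assms sphere_area_pos[where 'a='a]
  by (auto intro!: integrableI_nonneg integral_eq_nn_integral[THEN trans] less_imp_le)

lemma integral_norm_powr_outside:
  assumes "a > 0" "\<delta> > 0"
  shows "integrable lborel (\<lambda>x. indicator {x. norm x > \<delta>} x * norm (x::'a::euclidean_space) powr (- a - real DIM('a)))"
    "(\<integral>x. indicator {x. norm x > \<delta>} x * norm (x::'a::euclidean_space) powr (- a - real DIM('a)) \<partial>lborel) = sphere_area TYPE('a) * \<delta> powr (- a) / a"
  using nn_integral_norm_powr_outside[OF assms, where 'a='a] assms sphere_area_pos[where 'a='a]
  by (auto intro!: integrableI_nonneg integral_eq_nn_integral[THEN trans] less_imp_le)

text \<open>
  On a small ball the summed real part is at least a multiple of \<open>norm h powr t\<close>,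
  and the integral of \<open>norm h powr (t - r - n)\<close> over the ball is a multiple of
  \<open>1 / (t - r)\<close>. Outside the ball the integral stays bounded for \<open>r \<ge> t /
  2\<close>, and the first part dominates it when \<open>t - r\<close> is small.
\<close>

lemma kernel_const_lower:
  assumes t: "0 < t" "t < 1"
  shows "\<exists>c>0. \<exists>t0<t. 0 < t0 \<and> (\<forall>r. t0 \<le> r \<and> r < t \<longrightarrow> norm (kernel_const TYPE('n::finite) r t) \<ge> c / (t - r))"
proof -
  define n where "n = real CARD('n)"
  have "0 < CARD('n)" by simp
  then have n: "n \<ge> 1" unfolding n_def by linarith
  define \<omega> where "\<omega> = sphere_area TYPE(real ^ 'n)"
  have \<omega>: "\<omega> > 0" unfolding \<omega>_def by (rule sphere_area_pos)
  obtain \<kappa> \<eta> where k: "\<kappa> > 0" "\<eta> > 0" "\<eta> \<le> 1" "\<And>u. \<bar>u\<bar> \<le> \<eta> \<Longrightarrow> Re (difference_symbol t u) \<ge> \<kappa> * \<bar>u\<bar> powr t"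
    using Re_difference_symbol_lower[OF t] by blast
  define \<kappa>' where "\<kappa>' = \<kappa> * (1 / n) powr t"
  have k': "\<kappa>' > 0" using k n by (simp add: \<kappa>'_def)
  define A where "A = \<kappa>' * \<omega> * \<eta>"
  have A: "A > 0" using k' \<omega> k by (simp add: A_def)
  define B where "B = 2 * n * \<omega> / \<eta> * (2 / t)"
  have B: "B > 0" using n \<omega> k t by (simp add: B_def)
  define t0 where "t0 = max (t / 2) (t - A / (2 * B))"
  have t0: "t0 < t" "0 < t0" using t A B by (auto simp: t0_def)
  have "norm (kernel_const TYPE('n) r t) \<ge> (A / (2 * n)) / (t - r)" if r: "t0 \<le> r" "r < t" for r
  proof -
    have r0: "0 < r" "r \<ge> t / 2" "t - r \<le> A / (2 * B)" using r t0 by (auto simp: t0_def)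
    have r3: "0 < r" "r < t" "t \<le> 1" using r0 r t by auto
    define lo where "lo h = \<kappa>' * (indicator {h. norm h \<le> \<eta>} h * norm h powr ((t - r) - real DIM(real ^ 'n))) -
       2 * n * (indicator {h. norm h > \<eta>} h * norm h powr (- r - real DIM(real ^ 'n)))" for h :: "real ^ 'n"
    have i1: "integrable lborel (\<lambda>h::real ^ 'n. indicator {h. norm h \<le> \<eta>} h * norm h powr ((t - r) - real DIM(real ^ 'n)))"
      "(\<integral>h. indicator {h. norm h \<le> \<eta>} h * norm (h :: real ^ 'n) powr ((t - r) - real DIM(real ^ 'n)) \<partial>lborel) = \<omega> * \<eta> powr (t - r) / (t - r)"
      using integral_norm_powr_cball[where 'a="real ^ 'n" and a="t - r" and \<delta>=\<eta>] r k by (auto simp: \<omega>_def)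
    have i2: "integrable lborel (\<lambda>h::real ^ 'n. indicator {h. norm h > \<eta>} h * norm h powr (- r - real DIM(real ^ 'n)))"
      "(\<integral>h. indicator {h. norm h > \<eta>} h * norm (h :: real ^ 'n) powr (- r - real DIM(real ^ 'n)) \<partial>lborel) = \<omega> * \<eta> powr (- r) / r"
      using integral_norm_powr_outside[where 'a="real ^ 'n" and a=r and \<delta>=\<eta>] r0 k by (auto simp: \<omega>_def)
    have ilo: "integrable lborel lo" unfolding lo_def[abs_def] by (intro Bochner_Integration.integrable_diff integrable_mult_right i1 i2)
    have "(\<integral>h. lo h \<partial>lborel) = \<kappa>' * (\<omega> * \<eta> powr (t - r) / (t - r)) - 2 * n * (\<omega> * \<eta> powr (- r) / r)"
      unfolding lo_def using i1 i2
      by (subst Bochner_Integration.integral_diff) (auto simp: integral_mult_right_zero)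
    moreover have "\<kappa>' * (\<omega> * \<eta> powr (t - r) / (t - r)) \<ge> A / (t - r)"
    proof -
      have "\<eta> powr 1 \<le> \<eta> powr (t - r)" using k t r r0 by (intro powr_mono') auto
      then have "\<kappa>' * \<omega> * \<eta> \<le> \<kappa>' * \<omega> * \<eta> powr (t - r)" using k k' \<omega> by (intro mult_left_mono) auto
      then show ?thesis unfolding A_def using r by (simp add: divide_right_mono)
    qed
    moreover have "2 * n * (\<omega> * \<eta> powr (- r) / r) \<le> B"
    proof -
      have "\<eta> powr (- r) \<le> \<eta> powr (- 1)" using k t r r0 by (intro powr_mono') auto
      then have "\<eta> powr (- r) \<le> 1 / \<eta>" using k by (simp add: powr_minus_divide)
      moreover have "1 / r \<le> 2 / t" using r0 t by (simp add: field_simps)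
      ultimately have "\<eta> powr (- r) * (1 / r) \<le> (1 / \<eta>) * (2 / t)" using k r0 by (intro mult_mono) auto
      then have "2 * n * \<omega> * (\<eta> powr (- r) * (1 / r)) \<le> 2 * n * \<omega> * ((1 / \<eta>) * (2 / t))"
        using n \<omega> by (intro mult_left_mono) auto
      then show ?thesis by (simp add: B_def)
    qed
    moreover have "(\<integral>h. lo h \<partial>lborel) \<le> n * Re (kernel_const TYPE('n) r t)"
      unfolding n_def kernel_const_Re_sum(1)[OF r3]
    proof (rule integral_mono[OF ilo kernel_const_Re_sum(2)[OF r3]])
      fix h :: "real ^ 'n"
      show "lo h \<le> (\<Sum>b\<in>Basis. Re (difference_symbol t (h \<bullet> b))) * frac_kernel r h"
      proof (cases "norm h \<le> \<eta>")
        case True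
        have "\<kappa> * (norm h / n) powr t \<le> \<kappa> * (\<Sum>b\<in>Basis. \<bar>h \<bullet> b\<bar> powr t)"
          using norm_powr_le_sum[OF t(1), of h] k by (intro mult_left_mono) (auto simp: n_def)
        also have "\<dots> \<le> (\<Sum>b\<in>Basis. Re (difference_symbol t (h \<bullet> b)))"
          unfolding sum_distrib_left
          by (intro sum_mono k) (use True Basis_le_norm[of _ h] in \<open>force intro: order_trans\<close>)
        finally have "\<kappa>' * norm h powr t \<le> (\<Sum>b\<in>Basis. Re (difference_symbol t (h \<bullet> b)))"
          by (simp add: \<kappa>'_def powr_divide)
        then have "\<kappa>' * norm h powr t * frac_kernel r h \<le> (\<Sum>b\<in>Basis. Re (difference_symbol t (h \<bullet> b))) * frac_kernel r h"
          by (rule mult_right_mono) simp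
        moreover have "norm h powr t * frac_kernel r h = norm h powr ((t - r) - real DIM(real ^ 'n))"
          by (rule powr_frac_kernel)
        ultimately show ?thesis using True by (simp add: lo_def mult.assoc)
      next
        case False
        have "(\<Sum>b\<in>(Basis::(real ^ 'n) set). - 2) \<le> (\<Sum>b\<in>Basis. Re (difference_symbol t (h \<bullet> b)))"
        proof (rule sum_mono)
          fix b :: "real ^ 'n"
          show "- 2 \<le> Re (difference_symbol t (h \<bullet> b))"
            using norm_difference_symbol_le_2[of t "h \<bullet> b"] abs_Re_le_cmod[of "difference_symbol t (h \<bullet> b)"] t by linarith
        qed
        then have "- (2 * n) \<le> (\<Sum>b\<in>Basis. Re (difference_symbol t (h \<bullet> b)))" by (simp add: n_def)
        then have "- (2 * n) * frac_kernel r h \<le> (\<Sum>b\<in>Basis. Re (difference_symbol t (h \<bullet> b))) * frac_kernel r h" by (rule mult_right_mono) simp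
        then show ?thesis using False by (simp add: lo_def frac_kernel_def)
      qed
    qed
    ultimately have "A / (t - r) - B \<le> n * Re (kernel_const TYPE('n) r t)" by linarith
    moreover have "B \<le> A / (t - r) / 2" using r0(3) r B A by (simp add: field_simps)
    moreover have "a / 2 \<le> c" if "a - b \<le> c" "b \<le> a / 2" for a b c :: real using that by linarith
    ultimately have "A / (t - r) / 2 \<le> n * Re (kernel_const TYPE('n) r t)" by blast
    also have "\<dots> \<le> n * norm (kernel_const TYPE('n) r t)"
      using n complex_Re_le_cmod by (intro mult_left_mono) auto
    finally have "A / (t - r) / 2 \<le> norm (kernel_const TYPE('n) r t) * n" by (simp only: mult.commute)
    then have "A / (t - r) / 2 / n \<le> norm (kernel_const TYPE('n) r t)" using n by (subst pos_divide_le_eq) linarith+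
    then show ?thesis by (simp add: mult_ac)
  qed
  moreover have "A / (2 * n) > 0" using A n by simp
  ultimately show ?thesis using t0 by blast
qed

text \<open>
  For first order differences the real part of the symbol is \<open>cos u - 1\<close>, hence
  nonpositive and not identically zero. First order differences make the singular integral
  available at the order \<open>t\<close> itself, where those of order \<open>t\<close> diverge.
\<close>

lemma kernel_const_1_nz:
  assumes r: "0 < r" "r < 1"
  shows "kernel_const TYPE('n::finite) r 1 \<noteq> 0"
proof
  assume z: "kernel_const TYPE('n) r 1 = 0"
  have r3: "0 < r" "r < 1" "(1::real) \<le> 1" using r by auto
  define lo where "lo h = 1 / 8 * (indicator {h. norm h \<le> 1} h * norm h powr ((2 - r) - real DIM(real ^ 'n)))" for h :: "real ^ 'n"
  have i1: "integrable lborel (\<lambda>h::real ^ 'n. indicator {h. norm h \<le> 1} h * norm h powr ((2 - r) - real DIM(real ^ 'n)))"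
    "(\<integral>h. indicator {h. norm h \<le> 1} h * norm (h :: real ^ 'n) powr ((2 - r) - real DIM(real ^ 'n)) \<partial>lborel) = sphere_area TYPE(real ^ 'n) / (2 - r)"
    using integral_norm_powr_cball[where 'a="real ^ 'n" and a="2 - r" and \<delta>=1] r by auto
  have ilo: "integrable lborel lo" unfolding lo_def[abs_def] by (intro integrable_mult_right i1)
  have "0 < (\<integral>h. lo h \<partial>lborel)"
    unfolding lo_def integral_mult_right_zero i1 using sphere_area_pos[where 'a="real ^ 'n"] r by simp
  also have "(\<integral>h. lo h \<partial>lborel) \<le> (\<integral>h. - ((\<Sum>b\<in>Basis. Re (difference_symbol 1 (h \<bullet> b))) * frac_kernel r (h :: real ^ 'n)) \<partial>lborel)"
  proof (rule integral_mono[OF ilo])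
    show "integrable lborel (\<lambda>h. - ((\<Sum>b\<in>Basis. Re (difference_symbol 1 (h \<bullet> b))) * frac_kernel r (h :: real ^ 'n)))"
      by (intro Bochner_Integration.integrable_minus kernel_const_Re_sum(2)[OF r3])
    fix h :: "real ^ 'n"
    have c: "1 - cos u = 2 * (sin (u / 2))\<^sup>2" for u :: real using cos_double_sin[of "u / 2"] by simp
    have nn: "0 \<le> (\<Sum>b\<in>Basis. 1 - cos (h \<bullet> b))" by (intro sum_nonneg) auto
    have e: "- ((\<Sum>b\<in>Basis. Re (difference_symbol 1 (h \<bullet> b))) * frac_kernel r h) = (\<Sum>b\<in>Basis. 1 - cos (h \<bullet> b)) * frac_kernel r h"
      by (simp add: difference_symbol_1 sum_subtractf algebra_simps)
    show "lo h \<le> - ((\<Sum>b\<in>Basis. Re (difference_symbol 1 (h \<bullet> b))) * frac_kernel r h)"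
    proof (cases "norm h \<le> 1")
      case True
      have "1 / 8 * (norm h)\<^sup>2 = (\<Sum>b\<in>Basis. (h \<bullet> b)\<^sup>2 / 8)"
        unfolding power2_norm_eq_inner by (subst euclidean_inner) (simp add: sum_divide_distrib power2_eq_square)
      also have "\<dots> \<le> (\<Sum>b\<in>Basis. 1 - cos (h \<bullet> b))"
      proof (rule sum_mono)
        fix b :: "real ^ 'n" assume "b \<in> Basis"
        then have "\<bar>h \<bullet> b / 2\<bar> \<le> 1" using True Basis_le_norm[of b h] by simp
        from abs_sin_ge[OF this] have "(\<bar>h \<bullet> b / 2\<bar> / 2)\<^sup>2 \<le> \<bar>sin (h \<bullet> b / 2)\<bar>\<^sup>2" by (intro power_mono) auto
        then show "(h \<bullet> b)\<^sup>2 / 8 \<le> 1 - cos (h \<bullet> b)" unfolding c by (simp add: power_divide)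
      qed
      finally have "1 / 8 * (norm h)\<^sup>2 * frac_kernel r h \<le> (\<Sum>b\<in>Basis. 1 - cos (h \<bullet> b)) * frac_kernel r h"
        by (rule mult_right_mono) simp
      moreover have "(norm h)\<^sup>2 * frac_kernel r h = norm h powr ((2 - r) - real DIM(real ^ 'n))"
      proof (cases "h = 0")
        case False
        then have "(norm h)\<^sup>2 = norm h powr 2" by (simp add: powr_numeral)
        then show ?thesis using powr_frac_kernel[of h 2 r] by simp
      qed (simp add: frac_kernel_def)
      ultimately show ?thesis unfolding e using True by (simp add: lo_def mult.assoc)
    next
      case False
      then show ?thesis unfolding e using nn by (simp add: lo_def)
    qed
  qed
  also have "\<dots> = - (real CARD('n) * Re (kernel_const TYPE('n) r 1))"
    unfolding kernel_const_Re_sum(1)[OF r3] by simp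
  finally show False using z by simp
qed

lemma kernel_const_1_tendsto:
  assumes t: "0 < t" "t < 1" and r: "\<And>k. r0 \<le> r k" "\<And>k. r k \<le> t" "0 < r0" "r \<longlonglongrightarrow> t"
  shows "(\<lambda>k. kernel_const TYPE('n::finite) (r k) 1) \<longlonglongrightarrow> kernel_const TYPE('n) t 1"
  unfolding kernel_const_def kernel_symbol_def
proof (rule integral_dominated_convergence[where w="\<lambda>h::real ^ 'n. norm (difference_symbol 1 (h \<bullet> axis undefined 1)) * (frac_kernel r0 h + frac_kernel t h)"])
  have r0: "r0 \<le> t" using r(1)[of 0] r(2)[of 0] by simp
  have "integrable lborel (\<lambda>h::real ^ 'n. norm (difference_symbol 1 (h \<bullet> axis undefined 1) * of_real (frac_kernel r0 h)) + norm (difference_symbol 1 (h \<bullet> axis undefined 1) * of_real (frac_kernel t h)))"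
    using r0 r(3) t by (intro Bochner_Integration.integrable_add integrable_norm difference_symbol_kernel_integrable) auto
  then show "integrable lborel (\<lambda>h::real ^ 'n. norm (difference_symbol 1 (h \<bullet> axis undefined 1)) * (frac_kernel r0 h + frac_kernel t h))"
    by (simp add: norm_mult distrib_left)
  show "AE h::real ^ 'n in lborel. (\<lambda>k. difference_symbol 1 (h \<bullet> axis undefined 1) * of_real (frac_kernel (r k) h)) \<longlonglongrightarrow> difference_symbol 1 (h \<bullet> axis undefined 1) * of_real (frac_kernel t h)"
    using AE_lborel_singleton[of "0 :: real ^ 'n"]
    by eventually_elim (auto simp: frac_kernel_def intro!: tendsto_intros r)
  show "AE h::real ^ 'n in lborel. norm (difference_symbol 1 (h \<bullet> axis undefined 1) * of_real (frac_kernel (r k) h)) \<le> norm (difference_symbol 1 (h \<bullet> axis undefined 1)) * (frac_kernel r0 h + frac_kernel t h)" for k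
    by (intro AE_I2) (auto simp: norm_mult frac_kernel_le_sum[OF r(1) r(2)] intro!: mult_left_mono)
qed measurable

section \<open>The fractional Laplacian as a singular integral\<close>

lemma fdiff_measurable_pair [measurable]:
  assumes [measurable]: "f \<in> borel_measurable borel"
  shows "(\<lambda>z. fdiff t (fst z) f (snd z)) \<in> borel_measurable (lborel \<Otimes>\<^sub>M lborel)"
proof -
  interpret sigma_finite_measure "count_space (UNIV :: nat set)" by (rule sigma_finite_measure_count_space)
  show ?thesis unfolding fdiff_def wtrans_def by measurable
qed

lemma fdiff_measurable [measurable]:
  assumes [measurable]: "f \<in> borel_measurable borel"
  shows "fdiff t h f \<in> borel_measurable borel"
proof -
  interpret sigma_finite_measure "count_space (UNIV :: nat set)" by (rule sigma_finite_measure_count_space)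
  show ?thesis unfolding fdiff_def wtrans_def by measurable
qed

text \<open>
  After Fourier inversion the difference is a multiplication by its symbol, and integrating the
  symbol against the kernel gives a multiple of \<open>norm \<xi> powr r\<close>. Fubini's
  theorem applies, since the integral of the absolute value of the symbol grows at most linearly
  in \<open>\<xi>\<close>.
\<close>

lemma fdiff_kernel_identity:
  fixes \<phi> :: "real ^ 'n \<Rightarrow> complex"
  assumes \<phi>: "\<phi> \<in> schwartz" and r: "0 < r" "r < t" "t \<le> 1"
  shows "(\<integral>h. fdiff t h \<phi> x * of_real (frac_kernel r h) \<partial>lborel) = kernel_const TYPE('n) r t * frac_laplacian_schwartz r \<phi> x"
proof -
  define c where "c = complex_of_real ((2 * pi) ^ DIM(real ^ 'n))"
  have [measurable]: "\<phi> \<in> borel_measurable borel" using \<phi> by measurable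
  have d: "fdiff t h \<phi> x = (\<integral>\<xi>. cis (x \<bullet> \<xi>) * (difference_symbol t (h \<bullet> \<xi>) * fourier \<phi> \<xi>) \<partial>lborel) / c" for h
  proof -
    interpret translation_mixture "count_space UNIV" "\<lambda>j. complex_of_real (bcoef t j)" "\<lambda>j. (t - real j) *\<^sub>R h"
      using r by (intro fdiff_mixture) auto
    show ?thesis
      unfolding fdiff_def
      by (subst inv_fourier_wtrans[OF fourier_integrable[OF \<phi>] fourier_inversion[OF \<phi>, symmetric]])
         (simp only: inv_fourier_def wtrans_symbol_fdiff c_def)
  qed
  obtain K where K: "K \<ge> 0" "\<And>\<xi>::real ^ 'n. (\<integral>\<^sup>+h. ennreal (norm (difference_symbol t (h \<bullet> \<xi>))) * ennreal (frac_kernel r h) \<partial>lborel) \<le> ennreal (K * (1 + norm \<xi>))"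
    using difference_symbol_kernel_nn[OF r, where 'a="real ^ 'n"] by blast
  obtain C where C: "C \<ge> 0" "\<And>\<xi>. (1 + norm \<xi>) * norm (fourier \<phi> \<xi>) \<le> C * decay \<xi>" using fourier_decay[OF \<phi>] by blast
  have I: "integrable (lborel \<Otimes>\<^sub>M lborel) (\<lambda>(h, \<xi>). cis (x \<bullet> \<xi>) * (difference_symbol t (h \<bullet> \<xi>) * fourier \<phi> \<xi>) * of_real (frac_kernel r h))"
  proof (rule integrableI_bounded)
    show "(\<lambda>(h, \<xi>). cis (x \<bullet> \<xi>) * (difference_symbol t (h \<bullet> \<xi>) * fourier \<phi> \<xi>) * of_real (frac_kernel r h)) \<in> borel_measurable (lborel \<Otimes>\<^sub>M lborel)"
      unfolding cis_conv_exp by measurable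
    have "(\<integral>\<^sup>+z. ennreal (norm (case z of (h, \<xi>) \<Rightarrow> cis (x \<bullet> \<xi>) * (difference_symbol t (h \<bullet> \<xi>) * fourier \<phi> \<xi>) * of_real (frac_kernel r h))) \<partial>(lborel \<Otimes>\<^sub>M lborel))
      = (\<integral>\<^sup>+\<xi>. (\<integral>\<^sup>+h. ennreal (norm (fourier \<phi> \<xi>)) * (ennreal (norm (difference_symbol t (h \<bullet> \<xi>))) * ennreal (frac_kernel r h)) \<partial>lborel) \<partial>lborel)"
      by (subst lborel_pair.nn_integral_snd[symmetric])
         (auto simp: norm_mult ennreal_mult cis_conv_exp mult_ac intro!: nn_integral_cong)
    also have "\<dots> \<le> (\<integral>\<^sup>+\<xi>. ennreal (norm (fourier \<phi> \<xi>)) * ennreal (K * (1 + norm \<xi>)) \<partial>lborel)"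
      by (subst nn_integral_cmult, measurable) (intro nn_integral_mono mult_left_mono K, simp)
    also have "\<dots> \<le> (\<integral>\<^sup>+\<xi>. ennreal (norm (complex_of_real (K * C * decay (\<xi> :: real ^ 'n)))) \<partial>lborel)"
    proof (rule nn_integral_mono)
      fix \<xi> :: "real ^ 'n"
      have "K * ((1 + norm \<xi>) * norm (fourier \<phi> \<xi>)) \<le> K * (C * decay \<xi>)" by (intro mult_left_mono K C)
      then show "ennreal (norm (fourier \<phi> \<xi>)) * ennreal (K * (1 + norm \<xi>)) \<le> ennreal (norm (complex_of_real (K * C * decay \<xi>)))"
        using K(1) C(1) decay_pos[of \<xi>]
        by (simp add: norm_mult mult_ac flip: ennreal_mult)
    qed
    also have "\<dots> < \<infinity>"
      using integrable_decay_bound[of "\<lambda>\<xi>::real ^ 'n. complex_of_real (K * C * decay \<xi>)" "K * C"] K(1) C(1)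
      by (auto simp: integrable_iff_bounded norm_mult decay_pos less_imp_le)
    finally show "(\<integral>\<^sup>+z. ennreal (norm (case z of (h, \<xi>) \<Rightarrow> cis (x \<bullet> \<xi>) * (difference_symbol t (h \<bullet> \<xi>) * fourier \<phi> \<xi>) * of_real (frac_kernel r h))) \<partial>(lborel \<Otimes>\<^sub>M lborel)) < \<infinity>" .
  qed
  have "(\<integral>h. fdiff t h \<phi> x * of_real (frac_kernel r h) \<partial>lborel)
     = (\<integral>h. (\<integral>\<xi>. cis (x \<bullet> \<xi>) * (difference_symbol t (h \<bullet> \<xi>) * fourier \<phi> \<xi>) * of_real (frac_kernel r h) \<partial>lborel) / c \<partial>lborel)"
    unfolding d by simp
  also have "\<dots> = (\<integral>h. (\<integral>\<xi>. cis (x \<bullet> \<xi>) * (difference_symbol t (h \<bullet> \<xi>) * fourier \<phi> \<xi>) * of_real (frac_kernel r h) \<partial>lborel) \<partial>lborel) / c"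
    by simp
  also have "\<dots> = (\<integral>\<xi>. (\<integral>h. cis (x \<bullet> \<xi>) * (difference_symbol t (h \<bullet> \<xi>) * fourier \<phi> \<xi>) * of_real (frac_kernel r h) \<partial>lborel) \<partial>lborel) / c"
    using lborel_pair.Fubini_integral[OF I] by simp
  also have "\<dots> = (\<integral>\<xi>. kernel_const TYPE('n) r t * (cis (x \<bullet> \<xi>) * (of_real (norm \<xi> powr r) * fourier \<phi> \<xi>)) \<partial>lborel) / c"
  proof -
    have "(\<integral>h. cis (x \<bullet> \<xi>) * (difference_symbol t (h \<bullet> \<xi>) * fourier \<phi> \<xi>) * of_real (frac_kernel r h) \<partial>lborel) =
       kernel_const TYPE('n) r t * (cis (x \<bullet> \<xi>) * (of_real (norm \<xi> powr r) * fourier \<phi> \<xi>))" for \<xi>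
    proof -
      have "(\<integral>h. cis (x \<bullet> \<xi>) * (difference_symbol t (h \<bullet> \<xi>) * fourier \<phi> \<xi>) * of_real (frac_kernel r h) \<partial>lborel) =
        (\<integral>h. (cis (x \<bullet> \<xi>) * fourier \<phi> \<xi>) * (difference_symbol t (h \<bullet> \<xi>) * of_real (frac_kernel r h)) \<partial>lborel)"
        by (intro Bochner_Integration.integral_cong refl) (simp add: mult_ac)
      also have "\<dots> = (cis (x \<bullet> \<xi>) * fourier \<phi> \<xi>) * kernel_symbol r t \<xi>"
        unfolding kernel_symbol_def by (rule integral_mult_right_zero)
      finally show ?thesis using kernel_symbol_eq[OF r, of \<xi>] by (simp add: mult_ac)
    qed
    then show ?thesis by simp
  qed
  also have "\<dots> = kernel_const TYPE('n) r t * frac_laplacian_schwartz r \<phi> x"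
    unfolding frac_laplacian_schwartz_def inv_fourier_def c_def by simp
  finally show ?thesis .
qed

text \<open>
  Short increments of \<open>\<phi>\<close> are small with integrable decay, long ones are only
  bounded. Both bounds are at most a multiple of \<open>norm a powr \<rho>\<close> in their
  range.
\<close>

lemma increment_pairing:
  fixes \<phi> :: "'a::euclidean_space \<Rightarrow> complex"
  assumes p: "1 < p" and \<phi>: "\<phi> \<in> schwartz" and \<rho>: "0 \<le> \<rho>" "\<rho> \<le> 1"
  shows "\<exists>K\<ge>0. \<forall>f\<in>Lp p. \<forall>a b. (\<integral>\<^sup>+x. ennreal (norm (f x) * norm (\<phi> (x + b + a) - \<phi> (x + b))) \<partial>lborel)
     \<le> ennreal (K * norm a powr \<rho>) * Lp_norm p f"
proof -
  have [measurable]: "\<phi> \<in> borel_measurable borel" using \<phi> by measurable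
  obtain B where B: "\<And>x. norm (\<phi> x) \<le> B" using schwartz_bounded[OF \<phi>] by blast
  obtain K1 where K1: "K1 \<ge> 0" "\<And>f y. f \<in> Lp p \<Longrightarrow> (\<integral>\<^sup>+x. ennreal (norm (f (x + y)) * norm (\<phi> x)) \<partial>lborel) \<le> ennreal K1 * Lp_norm p f"
    using pairing_bound[OF p schwartz_integrable[OF \<phi>] B] by blast
  have di: "integrable lborel (\<lambda>x::'a. complex_of_real (decay x))"
    by (rule integrable_decay_bound[of _ 1]) (auto simp: decay_pos less_imp_le)
  have db: "norm (complex_of_real (decay x)) \<le> 1" for x :: 'a
    using decay_le_1[of x] decay_pos[of x] by simp
  obtain K2 where K2: "K2 \<ge> 0" "\<And>f y. f \<in> Lp p \<Longrightarrow> (\<integral>\<^sup>+x. ennreal (norm (f (x + y)) * norm (complex_of_real (decay (x::'a)))) \<partial>lborel) \<le> ennreal K2 * Lp_norm p f"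
    using pairing_bound[OF p di db] by blast
  obtain C where C: "C \<ge> 0" "\<And>x a. norm a \<le> 1 \<Longrightarrow> norm (\<phi> (x + a) - \<phi> x) \<le> C * norm a * decay x"
    using schwartz_increment_decay[OF \<phi>] by blast
  define K where "K = C * K2 + 2 * K1"
  have "(\<integral>\<^sup>+x. ennreal (norm (f x) * norm (\<phi> (x + b + a) - \<phi> (x + b))) \<partial>lborel)
     \<le> ennreal (K * norm a powr \<rho>) * Lp_norm p f" if f: "f \<in> Lp p" for f a b
  proof -
    have [measurable]: "f \<in> borel_measurable borel" using f by measurable
    have tr: "(\<integral>\<^sup>+x. ennreal (norm (f x) * G (x + c)) \<partial>lborel) = (\<integral>\<^sup>+x. ennreal (norm (f (x + (- c))) * G x) \<partial>lborel)"
      if [measurable]: "G \<in> borel_measurable borel" for G :: "'a \<Rightarrow> real" and c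
      using nn_integral_translate[of "\<lambda>x. ennreal (norm (f (x + (- c))) * G x)" c] by simp
    show ?thesis
    proof (cases "norm a \<le> 1")
      case True
      have "(\<integral>\<^sup>+x. ennreal (norm (f x) * norm (\<phi> (x + b + a) - \<phi> (x + b))) \<partial>lborel)
         \<le> (\<integral>\<^sup>+x. ennreal (C * norm a) * ennreal (norm (f x) * norm (complex_of_real (decay (x + b)))) \<partial>lborel)"
      proof (rule nn_integral_mono)
        fix x
        have "norm (f x) * norm (\<phi> (x + b + a) - \<phi> (x + b)) \<le> norm (f x) * (C * norm a * decay (x + b))"
          using C(2)[OF True, of "x + b"] by (intro mult_left_mono) auto
        then show "ennreal (norm (f x) * norm (\<phi> (x + b + a) - \<phi> (x + b))) \<le> ennreal (C * norm a) * ennreal (norm (f x) * norm (complex_of_real (decay (x + b))))"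
          using C(1) decay_pos[of "x + b"] by (simp add: mult_ac flip: ennreal_mult)
      qed
      also have "\<dots> = ennreal (C * norm a) * (\<integral>\<^sup>+x. ennreal (norm (f (x + (- b))) * norm (complex_of_real (decay x))) \<partial>lborel)"
        by (subst nn_integral_cmult, measurable) (subst tr[symmetric], auto)
      also have "\<dots> \<le> ennreal (C * norm a) * (ennreal K2 * Lp_norm p f)"
        by (intro mult_left_mono K2 f) auto
      also have "\<dots> = ennreal (C * norm a * K2) * Lp_norm p f"
        using C(1) K2(1) by (simp add: ennreal_mult mult.assoc)
      also have "\<dots> \<le> ennreal (K * norm a powr \<rho>) * Lp_norm p f"
      proof (intro mult_right_mono ennreal_leI)
        have "C * norm a * K2 = (C * K2) * norm a" by simp
        also have "\<dots> \<le> K * norm a powr \<rho>"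
          unfolding K_def using min_1_powr(1)[OF \<rho>, of "norm a"] True C(1) K2(1) K1(1) by (intro mult_mono) auto
        finally show "C * norm a * K2 \<le> K * norm a powr \<rho>" .
      qed simp
      finally show ?thesis .
    next
      case False
      have "(\<integral>\<^sup>+x. ennreal (norm (f x) * norm (\<phi> (x + b + a) - \<phi> (x + b))) \<partial>lborel)
         \<le> (\<integral>\<^sup>+x. ennreal (norm (f x) * norm (\<phi> (x + (b + a)))) + ennreal (norm (f x) * norm (\<phi> (x + b))) \<partial>lborel)"
      proof (rule nn_integral_mono)
        fix x
        have "norm (f x) * norm (\<phi> (x + b + a) - \<phi> (x + b)) \<le> norm (f x) * (norm (\<phi> (x + b + a)) + norm (\<phi> (x + b)))"
          by (intro mult_left_mono norm_triangle_ineq4) auto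
        then show "ennreal (norm (f x) * norm (\<phi> (x + b + a) - \<phi> (x + b))) \<le> ennreal (norm (f x) * norm (\<phi> (x + (b + a)))) + ennreal (norm (f x) * norm (\<phi> (x + b)))"
          by (simp add: distrib_left add.assoc flip: ennreal_plus)
      qed
      also have "\<dots> = (\<integral>\<^sup>+x. ennreal (norm (f (x + (- (b + a)))) * norm (\<phi> x)) \<partial>lborel) + (\<integral>\<^sup>+x. ennreal (norm (f (x + (- b))) * norm (\<phi> x)) \<partial>lborel)"
        by (subst nn_integral_add, measurable) (subst (1 2) tr[symmetric], auto)
      also have "\<dots> \<le> ennreal K1 * Lp_norm p f + ennreal K1 * Lp_norm p f"
        by (intro add_mono K1 f)
      also have "\<dots> = ennreal (2 * K1) * Lp_norm p f"
        using K1(1) by (simp add: distrib_right[symmetric] flip: ennreal_plus)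
      also have "\<dots> \<le> ennreal (K * norm a powr \<rho>) * Lp_norm p f"
      proof (intro mult_right_mono ennreal_leI)
        have "2 * K1 * 1 \<le> K * norm a powr \<rho>"
          unfolding K_def using min_1_powr(2)[OF \<rho>, of "norm a"] False C(1) K2(1) K1(1) by (intro mult_mono) auto
        then show "2 * K1 \<le> K * norm a powr \<rho>" by simp
      qed simp
      finally show ?thesis .
    qed
  qed
  moreover have "K \<ge> 0" using C K1 K2 by (simp add: K_def)
  ultimately show ?thesis by blast
qed

text \<open>
  The coefficients have sum zero, so the value at \<open>x + t *\<^sub>R h\<close> may be
  subtracted from every term.
\<close>

lemma norm_fdiff_le_increments:
  fixes \<phi> :: "'a::euclidean_space \<Rightarrow> complex"
  assumes t: "0 < t" "t \<le> 1" and bd: "\<And>x. norm (\<phi> x) \<le> B"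
  shows "ennreal (norm (fdiff t h \<phi> x)) \<le>
     (\<integral>\<^sup>+j. ennreal (\<bar>bcoef t j\<bar> * norm (\<phi> (x + t *\<^sub>R h + (- real j) *\<^sub>R h) - \<phi> (x + t *\<^sub>R h))) \<partial>count_space UNIV)"
proof -
  have i: "integrable (count_space UNIV) (\<lambda>j. complex_of_real (bcoef t j) * g j)" if "\<And>j. norm (g j) \<le> B" for g
  proof (rule Bochner_Integration.integrable_bound[of _ "\<lambda>j. B * \<bar>bcoef t j\<bar>"])
    show "integrable (count_space UNIV) (\<lambda>j. B * \<bar>bcoef t j\<bar>)" by (intro integrable_mult_right bcoef_abs_integrable t)
    have "norm (complex_of_real (bcoef t j) * g j) \<le> B * \<bar>bcoef t j\<bar>" for j
      using mult_right_mono[OF that[of j], of "\<bar>bcoef t j\<bar>"] by (simp add: norm_mult mult.commute)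
    then show "AE j in count_space UNIV. norm (complex_of_real (bcoef t j) * g j) \<le> norm (B * \<bar>bcoef t j\<bar>)"
      by (intro AE_I2) (simp add: order_trans[OF _ abs_ge_self])
  qed simp
  have z: "(\<integral>j. complex_of_real (bcoef t j) * \<phi> (x + t *\<^sub>R h) \<partial>count_space UNIV) = 0"
    by (simp only: integral_mult_left_zero bcoef_integral_0[OF t] mult_zero_left)
  have "fdiff t h \<phi> x = fdiff t h \<phi> x - (\<integral>j. complex_of_real (bcoef t j) * \<phi> (x + t *\<^sub>R h) \<partial>count_space UNIV)"
    by (simp only: z diff_zero)
  also have "\<dots> = (\<integral>j. complex_of_real (bcoef t j) * \<phi> (x + (t - real j) *\<^sub>R h) - complex_of_real (bcoef t j) * \<phi> (x + t *\<^sub>R h) \<partial>count_space UNIV)"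
    unfolding fdiff_def wtrans_def by (intro Bochner_Integration.integral_diff[symmetric] i bd)
  also have "\<dots> = (\<integral>j. complex_of_real (bcoef t j) * (\<phi> (x + t *\<^sub>R h + (- real j) *\<^sub>R h) - \<phi> (x + t *\<^sub>R h)) \<partial>count_space UNIV)"
    by (intro Bochner_Integration.integral_cong refl) (simp add: algebra_simps)
  finally have e: "fdiff t h \<phi> x = (\<integral>j. complex_of_real (bcoef t j) * (\<phi> (x + t *\<^sub>R h + (- real j) *\<^sub>R h) - \<phi> (x + t *\<^sub>R h)) \<partial>count_space UNIV)" .
  have "integrable (count_space UNIV) (\<lambda>j. complex_of_real (bcoef t j) * (\<phi> (x + t *\<^sub>R h + (- real j) *\<^sub>R h) - \<phi> (x + t *\<^sub>R h)))"
    unfolding right_diff_distrib by (intro Bochner_Integration.integrable_diff i bd)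
  from integral_norm_bound_ennreal[OF this]
  show ?thesis unfolding e norm_mult by simp
qed

lemma fdiff_pairing:
  fixes \<phi> :: "'a::euclidean_space \<Rightarrow> complex"
  assumes p: "1 < p" and \<phi>: "\<phi> \<in> schwartz" and t: "0 < t" "t \<le> 1" and \<rho>: "0 \<le> \<rho>" "\<rho> < t"
  shows "\<exists>K\<ge>0. \<forall>f\<in>Lp p. \<forall>h. (\<integral>\<^sup>+x. ennreal (norm (f x) * norm (fdiff t h \<phi> x)) \<partial>lborel)
     \<le> ennreal (K * norm h powr \<rho>) * Lp_norm p f"
proof -
  interpret pair_sigma_finite "count_space (UNIV :: nat set)" "lborel :: 'a measure"
    by (simp add: pair_sigma_finite_def lborel.sigma_finite_measure_axioms sigma_finite_measure_count_space)
  have [measurable]: "\<phi> \<in> borel_measurable borel" using \<phi> by measurable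
  obtain B where B: "\<And>x. norm (\<phi> x) \<le> B" using schwartz_bounded[OF \<phi>] by blast
  have \<rho>1: "\<rho> \<le> 1" using t \<rho> by simp
  obtain K where K: "K \<ge> 0" "\<And>f a b. f \<in> Lp p \<Longrightarrow> (\<integral>\<^sup>+x. ennreal (norm (f x) * norm (\<phi> (x + b + a) - \<phi> (x + b))) \<partial>lborel)
     \<le> ennreal (K * norm a powr \<rho>) * Lp_norm p f"
    using increment_pairing[OF p \<phi> \<rho>(1) \<rho>1] by blast
  have "(\<integral>\<^sup>+x. ennreal (norm (f x) * norm (fdiff t h \<phi> x)) \<partial>lborel) \<le> ennreal ((K * bcoef_moment t \<rho>) * norm h powr \<rho>) * Lp_norm p f"
    if f: "f \<in> Lp p" for f h
  proof -
    have [measurable]: "f \<in> borel_measurable borel" using f by measurable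
    define I where "I j x = norm (\<phi> (x + t *\<^sub>R h + (- real j) *\<^sub>R h) - \<phi> (x + t *\<^sub>R h))" for j x
    have [measurable]: "I j \<in> borel_measurable borel" for j unfolding I_def by measurable
    have Im2: "(\<lambda>z. ennreal (\<bar>bcoef t (fst z)\<bar> * (norm (f (snd z)) * I (fst z) (snd z)))) \<in> borel_measurable (count_space UNIV \<Otimes>\<^sub>M lborel)"
      unfolding I_def by measurable
    have "(\<integral>\<^sup>+x. ennreal (norm (f x) * norm (fdiff t h \<phi> x)) \<partial>lborel)
      \<le> (\<integral>\<^sup>+x. (\<integral>\<^sup>+j. ennreal (\<bar>bcoef t j\<bar> * (norm (f x) * I j x)) \<partial>count_space UNIV) \<partial>lborel)"
    proof (rule nn_integral_mono)
      fix x
      have "ennreal (norm (f x) * norm (fdiff t h \<phi> x)) = ennreal (norm (f x)) * ennreal (norm (fdiff t h \<phi> x))"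
        by (simp add: ennreal_mult)
      also have "\<dots> \<le> ennreal (norm (f x)) * (\<integral>\<^sup>+j. ennreal (\<bar>bcoef t j\<bar> * I j x) \<partial>count_space UNIV)"
        unfolding I_def by (intro mult_left_mono norm_fdiff_le_increments[OF t B]) simp
      also have "\<dots> = (\<integral>\<^sup>+j. ennreal (norm (f x)) * ennreal (\<bar>bcoef t j\<bar> * I j x) \<partial>count_space UNIV)"
        by (rule nn_integral_cmult[symmetric]) simp
      also have "\<dots> = (\<integral>\<^sup>+j. ennreal (\<bar>bcoef t j\<bar> * (norm (f x) * I j x)) \<partial>count_space UNIV)"
        by (intro nn_integral_cong) (simp add: I_def mult_ac flip: ennreal_mult)
      finally show "ennreal (norm (f x) * norm (fdiff t h \<phi> x)) \<le> (\<integral>\<^sup>+j. ennreal (\<bar>bcoef t j\<bar> * (norm (f x) * I j x)) \<partial>count_space UNIV)" .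
    qed
    also have "\<dots> = (\<integral>\<^sup>+j. (\<integral>\<^sup>+x. ennreal (\<bar>bcoef t j\<bar> * (norm (f x) * I j x)) \<partial>lborel) \<partial>count_space UNIV)"
      using Fubini'[of "\<lambda>j x. ennreal (\<bar>bcoef t j\<bar> * (norm (f x) * I j x))"] Im2 by (simp add: split_beta')
    also have "\<dots> \<le> (\<integral>\<^sup>+j. ennreal (\<bar>bcoef t j\<bar> * real j powr \<rho>) * (ennreal (K * norm h powr \<rho>) * Lp_norm p f) \<partial>count_space UNIV)"
    proof (rule nn_integral_mono)
      fix j
      have "(\<integral>\<^sup>+x. ennreal (\<bar>bcoef t j\<bar> * (norm (f x) * I j x)) \<partial>lborel) = ennreal \<bar>bcoef t j\<bar> * (\<integral>\<^sup>+x. ennreal (norm (f x) * I j x) \<partial>lborel)"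
        by (simp add: ennreal_mult' nn_integral_cmult)
      also have "\<dots> \<le> ennreal \<bar>bcoef t j\<bar> * (ennreal (K * norm ((- real j) *\<^sub>R h) powr \<rho>) * Lp_norm p f)"
        unfolding I_def by (intro mult_left_mono K f) simp
      also have "\<dots> = ennreal (\<bar>bcoef t j\<bar> * real j powr \<rho>) * (ennreal (K * norm h powr \<rho>) * Lp_norm p f)"
      proof -
        have e: "K * norm ((- real j) *\<^sub>R h) powr \<rho> = real j powr \<rho> * (K * norm h powr \<rho>)" by (simp add: powr_mult)
        show ?thesis unfolding e using K(1) by (simp add: ennreal_mult mult.assoc)
      qed
      finally show "(\<integral>\<^sup>+x. ennreal (\<bar>bcoef t j\<bar> * (norm (f x) * I j x)) \<partial>lborel) \<le> ennreal (\<bar>bcoef t j\<bar> * real j powr \<rho>) * (ennreal (K * norm h powr \<rho>) * Lp_norm p f)" .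
    qed
    also have "\<dots> = ennreal (bcoef_moment t \<rho>) * (ennreal (K * norm h powr \<rho>) * Lp_norm p f)"
      by (simp add: nn_integral_multc bcoef_moment_nn_integral[OF t \<rho>(2)])
    also have "\<dots> = ennreal ((K * bcoef_moment t \<rho>) * norm h powr \<rho>) * Lp_norm p f"
      proof -
      have e: "(K * bcoef_moment t \<rho>) * norm h powr \<rho> = bcoef_moment t \<rho> * (K * norm h powr \<rho>)" by simp
      show ?thesis unfolding e using K(1) bcoef_moment_nonneg[OF t \<rho>(2)] by (simp only: ennreal_mult mult.assoc mult_nonneg_nonneg powr_ge_zero)
    qed
    finally show ?thesis .
  qed
  then show ?thesis using K(1) bcoef_moment_nonneg[OF t \<rho>(2)] by (intro exI[of _ "K * bcoef_moment t \<rho>"]) auto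
qed

text \<open>
  \<open>fdiff_pairing\<close> with a positive exponent greater than \<open>r\<close> handles
  the singularity of the kernel at the origin, and with the exponent \<open>0\<close> its tail.
\<close>

lemma kernel_pairing:
  fixes \<phi> :: "'a::euclidean_space \<Rightarrow> complex"
  assumes p: "1 < p" and \<phi>: "\<phi> \<in> schwartz" and r: "0 < r" "r < t" "t \<le> 1"
  shows "\<exists>K\<ge>0. \<forall>f\<in>Lp p. (\<integral>\<^sup>+h. (\<integral>\<^sup>+x. ennreal (norm (f x) * norm (fdiff t h \<phi> x)) \<partial>lborel) * ennreal (frac_kernel r h) \<partial>lborel)
     \<le> ennreal K * Lp_norm p f"
proof -
  define \<rho> where "\<rho> = (r + t) / 2"
  have \<rho>: "0 \<le> \<rho>" "\<rho> < t" "r < \<rho>" using r by (auto simp: \<rho>_def)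
  have t: "0 < t" "t \<le> 1" using r by auto
  have [measurable]: "\<phi> \<in> borel_measurable borel" using \<phi> by measurable
  obtain K1 where K1: "K1 \<ge> 0" "\<And>f h. f \<in> Lp p \<Longrightarrow> (\<integral>\<^sup>+x. ennreal (norm (f x) * norm (fdiff t h \<phi> x)) \<partial>lborel) \<le> ennreal (K1 * norm h powr \<rho>) * Lp_norm p f"
    using fdiff_pairing[OF p \<phi> t \<rho>(1,2)] by blast
  have z: "(0::real) \<le> 0" "0 < t" by (auto simp: t)
  obtain K2 where K2: "K2 \<ge> 0" "\<And>f h. f \<in> Lp p \<Longrightarrow> (\<integral>\<^sup>+x. ennreal (norm (f x) * norm (fdiff t h \<phi> x)) \<partial>lborel) \<le> ennreal (K2 * norm h powr 0) * Lp_norm p f"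
    using fdiff_pairing[OF p \<phi> t z] by blast
  define c where "c = sphere_area TYPE('a) / (\<rho> - r) + sphere_area TYPE('a) / r"
  have c: "c \<ge> 0" using \<rho> r sphere_area_pos[where 'a='a] by (simp add: c_def)
  have "(\<integral>\<^sup>+h. (\<integral>\<^sup>+x. ennreal (norm (f x) * norm (fdiff t h \<phi> x)) \<partial>lborel) * ennreal (frac_kernel r h) \<partial>lborel) \<le> ennreal ((K1 + K2) * c) * Lp_norm p f"
    if f: "f \<in> Lp p" for f
  proof -
    have [measurable]: "f \<in> borel_measurable borel" using f by measurable
    obtain N where N: "N \<ge> 0" "Lp_norm p f = ennreal N" using Lp_cases f p by (metis less_trans zero_less_one)
    have "(\<integral>\<^sup>+h. (\<integral>\<^sup>+x. ennreal (norm (f x) * norm (fdiff t h \<phi> x)) \<partial>lborel) * ennreal (frac_kernel r h) \<partial>lborel) \<le>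
       ennreal (((K1 + K2) * N) * (sphere_area TYPE('a) / (\<rho> - r) + sphere_area TYPE('a) / r))"
    proof (rule nn_integral_frac_kernel_le)
      show "(\<lambda>h. \<integral>\<^sup>+x. ennreal (norm (f x) * norm (fdiff t h \<phi> x)) \<partial>lborel) \<in> borel_measurable borel"
        using fdiff_measurable_pair[of \<phi> t] by measurable
      fix h
      have "(\<integral>\<^sup>+x. ennreal (norm (f x) * norm (fdiff t h \<phi> x)) \<partial>lborel) \<le> ennreal (K1 * norm h powr \<rho> * N)"
        using K1(2)[OF f, of h] K1(1) N by (simp add: ennreal_mult)
      also have "\<dots> \<le> ennreal ((K1 + K2) * N * norm h powr \<rho>)"
        proof (rule ennreal_leI)
        have "(K1 + K2) * N * norm h powr \<rho> = K1 * norm h powr \<rho> * N + K2 * N * norm h powr \<rho>"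
          by (simp add: algebra_simps)
        then show "K1 * norm h powr \<rho> * N \<le> (K1 + K2) * N * norm h powr \<rho>"
          using K2(1) N by simp
      qed
      finally show "(\<integral>\<^sup>+x. ennreal (norm (f x) * norm (fdiff t h \<phi> x)) \<partial>lborel) \<le> ennreal ((K1 + K2) * N * norm h powr \<rho>)" .
      have "(\<integral>\<^sup>+x. ennreal (norm (f x) * norm (fdiff t h \<phi> x)) \<partial>lborel) \<le> ennreal (K2 * norm h powr 0 * N)"
        using K2(2)[OF f, of h] K2(1) N by (simp add: ennreal_mult)
      also have "\<dots> \<le> ennreal ((K1 + K2) * N)"
      proof (rule ennreal_leI)
        have "K2 * norm h powr 0 \<le> (K1 + K2) * 1" using K1(1) K2(1) by (intro mult_mono) auto
        then show "K2 * norm h powr 0 * N \<le> (K1 + K2) * N" using N by (intro mult_right_mono) auto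
      qed
      finally show "(\<integral>\<^sup>+x. ennreal (norm (f x) * norm (fdiff t h \<phi> x)) \<partial>lborel) \<le> ennreal ((K1 + K2) * N)" .
    qed (use r \<rho> K1(1) K2(1) N in auto)
    also have "\<dots> = ennreal ((K1 + K2) * c) * Lp_norm p f"
      using N K1(1) K2(1) c unfolding c_def[symmetric] by (simp add: mult_ac flip: ennreal_mult)
    finally show ?thesis .
  qed
  then show ?thesis using K1(1) K2(1) c by (intro exI[of _ "(K1 + K2) * c"]) auto
qed

lemma frac_laplacian_schwartz_measurable [measurable]:
  assumes [measurable]: "\<phi> \<in> borel_measurable borel"
  shows "frac_laplacian_schwartz r \<phi> \<in> borel_measurable borel"
  unfolding frac_laplacian_schwartz_def inv_fourier_def cis_conv_exp by measurable

lemma kernel_pairing_integrable: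
  fixes \<phi> :: "'a::euclidean_space \<Rightarrow> complex"
  assumes p: "1 < p" and \<phi>: "\<phi> \<in> schwartz" and r: "0 < r" "r < t" "t \<le> 1" and f: "f \<in> Lp p"
  shows "integrable (lborel \<Otimes>\<^sub>M lborel) (\<lambda>(h, x). f x * fdiff t h \<phi> x * of_real (frac_kernel r h))"
proof (rule integrableI_bounded)
  have [measurable]: "\<phi> \<in> borel_measurable borel" using \<phi> by measurable
  have [measurable]: "f \<in> borel_measurable borel" using f by measurable
  note [measurable] = fdiff_measurable_pair[of \<phi> t]
  show "(\<lambda>(h, x). f x * fdiff t h \<phi> x * of_real (frac_kernel r h)) \<in> borel_measurable (lborel \<Otimes>\<^sub>M lborel)"
    by (simp add: split_beta')
  obtain N where N: "N \<ge> 0" "Lp_norm p f = ennreal N" using Lp_cases f p by (metis less_trans zero_less_one)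
  obtain K where K: "(\<integral>\<^sup>+h. (\<integral>\<^sup>+x. ennreal (norm (f x) * norm (fdiff t h \<phi> x)) \<partial>lborel) * ennreal (frac_kernel r h) \<partial>lborel) \<le> ennreal K * Lp_norm p f"
    using kernel_pairing[OF p \<phi> r] f by blast
  have "(\<integral>\<^sup>+z. ennreal (norm (case z of (h, x) \<Rightarrow> f x * fdiff t h \<phi> x * of_real (frac_kernel r h))) \<partial>(lborel \<Otimes>\<^sub>M lborel))
     = (\<integral>\<^sup>+z. ennreal (norm (f (snd z)) * norm (fdiff t (fst z) \<phi> (snd z))) * ennreal (frac_kernel r (fst z)) \<partial>(lborel \<Otimes>\<^sub>M lborel))"
    by (intro nn_integral_cong) (simp add: split_beta' norm_mult ennreal_mult)
  also have "\<dots> = (\<integral>\<^sup>+h. (\<integral>\<^sup>+x. ennreal (norm (f x) * norm (fdiff t h \<phi> x)) \<partial>lborel) * ennreal (frac_kernel r h) \<partial>lborel)"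
    by (subst lborel.nn_integral_fst[symmetric]) (simp_all add: nn_integral_multc)
  also have "\<dots> < \<infinity>" using K N by (auto simp: ennreal_mult_less_top elim!: le_less_trans)
  finally show "(\<integral>\<^sup>+z. ennreal (norm (case z of (h, x) \<Rightarrow> f x * fdiff t h \<phi> x * of_real (frac_kernel r h))) \<partial>(lborel \<Otimes>\<^sub>M lborel)) < \<infinity>" .
qed

text \<open>
  The identity for test functions, paired with \<open>f\<close>; the absolute bound
  \<open>kernel_pairing\<close> allows the order of integration to be exchanged.
\<close>

lemma frac_laplacian_kernel:
  fixes \<phi> :: "real ^ 'n \<Rightarrow> complex"
  assumes p: "1 < p" and \<phi>: "\<phi> \<in> schwartz" and r: "0 < r" "r < t" "t \<le> 1" and f: "f \<in> Lp p"
  shows "kernel_const TYPE('n) r t * frac_laplacian r f \<phi> = (\<integral>h. (\<integral>x. f x * fdiff t h \<phi> x \<partial>lborel) * of_real (frac_kernel r h) \<partial>lborel)"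
    and "integrable lborel (\<lambda>h. (\<integral>x. f x * fdiff t h \<phi> x \<partial>lborel) * of_real (frac_kernel r h))"
proof -
  note I = kernel_pairing_integrable[OF p \<phi> r f]
  have "(\<integral>h. (\<integral>x. f x * fdiff t h \<phi> x \<partial>lborel) * of_real (frac_kernel r h) \<partial>lborel)
     = (\<integral>h. (\<integral>x. f x * fdiff t h \<phi> x * of_real (frac_kernel r h) \<partial>lborel) \<partial>lborel)" by simp
  also have "\<dots> = (\<integral>x. (\<integral>h. f x * fdiff t h \<phi> x * of_real (frac_kernel r h) \<partial>lborel) \<partial>lborel)"
    by (rule lborel_pair.Fubini_integral[OF I, symmetric])
  also have "\<dots> = (\<integral>x. kernel_const TYPE('n) r t * (f x * frac_laplacian_schwartz r \<phi> x) \<partial>lborel)"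
  proof (rule Bochner_Integration.integral_cong[OF refl])
    fix x
    have "(\<integral>h. f x * fdiff t h \<phi> x * of_real (frac_kernel r h) \<partial>lborel) = f x * (\<integral>h. fdiff t h \<phi> x * of_real (frac_kernel r h) \<partial>lborel)"
      by (simp add: mult.assoc)
    then show "(\<integral>h. f x * fdiff t h \<phi> x * of_real (frac_kernel r h) \<partial>lborel) = kernel_const TYPE('n) r t * (f x * frac_laplacian_schwartz r \<phi> x)"
      by (simp add: fdiff_kernel_identity[OF \<phi> r])
  qed
  also have "\<dots> = kernel_const TYPE('n) r t * frac_laplacian r f \<phi>"
    unfolding frac_laplacian_def by simp
  finally show "kernel_const TYPE('n) r t * frac_laplacian r f \<phi> = (\<integral>h. (\<integral>x. f x * fdiff t h \<phi> x \<partial>lborel) * of_real (frac_kernel r h) \<partial>lborel)" ..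
  show "integrable lborel (\<lambda>h. (\<integral>x. f x * fdiff t h \<phi> x \<partial>lborel) * of_real (frac_kernel r h))"
    using lborel_pair.integrable_fst[OF I] by simp
qed

text \<open>
  The singular integral with first order differences dominates \<open>frac_laplacian_schwartz r
  \<phi>\<close>.
\<close>

lemma frac_laplacian_pairing:
  fixes \<phi> :: "real ^ 'n \<Rightarrow> complex"
  assumes p: "1 < p" and \<phi>: "\<phi> \<in> schwartz" and r: "0 < r" "r < 1"
  shows "\<exists>K\<ge>0. \<forall>f\<in>Lp p. (\<integral>\<^sup>+x. ennreal (norm (f x * frac_laplacian_schwartz r \<phi> x)) \<partial>lborel) \<le> ennreal K * Lp_norm p f"
proof -
  have r3: "0 < r" "r < 1" "(1::real) \<le> 1" using r by auto
  have [measurable]: "\<phi> \<in> borel_measurable borel" using \<phi> by measurable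
  note [measurable] = fdiff_measurable_pair[of \<phi> 1]
  define k where "k = norm (kernel_const TYPE('n) r 1)"
  have k: "k > 0" using kernel_const_1_nz[OF r, where 'n='n] by (simp add: k_def)
  obtain K where K: "K \<ge> 0" "\<And>f. f \<in> Lp p \<Longrightarrow> (\<integral>\<^sup>+h. (\<integral>\<^sup>+x. ennreal (norm (f x) * norm (fdiff 1 h \<phi> x)) \<partial>lborel) * ennreal (frac_kernel r h) \<partial>lborel) \<le> ennreal K * Lp_norm p f"
    using kernel_pairing[OF p \<phi> r3] by blast
  have "(\<integral>\<^sup>+x. ennreal (norm (f x * frac_laplacian_schwartz r \<phi> x)) \<partial>lborel) \<le> ennreal (K / k) * Lp_norm p f" if f: "f \<in> Lp p" for f
  proof -
    have [measurable]: "f \<in> borel_measurable borel" using f by measurable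
    have pw: "ennreal (norm (f x * frac_laplacian_schwartz r \<phi> x)) \<le> ennreal (1 / k) * (\<integral>\<^sup>+h. ennreal (norm (f x) * norm (fdiff 1 h \<phi> x) * frac_kernel r h) \<partial>lborel)" for x
    proof -
      have nb: "ennreal (norm (\<integral>h. F h \<partial>lborel)) \<le> (\<integral>\<^sup>+h. ennreal (norm (F h)) \<partial>lborel)" for F :: "real ^ 'n \<Rightarrow> complex"
        using integral_norm_bound_ennreal[of lborel F] by (cases "integrable lborel F") (auto simp: not_integrable_integral_eq)
      have "f x * frac_laplacian_schwartz r \<phi> x = (\<integral>h. f x * (fdiff 1 h \<phi> x * of_real (frac_kernel r h)) \<partial>lborel) / kernel_const TYPE('n) r 1"
        using fdiff_kernel_identity[OF \<phi> r3, of x] kernel_const_1_nz[OF r, where 'n='n] by simp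
      then have "norm (f x * frac_laplacian_schwartz r \<phi> x) = norm (\<integral>h. f x * (fdiff 1 h \<phi> x * of_real (frac_kernel r h)) \<partial>lborel) / k"
        by (simp only: norm_divide k_def)
      then have "ennreal (norm (f x * frac_laplacian_schwartz r \<phi> x)) = ennreal (1 / k) * ennreal (norm (\<integral>h. f x * (fdiff 1 h \<phi> x * of_real (frac_kernel r h)) \<partial>lborel))"
        using k by (simp del: integral_mult_right_zero flip: ennreal_mult)
      also have "\<dots> \<le> ennreal (1 / k) * (\<integral>\<^sup>+h. ennreal (norm (f x * (fdiff 1 h \<phi> x * of_real (frac_kernel r h)))) \<partial>lborel)"
        by (intro mult_left_mono nb) simp
      finally show ?thesis by (simp add: norm_mult mult.assoc)
    qed
    have "(\<integral>\<^sup>+x. ennreal (norm (f x * frac_laplacian_schwartz r \<phi> x)) \<partial>lborel)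
      \<le> (\<integral>\<^sup>+x. ennreal (1 / k) * (\<integral>\<^sup>+h. ennreal (norm (f x) * norm (fdiff 1 h \<phi> x) * frac_kernel r h) \<partial>lborel) \<partial>lborel)"
      by (intro nn_integral_mono pw)
    also have "\<dots> = ennreal (1 / k) * (\<integral>\<^sup>+x. (\<integral>\<^sup>+h. ennreal (norm (f x) * norm (fdiff 1 h \<phi> x) * frac_kernel r h) \<partial>lborel) \<partial>lborel)"
    proof (rule nn_integral_cmult)
      have "(\<lambda>z. ennreal (norm (f (fst z)) * norm (fdiff 1 (snd z) \<phi> (fst z)) * frac_kernel r (snd z))) \<in> borel_measurable (lborel \<Otimes>\<^sub>M lborel)"
        using measurable_pair_swap[OF fdiff_measurable_pair[of \<phi> 1]] by (simp add: split_beta')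
      from lborel.borel_measurable_nn_integral_fst[OF this]
      show "(\<lambda>x. \<integral>\<^sup>+h. ennreal (norm (f x) * norm (fdiff 1 h \<phi> x) * frac_kernel r h) \<partial>lborel) \<in> borel_measurable lborel" by simp
    qed
    also have "(\<integral>\<^sup>+x. (\<integral>\<^sup>+h. ennreal (norm (f x) * norm (fdiff 1 h \<phi> x) * frac_kernel r h) \<partial>lborel) \<partial>lborel)
      = (\<integral>\<^sup>+h. (\<integral>\<^sup>+x. ennreal (norm (f x) * norm (fdiff 1 h \<phi> x) * frac_kernel r h) \<partial>lborel) \<partial>lborel)"
      by (rule lborel_pair.Fubini') (simp add: split_beta')
    also have "\<dots> = (\<integral>\<^sup>+h. (\<integral>\<^sup>+x. ennreal (norm (f x) * norm (fdiff 1 h \<phi> x)) \<partial>lborel) * ennreal (frac_kernel r h) \<partial>lborel)"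
      by (simp add: ennreal_mult nn_integral_multc)
    also have "ennreal (1 / k) * \<dots> \<le> ennreal (1 / k) * (ennreal K * Lp_norm p f)"
      by (intro mult_left_mono K f) simp
    also have "\<dots> = ennreal (K / k) * Lp_norm p f"
      using k K(1) by (simp add: mult.assoc[symmetric] flip: ennreal_mult)
    finally show ?thesis .
  qed
  then show ?thesis using K(1) k by (intro exI[of _ "K / k"]) auto
qed

lemma frac_laplacian_integrable:
  fixes \<phi> :: "real ^ 'n \<Rightarrow> complex"
  assumes p: "1 < p" and \<phi>: "\<phi> \<in> schwartz" and r: "0 < r" "r < 1" and f: "f \<in> Lp p"
  shows "integrable lborel (\<lambda>x. f x * frac_laplacian_schwartz r \<phi> x)"
proof (rule integrableI_bounded)
  have [measurable]: "\<phi> \<in> borel_measurable borel" "f \<in> borel_measurable borel" using \<phi> f by measurable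
  show "(\<lambda>x. f x * frac_laplacian_schwartz r \<phi> x) \<in> borel_measurable lborel" by measurable
  obtain N where N: "N \<ge> 0" "Lp_norm p f = ennreal N" using Lp_cases f p by (metis less_trans zero_less_one)
  obtain K where "(\<integral>\<^sup>+x. ennreal (norm (f x * frac_laplacian_schwartz r \<phi> x)) \<partial>lborel) \<le> ennreal K * Lp_norm p f"
    using frac_laplacian_pairing[OF p \<phi> r] f by blast
  then show "(\<integral>\<^sup>+x. ennreal (norm (f x * frac_laplacian_schwartz r \<phi> x)) \<partial>lborel) < \<infinity>"
    using N by (auto simp: ennreal_mult_less_top elim!: le_less_trans)
qed

text \<open>
  This is what weak convergence in \<open>L\<^sup>p\<close> is tested with: the distributions
  \<open>frac_laplacian r f\<^sub>k\<close> then converge on each test function.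
\<close>

lemma frac_laplacian_functional:
  fixes \<phi> :: "real ^ 'n \<Rightarrow> complex"
  assumes p: "1 < p" and \<phi>: "\<phi> \<in> schwartz" and r: "0 < r" "r < 1"
  shows "Lp_functional p (\<lambda>f :: real ^ 'n \<Rightarrow> complex. frac_laplacian r f \<phi>)"
  unfolding Lp_functional_def
proof (intro conjI ballI allI)
  show "frac_laplacian r (\<lambda>x. f x + g x) \<phi> = frac_laplacian r f \<phi> + frac_laplacian r g \<phi>"
    if "f \<in> Lp p" "g \<in> Lp p" for f g :: "real ^ 'n \<Rightarrow> complex"
    unfolding frac_laplacian_def distrib_right
    by (intro Bochner_Integration.integral_add frac_laplacian_integrable[OF p \<phi> r] that)
  show "frac_laplacian r (\<lambda>x. c * f x) \<phi> = c * frac_laplacian r f \<phi>" for c and f :: "real ^ 'n \<Rightarrow> complex"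
    unfolding frac_laplacian_def by (simp add: mult.assoc)
  obtain K where K: "\<And>f. f \<in> Lp p \<Longrightarrow> (\<integral>\<^sup>+x. ennreal (norm (f x * frac_laplacian_schwartz r \<phi> x)) \<partial>lborel) \<le> ennreal K * Lp_norm p f"
    using frac_laplacian_pairing[OF p \<phi> r] by blast
  show "\<exists>K. \<forall>f\<in>Lp p. ennreal (norm (frac_laplacian r (f :: real ^ 'n \<Rightarrow> complex) \<phi>)) \<le> ennreal K * Lp_norm p f"
  proof (intro exI ballI)
    fix f :: "real ^ 'n \<Rightarrow> complex" assume f: "f \<in> Lp p"
    show "ennreal (norm (frac_laplacian r f \<phi>)) \<le> ennreal K * Lp_norm p f"
      unfolding frac_laplacian_def
      by (rule order_trans[OF integral_norm_bound_ennreal[OF frac_laplacian_integrable[OF p \<phi> r f]] K[OF f]])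
  qed
qed

text \<open>
  In the singular integral with first order differences, the order enters only through the
  kernel and the constant. The kernels of the orders \<open>r0\<close> and \<open>t\<close>
  together dominate all those in between.
\<close>

lemma frac_laplacian_order_tendsto:
  fixes \<phi> :: "real ^ 'n \<Rightarrow> complex"
  assumes p: "1 < p" and \<phi>: "\<phi> \<in> schwartz" and f: "f \<in> Lp p"
    and t: "0 < t" "t < 1" and r: "\<And>k. r0 \<le> r k" "\<And>k. r k \<le> t" "0 < r0" "r \<longlonglongrightarrow> t"
  shows "(\<lambda>k. frac_laplacian (r k) f \<phi>) \<longlonglongrightarrow> frac_laplacian t f \<phi>"
proof -
  have r0t: "r0 \<le> t" using r(1)[of 0] r(2)[of 0] by simp
  have ok: "0 < s" "s < 1" "(1::real) \<le> 1" if "r0 \<le> s" "s \<le> t" for s using that r(3) t by auto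
  define P where "P h = (\<integral>x. f x * fdiff 1 h \<phi> x \<partial>lborel)" for h
  have Pi: "integrable lborel (\<lambda>h. P h * of_real (frac_kernel s h))" if "r0 \<le> s" "s \<le> t" for s
    unfolding P_def by (rule frac_laplacian_kernel(2)[OF p \<phi> ok[OF that] f])
  have Pe: "kernel_const TYPE('n) s 1 * frac_laplacian s f \<phi> = (\<integral>h. P h * of_real (frac_kernel s h) \<partial>lborel)" if "r0 \<le> s" "s \<le> t" for s
    unfolding P_def by (rule frac_laplacian_kernel(1)[OF p \<phi> ok[OF that] f])
  have "(\<lambda>k. \<integral>h. P h * of_real (frac_kernel (r k) h) \<partial>lborel) \<longlonglongrightarrow> (\<integral>h. P h * of_real (frac_kernel t h) \<partial>lborel)"
  proof (rule integral_dominated_convergence[where w="\<lambda>h. norm (P h * of_real (frac_kernel r0 h)) + norm (P h * of_real (frac_kernel t h))"])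
    show "integrable lborel (\<lambda>h. norm (P h * of_real (frac_kernel r0 h)) + norm (P h * of_real (frac_kernel t h)))"
      using r0t by (intro Bochner_Integration.integrable_add integrable_norm Pi) auto
    show "AE h in lborel. (\<lambda>k. P h * of_real (frac_kernel (r k) h)) \<longlonglongrightarrow> P h * of_real (frac_kernel t h)"
      using AE_lborel_singleton[of "0 :: real ^ 'n"]
      by eventually_elim (auto simp: frac_kernel_def intro!: tendsto_intros r)
    show "AE h in lborel. norm (P h * of_real (frac_kernel (r k) h)) \<le> norm (P h * of_real (frac_kernel r0 h)) + norm (P h * of_real (frac_kernel t h))" for k
    proof (intro AE_I2)
      fix h
      have "norm (P h) * frac_kernel (r k) h \<le> norm (P h) * (frac_kernel r0 h + frac_kernel t h)"
        by (intro mult_left_mono frac_kernel_le_sum r) simp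
      then show "norm (P h * of_real (frac_kernel (r k) h)) \<le> norm (P h * of_real (frac_kernel r0 h)) + norm (P h * of_real (frac_kernel t h))"
        by (simp add: norm_mult distrib_left)
    qed
  qed (use Pi[of t] Pi[OF r(1,2)] r0t in auto)
  then have l: "(\<lambda>k. kernel_const TYPE('n) (r k) 1 * frac_laplacian (r k) f \<phi>) \<longlonglongrightarrow> kernel_const TYPE('n) t 1 * frac_laplacian t f \<phi>"
    using Pe[OF r(1,2)] Pe[OF r0t order_refl] by simp
  have nz: "kernel_const TYPE('n) s 1 \<noteq> 0" if "r0 \<le> s" "s \<le> t" for s
    using ok[OF that] by (intro kernel_const_1_nz) auto
  have "(\<lambda>k. kernel_const TYPE('n) (r k) 1 * frac_laplacian (r k) f \<phi> / kernel_const TYPE('n) (r k) 1) \<longlonglongrightarrow> kernel_const TYPE('n) t 1 * frac_laplacian t f \<phi> / kernel_const TYPE('n) t 1"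
    by (intro tendsto_divide l kernel_const_1_tendsto[OF t r] nz r0t order_refl)
  then show ?thesis using nz[OF r(1,2)] nz[OF r0t order_refl] by simp
qed

section \<open>Estimating the singular integral\<close>

text \<open>
  Jensen's inequality in \<open>h\<close> for the weight \<open>w\<close>. The last conclusion
  provides the integrability for exchanging the order of integration when the average is paired
  with \<open>\<phi>\<close>.
\<close>

lemma kernel_average:
  fixes w :: "'a::euclidean_space \<Rightarrow> real" and u :: "'a \<Rightarrow> 'a \<Rightarrow> complex"
  assumes p: "1 < p" and w [measurable]: "w \<in> borel_measurable borel" and w0: "\<And>h. 0 \<le> w h"
    and u [measurable]: "(\<lambda>z. u (fst z) (snd z)) \<in> borel_measurable (lborel \<Otimes>\<^sub>M lborel)"
    and W: "0 < W" "(\<integral>\<^sup>+h. ennreal (w h) \<partial>lborel) \<le> ennreal W"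
    and J: "(\<integral>\<^sup>+h. (\<integral>\<^sup>+x. ennreal (w h * norm (u h x) powr p) \<partial>lborel) \<partial>lborel) \<le> ennreal J"
  shows "power_integral p (\<lambda>x. \<integral>h. of_real (w h) * u h x \<partial>lborel) \<le> ennreal (W powr (p - 1)) * ennreal J"
    and "(\<lambda>x. \<integral>h. of_real (w h) * u h x \<partial>lborel) \<in> borel_measurable borel"
    and "integrable lborel \<phi> \<Longrightarrow> (\<And>x. norm (\<phi> x) \<le> B) \<Longrightarrow>
      integrable (lborel \<Otimes>\<^sub>M lborel) (\<lambda>(h, x). of_real (w h) * u h x * \<phi> x)"
proof -
  have u1 [measurable]: "(\<lambda>x. u h x) \<in> borel_measurable borel" for h
    using measurable_compose[OF measurable_Pair1'[of h lborel lborel] u] by simp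
  have u2 [measurable]: "(\<lambda>h. u h x) \<in> borel_measurable borel" for x
    using measurable_compose[OF measurable_Pair2'[of x lborel lborel] u] by simp
  show m: "(\<lambda>x. \<integral>h. of_real (w h) * u h x \<partial>lborel) \<in> borel_measurable borel"
  proof -
    have "(\<lambda>(x, h). complex_of_real (w h) * u h x) \<in> borel_measurable (lborel \<Otimes>\<^sub>M lborel)"
      using measurable_compose[OF measurable_pair_swap' u] by (auto simp: split_beta')
    from lborel.borel_measurable_lebesgue_integral[OF this] show ?thesis by simp
  qed
  have "power_integral p (\<lambda>x. \<integral>h. of_real (w h) * u h x \<partial>lborel)
     \<le> (\<integral>\<^sup>+x. ennreal (W powr (p - 1)) * (\<integral>\<^sup>+h. ennreal (norm (complex_of_real (w h)) * norm (u h x) powr p) \<partial>lborel) \<partial>lborel)"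
    unfolding power_integral_def
    by (intro nn_integral_mono weighted_jensen) (use p w0 W in auto)
  also have "\<dots> = ennreal (W powr (p - 1)) * (\<integral>\<^sup>+x. (\<integral>\<^sup>+h. ennreal (w h * norm (u h x) powr p) \<partial>lborel) \<partial>lborel)"
  proof (subst nn_integral_cmult)
    have "(\<lambda>z. ennreal (norm (complex_of_real (w (snd z))) * norm (u (snd z) (fst z)) powr p)) \<in> borel_measurable (lborel \<Otimes>\<^sub>M lborel)"
      using measurable_pair_swap[OF u] by (simp add: split_beta')
    from lborel.borel_measurable_nn_integral_fst[OF this]
    show "(\<lambda>x. \<integral>\<^sup>+h. ennreal (norm (complex_of_real (w h)) * norm (u h x) powr p) \<partial>lborel) \<in> borel_measurable lborel" by simp
  qed (simp add: w0)
  also have "(\<integral>\<^sup>+x. (\<integral>\<^sup>+h. ennreal (w h * norm (u h x) powr p) \<partial>lborel) \<partial>lborel) = (\<integral>\<^sup>+h. (\<integral>\<^sup>+x. ennreal (w h * norm (u h x) powr p) \<partial>lborel) \<partial>lborel)"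
    by (rule lborel_pair.Fubini') (simp add: split_beta')
  also have "ennreal (W powr (p - 1)) * \<dots> \<le> ennreal (W powr (p - 1)) * ennreal J"
    by (intro mult_left_mono J) simp
  finally show "power_integral p (\<lambda>x. \<integral>h. of_real (w h) * u h x \<partial>lborel) \<le> ennreal (W powr (p - 1)) * ennreal J" .
  assume \<phi>: "integrable lborel \<phi>" and bd: "\<And>x. norm (\<phi> x) \<le> B"
  have [measurable]: "\<phi> \<in> borel_measurable borel" using \<phi> by auto
  have B0: "B \<ge> 0" using bd[of 0] norm_ge_zero order_trans by blast
  show "integrable (lborel \<Otimes>\<^sub>M lborel) (\<lambda>(h, x). of_real (w h) * u h x * \<phi> x)"
  proof (rule integrableI_bounded)
    show "(\<lambda>(h, x). of_real (w h) * u h x * \<phi> x) \<in> borel_measurable (lborel \<Otimes>\<^sub>M lborel)"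
      by (simp add: split_beta')
    define V where "V = W * (\<integral>x. norm (\<phi> x) \<partial>lborel)"
    have V0: "V \<ge> 0" using W by (simp add: V_def)
    have mass: "(\<integral>\<^sup>+z. ennreal (w (fst z) * norm (\<phi> (snd z))) \<partial>(lborel \<Otimes>\<^sub>M lborel)) \<le> ennreal V"
    proof -
      have "(\<integral>\<^sup>+z. ennreal (w (fst z) * norm (\<phi> (snd z))) \<partial>(lborel \<Otimes>\<^sub>M lborel)) = (\<integral>\<^sup>+h. (\<integral>\<^sup>+x. ennreal (w h * norm (\<phi> x)) \<partial>lborel) \<partial>lborel)"
        by (subst lborel.nn_integral_fst[symmetric]) auto
      also have "\<dots> = (\<integral>\<^sup>+h. ennreal (w h) * (\<integral>\<^sup>+x. ennreal (norm (\<phi> x)) \<partial>lborel) \<partial>lborel)"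
        by (simp add: ennreal_mult w0 nn_integral_cmult)
      also have "\<dots> = (\<integral>\<^sup>+h. ennreal (w h) \<partial>lborel) * (\<integral>\<^sup>+x. ennreal (norm (\<phi> x)) \<partial>lborel)"
        by (rule nn_integral_multc) simp
      also have "\<dots> \<le> ennreal W * ennreal (\<integral>x. norm (\<phi> x) \<partial>lborel)"
        using \<phi> by (intro mult_mono W) (auto simp: nn_integral_eq_integral)
      also have "\<dots> = ennreal V" using W unfolding V_def by (simp add: ennreal_mult)
      finally show ?thesis .
    qed
    have "(\<integral>\<^sup>+z. ennreal ((w (fst z) * norm (\<phi> (snd z))) * norm (u (fst z) (snd z)) powr p) \<partial>(lborel \<Otimes>\<^sub>M lborel))
      \<le> (\<integral>\<^sup>+z. ennreal B * ennreal (w (fst z) * norm (u (fst z) (snd z)) powr p) \<partial>(lborel \<Otimes>\<^sub>M lborel))"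
    proof (rule nn_integral_mono)
      fix z
      have "norm (\<phi> (snd z)) * (w (fst z) * norm (u (fst z) (snd z)) powr p) \<le> B * (w (fst z) * norm (u (fst z) (snd z)) powr p)"
        by (intro mult_right_mono bd) (simp add: w0)
      then show "ennreal ((w (fst z) * norm (\<phi> (snd z))) * norm (u (fst z) (snd z)) powr p) \<le> ennreal B * ennreal (w (fst z) * norm (u (fst z) (snd z)) powr p)"
        using B0 w0 by (auto simp: mult_ac intro!: ennreal_leI simp flip: ennreal_mult)
    qed
    also have "\<dots> = ennreal B * (\<integral>\<^sup>+h. (\<integral>\<^sup>+x. ennreal (w h * norm (u h x) powr p) \<partial>lborel) \<partial>lborel)"
      by (subst nn_integral_cmult) (auto simp: lborel.nn_integral_fst[symmetric])
    also have "\<dots> \<le> ennreal B * ennreal J" by (intro mult_left_mono J) simp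
    also have "\<dots> = ennreal (B * J)" using B0 by (simp add: ennreal_mult')
    finally obtain J' where J': "(\<integral>\<^sup>+z. ennreal ((w (fst z) * norm (\<phi> (snd z))) * norm (u (fst z) (snd z)) powr p) \<partial>(lborel \<Otimes>\<^sub>M lborel)) = ennreal J'" "0 \<le> J'"
      by (rule ennreal_le_realE)
    obtain I where I: "(\<integral>\<^sup>+z. ennreal ((w (fst z) * norm (\<phi> (snd z))) * norm (u (fst z) (snd z))) \<partial>(lborel \<Otimes>\<^sub>M lborel)) = ennreal I"
      using weighted_jensen_nn[OF p _ _ _ _ mass V0 J'] w0 by auto
    have "(\<integral>\<^sup>+z. ennreal (norm (case z of (h, x) \<Rightarrow> of_real (w h) * u h x * \<phi> x)) \<partial>(lborel \<Otimes>\<^sub>M lborel)) = ennreal I"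
      unfolding I[symmetric] by (intro nn_integral_cong) (simp add: split_beta' norm_mult w0 mult_ac)
    then show "(\<integral>\<^sup>+z. ennreal (norm (case z of (h, x) \<Rightarrow> of_real (w h) * u h x * \<phi> x)) \<partial>(lborel \<Otimes>\<^sub>M lborel)) < \<infinity>" by simp
  qed
qed

lemma lborel_integral_neg:
  fixes F :: "real ^ 'n \<Rightarrow> complex"
  assumes [measurable]: "F \<in> borel_measurable borel"
  shows "(\<integral>h. F (- h) \<partial>lborel) = (\<integral>h. F h \<partial>lborel)"
  using integral_scale[of F "- 1"] by simp

lemma lborel_integrable_neg:
  fixes F :: "real ^ 'n \<Rightarrow> complex"
  assumes F: "integrable lborel F"
  shows "integrable lborel (\<lambda>h. F (- h))"
proof -
  have [measurable]: "F \<in> borel_measurable borel" using F by auto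
  show ?thesis using F nn_integral_scale[of "\<lambda>h. ennreal (norm (F h))" "- 1"] by (simp add: integrable_iff_bounded)
qed

text \<open>
  The representing function is the singular integral itself, divided by its constant and split
  at \<open>norm h = 1\<close>. Inside the ball the kernel is written as a weight
  \<open>w1\<close> of finite mass times a power that belongs to \<open>u1\<close>. Outside, the
  kernel is the weight, and the differences are bounded in \<open>L\<^sup>p\<close> by twice the
  norm of \<open>f\<close>.
\<close>

lemma frac_laplacian_represented:
  fixes f :: "real ^ 'n \<Rightarrow> complex"
  assumes p: "1 < p" and f: "f \<in> Lp p" and r: "0 < r" "r < s" "s < t" "t \<le> 1"
    and k: "kernel_const TYPE('n) r t \<noteq> 0"
    and N: "0 \<le> N" "Lp_norm p f \<le> ennreal N"
    and Z: "0 \<le> Z" "(\<integral>\<^sup>+h. (\<integral>\<^sup>+x. ennreal (norm (fdiff t h f x) powr p * norm h powr (- (s * p) - real CARD('n))) \<partial>lborel) \<partial>lborel) \<le> ennreal (Z powr p)"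
  defines "\<omega> \<equiv> sphere_area TYPE(real ^ 'n)"
  shows "\<exists>g\<in>Lp p. represents g (frac_laplacian r f) \<and>
     Lp_norm p g \<le> ennreal (((\<omega> / ((s - r) * (p / (p - 1)))) powr ((p - 1) / p) * Z + \<omega> / r * 2 * N) / norm (kernel_const TYPE('n) r t))"
proof -
  have t: "0 < t" "t \<le> 1" "r < t" using r by auto
  have [measurable]: "f \<in> borel_measurable borel" using f by measurable
  note [measurable] = fdiff_measurable_pair[of f t]
  define n where "n = real DIM(real ^ 'n)"
  define q where "q = p / (p - 1)"
  have q: "q > 0" "q * (p - 1) = p" using p by (auto simp: q_def)
  have \<omega>: "\<omega> > 0" unfolding \<omega>_def by (rule sphere_area_pos)
  define A where "A = {h :: real ^ 'n. norm h \<le> 1}"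
  define A' where "A' = {h :: real ^ 'n. norm h > 1}"
  have [measurable]: "A \<in> sets borel" "A' \<in> sets borel" unfolding A_def A'_def by measurable
  \<comment> \<open>The exponent is chosen such that \<open>w1 h * norm (u1 h x) powr p\<close> is the
    integrand of the seminorm of order \<open>s\<close>, while \<open>w1 h\<close> times the
    second factor of \<open>u1 h x\<close> is the kernel of order \<open>r\<close>.\<close>
  define w1 where "w1 h = indicator A h * norm h powr ((s - r) * q - n)" for h :: "real ^ 'n"
  define u1 where "u1 h x = fdiff t h f x * of_real (norm h powr (- r - (s - r) * q))" for h x
  define w2 where "w2 h = indicator A' h * norm h powr (- r - n)" for h :: "real ^ 'n"
  define u2 where "u2 h x = fdiff t h f x" for h x
  define W1 where "W1 = \<omega> / ((s - r) * q)"
  define W2 where "W2 = \<omega> / r"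
  have W: "W1 > 0" "W2 > 0" using \<omega> r q by (auto simp: W1_def W2_def)
  have m1: "w1 \<in> borel_measurable borel" "w2 \<in> borel_measurable borel" unfolding w1_def w2_def by measurable
  have m2: "(\<lambda>z. u1 (fst z) (snd z)) \<in> borel_measurable (lborel \<Otimes>\<^sub>M lborel)" "(\<lambda>z. u2 (fst z) (snd z)) \<in> borel_measurable (lborel \<Otimes>\<^sub>M lborel)"
    unfolding u1_def u2_def by measurable
  have w0: "w1 h \<ge> 0" "w2 h \<ge> 0" for h by (auto simp: w1_def w2_def)
  have Wm: "(\<integral>\<^sup>+h. ennreal (w1 h) \<partial>lborel) \<le> ennreal W1" "(\<integral>\<^sup>+h. ennreal (w2 h) \<partial>lborel) \<le> ennreal W2"
    using nn_integral_norm_powr_cball[where 'a="real ^ 'n" and a="(s - r) * q" and \<delta>=1] nn_integral_norm_powr_outside[where 'a="real ^ 'n" and a=r and \<delta>=1] r q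
    unfolding w1_def w2_def A_def A'_def W1_def W2_def \<omega>_def n_def by auto
  have J1: "(\<integral>\<^sup>+h. (\<integral>\<^sup>+x. ennreal (w1 h * norm (u1 h x) powr p) \<partial>lborel) \<partial>lborel) \<le> ennreal (Z powr p)"
  proof (rule order_trans[OF _ Z(2)], intro nn_integral_mono ennreal_leI)
    fix h x :: "real ^ 'n"
    have "norm h powr ((s - r) * q - n) * norm h powr ((- r - (s - r) * q) * p) = norm h powr (- (s * p) - n)"
    proof -
      have "(s - r) * q - n + (- r - (s - r) * q) * p = - r * p - (s - r) * (q * (p - 1)) - n" by (simp add: algebra_simps)
      also have "\<dots> = - (s * p) - n" unfolding q(2) by (simp add: algebra_simps)
      finally show ?thesis by (simp only: powr_add[symmetric])
    qed
    then have "w1 h * norm (u1 h x) powr p = indicator A h * (norm (fdiff t h f x) powr p * norm h powr (- (s * p) - n))"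
      unfolding w1_def u1_def by (simp add: norm_mult powr_mult powr_powr mult_ac)
    also have "\<dots> \<le> 1 * (norm (fdiff t h f x) powr p * norm h powr (- (s * p) - n))"
      by (intro mult_right_mono) (auto simp: indicator_def)
    finally show "w1 h * norm (u1 h x) powr p \<le> norm (fdiff t h f x) powr p * norm h powr (- (s * p) - real CARD('n))"
      by (simp add: n_def)
  qed
  have fN: "power_integral p (fdiff t h f) \<le> ennreal ((2 * N) powr p)" for h
  proof -
    interpret translation_mixture "count_space UNIV" "\<lambda>j. complex_of_real (bcoef t j)" "\<lambda>j. (t - real j) *\<^sub>R h"
      using t by (intro fdiff_mixture) auto
    have "power_integral p (fdiff t h f) \<le> ennreal (2 powr p) * power_integral p f"
      unfolding fdiff_def by (rule power_integral_wtrans_le[OF p]) (use bcoef_mass[OF t(1,2)] in auto)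
    also have "\<dots> \<le> ennreal (2 powr p) * ennreal (N powr p)"
      using p N by (intro mult_left_mono power_integral_leI) auto
    finally show ?thesis using N by (simp add: powr_mult flip: ennreal_mult)
  qed
  have J2: "(\<integral>\<^sup>+h. (\<integral>\<^sup>+x. ennreal (w2 h * norm (u2 h x) powr p) \<partial>lborel) \<partial>lborel) \<le> ennreal (W2 * (2 * N) powr p)"
  proof -
    have "(\<integral>\<^sup>+h. (\<integral>\<^sup>+x. ennreal (w2 h * norm (u2 h x) powr p) \<partial>lborel) \<partial>lborel) = (\<integral>\<^sup>+h. ennreal (w2 h) * power_integral p (fdiff t h f) \<partial>lborel)"
      unfolding u2_def power_integral_def by (simp add: ennreal_mult w0 nn_integral_cmult)
    also have "\<dots> \<le> (\<integral>\<^sup>+h. ennreal (w2 h) * ennreal ((2 * N) powr p) \<partial>lborel)"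
      by (intro nn_integral_mono mult_left_mono fN) simp
    also have "\<dots> = (\<integral>\<^sup>+h. ennreal (w2 h) \<partial>lborel) * ennreal ((2 * N) powr p)"
      using m1 by (intro nn_integral_multc) simp
    also have "\<dots> \<le> ennreal W2 * ennreal ((2 * N) powr p)" by (intro mult_right_mono Wm) simp
    finally show ?thesis using W by (simp add: ennreal_mult)
  qed
  define g1 where "g1 x = (\<integral>h. of_real (w1 h) * u1 h x \<partial>lborel)" for x
  define g2 where "g2 x = (\<integral>h. of_real (w2 h) * u2 h x \<partial>lborel)" for x
  note ka1 = kernel_average[OF p m1(1) w0(1) m2(1) W(1) Wm(1) J1]
  note ka2 = kernel_average[OF p m1(2) w0(2) m2(2) W(2) Wm(2) J2]
  have gm [measurable]: "g1 \<in> borel_measurable borel" "g2 \<in> borel_measurable borel"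
    unfolding g1_def g2_def using ka1(2) ka2(2) by simp_all
  have n1: "Lp_norm p g1 \<le> ennreal (W1 powr ((p - 1) / p) * Z)"
  proof (rule Lp_norm_leI)
    have "power_integral p g1 \<le> ennreal (W1 powr (p - 1)) * ennreal (Z powr p)" unfolding g1_def by (rule ka1(1))
    also have "\<dots> = ennreal ((W1 powr ((p - 1) / p) * Z) powr p)"
      using p Z by (simp add: powr_mult powr_powr flip: ennreal_mult)
    finally show "power_integral p g1 \<le> ennreal ((W1 powr ((p - 1) / p) * Z) powr p)" .
  qed (use p Z in auto)
  have n2: "Lp_norm p g2 \<le> ennreal (W2 * 2 * N)"
  proof (rule Lp_norm_leI)
    have "power_integral p g2 \<le> ennreal (W2 powr (p - 1)) * ennreal (W2 * (2 * N) powr p)" unfolding g2_def by (rule ka2(1))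
    also have "\<dots> = ennreal ((W2 * 2 * N) powr p)"
    proof -
      have "W2 powr (p - 1) * (W2 * (2 * N) powr p) = (W2 powr (p - 1) * W2 powr 1) * (2 * N) powr p" using W by simp
      also have "W2 powr (p - 1) * W2 powr 1 = W2 powr p" unfolding powr_add[symmetric] by simp
      also have "\<dots> * (2 * N) powr p = (W2 * 2 * N) powr p" by (simp add: powr_mult mult.assoc)
      finally show ?thesis using W by (simp flip: ennreal_mult)
    qed
    finally show "power_integral p g2 \<le> ennreal ((W2 * 2 * N) powr p)" .
  qed (use p N W in auto)
  define S where "S = W1 powr ((p - 1) / p) * Z + W2 * 2 * N"
  have S0: "S \<ge> 0" using W Z N by (simp add: S_def)
  have n12: "Lp_norm p (\<lambda>x. g1 x + g2 x) \<le> ennreal S"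
    unfolding S_def by (rule Lp_norm_triangle[OF p gm _ n1 _ n2]) (use W Z N in auto)
  define c where "c = kernel_const TYPE('n) r t"
  define g where "g x = inverse c * (g1 x + g2 x)" for x
  have gm' [measurable]: "g \<in> borel_measurable borel" unfolding g_def[abs_def] by measurable
  have ng: "Lp_norm p g \<le> ennreal (S / norm c)"
  proof (rule Lp_norm_leI)
    have "power_integral p g = ennreal (norm (inverse c) powr p) * power_integral p (\<lambda>x. g1 x + g2 x)"
      unfolding g_def[abs_def] using p by (intro power_integral_cmult) auto
    also have "\<dots> \<le> ennreal (norm (inverse c) powr p) * ennreal (S powr p)"
      using p S0 n12 by (intro mult_left_mono power_integral_leI) auto
    also have "\<dots> = ennreal ((S / norm c) powr p)"
      using S0 by (simp add: norm_inverse divide_inverse powr_mult mult.commute flip: ennreal_mult)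
    finally show "power_integral p g \<le> ennreal ((S / norm c) powr p)" .
  qed (use p S0 in auto)
  then have gLp: "g \<in> Lp p" unfolding Lp_def by (auto elim!: le_less_trans)
  have "represents g (frac_laplacian r f)"
    unfolding represents_def
  proof
    fix \<phi> :: "real ^ 'n \<Rightarrow> complex" assume \<phi>: "\<phi> \<in> schwartz"
    have [measurable]: "\<phi> \<in> borel_measurable borel" using \<phi> by measurable
    obtain B where B: "\<And>x. norm (\<phi> x) \<le> B" using schwartz_bounded[OF \<phi>] by blast
    have \<phi>i: "integrable lborel \<phi>" by (rule schwartz_integrable[OF \<phi>])
    note I1 = ka1(3)[OF \<phi>i B] and I2 = ka2(3)[OF \<phi>i B]
    define P where "P h = (\<integral>x. f x * fdiff t h \<phi> x \<partial>lborel)" for h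
    have Pi: "integrable lborel (\<lambda>h. P h * of_real (frac_kernel r h))"
      and Pe: "c * frac_laplacian r f \<phi> = (\<integral>h. P h * of_real (frac_kernel r h) \<partial>lborel)"
      unfolding P_def c_def using frac_laplacian_kernel[OF p \<phi> r(1) t(3,2) f] by auto
    have Pi': "integrable lborel (\<lambda>h. P (- h) * of_real (frac_kernel r h))"
      using lborel_integrable_neg[OF Pi] by simp
    \<comment> \<open>Duality reverses the step, which is harmless because the kernel is even.\<close>
    have dual: "(\<integral>x. fdiff t h f x * \<phi> x \<partial>lborel) = P (- h)" for h
    proof -
      interpret translation_mixture "count_space UNIV" "\<lambda>j. complex_of_real (bcoef t j)" "\<lambda>j. (t - real j) *\<^sub>R h"
        using t by (intro fdiff_mixture) auto
      show ?thesis unfolding P_def fdiff_def by (subst wtrans_duality[OF p f \<phi>i B]) simp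
    qed
    have e1: "(\<integral>x. of_real (w1 h) * u1 h x * \<phi> x \<partial>lborel) = of_real (indicator A h) * (P (- h) * of_real (frac_kernel r h))" for h
    proof -
      have e: "norm h powr ((s - r) * q - n) * norm h powr (- r - (s - r) * q) = frac_kernel r h"
        unfolding powr_add[symmetric] frac_kernel_def n_def by (rule arg_cong2[where f="(powr)"]) simp_all
      have "(\<integral>x. of_real (w1 h) * u1 h x * \<phi> x \<partial>lborel)
         = (\<integral>x. of_real (indicator A h * frac_kernel r h) * (fdiff t h f x * \<phi> x) \<partial>lborel)"
        unfolding w1_def u1_def e[symmetric] by (simp add: mult_ac)
      also have "\<dots> = of_real (indicator A h * frac_kernel r h) * P (- h)"
        by (subst integral_mult_right_zero) (simp only: dual)
      finally show ?thesis by (simp add: mult_ac)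
    qed
    have e2: "(\<integral>x. of_real (w2 h) * u2 h x * \<phi> x \<partial>lborel) = of_real (indicator A' h) * (P (- h) * of_real (frac_kernel r h))" for h
    proof -
      have "(\<integral>x. of_real (w2 h) * u2 h x * \<phi> x \<partial>lborel)
         = (\<integral>x. of_real (indicator A' h * frac_kernel r h) * (fdiff t h f x * \<phi> x) \<partial>lborel)"
        unfolding w2_def u2_def frac_kernel_def n_def by (simp add: mult_ac)
      also have "\<dots> = of_real (indicator A' h * frac_kernel r h) * P (- h)"
        by (subst integral_mult_right_zero) (simp only: dual)
      finally show ?thesis by (simp add: mult_ac)
    qed
    have gi: "integrable lborel (\<lambda>x. g1 x * \<phi> x)" "integrable lborel (\<lambda>x. g2 x * \<phi> x)"
      using lborel_pair.integrable_snd[OF I1] lborel_pair.integrable_snd[OF I2] unfolding g1_def g2_def by simp_all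
    have s1: "(\<integral>x. g1 x * \<phi> x \<partial>lborel) = (\<integral>h. of_real (indicator A h) * (P (- h) * of_real (frac_kernel r h)) \<partial>lborel)"
    proof -
      have "(\<integral>x. g1 x * \<phi> x \<partial>lborel) = (\<integral>x. (\<integral>h. of_real (w1 h) * u1 h x * \<phi> x \<partial>lborel) \<partial>lborel)"
        unfolding g1_def by simp
      also have "\<dots> = (\<integral>h. (\<integral>x. of_real (w1 h) * u1 h x * \<phi> x \<partial>lborel) \<partial>lborel)"
        by (rule lborel_pair.Fubini_integral[OF I1])
      finally show ?thesis unfolding e1 .
    qed
    have s2: "(\<integral>x. g2 x * \<phi> x \<partial>lborel) = (\<integral>h. of_real (indicator A' h) * (P (- h) * of_real (frac_kernel r h)) \<partial>lborel)"
    proof -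
      have "(\<integral>x. g2 x * \<phi> x \<partial>lborel) = (\<integral>x. (\<integral>h. of_real (w2 h) * u2 h x * \<phi> x \<partial>lborel) \<partial>lborel)"
        unfolding g2_def by simp
      also have "\<dots> = (\<integral>h. (\<integral>x. of_real (w2 h) * u2 h x * \<phi> x \<partial>lborel) \<partial>lborel)"
        by (rule lborel_pair.Fubini_integral[OF I2])
      finally show ?thesis unfolding e2 .
    qed
    have ind: "integrable lborel (\<lambda>h. of_real (indicator X h) * (P (- h) * of_real (frac_kernel r h)))" if [measurable]: "X \<in> sets borel" for X
    proof (rule Bochner_Integration.integrable_bound[OF Pi'])
      show "(\<lambda>h. of_real (indicator X h) * (P (- h) * of_real (frac_kernel r h))) \<in> borel_measurable lborel"
        using borel_measurable_integrable[OF Pi'] that by measurable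
    qed (auto simp: norm_mult indicator_def)
    have "(\<integral>x. (g1 x + g2 x) * \<phi> x \<partial>lborel) = (\<integral>x. g1 x * \<phi> x \<partial>lborel) + (\<integral>x. g2 x * \<phi> x \<partial>lborel)"
      unfolding distrib_right using gi by (rule Bochner_Integration.integral_add)
    also have "\<dots> = (\<integral>h. of_real (indicator A h) * (P (- h) * of_real (frac_kernel r h)) + of_real (indicator A' h) * (P (- h) * of_real (frac_kernel r h)) \<partial>lborel)"
      unfolding s1 s2 by (intro Bochner_Integration.integral_add[symmetric] ind) measurable
    also have "\<dots> = (\<integral>h. P (- h) * of_real (frac_kernel r h) \<partial>lborel)"
      by (intro Bochner_Integration.integral_cong refl) (auto simp: A_def A'_def indicator_def)
    also have "\<dots> = c * frac_laplacian r f \<phi>"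
      unfolding Pe using lborel_integral_neg[of "\<lambda>h. P h * of_real (frac_kernel r h)"] borel_measurable_integrable[OF Pi] by simp
    finally have "(\<integral>x. (g1 x + g2 x) * \<phi> x \<partial>lborel) = c * frac_laplacian r f \<phi>" .
    then show "frac_laplacian r f \<phi> = (\<integral>x. g x * \<phi> x \<partial>lborel)"
      unfolding g_def using k by (simp add: mult.assoc c_def)
  qed
  then show ?thesis using gLp ng unfolding S_def W1_def W2_def c_def q_def by blast
qed

section \<open>Weak compactness of bounded sequences in \<open>L\<^sup>p\<close>\<close>

lemma powr_midpoint_less:
  fixes u v p :: real
  assumes p: "1 < p" and u: "0 \<le> u" "u < v"
  shows "((u + v) / 2) powr p < (u powr p + v powr p) / 2"
proof -
  define x where "x = (u + v) / 2"
  have x: "u < x" "x < v" "0 < x" using u by (auto simp: x_def)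
  have c: "continuous_on X (\<lambda>y. y powr p)" if "X \<subseteq> {0..}" for X :: "real set"
    using p that by (intro continuous_on_powr') (auto intro!: continuous_intros)
  have d: "((\<lambda>y. y powr p) has_real_derivative p * y powr (p - 1)) (at y)" if "y > 0" for y :: real
    using that by (auto intro!: derivative_eq_intros)
  have df: "(\<lambda>y. y powr p) differentiable (at y)" if "y > 0" for y :: real
    using d[OF that] by (auto simp: real_differentiable_def)
  have "\<exists>l z. u < z \<and> z < x \<and> ((\<lambda>y. y powr p) has_real_derivative l) (at z) \<and> x powr p - u powr p = (x - u) * l"
    using u x by (intro MVT c) (auto intro!: df)
  then obtain l z where z: "u < z" "z < x" "((\<lambda>y. y powr p) has_real_derivative l) (at z)" "x powr p - u powr p = (x - u) * l" by blast
  have "\<exists>l z. x < z \<and> z < v \<and> ((\<lambda>y. y powr p) has_real_derivative l) (at z) \<and> v powr p - x powr p = (v - x) * l"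
    using u x by (intro MVT c) (auto intro!: df)
  then obtain l' z' where z': "x < z'" "z' < v" "((\<lambda>y. y powr p) has_real_derivative l') (at z')" "v powr p - x powr p = (v - x) * l'" by blast
  have l: "l = p * z powr (p - 1)" using DERIV_unique[OF z(3) d] z u by simp
  have l': "l' = p * z' powr (p - 1)" using DERIV_unique[OF z'(3) d] z' x by simp
  have "l < l'" unfolding l l' using p z z' u by (intro mult_strict_left_mono powr_less_mono2) auto
  then have "(v - x) * l < (v - x) * l'" using x by (intro mult_strict_left_mono) auto
  moreover have "x - u = v - x" by (simp add: x_def field_simps)
  ultimately have "x powr p - u powr p < v powr p - x powr p"
    unfolding z(4) z'(4) by (simp only:)
  then show ?thesis by (simp add: x_def)
qed

text \<open>
  Its integral over two functions tells how much smaller the \<open>p\<close>-th power integral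
  of the midpoint is than the mean of the two.
\<close>

definition convexity_gap :: "real \<Rightarrow> complex \<Rightarrow> complex \<Rightarrow> real" where
  "convexity_gap p a b = norm a powr p / 2 + norm b powr p / 2 - norm ((a + b) / 2) powr p"

text \<open>
  For equal norms the parallelogram law makes the midpoint shorter; for different norms the
  \<open>p\<close>-th power is strictly convex.
\<close>

lemma convexity_gap_pos:
  assumes p: "1 < p" and ab: "a \<noteq> b"
  shows "convexity_gap p a b > 0"
proof (cases "norm a = norm b")
  case True
  have "(norm (a + b))\<^sup>2 + (norm (a - b))\<^sup>2 = 2 * (norm a)\<^sup>2 + 2 * (norm b)\<^sup>2"
    by (simp add: power2_norm_eq_inner inner_simps)
  moreover have "(norm (a - b))\<^sup>2 > 0" using ab by simp
  moreover have "(2 * norm a)\<^sup>2 = 2 * (norm a)\<^sup>2 + 2 * (norm b)\<^sup>2" by (simp add: True power_mult_distrib)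
  ultimately have "(norm (a + b))\<^sup>2 < (2 * norm a)\<^sup>2" by linarith
  then have "norm (a + b) < 2 * norm a" by (rule power_less_imp_less_base) simp
  then have "norm ((a + b) / 2) powr p < norm a powr p"
    using p by (intro powr_less_mono2) (auto simp: norm_divide)
  then show ?thesis unfolding convexity_gap_def by (simp add: True)
next
  case False
  have "norm ((a + b) / 2) \<le> (norm a + norm b) / 2"
    using norm_triangle_ineq[of a b] by (simp add: norm_divide)
  then have "norm ((a + b) / 2) powr p \<le> ((norm a + norm b) / 2) powr p"
    using p by (intro powr_mono2) auto
  also have "\<dots> < (norm a powr p + norm b powr p) / 2"
    using False powr_midpoint_less[OF p, of "norm a" "norm b"] powr_midpoint_less[OF p, of "norm b" "norm a"]
    by (cases "norm a < norm b") (auto simp: add.commute)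
  finally show ?thesis unfolding convexity_gap_def by simp
qed

lemma convexity_gap_nonneg: "1 < p \<Longrightarrow> convexity_gap p a b \<ge> 0"
  using convexity_gap_pos[of p a b] by (cases "a = b") (auto simp: convexity_gap_def)

lemma convexity_gap_scale:
  assumes "c > 0" shows "convexity_gap p (of_real c * a) (of_real c * b) = c powr p * convexity_gap p a b"
proof -
  have "(of_real c * a + of_real c * b) / 2 = of_real c * ((a + b) / 2)" by (simp add: algebra_simps)
  then show ?thesis using assms unfolding convexity_gap_def by (simp only: norm_mult norm_of_real powr_mult) (simp add: algebra_simps)
qed

text \<open>
  The convexity gap is positive on the compact set of normalized pairs that stay apart, hence
  bounded below there. By homogeneity it controls the distance of all pairs.
\<close>

lemma convexity_gap_controls_distance:
  assumes p: "1 < p" and e: "0 < e"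
  shows "\<exists>D\<ge>0. \<forall>a b. norm (a - b) powr p \<le> e * (norm a powr p + norm b powr p) + D * convexity_gap p a b"
proof -
  define K where "K = {z :: complex \<times> complex. norm (fst z) powr p + norm (snd z) powr p = 1 \<and> e \<le> norm (fst z - snd z) powr p}"
  have cn: "continuous_on UNIV (\<lambda>z. norm (F z) powr p)" if "continuous_on UNIV F" for F :: "complex \<times> complex \<Rightarrow> complex"
    using p that by (intro continuous_on_powr' continuous_on_norm continuous_on_const) auto
  have "compact K"
  proof (rule compact_eq_bounded_closed[THEN iffD2], intro conjI)
    have "norm z \<le> 2" if "z \<in> K" for z
    proof -
      have 1: "norm (fst z) powr p \<le> 1" "norm (snd z) powr p \<le> 1"
        using that powr_ge_zero[of "norm (fst z)" p] powr_ge_zero[of "norm (snd z)" p] unfolding K_def by (auto simp del: powr_ge_zero)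
      have "norm (fst z) \<le> 1" "norm (snd z) \<le> 1"
        using 1 p powr_less_mono2[of p 1 "norm (fst z)"] powr_less_mono2[of p 1 "norm (snd z)"] by fastforce+
      then show ?thesis using norm_Pair_le[of "fst z" "snd z"] by simp
    qed
    then show "bounded K" unfolding bounded_iff by blast
    have "closed {z :: complex \<times> complex. norm (fst z) powr p + norm (snd z) powr p = 1}"
      by (intro closed_Collect_eq continuous_on_add cn continuous_intros)
    moreover have "closed {z :: complex \<times> complex. e \<le> norm (fst z - snd z) powr p}"
      by (intro closed_Collect_le cn continuous_intros)
    ultimately show "closed K" unfolding K_def by (rule closed_Collect_conj)
  qed
  moreover have "continuous_on K (\<lambda>z. convexity_gap p (fst z) (snd z))"
  proof (rule continuous_on_subset[of UNIV])
    have "continuous_on UNIV (\<lambda>z :: complex \<times> complex. norm (fst z) powr p)"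
      "continuous_on UNIV (\<lambda>z :: complex \<times> complex. norm (snd z) powr p)"
      "continuous_on UNIV (\<lambda>z :: complex \<times> complex. norm ((fst z + snd z) / 2) powr p)"
      by (intro cn continuous_intros; simp)+
    then show "continuous_on UNIV (\<lambda>z. convexity_gap p (fst z) (snd z))"
      unfolding convexity_gap_def by (intro continuous_on_diff continuous_on_add continuous_on_divide continuous_on_const) auto
  qed simp
  ultimately have "\<exists>\<delta>>0. \<forall>z\<in>K. \<delta> \<le> convexity_gap p (fst z) (snd z)"
  proof (cases "K = {}")
    case False
    then obtain z0 where z0: "z0 \<in> K" "\<And>z. z \<in> K \<Longrightarrow> convexity_gap p (fst z0) (snd z0) \<le> convexity_gap p (fst z) (snd z)"
      using continuous_attains_inf[OF \<open>compact K\<close> False \<open>continuous_on K _\<close>] by blast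
    have "fst z0 \<noteq> snd z0" using z0(1) e p unfolding K_def by auto
    then show ?thesis using convexity_gap_pos[OF p] z0 by blast
  qed (auto intro: exI[of _ 1])
  then obtain \<delta> where \<delta>: "\<delta> > 0" "\<And>z. z \<in> K \<Longrightarrow> \<delta> \<le> convexity_gap p (fst z) (snd z)" by blast
  have "norm (a - b) powr p \<le> e * (norm a powr p + norm b powr p) + (2 powr p / \<delta>) * convexity_gap p a b" for a b
  proof (cases "norm (a - b) powr p \<le> e * (norm a powr p + norm b powr p)")
    case True
    then show ?thesis using convexity_gap_nonneg[OF p, of a b] \<delta> by (simp add: add_increasing2)
  next
    case False
    define S where "S = norm a powr p + norm b powr p"
    have S: "S > 0"
    proof (rule ccontr)
      assume "\<not> S > 0"
      then have "norm a powr p = 0" "norm b powr p = 0"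
        unfolding S_def using powr_ge_zero[of "norm a" p] powr_ge_zero[of "norm b" p] by linarith+
      then have "a = 0" "b = 0" by auto
      then show False using False p by simp
    qed
    define c where "c = S powr (1 / p)"
    have c: "c > 0" "c powr p = S" using S p by (auto simp: c_def powr_powr)
    define a' where "a' = a / of_real c"
    define b' where "b' = b / of_real c"
    have ab: "a = of_real c * a'" "b = of_real c * b'" using c by (auto simp: a'_def b'_def)
    have n: "norm (of_real c * z) powr p = S * norm z powr p" for z :: complex
      using c by (simp add: norm_mult powr_mult)
    have "(a', b') \<in> K"
    proof -
      have "S * (norm a' powr p + norm b' powr p) = norm (of_real c * a') powr p + norm (of_real c * b') powr p"
        by (simp only: distrib_left n)
      also have "\<dots> = S" by (simp only: ab[symmetric] S_def)
      finally have "S * (norm a' powr p + norm b' powr p) = S * 1" by simp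
      then have 1: "norm a' powr p + norm b' powr p = 1" using S mult_left_cancel[of S] by blast
      have "a - b = of_real c * (a' - b')" unfolding ab by (simp add: algebra_simps)
      then have "e * S < S * norm (a' - b') powr p" using False unfolding S_def[symmetric] by (simp add: n)
      then have "e < norm (a' - b') powr p" using S by (simp add: mult.commute)
      then show ?thesis using 1 unfolding K_def by simp
    qed
    then have "\<delta> \<le> convexity_gap p a' b'" using \<delta>(2)[of "(a', b')"] by simp
    then have "\<delta> * S \<le> convexity_gap p a b" unfolding ab convexity_gap_scale[OF c(1)] c(2) using S by (simp add: mult.commute)
    have "norm (a - b) powr p \<le> (2 * max (norm a) (norm b)) powr p"
      using p norm_triangle_ineq4[of a b] by (intro powr_mono2) auto
    also have "\<dots> \<le> 2 powr p * S"
      unfolding powr_mult S_def by (intro mult_left_mono) (auto simp: max_def)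
    also have "\<dots> \<le> (2 powr p / \<delta>) * convexity_gap p a b"
      using \<open>\<delta> * S \<le> convexity_gap p a b\<close> \<delta>(1) by (simp add: field_simps)
    finally show ?thesis using e S unfolding S_def[symmetric] by (simp add: add_increasing)
  qed
  then show ?thesis using \<delta>(1) by (intro exI[of _ "2 powr p / \<delta>"]) auto
qed

definition real_power_integral :: "real \<Rightarrow> ('a::euclidean_space \<Rightarrow> complex) \<Rightarrow> real" where
  "real_power_integral p f = (\<integral>x. norm (f x) powr p \<partial>lborel)"

lemma power_integral_eq:
  assumes "f \<in> borel_measurable borel" "power_integral p f \<le> ennreal M"
  shows "integrable lborel (\<lambda>x. norm (f x) powr p)" "power_integral p f = ennreal (real_power_integral p f)"
proof -
  show i: "integrable lborel (\<lambda>x. norm (f x) powr p)"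
    using assms by (intro integrableI_nonneg) (auto simp: power_integral_def elim!: le_less_trans)
  show "power_integral p f = ennreal (real_power_integral p f)"
    unfolding power_integral_def real_power_integral_def using i by (intro nn_integral_eq_integral) auto
qed

text \<open>
  Midpoints suffice in place of all convex combinations, since two almost minimal elements are
  only compared with their midpoint.
\<close>

inductive_set midhull :: "(nat \<Rightarrow> 'a \<Rightarrow> complex) \<Rightarrow> nat \<Rightarrow> ('a \<Rightarrow> complex) set"
  for g :: "nat \<Rightarrow> 'a \<Rightarrow> complex" and m :: nat where
  member: "m \<le> k \<Longrightarrow> g k \<in> midhull g m"
| midpoint: "u \<in> midhull g m \<Longrightarrow> v \<in> midhull g m \<Longrightarrow> (\<lambda>x. (u x + v x) / 2) \<in> midhull g m"

lemma midhull_antimono: "u \<in> midhull g m \<Longrightarrow> m' \<le> m \<Longrightarrow> u \<in> midhull g m'"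
  by (induction rule: midhull.induct) (auto intro: midhull.intros)

lemma midhull_bounded:
  fixes g :: "nat \<Rightarrow> 'a::euclidean_space \<Rightarrow> complex"
  assumes p: "1 < p" and g: "\<And>k. g k \<in> borel_measurable borel" "\<And>k. power_integral p (g k) \<le> ennreal M" and M: "0 \<le> M"
    and u: "u \<in> midhull g m"
  shows "u \<in> borel_measurable borel \<and> power_integral p u \<le> ennreal M"
  using u
proof (induction rule: midhull.induct)
  case (midpoint u v)
  then have [measurable]: "u \<in> borel_measurable borel" "v \<in> borel_measurable borel" by auto
  have "power_integral p (\<lambda>x. (u x + v x) / 2) \<le> (\<integral>\<^sup>+x. ennreal (1/2) * ennreal (norm (u x) powr p) + ennreal (1/2) * ennreal (norm (v x) powr p) \<partial>lborel)"
    unfolding power_integral_def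
  proof (rule nn_integral_mono)
    fix x
    have "norm ((u x + v x) / 2) powr p \<le> 1/2 * norm (u x) powr p + 1/2 * norm (v x) powr p"
      using convexity_gap_nonneg[OF p, of "u x" "v x"] by (simp add: convexity_gap_def)
    then show "ennreal (norm ((u x + v x) / 2) powr p) \<le> ennreal (1/2) * ennreal (norm (u x) powr p) + ennreal (1/2) * ennreal (norm (v x) powr p)"
      by (subst (1 2) ennreal_mult[symmetric], simp_all del: ennreal_plus flip: ennreal_plus)
  qed
  also have "\<dots> = ennreal (1/2) * power_integral p u + ennreal (1/2) * power_integral p v"
    unfolding power_integral_def by (simp add: nn_integral_add nn_integral_cmult)
  also have "\<dots> \<le> ennreal (1/2) * ennreal M + ennreal (1/2) * ennreal M"
    using midpoint by (intro add_mono mult_left_mono) auto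
  also have "\<dots> = ennreal M"
  proof -
    have h: "ennreal (1/2) * ennreal M = ennreal (1/2 * M)" using M by (intro ennreal_mult[symmetric]) auto
    show ?thesis unfolding h using M by (subst ennreal_plus[symmetric]) auto
  qed
  finally show ?case by simp
qed (use g in auto)

lemma midhull_functional:
  fixes g :: "nat \<Rightarrow> 'a::euclidean_space \<Rightarrow> complex"
  assumes i: "\<And>k. integrable lborel (\<lambda>x. g k x * \<phi> x)"
    and c: "\<And>k. m \<le> k \<Longrightarrow> norm ((\<integral>x. g k x * \<phi> x \<partial>lborel) - L) \<le> e"
    and u: "u \<in> midhull g m"
  shows "integrable lborel (\<lambda>x. u x * \<phi> x) \<and> norm ((\<integral>x. u x * \<phi> x \<partial>lborel) - L) \<le> e"
  using u
proof (induction rule: midhull.induct)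
  case (midpoint u v)
  define U where "U = (\<integral>x. u x * \<phi> x \<partial>lborel)"
  define V where "V = (\<integral>x. v x * \<phi> x \<partial>lborel)"
  have eq: "(\<lambda>x. (u x + v x) / 2 * \<phi> x) = (\<lambda>x. (u x * \<phi> x + v x * \<phi> x) / 2)"
    by (simp add: fun_eq_iff algebra_simps add_divide_distrib)
  have "(\<integral>x. (u x + v x) / 2 * \<phi> x \<partial>lborel) = (U + V) / 2"
    unfolding eq U_def V_def using midpoint by simp
  moreover have "norm ((U + V) / 2 - L) \<le> e"
  proof -
    have "(U + V) / 2 - L = ((U - L) + (V - L)) / 2" by (simp add: field_simps)
    also have "norm \<dots> \<le> (norm (U - L) + norm (V - L)) / 2"
      using norm_triangle_ineq[of "U - L" "V - L"] by (simp add: norm_divide)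
    also have "\<dots> \<le> e" using midpoint unfolding U_def V_def by simp
    finally show ?thesis .
  qed
  moreover have "integrable lborel (\<lambda>x. (u x + v x) / 2 * \<phi> x)" unfolding eq using midpoint by auto
  ultimately show ?case by simp
qed (use i c in auto)

text \<open>
  Elements of almost minimal norm in the midpoint hulls of the tails form a Cauchy sequence,
  because the midpoint of two of them is not much shorter.
\<close>

lemma midhull_cauchy_sequence:
  fixes g :: "nat \<Rightarrow> 'a::euclidean_space \<Rightarrow> complex"
  assumes p: "1 < p" and g: "\<And>k. g k \<in> borel_measurable borel" "\<And>k. power_integral p (g k) \<le> ennreal M" and M: "0 \<le> M"
  shows "\<exists>u. (\<forall>m. u m \<in> midhull g m) \<and> (\<forall>e>0. \<exists>m0. \<forall>m\<ge>m0. \<forall>l\<ge>m. power_integral p (\<lambda>x. u l x - u m x) \<le> ennreal e)"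
proof -
  define iv where "iv m = inverse (real (Suc m))" for m
  have iv: "iv \<longlonglongrightarrow> 0" "\<And>m. iv m > 0" "\<And>m l. m \<le> l \<Longrightarrow> iv l \<le> iv m"
    unfolding iv_def by (rule LIMSEQ_inverse_real_of_nat) (auto intro: le_imp_inverse_le)
  note mb = midhull_bounded[where g=g, OF p g M]
  have pi: "integrable lborel (\<lambda>x. norm (u x) powr p)" "power_integral p u = ennreal (real_power_integral p u)" if "u \<in> midhull g m" for u m
    using power_integral_eq[of u p M] mb[OF that] by auto
  have pM: "0 \<le> real_power_integral p u" "real_power_integral p u \<le> M" if "u \<in> midhull g m" for u m
    using mb[OF that] pi[OF that] M by (auto simp: real_power_integral_def)
  define d where "d m = (INF u\<in>midhull g m. real_power_integral p u)" for m
  have ne: "midhull g m \<noteq> {}" for m using midhull.member[of m m g] by blast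
  have bb: "bdd_below (real_power_integral p ` midhull g m)" for m by (rule bdd_belowI2[of _ 0]) (rule pM(1))
  have dle: "d m \<le> real_power_integral p u" if "u \<in> midhull g m" for u m unfolding d_def by (intro cINF_lower bb that)
  have dmono: "incseq d"
  proof (rule incseq_SucI)
    fix m show "d m \<le> d (Suc m)"
      unfolding d_def by (intro cINF_superset_mono ne bb) (auto intro: midhull_antimono)
  qed
  have dM: "d m \<le> M" for m using dle[OF midhull.member[of m m g]] pM(2)[OF midhull.member[of m m g]] by simp
  obtain D where D0: "d \<longlonglongrightarrow> D" "\<forall>m. d m \<le> D"
    by (rule incseq_convergent[OF dmono, of M]) (use dM in auto)
  note D = D0(1) D0(2)[rule_format]
  have "\<forall>m. \<exists>u. u \<in> midhull g m \<and> real_power_integral p u < d m + iv m"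
  proof
    fix m
    have "(INF u\<in>midhull g m. real_power_integral p u) < d m + iv m" using iv(2)[of m] by (simp add: d_def)
    then show "\<exists>u. u \<in> midhull g m \<and> real_power_integral p u < d m + iv m"
      unfolding cINF_less_iff[OF ne bb] by blast
  qed
  then obtain u where u: "\<And>m. u m \<in> midhull g m" "\<And>m. real_power_integral p (u m) < d m + iv m" by metis
  have "\<exists>m0. \<forall>m\<ge>m0. \<forall>l\<ge>m. power_integral p (\<lambda>x. u l x - u m x) \<le> ennreal e" if e: "e > 0" for e
  proof -
    define e1 where "e1 = e / (4 * (M + 1))"
    have e1: "e1 > 0" using e M by (simp add: e1_def)
    obtain C where C: "C \<ge> 0" "\<And>a b. norm (a - b) powr p \<le> e1 * (norm a powr p + norm b powr p) + C * convexity_gap p a b"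
      using convexity_gap_controls_distance[OF p e1] by blast
    define e2 where "e2 = e / (4 * (C + 1))"
    have e2: "e2 > 0" using e C by (simp add: e2_def)
    have "(\<lambda>m. (D - d m) + iv m) \<longlonglongrightarrow> (D - D) + 0"
      by (intro tendsto_intros D iv)
    then have "\<forall>\<^sub>F m in sequentially. (D - d m) + iv m < e2"
      using e2 by (intro order_tendstoD) auto
    then obtain m0 where m0: "\<And>m. m \<ge> m0 \<Longrightarrow> (D - d m) + iv m < e2"
      unfolding eventually_sequentially by blast
    have "power_integral p (\<lambda>x. u l x - u m x) \<le> ennreal e" if ml: "m \<ge> m0" "l \<ge> m" for m l
    proof -
      have ul: "u l \<in> midhull g m" using midhull_antimono[OF u(1) ml(2)] .
      define w where "w x = (u l x + u m x) / 2" for x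
      have w: "w \<in> midhull g m" unfolding w_def[abs_def] by (rule midhull.midpoint[OF ul u(1)])
      have [measurable]: "u l \<in> borel_measurable borel" "u m \<in> borel_measurable borel" using mb[OF u(1)] by auto
      note ii = pi(1)[OF u(1)[of l]] pi(1)[OF u(1)[of m]] pi(1)[OF w]
      have gi: "integrable lborel (\<lambda>x. convexity_gap p (u l x) (u m x))"
        unfolding convexity_gap_def w_def[symmetric] using ii by auto
      have "(\<integral>x. convexity_gap p (u l x) (u m x) \<partial>lborel) = real_power_integral p (u l) / 2 + real_power_integral p (u m) / 2 - real_power_integral p w"
        unfolding convexity_gap_def w_def[symmetric] real_power_integral_def using ii by simp
      also have "\<dots> \<le> (d l + iv l) / 2 + (d m + iv m) / 2 - d m"
          using u(2)[of l] u(2)[of m] dle[OF w]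
        by (intro diff_mono add_mono divide_right_mono) (auto intro: less_imp_le)
      also have "\<dots> \<le> (D - d m) + iv m"
      proof -
        have "iv l \<le> iv m" using ml by (intro iv)
        then have "(d l + iv l) / 2 \<le> (D + iv m) / 2" "(d m + iv m) / 2 \<le> (D + iv m) / 2"
          using D(2)[of l] D(2)[of m] by (simp_all add: add_mono divide_right_mono)
        then have "(d l + iv l) / 2 + (d m + iv m) / 2 \<le> (D + iv m) / 2 + (D + iv m) / 2" by (rule add_mono)
        also have "\<dots> = D + iv m" by (rule field_sum_of_halves)
        finally show ?thesis by simp
      qed
      also have "\<dots> < e2" using m0 ml by simp
      finally have gl: "(\<integral>x. convexity_gap p (u l x) (u m x) \<partial>lborel) \<le> e2" by simp
      define R where "R x = e1 * (norm (u l x) powr p + norm (u m x) powr p) + C * convexity_gap p (u l x) (u m x)" for x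
      have R0: "R x \<ge> 0" for x using e1 C convexity_gap_nonneg[OF p] unfolding R_def by (intro add_nonneg_nonneg mult_nonneg_nonneg) auto
      have Ri: "integrable lborel R" unfolding R_def[abs_def] using ii gi by auto
      have "power_integral p (\<lambda>x. u l x - u m x) \<le> (\<integral>\<^sup>+x. ennreal (R x) \<partial>lborel)"
        unfolding power_integral_def R_def by (intro nn_integral_mono ennreal_leI C)
      also have "\<dots> = ennreal (\<integral>x. R x \<partial>lborel)"
        using Ri R0 by (intro nn_integral_eq_integral) auto
      also have "(\<integral>x. R x \<partial>lborel) = e1 * (real_power_integral p (u l) + real_power_integral p (u m)) + C * (\<integral>x. convexity_gap p (u l x) (u m x) \<partial>lborel)"
        unfolding R_def real_power_integral_def using ii gi by simp
      also have "\<dots> \<le> e1 * (M + M) + C * e2"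
        using pM(2)[OF u(1)] e1 gl C by (intro add_mono mult_left_mono) auto
      also have "\<dots> \<le> e / 2 + e / 2"
      proof (rule add_mono)
        have "e1 * (M + M) = e / 2 * (M / (M + 1))" using M by (simp add: e1_def field_simps)
        also have "\<dots> \<le> e / 2 * 1" using M e by (intro mult_left_mono) auto
        finally show "e1 * (M + M) \<le> e / 2" by simp
        have "C * e2 = e / 4 * (C / (C + 1))" using C by (simp add: e2_def)
        also have "\<dots> \<le> e / 4 * 1" using C e by (intro mult_left_mono) auto
        finally show "C * e2 \<le> e / 2" using e by simp
      qed
      finally show ?thesis by (simp add: ennreal_leI)
    qed
    then show ?thesis by blast
  qed
  then show ?thesis using u(1) by blast
qed

text \<open>
  Along a fast subsequence the increments, weighted by \<open>2 powr (i * p)\<close>, have a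
  summable integral. So at almost every point they decrease geometrically and the subsequence
  converges. Fatou's lemma carries the bounds to the limit.
\<close>

lemma Lp_complete:
  fixes u :: "nat \<Rightarrow> 'a::euclidean_space \<Rightarrow> complex"
  assumes p: "1 < p" and u [measurable]: "\<And>m. u m \<in> borel_measurable borel"
    and c: "\<And>e. e > 0 \<Longrightarrow> \<exists>m0. \<forall>m\<ge>m0. \<forall>l\<ge>m. power_integral p (\<lambda>x. u l x - u m x) \<le> ennreal e"
    and M: "\<And>m. power_integral p (u m) \<le> ennreal M"
  shows "\<exists>v\<in>borel_measurable borel. power_integral p v \<le> ennreal M \<and>
    (\<forall>e>0. \<exists>m0. \<forall>m\<ge>m0. power_integral p (\<lambda>x. v x - u m x) \<le> ennreal e)"
proof -
  have "\<forall>i. \<exists>m0\<ge>i. \<forall>m\<ge>m0. \<forall>l\<ge>m. power_integral p (\<lambda>x. u l x - u m x) \<le> ennreal ((1/2) powr (real i * p) * (1/2) ^ i)"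
  proof
    fix i :: nat
    obtain m0 where m0: "\<forall>m\<ge>m0. \<forall>l\<ge>m. power_integral p (\<lambda>x. u l x - u m x) \<le> ennreal ((1/2) powr (real i * p) * (1/2) ^ i)"
      using c[of "(1/2) powr (real i * p) * (1/2) ^ i"] by auto
    then show "\<exists>m0\<ge>i. \<forall>m\<ge>m0. \<forall>l\<ge>m. power_integral p (\<lambda>x. u l x - u m x) \<le> ennreal ((1/2) powr (real i * p) * (1/2) ^ i)"
      by (intro exI[of _ "max m0 i"]) auto
  qed
  then obtain n where n: "\<And>i. i \<le> n i" "\<And>i m l. n i \<le> m \<Longrightarrow> m \<le> l \<Longrightarrow> power_integral p (\<lambda>x. u l x - u m x) \<le> ennreal ((1/2) powr (real i * p) * (1/2) ^ i)"
    by metis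
  define N where "N i = Max (n ` {..i})" for i
  have Nge: "n i \<le> N i" "i \<le> N i" for i
  proof -
    show "n i \<le> N i" unfolding N_def by (intro Max_ge) auto
    then show "i \<le> N i" using n(1)[of i] by simp
  qed
  have Nmono: "N i \<le> N (Suc i)" for i unfolding N_def by (intro Max_mono) auto
  define v where "v i = u (N i)" for i
  have [measurable]: "v i \<in> borel_measurable borel" for i unfolding v_def by simp
  define Q where "Q x = (\<Sum>i. ennreal (2 powr (real i * p) * norm (v (Suc i) x - v i x) powr p))" for x
  have "(\<integral>\<^sup>+x. Q x \<partial>lborel) = (\<Sum>i. \<integral>\<^sup>+x. ennreal (2 powr (real i * p) * norm (v (Suc i) x - v i x) powr p) \<partial>lborel)"
    unfolding Q_def by (intro nn_integral_suminf) measurable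
  also have "\<dots> \<le> (\<Sum>i. ennreal ((1/2) ^ i))"
  proof (intro suminf_le allI summableI)
    fix i
    have "(\<integral>\<^sup>+x. ennreal (2 powr (real i * p) * norm (v (Suc i) x - v i x) powr p) \<partial>lborel) = ennreal (2 powr (real i * p)) * power_integral p (\<lambda>x. v (Suc i) x - v i x)"
      unfolding power_integral_def by (simp add: ennreal_mult nn_integral_cmult)
    also have "\<dots> \<le> ennreal (2 powr (real i * p)) * ennreal ((1/2) powr (real i * p) * (1/2) ^ i)"
      unfolding v_def by (intro mult_left_mono n Nge Nmono) simp
    also have "\<dots> = ennreal ((1/2) ^ i)"
      by (simp add: powr_divide flip: ennreal_mult)
    finally show "(\<integral>\<^sup>+x. ennreal (2 powr (real i * p) * norm (v (Suc i) x - v i x) powr p) \<partial>lborel) \<le> ennreal ((1/2) ^ i)" .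
  qed
  also have "\<dots> = ennreal (\<Sum>i. (1/2) ^ i)" by (intro suminf_ennreal2 summable_geometric) auto
  also have "\<dots> < \<infinity>" by simp
  finally have "(\<integral>\<^sup>+x. Q x \<partial>lborel) \<noteq> \<infinity>" by simp
  then have "AE x in lborel. Q x \<noteq> \<infinity>"
    by (intro nn_integral_PInf_AE) (auto simp: Q_def)
  then have conv: "AE x in lborel. convergent (\<lambda>i. v i x)"
  proof eventually_elim
    case (elim x)
    then obtain q where q: "Q x = ennreal q" "q \<ge> 0" by (cases "Q x") auto
    have b: "norm (v (Suc i) x - v i x) \<le> q powr (1 / p) * (1/2) ^ i" for i
    proof -
      have "ennreal (2 powr (real i * p) * norm (v (Suc i) x - v i x) powr p) \<le> ennreal q"
      proof -
        have single: "T i \<le> suminf T" for T :: "nat \<Rightarrow> ennreal"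
        proof -
          have "sum T {i} \<le> suminf T" by (rule sum_le_suminf[OF summableI]) auto
          then show ?thesis by simp
        qed
        show ?thesis unfolding q(1)[symmetric] Q_def by (rule single)
      qed
      then have "2 powr (real i * p) * norm (v (Suc i) x - v i x) powr p \<le> q" using q by simp
      then have "(2 ^ i * norm (v (Suc i) x - v i x)) powr p \<le> (q powr (1 / p)) powr p"
        using q p by (simp add: powr_mult powr_powr powr_realpow[symmetric])
      then have "2 ^ i * norm (v (Suc i) x - v i x) \<le> q powr (1 / p)"
        using p by (smt (verit) powr_ge_zero powr_less_mono2)
      then show ?thesis by (simp add: power_divide field_simps)
    qed
    have "summable (\<lambda>i. v (Suc i) x - v i x)"
    proof (rule summable_comparison_test')
      show "summable (\<lambda>i. q powr (1 / p) * (1/2) ^ i)" by (intro summable_mult summable_geometric) auto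
      show "norm (v (Suc i) x - v i x) \<le> q powr (1 / p) * (1/2) ^ i" if "0 \<le> i" for i by (rule b)
    qed
    then have "convergent (\<lambda>i. v i x - v 0 x)"
      by (simp only: summable_iff_convergent sum_lessThan_telescope[of "\<lambda>i. v i x"])
    then have "convergent (\<lambda>i. (v i x - v 0 x) + v 0 x)" by (intro convergent_add convergent_const)
    then show ?case by simp
  qed
  define w where "w x = lim (\<lambda>i. v i x)" for x
  have wm [measurable]: "w \<in> borel_measurable borel"
    unfolding w_def[abs_def] by (rule borel_measurable_lim_metric) simp
  have lim: "AE x in lborel. (\<lambda>i. v i x) \<longlonglongrightarrow> w x"
    using conv by eventually_elim (simp add: w_def convergent_LIMSEQ_iff)
  have fatou: "power_integral p (\<lambda>x. w x - f x) \<le> ennreal e"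
    if [measurable]: "f \<in> borel_measurable borel" and le: "\<forall>\<^sub>F i in sequentially. power_integral p (\<lambda>x. v i x - f x) \<le> ennreal e" for f e
  proof -
    have "power_integral p (\<lambda>x. w x - f x) = (\<integral>\<^sup>+x. liminf (\<lambda>i. ennreal (norm (v i x - f x) powr p)) \<partial>lborel)"
      unfolding power_integral_def
    proof (rule nn_integral_cong_AE, use lim in eventually_elim)
      case (elim x)
      then have "(\<lambda>i. ennreal (norm (v i x - f x) powr p)) \<longlonglongrightarrow> ennreal (norm (w x - f x) powr p)"
        using p by (intro tendsto_ennrealI tendsto_powr' tendsto_norm tendsto_diff tendsto_const) auto
      then show ?case by (intro lim_imp_Liminf[symmetric]) auto
    qed
    also have "\<dots> \<le> liminf (\<lambda>i. power_integral p (\<lambda>x. v i x - f x))"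
      unfolding power_integral_def by (rule nn_integral_liminf) measurable
    also have "\<dots> \<le> ennreal e"
      using le by (intro Liminf_le) auto
    finally show ?thesis .
  qed
  show ?thesis
  proof (intro bexI conjI allI impI)
    show "power_integral p w \<le> ennreal M"
      using fatou[of "\<lambda>_. 0" M] M by (simp add: v_def)
    fix e :: real assume "e > 0"
    then obtain m0 where m0: "\<And>m l. m0 \<le> m \<Longrightarrow> m \<le> l \<Longrightarrow> power_integral p (\<lambda>x. u l x - u m x) \<le> ennreal e" using c by blast
    show "\<exists>m0. \<forall>m\<ge>m0. power_integral p (\<lambda>x. w x - u m x) \<le> ennreal e"
    proof (intro exI allI impI)
      fix m assume m: "m0 \<le> m"
      show "power_integral p (\<lambda>x. w x - u m x) \<le> ennreal e"
      proof (rule fatou)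
        show "\<forall>\<^sub>F i in sequentially. power_integral p (\<lambda>x. v i x - u m x) \<le> ennreal e"
          unfolding eventually_sequentially v_def
          by (intro exI[of _ m] allI impI m0 m) (use Nge(2) order_trans in blast)
      qed simp
    qed
  qed (rule wm)
qed

text \<open>
  The pairing with \<open>\<phi>\<close> maps the midpoint hull of a late tail into a small disc
  around \<open>T \<phi>\<close>. Hence the pairings with the Cauchy sequence drawn from these
  hulls have the limit \<open>T \<phi>\<close> as well, and this sequence converges in norm.
\<close>

theorem Lp_weak_limit:
  fixes g :: "nat \<Rightarrow> 'a::euclidean_space \<Rightarrow> complex"
  assumes p: "1 < p" and g: "\<And>k. g k \<in> borel_measurable borel" "\<And>k. power_integral p (g k) \<le> ennreal M" and M: "0 \<le> M"
    and S: "\<And>\<phi>. \<phi> \<in> S \<Longrightarrow> integrable lborel \<phi>" "\<And>\<phi>. \<phi> \<in> S \<Longrightarrow> \<exists>B. \<forall>x. norm (\<phi> x) \<le> B"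
    and T: "\<And>\<phi>. \<phi> \<in> S \<Longrightarrow> (\<lambda>k. \<integral>x. g k x * \<phi> x \<partial>lborel) \<longlonglongrightarrow> T \<phi>"
  shows "\<exists>v\<in>borel_measurable borel. power_integral p v \<le> ennreal M \<and> (\<forall>\<phi>\<in>S. T \<phi> = (\<integral>x. v x * \<phi> x \<partial>lborel))"
proof -
  obtain u where u: "\<And>m. u m \<in> midhull g m" "\<And>e. e > 0 \<Longrightarrow> \<exists>m0. \<forall>m\<ge>m0. \<forall>l\<ge>m. power_integral p (\<lambda>x. u l x - u m x) \<le> ennreal e"
    using midhull_cauchy_sequence[where g=g, OF p g M] by blast
  have ub: "u m \<in> borel_measurable borel" "power_integral p (u m) \<le> ennreal M" for m
    using midhull_bounded[where g=g, OF p g M u(1)] by auto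
  obtain v where v: "v \<in> borel_measurable borel" "power_integral p v \<le> ennreal M"
     "\<And>e. e > 0 \<Longrightarrow> \<exists>m0. \<forall>m\<ge>m0. power_integral p (\<lambda>x. v x - u m x) \<le> ennreal e"
    using Lp_complete[where u=u, OF p ub(1) u(2) ub(2)] by blast
  note [measurable] = v(1) ub(1)
  have "T \<phi> = (\<integral>x. v x * \<phi> x \<partial>lborel)" if \<phi>: "\<phi> \<in> S" for \<phi>
  proof (rule LIMSEQ_unique)
    obtain B where B: "\<And>x. norm (\<phi> x) \<le> B" using S(2)[OF \<phi>] by blast
    have inLp: "f \<in> Lp p" if "f \<in> borel_measurable borel" "power_integral p f \<le> ennreal e" for f :: "'a \<Rightarrow> complex" and e
      using that unfolding Lp_iff by (auto elim!: le_less_trans)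
    have int: "integrable lborel (\<lambda>x. f x * \<phi> x)" if "f \<in> Lp p" for f
      by (rule integrable_pairing[OF p S(1)[OF \<phi>] B that])
    have gi: "integrable lborel (\<lambda>x. g k x * \<phi> x)" for k by (rule int[OF inLp[OF g(1) g(2)]])
    show "(\<lambda>m. \<integral>x. u m x * \<phi> x \<partial>lborel) \<longlonglongrightarrow> T \<phi>"
    proof (rule LIMSEQ_I)
      fix e :: real assume e: "e > 0"
      obtain m0 where m0: "\<And>k. k \<ge> m0 \<Longrightarrow> norm ((\<integral>x. g k x * \<phi> x \<partial>lborel) - T \<phi>) < e / 2"
        using LIMSEQ_D[OF T[OF \<phi>], of "e / 2"] e by auto
      have "norm ((\<integral>x. u m x * \<phi> x \<partial>lborel) - T \<phi>) < e" if "m \<ge> m0" for m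
      proof -
        have "norm ((\<integral>x. u m x * \<phi> x \<partial>lborel) - T \<phi>) \<le> e / 2"
          using midhull_functional[OF gi _ u(1)[of m], of "T \<phi>" "e / 2"] m0 that
          by (meson less_imp_le order_trans)
        then show ?thesis using e by simp
      qed
      then show "\<exists>m0. \<forall>m\<ge>m0. norm ((\<integral>x. u m x * \<phi> x \<partial>lborel) - T \<phi>) < e" by blast
    qed
    obtain K where K: "K \<ge> 0" "\<And>f y. f \<in> Lp p \<Longrightarrow> (\<integral>\<^sup>+x. ennreal (norm (f (x + y)) * norm (\<phi> x)) \<partial>lborel) \<le> ennreal K * Lp_norm p f"
      using pairing_bound[OF p S(1)[OF \<phi>] B] by blast
    show "(\<lambda>m. \<integral>x. u m x * \<phi> x \<partial>lborel) \<longlonglongrightarrow> (\<integral>x. v x * \<phi> x \<partial>lborel)"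
    proof (rule LIMSEQ_I)
      fix e :: real assume e: "e > 0"
      define e1 where "e1 = e / (2 * (K + 1))"
      have e1: "e1 > 0" using e K by (simp add: e1_def)
      obtain m0 where m0: "\<And>m. m \<ge> m0 \<Longrightarrow> power_integral p (\<lambda>x. v x - u m x) \<le> ennreal (e1 powr p)"
        using v(3)[of "e1 powr p"] e1 by auto
      have "norm ((\<integral>x. u m x * \<phi> x \<partial>lborel) - (\<integral>x. v x * \<phi> x \<partial>lborel)) < e" if "m \<ge> m0" for m
      proof -
        have dL: "(\<lambda>x. v x - u m x) \<in> Lp p" by (rule inLp[OF _ m0[OF that]]) measurable
        have "Lp_norm p (\<lambda>x. v x - u m x) \<le> ennreal e1"
          using p e1 by (intro Lp_norm_leI m0 that) auto
        have "ennreal (norm (\<integral>x. (v x - u m x) * \<phi> x \<partial>lborel)) \<le> (\<integral>\<^sup>+x. ennreal (norm ((v x - u m x) * \<phi> x)) \<partial>lborel)"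
          by (rule integral_norm_bound_ennreal[OF int[OF dL]])
        also have "\<dots> \<le> ennreal K * Lp_norm p (\<lambda>x. v x - u m x)"
          using K(2)[OF dL, of 0] by (simp add: norm_mult)
        also have "\<dots> \<le> ennreal K * ennreal e1"
          by (intro mult_left_mono \<open>Lp_norm p _ \<le> _\<close>) simp
        also have "\<dots> = ennreal (K * e1)" using K(1) e1 by (simp add: ennreal_mult)
        finally have "norm (\<integral>x. (v x - u m x) * \<phi> x \<partial>lborel) \<le> K * e1" using K(1) e1 by simp
        also have "K * e1 = e / 2 * (K / (K + 1))" using K(1) by (simp add: e1_def)
        also have "\<dots> \<le> e / 2 * 1" using K(1) e by (intro mult_left_mono) auto
        also have "\<dots> < e" using e by simp
        finally have "norm (\<integral>x. (v x - u m x) * \<phi> x \<partial>lborel) < e" .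
        moreover have "(\<integral>x. (v x - u m x) * \<phi> x \<partial>lborel) = (\<integral>x. v x * \<phi> x \<partial>lborel) - (\<integral>x. u m x * \<phi> x \<partial>lborel)"
          unfolding left_diff_distrib by (intro Bochner_Integration.integral_diff int inLp[OF v(1,2)] inLp[OF ub])
        ultimately show ?thesis by (simp add: norm_minus_commute)
      qed
      then show "\<exists>m0. \<forall>m\<ge>m0. norm ((\<integral>x. u m x * \<phi> x \<partial>lborel) - (\<integral>x. v x * \<phi> x \<partial>lborel)) < e" by blast
    qed
  qed
  then show ?thesis using v(1,2) by blast
qed

section \<open>Bessel potentials\<close>

definition gamma_density :: "real \<Rightarrow> real \<Rightarrow> real" where
  "gamma_density \<kappa> \<tau> = indicator {0..} \<tau> * \<tau> powr (\<kappa> - 1) / exp \<tau> / Gamma \<kappa>"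

lemma gamma_density_nonneg: "\<kappa> > 0 \<Longrightarrow> gamma_density \<kappa> \<tau> \<ge> 0"
  by (simp add: gamma_density_def Gamma_real_pos less_imp_le)

lemma gamma_density_measurable [measurable]: "gamma_density \<kappa> \<in> borel_measurable borel"
  unfolding gamma_density_def[abs_def] by measurable

lemma gamma_density_laplace_nn:
  assumes k: "\<kappa> > 0" and l: "0 \<le> \<mu>"
  shows "(\<integral>\<^sup>+\<tau>. ennreal (gamma_density \<kappa> \<tau> * exp (- (\<tau> * \<mu>))) \<partial>lborel) = ennreal ((1 + \<mu>) powr (- \<kappa>))"
proof -
  define c where "c = 1 + \<mu>"
  have c: "c > 0" using l by (simp add: c_def)
  have G: "Gamma \<kappa> > 0" using k by (rule Gamma_real_pos)
  have "ennreal (Gamma \<kappa>) = (\<integral>\<^sup>+\<tau>. ennreal (indicator {0..} \<tau> * \<tau> powr (\<kappa> - 1) / exp \<tau>) \<partial>lborel)"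
    by (rule Gamma_conv_nn_integral_real[OF k])
  also have "\<dots> = ennreal \<bar>c\<bar> * (\<integral>\<^sup>+\<tau>. ennreal (indicator {0..} (0 + c * \<tau>) * (0 + c * \<tau>) powr (\<kappa> - 1) / exp (0 + c * \<tau>)) \<partial>lborel)"
    using c by (intro nn_integral_real_affine) auto
  also have "\<dots> = (\<integral>\<^sup>+\<tau>. ennreal \<bar>c\<bar> * ennreal (indicator {0..} (0 + c * \<tau>) * (0 + c * \<tau>) powr (\<kappa> - 1) / exp (0 + c * \<tau>)) \<partial>lborel)"
    by (rule nn_integral_cmult[symmetric]) measurable
  also have "\<dots> = (\<integral>\<^sup>+\<tau>. ennreal (Gamma \<kappa> * c powr \<kappa>) * ennreal (gamma_density \<kappa> \<tau> * exp (- (\<tau> * \<mu>))) \<partial>lborel)"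
  proof (rule nn_integral_cong)
    fix \<tau> :: real
    have "c * (indicator {0..} (c * \<tau>) * (c * \<tau>) powr (\<kappa> - 1) / exp (c * \<tau>)) = Gamma \<kappa> * c powr \<kappa> * (gamma_density \<kappa> \<tau> * exp (- (\<tau> * \<mu>)))"
    proof (cases "\<tau> \<ge> 0")
      case True
      have "c * (c * \<tau>) powr (\<kappa> - 1) = c powr 1 * c powr (\<kappa> - 1) * \<tau> powr (\<kappa> - 1)"
        using c by (simp add: powr_mult)
      also have "c powr 1 * c powr (\<kappa> - 1) = c powr \<kappa>" unfolding powr_add[symmetric] by simp
      finally have e1: "c * (c * \<tau>) powr (\<kappa> - 1) = c powr \<kappa> * \<tau> powr (\<kappa> - 1)" .
      have e2: "exp (c * \<tau>) = exp \<tau> * exp (\<tau> * \<mu>)" by (simp add: c_def exp_add[symmetric] algebra_simps)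
      have "c * (indicator {0..} (c * \<tau>) * (c * \<tau>) powr (\<kappa> - 1) / exp (c * \<tau>)) = c * (c * \<tau>) powr (\<kappa> - 1) / exp (c * \<tau>)"
        using True c by simp
      also have "\<dots> = Gamma \<kappa> * c powr \<kappa> * (gamma_density \<kappa> \<tau> * exp (- (\<tau> * \<mu>)))"
        unfolding e1 e2 gamma_density_def using True G by (simp add: exp_minus field_simps)
      finally show ?thesis .
    next
      case False
      then have "c * \<tau> < 0" using c by (simp add: mult_pos_neg)
      then show ?thesis using False by (simp add: gamma_density_def)
    qed
    then show "ennreal \<bar>c\<bar> * ennreal (indicator {0..} (0 + c * \<tau>) * (0 + c * \<tau>) powr (\<kappa> - 1) / exp (0 + c * \<tau>)) = ennreal (Gamma \<kappa> * c powr \<kappa>) * ennreal (gamma_density \<kappa> \<tau> * exp (- (\<tau> * \<mu>)))"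
      using c G gamma_density_nonneg[OF k, of \<tau>] by (simp flip: ennreal_mult)
  qed
  also have "\<dots> = ennreal (Gamma \<kappa> * c powr \<kappa>) * (\<integral>\<^sup>+\<tau>. ennreal (gamma_density \<kappa> \<tau> * exp (- (\<tau> * \<mu>))) \<partial>lborel)"
    by (rule nn_integral_cmult) measurable
  finally have e: "ennreal (Gamma \<kappa>) = ennreal (Gamma \<kappa> * c powr \<kappa>) * (\<integral>\<^sup>+\<tau>. ennreal (gamma_density \<kappa> \<tau> * exp (- (\<tau> * \<mu>))) \<partial>lborel)" .
  have "ennreal ((1 + \<mu>) powr (- \<kappa>)) = ennreal (inverse (Gamma \<kappa> * c powr \<kappa>)) * ennreal (Gamma \<kappa>)"
    using G c by (simp add: powr_minus c_def[symmetric] field_simps flip: ennreal_mult)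
  also have "\<dots> = (ennreal (inverse (Gamma \<kappa> * c powr \<kappa>)) * ennreal (Gamma \<kappa> * c powr \<kappa>)) * (\<integral>\<^sup>+\<tau>. ennreal (gamma_density \<kappa> \<tau> * exp (- (\<tau> * \<mu>))) \<partial>lborel)"
    by (subst e) (simp only: mult.assoc)
  also have "ennreal (inverse (Gamma \<kappa> * c powr \<kappa>)) * ennreal (Gamma \<kappa> * c powr \<kappa>) = 1"
    proof -
    define A where "A = Gamma \<kappa> * c powr \<kappa>"
    have A: "A > 0" using G c by (simp add: A_def)
    show ?thesis unfolding A_def[symmetric] using A by (simp flip: ennreal_mult)
  qed
  finally show ?thesis by simp
qed

lemma gamma_density_laplace:
  assumes k: "\<kappa> > 0" and l: "0 \<le> \<mu>"
  shows "integrable lborel (\<lambda>\<tau>. gamma_density \<kappa> \<tau> * exp (- (\<tau> * \<mu>)))"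
    "(\<integral>\<tau>. gamma_density \<kappa> \<tau> * exp (- (\<tau> * \<mu>)) \<partial>lborel) = (1 + \<mu>) powr (- \<kappa>)"
  using gamma_density_laplace_nn[OF assms] gamma_density_nonneg[OF k]
  by (auto intro!: integrableI_nonneg integral_eq_nn_integral[THEN trans])

lemma gamma_density_nn: "\<kappa> > 0 \<Longrightarrow> (\<integral>\<^sup>+\<tau>. ennreal (gamma_density \<kappa> \<tau>) \<partial>lborel) = 1"
  using gamma_density_laplace_nn[of \<kappa> 0] by simp

lemma gamma_density_moment:
  assumes k: "\<kappa> > 0" and a: "a \<ge> 0"
  shows "(\<integral>\<^sup>+\<tau>. ennreal (gamma_density \<kappa> \<tau> * \<tau> powr a) \<partial>lborel) < \<infinity>"
proof -
  have G: "Gamma \<kappa> > 0" "Gamma (\<kappa> + a) > 0" using k a by (auto intro: Gamma_real_pos)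
  have "(\<integral>\<^sup>+\<tau>. ennreal (gamma_density \<kappa> \<tau> * \<tau> powr a) \<partial>lborel) = (\<integral>\<^sup>+\<tau>. ennreal (Gamma (\<kappa> + a) / Gamma \<kappa>) * ennreal (gamma_density (\<kappa> + a) \<tau>) \<partial>lborel)"
  proof (rule nn_integral_cong)
    fix \<tau> :: real
    have "\<tau> powr (\<kappa> - 1) * \<tau> powr a = \<tau> powr (\<kappa> + a - 1)"
      unfolding powr_add[symmetric] by (rule arg_cong2[where f="(powr)"]) simp_all
    then have "gamma_density \<kappa> \<tau> * \<tau> powr a = Gamma (\<kappa> + a) / Gamma \<kappa> * gamma_density (\<kappa> + a) \<tau>"
      using G unfolding gamma_density_def by (simp add: mult_ac)
    then show "ennreal (gamma_density \<kappa> \<tau> * \<tau> powr a) = ennreal (Gamma (\<kappa> + a) / Gamma \<kappa>) * ennreal (gamma_density (\<kappa> + a) \<tau>)"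
      using G gamma_density_nonneg[of "\<kappa> + a" \<tau>] k a by (simp flip: ennreal_mult)
  qed
  also have "\<dots> = ennreal (Gamma (\<kappa> + a) / Gamma \<kappa>)"
    using gamma_density_nn[of "\<kappa> + a"] k a by (simp add: nn_integral_cmult)
  finally show ?thesis by simp
qed

text \<open>
  A Gaussian vector scaled by a random time: \<open>\<tau>\<close> has the Gamma distribution
  with parameter \<open>\<kappa>\<close>, and given \<open>\<tau>\<close> the shift is normal
  with covariance \<open>2 * \<tau> / \<epsilon>\<close> times the identity. Its law is the
  Bessel kernel, whose symbol \<open>(1 + |\<xi>|\<^sup>2 / \<epsilon>) powr (-
  \<kappa>)\<close> is that of a probability measure for every \<open>\<kappa> > 0\<close>.
\<close>

definition bessel_weight :: "real \<Rightarrow> real \<times> 'a::euclidean_space \<Rightarrow> real" where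
  "bessel_weight \<kappa> \<omega> = gamma_density \<kappa> (fst \<omega>) * gauss (snd \<omega>)"

definition bessel_shift :: "real \<Rightarrow> real \<times> 'a::euclidean_space \<Rightarrow> 'a" where
  "bessel_shift \<epsilon> \<omega> = sqrt (2 * fst \<omega> / \<epsilon>) *\<^sub>R snd \<omega>"

abbreviation bessel_space :: "(real \<times> 'a::euclidean_space) measure" where
  "bessel_space \<equiv> lborel \<Otimes>\<^sub>M lborel"

lemma bessel_measurable [measurable]:
  "bessel_weight \<kappa> \<in> borel_measurable bessel_space" "bessel_shift \<epsilon> \<in> borel_measurable bessel_space"
  unfolding bessel_weight_def[abs_def] bessel_shift_def[abs_def] by measurable

lemma bessel_weight_nonneg: "\<kappa> > 0 \<Longrightarrow> bessel_weight \<kappa> \<omega> \<ge> 0"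
  by (simp add: bessel_weight_def gamma_density_nonneg)

lemma gauss_nn: "(\<integral>\<^sup>+z. ennreal (gauss (z::'a::euclidean_space)) \<partial>lborel) = 1"
  using gauss_integrable[where 'a='a] gauss_integral[where 'a='a] by (subst nn_integral_eq_integral) auto

lemma bessel_mass_nn:
  assumes "\<kappa> > 0"
  shows "(\<integral>\<^sup>+\<omega>. ennreal (bessel_weight \<kappa> \<omega>) \<partial>(bessel_space :: (real \<times> 'a::euclidean_space) measure)) = 1"
proof -
  have "(\<integral>\<^sup>+\<omega>. ennreal (bessel_weight \<kappa> \<omega>) \<partial>(bessel_space :: (real \<times> 'a) measure)) = (\<integral>\<^sup>+\<tau>. (\<integral>\<^sup>+z. ennreal (gamma_density \<kappa> \<tau> * gauss (z::'a)) \<partial>lborel) \<partial>lborel)"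
    by (subst lborel.nn_integral_fst[symmetric]) (auto simp: bessel_weight_def)
  also have "\<dots> = 1"
    using gamma_density_nonneg[OF assms] by (simp add: ennreal_mult nn_integral_cmult gauss_nn gamma_density_nn assms)
  finally show ?thesis .
qed

lemma bessel_integrable:
  assumes "\<kappa> > 0"
  shows "integrable (bessel_space :: (real \<times> 'a::euclidean_space) measure) (bessel_weight \<kappa>)"
  using bessel_mass_nn[OF assms, where 'a='a]
  by (intro integrableI_nonneg AE_I2[OF bessel_weight_nonneg[OF assms]]) auto

lemma bessel_sigma_finite: "sigma_finite_measure (bessel_space :: (real \<times> 'a::euclidean_space) measure)"
  unfolding lborel_prod by (rule lborel.sigma_finite_measure_axioms)

lemma bessel_mixture:
  assumes "\<kappa> > 0"
  shows "translation_mixture bessel_space (\<lambda>\<omega>. complex_of_real (bessel_weight \<kappa> \<omega>)) (bessel_shift \<epsilon> :: _ \<Rightarrow> 'a::euclidean_space)"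
using bessel_sigma_finite bessel_integrable[OF assms, where 'a='a]
  by (intro translation_mixture.intro translation_mixture_axioms.intro) auto

lemma bessel_mass:
  assumes "\<kappa> > 0"
  shows "(\<integral>\<omega>. norm (complex_of_real (bessel_weight \<kappa> \<omega>)) \<partial>(bessel_space :: (real \<times> 'a::euclidean_space) measure)) = 1"
  using bessel_mass_nn[OF assms, where 'a='a] bessel_weight_nonneg[OF assms, where 'a='a]
  by (intro integral_eq_nn_integral[THEN trans]) auto

text \<open>
  Given \<open>\<tau>\<close>, the Gaussian has the transform \<open>exp (- \<tau> *
  |\<xi>|\<^sup>2 / \<epsilon>)\<close>; averaging over \<open>\<tau>\<close> is the Laplace
  transform of the Gamma density.
\<close>

lemma bessel_symbol:
  fixes \<xi> :: "'a::euclidean_space"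
  assumes k: "\<kappa> > 0" and e: "\<epsilon> > 0"
  shows "wtrans_symbol bessel_space (\<lambda>\<omega>. complex_of_real (bessel_weight \<kappa> \<omega>)) (bessel_shift \<epsilon>) \<xi> =
     of_real ((1 + (norm \<xi>)\<^sup>2 / \<epsilon>) powr (- \<kappa>))"
proof -
  define F where "F \<omega> = complex_of_real (bessel_weight \<kappa> \<omega>) * cis (bessel_shift \<epsilon> \<omega> \<bullet> \<xi>)" for \<omega> :: "real \<times> 'a"
  have Fi: "integrable bessel_space F"
  proof (rule Bochner_Integration.integrable_bound[OF bessel_integrable[OF k, where 'a='a]])
    show "F \<in> borel_measurable bessel_space" unfolding F_def[abs_def] cis_conv_exp by measurable
  qed (simp add: F_def norm_mult)
  have "wtrans_symbol bessel_space (\<lambda>\<omega>. complex_of_real (bessel_weight \<kappa> \<omega>)) (bessel_shift \<epsilon>) \<xi> = (\<integral>\<omega>. F \<omega> \<partial>bessel_space)"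
    by (simp add: wtrans_symbol_def F_def)
  also have "\<dots> = (\<integral>\<tau>. (\<integral>z. F (\<tau>, z) \<partial>lborel) \<partial>lborel)"
    by (rule lborel_pair.integral_fst'[OF Fi, symmetric])
  also have "\<dots> = (\<integral>\<tau>. complex_of_real (gamma_density \<kappa> \<tau> * exp (- (\<tau> * ((norm \<xi>)\<^sup>2 / \<epsilon>)))) \<partial>lborel)"
  proof (rule Bochner_Integration.integral_cong[OF refl])
    fix \<tau> :: real
    show "(\<integral>z. F (\<tau>, z) \<partial>lborel) = complex_of_real (gamma_density \<kappa> \<tau> * exp (- (\<tau> * ((norm \<xi>)\<^sup>2 / \<epsilon>))))"
    proof (cases "\<tau> \<ge> 0")
      case True
      have "(\<integral>z. F (\<tau>, z) \<partial>lborel) = (\<integral>z. of_real (gamma_density \<kappa> \<tau>) * (gauss z * cis (z \<bullet> (sqrt (2 * \<tau> / \<epsilon>) *\<^sub>R \<xi>))) \<partial>lborel)"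
        unfolding F_def bessel_weight_def bessel_shift_def by (simp add: mult.assoc)
      also have "\<dots> = of_real (gamma_density \<kappa> \<tau>) * of_real (exp (- (norm (sqrt (2 * \<tau> / \<epsilon>) *\<^sub>R \<xi>))\<^sup>2 / 2))"
        by (simp only: integral_mult_right_zero gauss_fourier)
      also have "(norm (sqrt (2 * \<tau> / \<epsilon>) *\<^sub>R \<xi>))\<^sup>2 = 2 * \<tau> / \<epsilon> * (norm \<xi>)\<^sup>2"
        using True e by (simp add: power_mult_distrib)
      finally show ?thesis by simp
    next
      case False
      then show ?thesis by (simp add: F_def bessel_weight_def gamma_density_def)
    qed
  qed
  also have "\<dots> = of_real ((1 + (norm \<xi>)\<^sup>2 / \<epsilon>) powr (- \<kappa>))"
    using gamma_density_laplace(2)[OF k, of "(norm \<xi>)\<^sup>2 / \<epsilon>"] e by (subst integral_complex_of_real) simp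
  finally show ?thesis .
qed

lemma bessel_moments:
  assumes k: "\<kappa> > 0" and e: "\<epsilon> > 0"
  shows "integrable bessel_space (\<lambda>\<omega>. norm (bessel_shift \<epsilon> \<omega> :: 'a::euclidean_space) ^ m * norm (complex_of_real (bessel_weight \<kappa> \<omega>)))"
proof (rule integrableI_bounded)
  have "(\<integral>\<^sup>+\<omega>. ennreal (norm (norm (bessel_shift \<epsilon> \<omega> :: 'a) ^ m * norm (complex_of_real (bessel_weight \<kappa> \<omega>)))) \<partial>bessel_space)
    = (\<integral>\<^sup>+\<omega>. ennreal ((2 / \<epsilon>) powr (real m / 2)) * (ennreal (gamma_density \<kappa> (fst \<omega>) * fst \<omega> powr (real m / 2)) * ennreal (norm (snd \<omega> :: 'a) ^ m * gauss (snd \<omega>))) \<partial>bessel_space)"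
  proof (rule nn_integral_cong)
    fix \<omega> :: "real \<times> 'a"
    obtain \<tau> z where w: "\<omega> = (\<tau>, z)" by fastforce
    have "norm (norm (bessel_shift \<epsilon> \<omega> :: 'a) ^ m * norm (complex_of_real (bessel_weight \<kappa> \<omega>))) =
       (2 / \<epsilon>) powr (real m / 2) * ((gamma_density \<kappa> \<tau> * \<tau> powr (real m / 2)) * (norm z ^ m * gauss z))"
    proof (cases "\<tau> > 0")
      case True
      have "sqrt (2 * \<tau> / \<epsilon>) ^ m = (2 * \<tau> / \<epsilon>) powr (real m / 2)"
        using True e by (simp add: powr_half_sqrt[symmetric] powr_powr powr_realpow[symmetric])
      also have "\<dots> = (2 / \<epsilon> * \<tau>) powr (real m / 2)" by simp
      also have "\<dots> = (2 / \<epsilon>) powr (real m / 2) * \<tau> powr (real m / 2)" by (rule powr_mult)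
      finally have s: "sqrt (2 * \<tau> / \<epsilon>) ^ m = (2 / \<epsilon>) powr (real m / 2) * \<tau> powr (real m / 2)" .
      have "sqrt (2 * \<tau> / \<epsilon>) \<ge> 0" using True e by simp
      then have "norm (norm (bessel_shift \<epsilon> \<omega> :: 'a) ^ m * norm (complex_of_real (bessel_weight \<kappa> \<omega>))) = sqrt (2 * \<tau> / \<epsilon>) ^ m * norm z ^ m * (gamma_density \<kappa> \<tau> * gauss z)"
        using gamma_density_nonneg[OF k] by (simp add: w bessel_shift_def bessel_weight_def power_mult_distrib abs_mult norm_mult)
      then show ?thesis unfolding s by (simp only: mult_ac)
    next
      case False
      have "gamma_density \<kappa> \<tau> = 0 \<or> \<tau> = 0" using False by (auto simp: gamma_density_def)
      moreover have "gamma_density \<kappa> 0 = 0" by (simp add: gamma_density_def)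
      ultimately have "gamma_density \<kappa> \<tau> = 0" by auto
      then show ?thesis by (simp add: w bessel_weight_def)
    qed
    then show "ennreal (norm (norm (bessel_shift \<epsilon> \<omega> :: 'a) ^ m * norm (complex_of_real (bessel_weight \<kappa> \<omega>)))) =
       ennreal ((2 / \<epsilon>) powr (real m / 2)) * (ennreal (gamma_density \<kappa> (fst \<omega>) * fst \<omega> powr (real m / 2)) * ennreal (norm (snd \<omega> :: 'a) ^ m * gauss (snd \<omega>)))"
      using gamma_density_nonneg[OF k] by (simp add: w flip: ennreal_mult)
  qed
  also have "\<dots> = ennreal ((2 / \<epsilon>) powr (real m / 2)) * (\<integral>\<^sup>+\<omega>. ennreal (gamma_density \<kappa> (fst \<omega>) * fst \<omega> powr (real m / 2)) * ennreal (norm (snd \<omega> :: 'a) ^ m * gauss (snd \<omega>)) \<partial>bessel_space)"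
    by (rule nn_integral_cmult) measurable
  also have "(\<integral>\<^sup>+\<omega>. ennreal (gamma_density \<kappa> (fst \<omega>) * fst \<omega> powr (real m / 2)) * ennreal (norm (snd \<omega> :: 'a) ^ m * gauss (snd \<omega>)) \<partial>bessel_space)
     = (\<integral>\<^sup>+\<tau>. ennreal (gamma_density \<kappa> \<tau> * \<tau> powr (real m / 2)) \<partial>lborel) * (\<integral>\<^sup>+z. ennreal (norm (z::'a) ^ m * gauss z) \<partial>lborel)"
    by (subst lborel.nn_integral_fst[symmetric]) (auto simp: nn_integral_cmult nn_integral_multc)
  also have "(\<integral>\<^sup>+z. ennreal (norm (z::'a) ^ m * gauss z) \<partial>lborel) = ennreal (\<integral>z. norm (z::'a) ^ m * gauss z \<partial>lborel)"
    by (intro nn_integral_eq_integral gauss_moments) auto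
  also have "ennreal ((2 / \<epsilon>) powr (real m / 2)) * ((\<integral>\<^sup>+\<tau>. ennreal (gamma_density \<kappa> \<tau> * \<tau> powr (real m / 2)) \<partial>lborel) * ennreal (\<integral>z. norm (z::'a) ^ m * gauss z \<partial>lborel)) < \<infinity>"
    using gamma_density_moment[OF k, of "real m / 2"] by (auto simp: ennreal_mult_less_top)
  finally show "(\<integral>\<^sup>+\<omega>. ennreal (norm (norm (bessel_shift \<epsilon> \<omega> :: 'a) ^ m * norm (complex_of_real (bessel_weight \<kappa> \<omega>)))) \<partial>bessel_space) < \<infinity>" .
qed measurable

section \<open>Lowering the order of differentiation\<close>

text \<open>
  The coefficients of \<open>(1 - u) powr \<alpha> - (1 - u) powr \<beta>\<close>, from the
  power \<open>u ^ 1\<close> on; those of \<open>u ^ 0\<close> cancel.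
\<close>

definition bcoef_diff :: "real \<Rightarrow> real \<Rightarrow> nat \<Rightarrow> real" where
  "bcoef_diff \<alpha> \<beta> i = bcoef \<alpha> (Suc i) - bcoef \<beta> (Suc i)"

lemma bcoef_diff_summable:
  assumes "0 < \<alpha>" "\<alpha> \<le> 1" "0 < \<beta>" "\<beta> \<le> 1"
  shows "summable (\<lambda>i. \<bar>bcoef_diff \<alpha> \<beta> i\<bar>)" "(\<Sum>i. \<bar>bcoef_diff \<alpha> \<beta> i\<bar>) \<le> 2"
proof -
  have s: "(\<lambda>i. \<bar>bcoef \<alpha> (Suc i)\<bar> + \<bar>bcoef \<beta> (Suc i)\<bar>) sums (1 + 1)"
    by (intro sums_add bcoef_abs_sum assms)
  have le: "\<bar>bcoef_diff \<alpha> \<beta> i\<bar> \<le> \<bar>bcoef \<alpha> (Suc i)\<bar> + \<bar>bcoef \<beta> (Suc i)\<bar>" for i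
    unfolding bcoef_diff_def by simp
  show sm: "summable (\<lambda>i. \<bar>bcoef_diff \<alpha> \<beta> i\<bar>)"
    by (rule summable_comparison_test'[OF sums_summable[OF s]]) (use le in auto)
  show "(\<Sum>i. \<bar>bcoef_diff \<alpha> \<beta> i\<bar>) \<le> 2"
    using suminf_le[OF le sm sums_summable[OF s]] sums_unique[OF s] by simp
qed

lemma bcoef_tail_sums:
  assumes a: "0 < \<alpha>" "\<alpha> \<le> 1" and u: "0 < u" "u \<le> 1"
  shows "(\<lambda>i. bcoef \<alpha> (Suc i) * u ^ Suc i) sums ((1 - u) powr \<alpha> - 1)"
proof (cases "u = 1")
  case True
  have "(\<lambda>i. bcoef \<alpha> (Suc i)) sums (0 - bcoef \<alpha> 0)"
    using bcoef_sums_0[OF a] by (subst sums_Suc_iff) simp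
  then show ?thesis using True a by simp
next
  case False
  then have "(\<lambda>i. (\<alpha> gchoose i) * (- u) ^ i) sums (1 + - u) powr \<alpha>"
    using u by (intro gen_binomial_real) auto
  moreover have "(\<alpha> gchoose i) * (- u) ^ i = bcoef \<alpha> i * u ^ i" for i
    by (subst power_minus) (simp add: bcoef_def mult_ac)
  ultimately have "(\<lambda>i. bcoef \<alpha> i * u ^ i) sums (1 - u) powr \<alpha>" by simp
  then show ?thesis using sums_Suc_iff[of "\<lambda>i. bcoef \<alpha> i * u ^ i" "(1 - u) powr \<alpha> - 1"] by simp
qed

text \<open>
  With \<open>u = 1 / (1 + \<mu> / \<epsilon>)\<close>, the value of the series is
  \<open>\<epsilon> powr \<alpha> * u powr (- \<alpha>) * ((1 - u) powr \<alpha> - (1 - u) powr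
  \<beta>)\<close>. In the expansion of the last factor in powers of \<open>u\<close> the
  constant term cancels, so after division by \<open>u powr \<alpha>\<close> all exponents of
  \<open>u\<close> are positive and every term is a multiple of a Bessel symbol.
\<close>

lemma symbol_decomposition:
  assumes a: "0 < \<alpha>" "\<alpha> \<le> \<beta>" "\<beta> < 1" and e: "0 < \<epsilon>" and l: "0 \<le> \<mu>"
  shows "(\<lambda>i. bcoef_diff \<alpha> \<beta> i * \<epsilon> powr \<alpha> * (1 + \<mu> / \<epsilon>) powr (- (real (Suc i) - \<alpha>))) sums
    (\<mu> powr \<alpha> - \<mu> powr \<beta> * (\<epsilon> powr (- (\<beta> - \<alpha>)) * (1 + \<mu> / \<epsilon>) powr (- (\<beta> - \<alpha>))))"
proof -
  define x where "x = \<mu> / \<epsilon>"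
  define u where "u = 1 / (1 + x)"
  have x: "x \<ge> 0" using l e by (simp add: x_def)
  have u: "0 < u" "u \<le> 1" using x by (auto simp: u_def field_simps)
  have xu: "1 - u = x * u" using x by (simp add: u_def field_simps)
  have pu: "(1 + x) powr (- y) = u powr y" for y
    using x by (simp add: u_def powr_divide powr_minus_divide)
  have "(\<lambda>i. bcoef \<alpha> (Suc i) * u ^ Suc i - bcoef \<beta> (Suc i) * u ^ Suc i) sums (((1 - u) powr \<alpha> - 1) - ((1 - u) powr \<beta> - 1))"
    using a u by (intro sums_diff bcoef_tail_sums) auto
  then have "(\<lambda>i. (\<epsilon> powr \<alpha> * u powr (- \<alpha>)) * (bcoef \<alpha> (Suc i) * u ^ Suc i - bcoef \<beta> (Suc i) * u ^ Suc i)) sums ((\<epsilon> powr \<alpha> * u powr (- \<alpha>)) * (((1 - u) powr \<alpha> - 1) - ((1 - u) powr \<beta> - 1)))"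
    by (rule sums_mult)
  moreover have "(\<epsilon> powr \<alpha> * u powr (- \<alpha>)) * (bcoef \<alpha> (Suc i) * u ^ Suc i - bcoef \<beta> (Suc i) * u ^ Suc i) = bcoef_diff \<alpha> \<beta> i * \<epsilon> powr \<alpha> * (1 + \<mu> / \<epsilon>) powr (- (real (Suc i) - \<alpha>))" for i
  proof -
    have "u ^ Suc i = u powr (real (Suc i))" using u by (intro powr_realpow[symmetric]) auto
    then have "u powr (- \<alpha>) * u ^ Suc i = u powr (real (Suc i) - \<alpha>)" by (simp flip: powr_add)
    moreover have "(1 + \<mu> / \<epsilon>) powr (- (real (Suc i) - \<alpha>)) = u powr (real (Suc i) - \<alpha>)"
      unfolding x_def[symmetric] by (rule pu)
    moreover have "(\<epsilon> powr \<alpha> * u powr (- \<alpha>)) * (bcoef \<alpha> (Suc i) * u ^ Suc i - bcoef \<beta> (Suc i) * u ^ Suc i) = bcoef_diff \<alpha> \<beta> i * \<epsilon> powr \<alpha> * (u powr (- \<alpha>) * u ^ Suc i)"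
      unfolding bcoef_diff_def by (simp only: left_diff_distrib right_diff_distrib mult_ac)
    ultimately show ?thesis by simp
  qed
  moreover have "(\<epsilon> powr \<alpha> * u powr (- \<alpha>)) * (((1 - u) powr \<alpha> - 1) - ((1 - u) powr \<beta> - 1)) = \<mu> powr \<alpha> - \<mu> powr \<beta> * (\<epsilon> powr (- (\<beta> - \<alpha>)) * (1 + \<mu> / \<epsilon>) powr (- (\<beta> - \<alpha>)))"
  proof -
    have lx: "\<mu> = \<epsilon> * x" using e by (simp add: x_def)
    have A: "u powr (- \<alpha>) * (1 - u) powr \<alpha> = x powr \<alpha>"
    proof -
      have "u powr (- \<alpha>) * (1 - u) powr \<alpha> = x powr \<alpha> * (u powr (- \<alpha>) * u powr \<alpha>)" unfolding xu powr_mult by simp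
      also have "u powr (- \<alpha>) * u powr \<alpha> = 1" unfolding powr_add[symmetric] using u by simp
      finally show ?thesis by simp
    qed
    have B: "u powr (- \<alpha>) * (1 - u) powr \<beta> = x powr \<beta> * u powr (\<beta> - \<alpha>)"
    proof -
      have "u powr (- \<alpha>) * (1 - u) powr \<beta> = x powr \<beta> * (u powr (- \<alpha>) * u powr \<beta>)" unfolding xu powr_mult by simp
      also have "u powr (- \<alpha>) * u powr \<beta> = u powr (\<beta> - \<alpha>)" unfolding powr_add[symmetric] by simp
      finally show ?thesis .
    qed
    have C: "\<epsilon> powr \<beta> * \<epsilon> powr (- (\<beta> - \<alpha>)) = \<epsilon> powr \<alpha>" unfolding powr_add[symmetric] by simp
    have "(\<epsilon> powr \<alpha> * u powr (- \<alpha>)) * (((1 - u) powr \<alpha> - 1) - ((1 - u) powr \<beta> - 1)) = \<epsilon> powr \<alpha> * (u powr (- \<alpha>) * (1 - u) powr \<alpha>) - \<epsilon> powr \<alpha> * (u powr (- \<alpha>) * (1 - u) powr \<beta>)"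
      by (simp add: algebra_simps)
    also have "\<dots> = \<epsilon> powr \<alpha> * x powr \<alpha> - (\<epsilon> powr \<beta> * \<epsilon> powr (- (\<beta> - \<alpha>))) * (x powr \<beta> * u powr (\<beta> - \<alpha>))"
      unfolding A B C ..
    also have "\<dots> = \<mu> powr \<alpha> - \<mu> powr \<beta> * (\<epsilon> powr (- (\<beta> - \<alpha>)) * u powr (\<beta> - \<alpha>))"
      unfolding lx powr_mult by (simp only: mult_ac)
    finally show ?thesis unfolding x_def[symmetric] pu .
  qed
  ultimately show ?thesis by (simp only:)
qed

abbreviation rest_space :: "(nat \<times> real \<times> 'a::euclidean_space) measure" where
  "rest_space \<equiv> count_space UNIV \<Otimes>\<^sub>M bessel_space"

text \<open>
  The extra natural number indexes the terms of \<open>symbol_decomposition\<close>, so that the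
  whole series is the symbol of one mixture.
\<close>

definition rest_weight :: "real \<Rightarrow> real \<Rightarrow> real \<Rightarrow> nat \<times> real \<times> 'a::euclidean_space \<Rightarrow> real" where
  "rest_weight \<alpha> \<beta> \<epsilon> z = bcoef_diff \<alpha> \<beta> (fst z) * \<epsilon> powr \<alpha> * bessel_weight (real (Suc (fst z)) - \<alpha>) (snd z)"

lemma rest_pair: "pair_sigma_finite (count_space (UNIV :: nat set)) (bessel_space :: (real \<times> 'a::euclidean_space) measure)"
by (simp add: pair_sigma_finite_def sigma_finite_measure_count_space bessel_sigma_finite)

lemma rest_weight_measurable [measurable]:
  "(rest_weight \<alpha> \<beta> \<epsilon> :: nat \<times> real \<times> 'a::euclidean_space \<Rightarrow> real) \<in> borel_measurable rest_space"
proof (rule measurable_pair_measure_countable1)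
  show "(\<lambda>y. rest_weight \<alpha> \<beta> \<epsilon> (i, y :: real \<times> 'a)) \<in> borel_measurable bessel_space" if "i \<in> UNIV" for i
    unfolding rest_weight_def by simp
qed simp

lemma rest_mass_nn:
  assumes a: "0 < \<alpha>" "\<alpha> \<le> \<beta>" "\<beta> < 1" and e: "0 < \<epsilon>"
  shows "(\<integral>\<^sup>+z. ennreal \<bar>rest_weight \<alpha> \<beta> \<epsilon> z\<bar> \<partial>(rest_space :: (nat \<times> real \<times> 'a::euclidean_space) measure)) \<le> ennreal (2 * \<epsilon> powr \<alpha>)"
proof -
  interpret pair_sigma_finite "count_space (UNIV :: nat set)" "bessel_space :: (real \<times> 'a) measure" by (rule rest_pair)
  have s: "0 < \<alpha>" "\<alpha> \<le> 1" "0 < \<beta>" "\<beta> \<le> 1" using a by auto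
  have "(\<integral>\<^sup>+z. ennreal \<bar>rest_weight \<alpha> \<beta> \<epsilon> z\<bar> \<partial>(rest_space :: (nat \<times> real \<times> 'a) measure)) =
     (\<integral>\<^sup>+i. (\<integral>\<^sup>+\<omega>. ennreal \<bar>rest_weight \<alpha> \<beta> \<epsilon> (i, \<omega> :: real \<times> 'a)\<bar> \<partial>bessel_space) \<partial>count_space UNIV)"
    by (rule sigma_finite_measure.nn_integral_fst[OF bessel_sigma_finite, symmetric]) measurable
  also have "\<dots> = (\<integral>\<^sup>+i. ennreal (\<bar>bcoef_diff \<alpha> \<beta> i\<bar> * \<epsilon> powr \<alpha>) \<partial>count_space UNIV)"
  proof (rule nn_integral_cong)
    fix i :: nat
    have k: "real (Suc i) - \<alpha> > 0" using a by simp
    have "(\<integral>\<^sup>+\<omega>. ennreal \<bar>rest_weight \<alpha> \<beta> \<epsilon> (i, \<omega> :: real \<times> 'a)\<bar> \<partial>bessel_space) =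
       (\<integral>\<^sup>+\<omega>. ennreal (\<bar>bcoef_diff \<alpha> \<beta> i\<bar> * \<epsilon> powr \<alpha>) * ennreal (bessel_weight (real (Suc i) - \<alpha>) (\<omega> :: real \<times> 'a)) \<partial>bessel_space)"
      using bessel_weight_nonneg[OF k, where 'a='a]
      by (intro nn_integral_cong) (simp add: rest_weight_def abs_mult flip: ennreal_mult)
    also have "\<dots> = ennreal (\<bar>bcoef_diff \<alpha> \<beta> i\<bar> * \<epsilon> powr \<alpha>)"
      by (simp add: nn_integral_cmult bessel_mass_nn[OF k] del: of_nat_Suc)
    finally show "(\<integral>\<^sup>+\<omega>. ennreal \<bar>rest_weight \<alpha> \<beta> \<epsilon> (i, \<omega> :: real \<times> 'a)\<bar> \<partial>bessel_space) = ennreal (\<bar>bcoef_diff \<alpha> \<beta> i\<bar> * \<epsilon> powr \<alpha>)" .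
  qed
  also have "\<dots> = ennreal (\<Sum>i. \<bar>bcoef_diff \<alpha> \<beta> i\<bar> * \<epsilon> powr \<alpha>)"
    unfolding nn_integral_count_space_nat by (intro suminf_ennreal2 summable_mult2 bcoef_diff_summable s) auto
  also have "(\<Sum>i. \<bar>bcoef_diff \<alpha> \<beta> i\<bar> * \<epsilon> powr \<alpha>) = (\<Sum>i. \<bar>bcoef_diff \<alpha> \<beta> i\<bar>) * \<epsilon> powr \<alpha>"
    by (rule suminf_mult2[symmetric, OF bcoef_diff_summable(1)[OF s]])
  also have "ennreal \<dots> \<le> ennreal (2 * \<epsilon> powr \<alpha>)"
    by (intro ennreal_leI mult_right_mono bcoef_diff_summable(2)[OF s]) simp
  finally show ?thesis .
qed

lemma rest_integrable:
  assumes "0 < \<alpha>" "\<alpha> \<le> \<beta>" "\<beta> < 1" "0 < \<epsilon>"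
  shows "integrable (rest_space :: (nat \<times> real \<times> 'a::euclidean_space) measure) (rest_weight \<alpha> \<beta> \<epsilon>)"
  using rest_mass_nn[OF assms, where 'a='a] by (intro integrableI_bounded) (auto elim!: le_less_trans)

lemma rest_mass:
  assumes "0 < \<alpha>" "\<alpha> \<le> \<beta>" "\<beta> < 1" "0 < \<epsilon>"
  shows "(\<integral>z. norm (complex_of_real (rest_weight \<alpha> \<beta> \<epsilon> z)) \<partial>(rest_space :: (nat \<times> real \<times> 'a::euclidean_space) measure)) \<le> 2 * \<epsilon> powr \<alpha>"
proof -
  have "ennreal (\<integral>z. \<bar>rest_weight \<alpha> \<beta> \<epsilon> z\<bar> \<partial>(rest_space :: (nat \<times> real \<times> 'a) measure)) = (\<integral>\<^sup>+z. ennreal \<bar>rest_weight \<alpha> \<beta> \<epsilon> z\<bar> \<partial>(rest_space :: (nat \<times> real \<times> 'a) measure))"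
    using rest_integrable[OF assms, where 'a='a] by (intro nn_integral_eq_integral[symmetric]) auto
  then have "ennreal (\<integral>z. \<bar>rest_weight \<alpha> \<beta> \<epsilon> z\<bar> \<partial>(rest_space :: (nat \<times> real \<times> 'a) measure)) \<le> ennreal (2 * \<epsilon> powr \<alpha>)"
    using rest_mass_nn[OF assms, where 'a='a] by (simp only:)
  then show ?thesis by (subst (asm) ennreal_le_iff) auto
qed

lemma rest_mixture:
  assumes "0 < \<alpha>" "\<alpha> \<le> \<beta>" "\<beta> < 1" "0 < \<epsilon>"
  shows "translation_mixture rest_space (\<lambda>z. complex_of_real (rest_weight \<alpha> \<beta> \<epsilon> z)) (\<lambda>z. bessel_shift \<epsilon> (snd z) :: 'a::euclidean_space)"
proof -
  interpret pair_sigma_finite "count_space (UNIV :: nat set)" "bessel_space :: (real \<times> 'a) measure" by (rule rest_pair)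
  show ?thesis
    using rest_integrable[OF assms, where 'a='a] P.sigma_finite_measure_axioms
    by (intro translation_mixture.intro translation_mixture_axioms.intro) auto
qed

lemma rest_symbol:
  fixes \<xi> :: "'a::euclidean_space"
  assumes a: "0 < \<alpha>" "\<alpha> \<le> \<beta>" "\<beta> < 1" and e: "0 < \<epsilon>"
  shows "wtrans_symbol rest_space (\<lambda>z. complex_of_real (rest_weight \<alpha> \<beta> \<epsilon> z)) (\<lambda>z. bessel_shift \<epsilon> (snd z)) \<xi> =
    of_real (norm \<xi> powr (2 * \<alpha>) - norm \<xi> powr (2 * \<beta>) * (\<epsilon> powr (- (\<beta> - \<alpha>)) * (1 + (norm \<xi>)\<^sup>2 / \<epsilon>) powr (- (\<beta> - \<alpha>))))"
proof -
  interpret pair_sigma_finite "count_space (UNIV :: nat set)" "bessel_space :: (real \<times> 'a) measure" by (rule rest_pair)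
  have s: "0 < \<alpha>" "\<alpha> \<le> 1" "0 < \<beta>" "\<beta> \<le> 1" using a by auto
  define F where "F z = complex_of_real (rest_weight \<alpha> \<beta> \<epsilon> z) * cis (bessel_shift \<epsilon> (snd z) \<bullet> \<xi>)" for z :: "nat \<times> real \<times> 'a"
  have Fi: "integrable rest_space F"
  proof (rule Bochner_Integration.integrable_bound[OF rest_integrable[OF a e, where 'a='a]])
    show "F \<in> borel_measurable rest_space" unfolding F_def[abs_def] cis_conv_exp by measurable
  qed (simp add: F_def norm_mult)
  define \<mu> where "\<mu> = (norm \<xi>)\<^sup>2"
  have np: "norm \<xi> powr (2 * y) = \<mu> powr y" for y
    unfolding \<mu>_def by (cases "\<xi> = 0") (auto simp: powr_powr[symmetric] powr_numeral)
  define G where "G i = bcoef_diff \<alpha> \<beta> i * \<epsilon> powr \<alpha> * (1 + \<mu> / \<epsilon>) powr (- (real (Suc i) - \<alpha>))" for i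
  have inner: "(\<integral>\<omega>. F (i, \<omega>) \<partial>bessel_space) = of_real (G i)" for i
  proof -
    have k: "real (Suc i) - \<alpha> > 0" using a by simp
    have "(\<integral>\<omega>. F (i, \<omega>) \<partial>bessel_space) = (\<integral>\<omega>. of_real (bcoef_diff \<alpha> \<beta> i * \<epsilon> powr \<alpha>) * (complex_of_real (bessel_weight (real (Suc i) - \<alpha>) \<omega>) * cis (bessel_shift \<epsilon> \<omega> \<bullet> \<xi>)) \<partial>bessel_space)"
      unfolding F_def rest_weight_def by (simp add: mult.assoc)
    also have "\<dots> = of_real (bcoef_diff \<alpha> \<beta> i * \<epsilon> powr \<alpha>) * wtrans_symbol bessel_space (\<lambda>\<omega>. complex_of_real (bessel_weight (real (Suc i) - \<alpha>) \<omega>)) (bessel_shift \<epsilon>) \<xi>"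
      unfolding wtrans_symbol_def by (rule integral_mult_right_zero)
    also have "\<dots> = of_real (G i)" unfolding bessel_symbol[OF k e] G_def \<mu>_def by simp
    finally show ?thesis .
  qed
  have "wtrans_symbol rest_space (\<lambda>z. complex_of_real (rest_weight \<alpha> \<beta> \<epsilon> z)) (\<lambda>z. bessel_shift \<epsilon> (snd z)) \<xi> = (\<integral>z. F z \<partial>rest_space)"
    by (simp add: wtrans_symbol_def F_def)
  also have "\<dots> = (\<integral>i. (\<integral>\<omega>. F (i, \<omega>) \<partial>bessel_space) \<partial>count_space UNIV)"
    by (rule integral_fst'[OF Fi, symmetric])
  also have "\<dots> = (\<integral>i. complex_of_real (G i) \<partial>count_space UNIV)" unfolding inner ..
  also have "\<dots> = (\<Sum>i. complex_of_real (G i))"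
  proof (rule integral_count_space_nat)
    show "integrable (count_space UNIV) (\<lambda>i. complex_of_real (G i))"
      using integrable_fst'[OF Fi] unfolding inner .
  qed
  also have "\<dots> = of_real (\<mu> powr \<alpha> - \<mu> powr \<beta> * (\<epsilon> powr (- (\<beta> - \<alpha>)) * (1 + \<mu> / \<epsilon>) powr (- (\<beta> - \<alpha>))))"
    unfolding G_def by (intro sums_unique[symmetric] sums_of_real symbol_decomposition a e) (simp add: \<mu>_def)
  finally show ?thesis unfolding np \<mu>_def[symmetric] .
qed

text \<open>
  The candidate is a multiple of the Bessel potential of \<open>g\<close> plus the rest mixture
  of \<open>f\<close>. In its pairing with \<open>\<phi>\<close> both mixtures move to
  \<open>\<phi>\<close>. The Bessel potential \<open>\<psi>\<close> of \<open>\<phi>\<close> is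
  again a Schwartz function, so \<open>g\<close> may be replaced by \<open>frac_laplacian r'
  f\<close> there, and the symbols add up to that of order \<open>r\<close>.
\<close>

theorem frac_laplacian_lower_order:
  fixes f g :: "real ^ 'n \<Rightarrow> complex"
  assumes p: "1 < p" and f: "f \<in> Lp p" and r: "0 < r" "r < r'" "r' < 1" and e: "0 < \<epsilon>"
    and g: "g \<in> Lp p" "represents g (frac_laplacian r' f)"
  shows "\<exists>g'\<in>Lp p. represents g' (frac_laplacian r f) \<and>
    Lp_norm p g' \<le> ennreal (\<epsilon> powr (- (r' - r) / 2)) * Lp_norm p g + ennreal (2 * \<epsilon> powr (r / 2)) * Lp_norm p f"
proof -
  \<comment> \<open>Half the orders, because the Bessel symbols are functions of
    \<open>|\<xi>|\<^sup>2\<close>.\<close>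
  define \<alpha> where "\<alpha> = r / 2"
  define \<beta> where "\<beta> = r' / 2"
  define \<gamma> where "\<gamma> = \<beta> - \<alpha>"
  have ab: "0 < \<alpha>" "\<alpha> \<le> \<beta>" "\<beta> < 1" and ga: "\<gamma> > 0" using r by (auto simp: \<alpha>_def \<beta>_def \<gamma>_def)
  define w :: "real \<times> (real ^ 'n) \<Rightarrow> complex" where "w = (\<lambda>\<omega>. complex_of_real (bessel_weight \<gamma> \<omega>))"
  define Y :: "real \<times> (real ^ 'n) \<Rightarrow> real ^ 'n" where "Y = bessel_shift \<epsilon>"
  define w' :: "nat \<times> real \<times> (real ^ 'n) \<Rightarrow> complex" where "w' = (\<lambda>z. complex_of_real (rest_weight \<alpha> \<beta> \<epsilon> z))"
  define Y' :: "nat \<times> real \<times> (real ^ 'n) \<Rightarrow> real ^ 'n" where "Y' = (\<lambda>z. bessel_shift \<epsilon> (snd z))"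
  interpret B: translation_mixture "bessel_space :: (real \<times> (real ^ 'n)) measure" w Y
    unfolding w_def Y_def by (rule bessel_mixture[OF ga])
  interpret Bn: translation_mixture "bessel_space :: (real \<times> (real ^ 'n)) measure" w "\<lambda>\<omega>. - Y \<omega>" by (rule B.translation_mixture_reflect)
  interpret R: translation_mixture "rest_space :: (nat \<times> real \<times> (real ^ 'n)) measure" w' Y'
    unfolding w'_def Y'_def by (rule rest_mixture[OF ab e])
  interpret Rn: translation_mixture "rest_space :: (nat \<times> real \<times> (real ^ 'n)) measure" w' "\<lambda>z. - Y' z" by (rule R.translation_mixture_reflect)
  define c where "c = \<epsilon> powr (- \<gamma>)"
  have c: "c > 0" using e by (simp add: c_def)
  define g1 where "g1 = wtrans bessel_space w Y g"
  define g2 where "g2 = wtrans rest_space w' Y' f"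
  define g' where "g' x = of_real c * g1 x + g2 x" for x
  have g1: "g1 \<in> Lp p" unfolding g1_def by (rule B.wtrans_Lp[OF p g(1)])
  have g2: "g2 \<in> Lp p" unfolding g2_def by (rule R.wtrans_Lp[OF p f])
  note [measurable] = Lp_measurable[OF g1] Lp_measurable[OF g2]
  have p0: "0 < p" using p by simp
  obtain Ng where Ng: "Ng \<ge> 0" "Lp_norm p g = ennreal Ng" using Lp_cases[OF p0 g(1)] by metis
  obtain Nf where Nf: "Nf \<ge> 0" "Lp_norm p f = ennreal Nf" using Lp_cases[OF p0 f] by metis
  have n1: "Lp_norm p g1 \<le> ennreal Ng"
    using B.Lp_norm_wtrans_le[OF p g(1), of 1] bessel_mass[OF ga, where 'a="real ^ 'n"] unfolding g1_def w_def Ng by simp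
  have n2: "Lp_norm p g2 \<le> ennreal (2 * \<epsilon> powr \<alpha> * Nf)"
    using R.Lp_norm_wtrans_le[OF p f, of "2 * \<epsilon> powr \<alpha>"] rest_mass[OF ab e, where 'a="real ^ 'n"] e Nf(1)
    unfolding g2_def w'_def Nf(2) by (simp add: ennreal_mult)
  have n1': "Lp_norm p (\<lambda>x. of_real c * g1 x) \<le> ennreal (c * Ng)"
  proof (rule Lp_norm_leI[OF p0])
    have "power_integral p (\<lambda>x. of_real c * g1 x) = ennreal (norm (complex_of_real c) powr p) * power_integral p g1" by (rule power_integral_cmult[OF p0]) simp
    also have "\<dots> \<le> ennreal (norm (complex_of_real c) powr p) * ennreal (Ng powr p)"
      using p0 Ng n1 by (intro mult_left_mono power_integral_leI) auto
    also have "\<dots> = ennreal ((c * Ng) powr p)" using c Ng by (simp add: powr_mult flip: ennreal_mult)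
    finally show "power_integral p (\<lambda>x. of_real c * g1 x) \<le> ennreal ((c * Ng) powr p)" .
  qed (use c Ng in simp)
  have n: "Lp_norm p g' \<le> ennreal (c * Ng + 2 * \<epsilon> powr \<alpha> * Nf)"
    unfolding g'_def[abs_def] using c Ng Nf by (intro Lp_norm_triangle[OF p _ _ _ n1' _ n2]) auto
  have "g' \<in> borel_measurable borel" unfolding g'_def[abs_def] by measurable
  then have g'Lp: "g' \<in> Lp p" using n unfolding Lp_def by (auto elim!: le_less_trans)
  have "represents g' (frac_laplacian r f)"
    unfolding represents_def
  proof
    fix \<phi> :: "real ^ 'n \<Rightarrow> complex" assume \<phi>: "\<phi> \<in> schwartz"
    have [measurable]: "\<phi> \<in> borel_measurable borel" using \<phi> by measurable
    obtain M where M: "\<And>x. norm (\<phi> x) \<le> M" using schwartz_bounded[OF \<phi>] by blast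
    have \<phi>i: "integrable lborel \<phi>" by (rule schwartz_integrable[OF \<phi>])
    define \<psi> where "\<psi> = wtrans bessel_space w (\<lambda>\<omega>. - Y \<omega>) \<phi>"
    define \<eta> where "\<eta> = wtrans rest_space w' (\<lambda>z. - Y' z) \<phi>"
    have \<psi>: "\<psi> \<in> schwartz"
      unfolding \<psi>_def by (rule Bn.wtrans_schwartz[OF \<phi>]) (use bessel_moments[OF ga e] in \<open>simp add: w_def Y_def\<close>)
    have neg: "wtrans_symbol A v (\<lambda>\<omega>. - Z \<omega>) \<xi> = wtrans_symbol A v Z (- \<xi>)" for A and v :: "'z \<Rightarrow> complex" and Z :: "'z \<Rightarrow> real ^ 'n" and \<xi>
      by (simp add: wtrans_symbol_def)
    define sb where "sb \<xi> = complex_of_real ((1 + (norm (\<xi> :: real ^ 'n))\<^sup>2 / \<epsilon>) powr (- \<gamma>))" for \<xi>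
    define sr where "sr \<xi> = wtrans_symbol rest_space w' (\<lambda>z. - Y' z) \<xi>" for \<xi>
    have sb: "wtrans_symbol bessel_space w (\<lambda>\<omega>. - Y \<omega>) \<xi> = sb \<xi>" for \<xi>
      unfolding w_def Y_def bessel_symbol[OF ga e, of "- \<xi>"] sb_def by (simp add: wtrans_symbol_def) (use bessel_symbol[OF ga e, of "- \<xi>"] in \<open>simp add: wtrans_symbol_def\<close>)
    have sr: "sr \<xi> = of_real (norm \<xi> powr r) - of_real c * (of_real (norm \<xi> powr r') * sb \<xi>)" for \<xi>
    proof -
      have "sr \<xi> = wtrans_symbol rest_space w' Y' (- \<xi>)" by (simp add: sr_def wtrans_symbol_def)
      also have "\<dots> = of_real (norm (- \<xi>) powr (2 * \<alpha>) - norm (- \<xi>) powr (2 * \<beta>) * (\<epsilon> powr (- (\<beta> - \<alpha>)) * (1 + (norm (- \<xi>))\<^sup>2 / \<epsilon>) powr (- (\<beta> - \<alpha>))))"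
        unfolding w'_def Y'_def by (rule rest_symbol[OF ab e])
      also have "\<dots> = of_real (norm \<xi> powr r) - of_real c * (of_real (norm \<xi> powr r') * sb \<xi>)"
        unfolding sb_def c_def \<gamma>_def by (simp add: \<alpha>_def \<beta>_def)
      finally show ?thesis .
    qed
    have F\<psi>: "fourier \<psi> \<xi> = sb \<xi> * fourier \<phi> \<xi>" for \<xi>
      unfolding \<psi>_def Bn.fourier_wtrans[OF \<phi>i] sb ..
    have i1: "integrable lborel (\<lambda>\<xi>. of_real (norm \<xi> powr r) * fourier \<phi> \<xi>)" using r by (intro powr_fourier_integrable \<phi>) auto
    have i2: "integrable lborel (\<lambda>\<xi>. of_real (norm \<xi> powr r') * (sb \<xi> * fourier \<phi> \<xi>))"
      using powr_fourier_integrable[OF \<psi>, of r'] r unfolding F\<psi> by auto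
    have pw: "\<eta> x = frac_laplacian_schwartz r \<phi> x - of_real c * frac_laplacian_schwartz r' \<psi> x" for x
    proof -
      have "\<eta> x = inv_fourier (\<lambda>\<xi>. sr \<xi> * fourier \<phi> \<xi>) x"
        unfolding \<eta>_def sr_def by (rule Rn.inv_fourier_wtrans[OF fourier_integrable[OF \<phi>] fourier_inversion[OF \<phi>, symmetric]])
      also have "\<dots> = (\<integral>\<xi>. cis (x \<bullet> \<xi>) * (of_real (norm \<xi> powr r) * fourier \<phi> \<xi>) - of_real c * (cis (x \<bullet> \<xi>) * (of_real (norm \<xi> powr r') * (sb \<xi> * fourier \<phi> \<xi>))) \<partial>lborel) / of_real ((2 * pi) ^ DIM(real ^ 'n))"
        unfolding inv_fourier_def sr by (intro arg_cong2[where f="(/)"] Bochner_Integration.integral_cong refl) (simp add: algebra_simps)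
      also have "\<dots> = frac_laplacian_schwartz r \<phi> x - of_real c * frac_laplacian_schwartz r' \<psi> x"
        unfolding frac_laplacian_schwartz_def inv_fourier_def F\<psi>
        by (subst Bochner_Integration.integral_diff) (auto intro!: integrable_cis_mult i1 i2 simp: diff_divide_distrib)
      finally show ?thesis .
    qed
    have j1: "integrable lborel (\<lambda>x. f x * frac_laplacian_schwartz r \<phi> x)" using r by (intro frac_laplacian_integrable[OF p \<phi> _ _ f]) auto
    have j2: "integrable lborel (\<lambda>x. f x * frac_laplacian_schwartz r' \<psi> x)" using r by (intro frac_laplacian_integrable[OF p \<psi> _ _ f]) auto
    have "(\<integral>x. g' x * \<phi> x \<partial>lborel) = (\<integral>x. of_real c * (g1 x * \<phi> x) + g2 x * \<phi> x \<partial>lborel)"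
      unfolding g'_def by (simp add: distrib_right mult.assoc)
    also have "\<dots> = of_real c * (\<integral>x. g1 x * \<phi> x \<partial>lborel) + (\<integral>x. g2 x * \<phi> x \<partial>lborel)"
      using integrable_pairing[OF p \<phi>i M g1] integrable_pairing[OF p \<phi>i M g2] by simp
    also have "(\<integral>x. g1 x * \<phi> x \<partial>lborel) = (\<integral>x. g x * \<psi> x \<partial>lborel)"
      unfolding g1_def \<psi>_def by (rule B.wtrans_duality[OF p g(1) \<phi>i M])
    also have "\<dots> = frac_laplacian r' f \<psi>" using g(2) \<psi> unfolding represents_def by simp
    also have "(\<integral>x. g2 x * \<phi> x \<partial>lborel) = (\<integral>x. f x * \<eta> x \<partial>lborel)"
      unfolding g2_def \<eta>_def by (rule R.wtrans_duality[OF p f \<phi>i M])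
    also have "\<dots> = (\<integral>x. f x * frac_laplacian_schwartz r \<phi> x - of_real c * (f x * frac_laplacian_schwartz r' \<psi> x) \<partial>lborel)"
      unfolding pw by (simp add: right_diff_distrib mult_ac)
    also have "\<dots> = frac_laplacian r f \<phi> - of_real c * frac_laplacian r' f \<psi>"
      unfolding frac_laplacian_def using j1 j2 by simp
    finally show "frac_laplacian r f \<phi> = (\<integral>x. g' x * \<phi> x \<partial>lborel)" by simp
  qed
  moreover have "ennreal (c * Ng + 2 * \<epsilon> powr \<alpha> * Nf) = ennreal (\<epsilon> powr (- (r' - r) / 2)) * Lp_norm p g + ennreal (2 * \<epsilon> powr (r / 2)) * Lp_norm p f"
  proof -
    have "- \<gamma> = - (r' - r) / 2" by (simp add: \<gamma>_def \<alpha>_def \<beta>_def field_simps)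
    then have cg: "\<epsilon> powr (- (r' - r) / 2) = c" unfolding c_def by (simp only:)
    show ?thesis unfolding cg \<alpha>_def[symmetric] Ng(2) Nf(2) using Ng(1) Nf(1) c by (simp add: ennreal_mult ennreal_plus)
  qed
  ultimately show ?thesis using g'Lp n by metis
qed

section \<open>The Butzer seminorm in terms of mixtures\<close>

text \<open>
  The integral over \<open>x\<close> of the weighted \<open>p\<close>-th powers is finite, hence
  these are finite for almost every \<open>x\<close>, and Jensen's inequality bounds the first
  powers by them.
\<close>

lemma (in translation_mixture) wtrans_AE_integrable:
  assumes p: "1 < p" and f: "f \<in> Lp p"
  shows "AE x in lborel. integrable M (\<lambda>\<omega>. w \<omega> * f (x + Y \<omega>))"
proof -
  interpret pair_sigma_finite M lborel by (rule pair_lborel)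
  have [measurable]: "f \<in> borel_measurable borel" using f by measurable
  define W where "W = (\<integral>\<omega>. norm (w \<omega>) \<partial>M)"
  have W0: "W \<ge> 0" by (simp add: W_def)
  have W: "(\<integral>\<^sup>+\<omega>. ennreal (norm (w \<omega>)) \<partial>M) \<le> ennreal W" by (rule mass_nn) (simp add: W_def)
  define H where "H x = (\<integral>\<^sup>+\<omega>. ennreal (norm (w \<omega>) * norm (f (x + Y \<omega>)) powr p) \<partial>M)" for x
  have "(\<integral>\<^sup>+x. H x \<partial>lborel) = (\<integral>\<^sup>+\<omega>. (\<integral>\<^sup>+x. ennreal (norm (w \<omega>) * norm (f (x + Y \<omega>)) powr p) \<partial>lborel) \<partial>M)"
    unfolding H_def by (rule Fubini') measurable
  also have "\<dots> = (\<integral>\<^sup>+\<omega>. ennreal (norm (w \<omega>)) * power_integral p f \<partial>M)"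
    using power_integral_translate[of f p] by (simp add: ennreal_mult power_integral_def nn_integral_cmult)
  also have "\<dots> = (\<integral>\<^sup>+\<omega>. ennreal (norm (w \<omega>)) \<partial>M) * power_integral p f"
    by (rule nn_integral_multc) measurable
  also have "\<dots> < \<infinity>"
    using f w_int by (auto simp: Lp_iff ennreal_mult_less_top integrable_iff_bounded)
  finally have "(\<integral>\<^sup>+x. H x \<partial>lborel) \<noteq> \<infinity>" by simp
  then have "AE x in lborel. H x \<noteq> \<infinity>"
    by (intro nn_integral_PInf_AE) (auto simp: H_def)
  then show ?thesis
  proof eventually_elim
    case (elim x)
    then obtain J where J: "H x = ennreal J" "0 \<le> J" by (cases "H x") auto
    have "\<exists>I\<ge>0. (\<integral>\<^sup>+\<omega>. ennreal (norm (w \<omega>) * norm (f (x + Y \<omega>))) \<partial>M) = ennreal I \<and> I powr p \<le> W powr (p - 1) * J"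
      by (rule weighted_jensen_nn[OF p _ _ _ _ W W0 J(1)[unfolded H_def] J(2)]) auto
    then show ?case by (intro integrableI_bounded) (auto simp: norm_mult)
  qed
qed

lemma frac_diff_eq_fdiff:
  assumes p: "1 < p" and f: "f \<in> Lp p" and t: "0 < t" "t \<le> 1"
  shows "AE x in lborel. frac_diff t h f x = fdiff t h f x"
proof -
  interpret translation_mixture "count_space UNIV" "\<lambda>j. complex_of_real (bcoef t j)" "\<lambda>j. (t - real j) *\<^sub>R h"
    by (rule fdiff_mixture[OF t])
  show ?thesis
    using wtrans_AE_integrable[OF p f]
  proof eventually_elim
    case (elim x)
    show ?case unfolding fdiff_def wtrans_def integral_count_space_nat[OF elim]
      by (simp add: frac_diff_def bcoef_def)
  qed
qed

lemma Butzer_seminorm_fdiff: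
  fixes f :: "'a::euclidean_space \<Rightarrow> complex"
  assumes p: "1 < p" and f: "f \<in> Lp p" and t: "0 < t" "t \<le> 1"
  shows "Butzer_seminorm s p t f = ennroot p (\<integral>\<^sup>+h. (\<integral>\<^sup>+x.
     ennreal (norm (fdiff t h f x) powr p * norm h powr (- (s * p) - real DIM('a))) \<partial>lborel) \<partial>lborel)"
proof -
  have "(\<integral>\<^sup>+x. ennreal (norm (frac_diff t h f x) powr p / norm h powr (s * p + real DIM('a))) \<partial>lborel)
    = (\<integral>\<^sup>+x. ennreal (norm (fdiff t h f x) powr p * norm h powr (- (s * p) - real DIM('a))) \<partial>lborel)" for h
    using frac_diff_eq_fdiff[OF p f t, of h]
  proof (intro nn_integral_cong_AE, eventually_elim)
    case (elim x)
    have "norm h powr (- (s * p) - real DIM('a)) = 1 / norm h powr (s * p + real DIM('a))"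
      using powr_minus_divide[of "norm h" "s * p + real DIM('a)"] by simp
    then show ?case by (simp add: elim)
  qed
  then show ?thesis unfolding Butzer_seminorm_def by simp
qed

section \<open>Uniform bounds of fractional orders\<close>

lemma ennroot_leD:
  assumes "0 < p" "0 \<le> Z" "ennroot p y \<le> ennreal Z"
  shows "y \<le> ennreal (Z powr p)"
proof -
  have "y < \<infinity>" using assms(3) by (metis ennroot_finite_iff le_less_trans ennreal_less_top infinity_ennreal_def)
  then obtain N where "N \<ge> 0" "y = ennreal (N powr p)" "ennroot p y = ennreal N"
    using ennroot_cases assms(1) by blast
  then show ?thesis using assms by (simp add: powr_mono2 ennreal_leI)
qed

text \<open>
  The order \<open>2 * s - t\<close> has the same distance from \<open>s\<close> as
  \<open>s\<close> has from \<open>t\<close>. With this choice the three singular factors, the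
  powers of \<open>t - s\<close> from the seminorm, from Hoelder's inequality and from the
  constant in front of the integral, cancel.
\<close>

lemma reflected_order_estimate:
  assumes p: "1 < p" and t: "0 < t" "t < 1"
  shows "\<exists>C>0. \<exists>t0<t. 0 < t0 \<and> (\<forall>f\<in>(Lp p :: (real ^ 'n \<Rightarrow> complex) set). \<forall>s L.
    t0 \<le> 2 * s - t \<longrightarrow> s < t \<longrightarrow> 0 \<le> L \<longrightarrow>
    Lp_norm p f + ennreal ((t - s) powr (1 / p)) * Butzer_seminorm s p t f \<le> ennreal L \<longrightarrow>
    (\<exists>g\<in>Lp p. represents g (frac_laplacian (2 * s - t) f) \<and> Lp_norm p g \<le> ennreal (C * L)))"
proof -
  obtain c t0 where c: "c > 0" and t0: "t0 < t" "0 < t0"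
    and kc: "\<And>r. t0 \<le> r \<Longrightarrow> r < t \<Longrightarrow> norm (kernel_const TYPE('n) r t) \<ge> c / (t - r)"
    using kernel_const_lower[OF t, where 'n='n] by blast
  define \<omega> where "\<omega> = sphere_area TYPE(real ^ 'n)"
  have \<omega>: "\<omega> > 0" unfolding \<omega>_def by (rule sphere_area_pos)
  define q where "q = p / (p - 1)"
  have q: "q > 0" using p by (simp add: q_def)
  define A where "A = (\<omega> / q) powr ((p - 1) / p)"
  have A: "A > 0" using \<omega> q by (simp add: A_def)
  define C where "C = 2 * (A + 2 * \<omega> / t0) / c"
  have C: "C > 0" using A \<omega> t0 c by (simp add: C_def add_pos_pos)
  have "\<exists>g\<in>Lp p. represents g (frac_laplacian (2 * s - t) f) \<and> Lp_norm p g \<le> ennreal (C * L)"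
    if f: "f \<in> Lp p" and s: "t0 \<le> 2 * s - t" "s < t" and L: "0 \<le> L"
     and b: "Lp_norm p f + ennreal ((t - s) powr (1 / p)) * Butzer_seminorm s p t f \<le> ennreal L"
    for f :: "real ^ 'n \<Rightarrow> complex" and s L
  proof -
    define r where "r = 2 * s - t"
    define a where "a = t - s"
    have a: "a > 0" "a \<le> 1" "s - r = a" "t - r = 2 * a" using s t t0 by (auto simp: a_def r_def)
    have r: "0 < r" "r < s" "s < t" "t \<le> 1" "t0 \<le> r" "r < t" using s t t0 a by (auto simp: r_def)
    define k where "k = norm (kernel_const TYPE('n) r t)"
    have k: "k \<ge> c / (2 * a)" using kc[OF r(5,6)] a by (simp add: k_def)
    have k0: "k > 0" using k c a by (smt (verit) divide_pos_pos mult_pos_pos)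
    have N: "Lp_norm p f \<le> ennreal L" using b by (rule order_trans[rotated]) simp
    define Z where "Z = a powr (- (1 / p)) * L"
    have Z0: "Z \<ge> 0" using L by (simp add: Z_def)
    have Zb: "Butzer_seminorm s p t f \<le> ennreal Z"
    proof -
      have "ennreal (a powr (1 / p)) * Butzer_seminorm s p t f \<le> ennreal L"
        unfolding a_def using b by (rule order_trans[rotated]) simp
      then have "ennreal (a powr (- (1 / p))) * (ennreal (a powr (1 / p)) * Butzer_seminorm s p t f) \<le> ennreal (a powr (- (1 / p))) * ennreal L"
        by (rule mult_left_mono) simp
      also have "ennreal (a powr (- (1 / p))) * (ennreal (a powr (1 / p)) * Butzer_seminorm s p t f) = Butzer_seminorm s p t f"
        using a by (simp add: mult.assoc[symmetric] powr_minus flip: ennreal_mult)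
      also have "ennreal (a powr (- (1 / p))) * ennreal L = ennreal Z"
        using L by (simp add: Z_def ennreal_mult)
      finally show ?thesis .
    qed
    have Zi: "(\<integral>\<^sup>+h. (\<integral>\<^sup>+x. ennreal (norm (fdiff t h f x) powr p * norm h powr (- (s * p) - real CARD('n))) \<partial>lborel) \<partial>lborel) \<le> ennreal (Z powr p)"
      using ennroot_leD[OF _ Z0 Zb[unfolded Butzer_seminorm_fdiff[OF p f t(1) less_imp_le[OF t(2)]]]] p by simp
    have knz: "kernel_const TYPE('n) r t \<noteq> 0" using k0 unfolding k_def by simp
    obtain g where g: "g \<in> Lp p" "represents g (frac_laplacian r f)"
      "Lp_norm p g \<le> ennreal (((\<omega> / ((s - r) * (p / (p - 1)))) powr ((p - 1) / p) * Z + \<omega> / r * 2 * L) / k)"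
      using frac_laplacian_represented[OF p f r(1,2,3,4) knz L N Z0 Zi] unfolding \<omega>_def k_def by blast
    have "((\<omega> / ((s - r) * (p / (p - 1)))) powr ((p - 1) / p) * Z + \<omega> / r * 2 * L) / k \<le> C * L"
    proof -
      have e1: "(\<omega> / ((s - r) * (p / (p - 1)))) powr ((p - 1) / p) * Z = A / a * L"
      proof -
        have "\<omega> / ((s - r) * (p / (p - 1))) = (\<omega> / q) / a" unfolding a(3) q_def[symmetric] by (simp add: mult.commute)
        then have "(\<omega> / ((s - r) * (p / (p - 1)))) powr ((p - 1) / p) * Z = A * (1 / a powr ((p - 1) / p) * a powr (- (1 / p))) * L"
          unfolding A_def Z_def by (simp only: powr_divide) simp
        also have "1 / a powr ((p - 1) / p) * a powr (- (1 / p)) = a powr (- ((p - 1) / p)) * a powr (- (1 / p))"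
          by (simp only: powr_minus_divide)
        also have "\<dots> = a powr (- 1)"
          unfolding powr_add[symmetric] using p by (intro arg_cong2[where f="(powr)"]) (auto simp: field_simps)
        also have "\<dots> = 1 / a" using a by (simp add: powr_minus_divide)
        finally show ?thesis by simp
      qed
      have e2: "\<omega> / r * 2 * L \<le> 2 * \<omega> / t0 / a * L"
      proof -
        have "\<omega> / r \<le> \<omega> / t0" using \<omega> r t0 by (intro divide_left_mono) auto
        also have "\<omega> / t0 \<le> \<omega> / t0 / a"
          using \<omega> t0 a by (simp add: le_divide_eq mult_left_le)
        finally have "\<omega> / r * (2 * L) \<le> \<omega> / t0 / a * (2 * L)" using L by (intro mult_right_mono) auto
        then show ?thesis by (simp add: mult_ac)
      qed
      define X where "X = (A + 2 * \<omega> / t0) / a * L"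
      have X: "X \<ge> 0" using A \<omega> t0 a L by (simp add: X_def)
      have "(\<omega> / ((s - r) * (p / (p - 1)))) powr ((p - 1) / p) * Z + \<omega> / r * 2 * L \<le> A / a * L + 2 * \<omega> / t0 / a * L"
        unfolding e1 by (rule add_left_mono[OF e2])
      also have "\<dots> = X" by (simp only: X_def add_divide_distrib distrib_right)
      finally have "((\<omega> / ((s - r) * (p / (p - 1)))) powr ((p - 1) / p) * Z + \<omega> / r * 2 * L) / k \<le> X / k"
        using k0 by (intro divide_right_mono) auto
      also have "X / k \<le> X / (c / (2 * a))"
        using X k k0 c a by (intro divide_left_mono) auto
      also have "\<dots> = C * L" unfolding X_def C_def using a c by (simp add: field_simps)
      finally show ?thesis .
    qed
    then have "Lp_norm p g \<le> ennreal (C * L)" using g(3) by (meson ennreal_leI order_trans)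
    then show ?thesis using g(1,2) unfolding r_def by blast
  qed
  then show ?thesis using C t0 by blast
qed

text \<open>
  Lowering the order \<open>2 * s - t\<close> with \<open>\<epsilon> = 1\<close> makes the bound
  available at one order for all \<open>s\<close> close to \<open>t\<close>. At
  \<open>\<epsilon> = 1\<close> the rest contributes \<open>2\<close> to the constant.
\<close>

lemma lower_order_estimate:
  assumes p: "1 < p" and t: "0 < t" "t < 1"
  shows "\<exists>C>0. \<exists>t0<t. 0 < t0 \<and> (\<forall>f\<in>(Lp p :: (real ^ 'n \<Rightarrow> complex) set). \<forall>r s L.
    0 < r \<longrightarrow> max t0 r < 2 * s - t \<longrightarrow> s < t \<longrightarrow> 0 \<le> L \<longrightarrow>
    Lp_norm p f + ennreal ((t - s) powr (1 / p)) * Butzer_seminorm s p t f \<le> ennreal L \<longrightarrow>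
    (\<exists>g\<in>Lp p. represents g (frac_laplacian r f) \<and> Lp_norm p g \<le> ennreal (C * L)))"
proof -
  obtain C t0 where C: "C > 0" and t0: "t0 < t" "0 < t0"
    and est: "\<And>f s L. f \<in> (Lp p :: (real ^ 'n \<Rightarrow> complex) set) \<Longrightarrow> t0 \<le> 2 * s - t \<Longrightarrow> s < t \<Longrightarrow> 0 \<le> L \<Longrightarrow>
      Lp_norm p f + ennreal ((t - s) powr (1 / p)) * Butzer_seminorm s p t f \<le> ennreal L \<Longrightarrow>
      \<exists>g\<in>Lp p. represents g (frac_laplacian (2 * s - t) f) \<and> Lp_norm p g \<le> ennreal (C * L)"
    using reflected_order_estimate[OF p t, where 'n='n] by blast
  have "\<exists>g\<in>Lp p. represents g (frac_laplacian r f) \<and> Lp_norm p g \<le> ennreal ((C + 2) * L)"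
    if f: "f \<in> Lp p" and r: "0 < r" "max t0 r < 2 * s - t" and s: "s < t" and L: "0 \<le> L"
      and b: "Lp_norm p f + ennreal ((t - s) powr (1 / p)) * Butzer_seminorm s p t f \<le> ennreal L"
    for f :: "real ^ 'n \<Rightarrow> complex" and r s L
  proof -
    obtain g where g: "g \<in> Lp p" "represents g (frac_laplacian (2 * s - t) f)" "Lp_norm p g \<le> ennreal (C * L)"
      using est[OF f _ s L b] r by auto
    have N: "Lp_norm p f \<le> ennreal L" using b by (rule order_trans[rotated]) simp
    have r': "r < 2 * s - t" "2 * s - t < 1" using r s t by auto
    obtain g' where g': "g' \<in> Lp p" "represents g' (frac_laplacian r f)"
      "Lp_norm p g' \<le> ennreal (1 powr (- (2 * s - t - r) / 2)) * Lp_norm p g + ennreal (2 * 1 powr (r / 2)) * Lp_norm p f"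
      using frac_laplacian_lower_order[OF p f r(1) r' zero_less_one g(1,2)] by blast
    have "Lp_norm p g' \<le> ennreal 1 * ennreal (C * L) + ennreal 2 * ennreal L"
      using g'(3) by (rule order_trans) (intro add_mono mult_mono g(3) N; simp)
    also have "\<dots> = ennreal ((C + 2) * L)"
      proof -
      have "ennreal 2 * ennreal L = ennreal (2 * L)" using L by (intro ennreal_mult[symmetric]) auto
      moreover have "ennreal (C * L) + ennreal (2 * L) = ennreal (C * L + 2 * L)"
        using C L by (intro ennreal_plus[symmetric]) auto
      ultimately show ?thesis by (simp add: distrib_right)
    qed
    finally show ?thesis using g'(1,2) by blast
  qed
  then show ?thesis using C t0 by (intro exI[of _ "C + 2"]) auto
qed

section \<open>Norms of the fractional Laplacian as the order varies\<close>

lemma less_add_ennreal: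
  assumes "x \<noteq> \<infinity>" "0 < e"
  shows "x < x + ennreal e"
proof (cases x)
  case (real r)
  then have "x + ennreal e = ennreal (r + e)" using assms by (simp add: ennreal_plus)
  then show ?thesis using real assms by (auto intro!: ennreal_lessI)
qed (use assms in simp)

lemma dist_Lp_norm_le:
  assumes "g \<in> Lp p" "represents g T"
  shows "dist_Lp_norm p T \<le> Lp_norm p g"
  unfolding dist_Lp_norm_def using assms by (intro INF_lower) auto

lemma dist_Lp_norm_lower_order:
  fixes f :: "real ^ 'n \<Rightarrow> complex"
  assumes p: "1 < p" and f: "f \<in> Lp p" and r: "0 < r" "r < r'" "r' < 1" and e: "0 < \<epsilon>"
    and N: "0 \<le> N" "Lp_norm p f \<le> ennreal N"
  shows "dist_Lp_norm p (frac_laplacian r f) \<le>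
    ennreal (\<epsilon> powr (- (r' - r) / 2)) * dist_Lp_norm p (frac_laplacian r' f) + ennreal (2 * \<epsilon> powr (r / 2) * N)"
proof -
  define c where "c = \<epsilon> powr (- (r' - r) / 2)"
  have c: "c > 0" using e by (simp add: c_def)
  define D where "D = dist_Lp_norm p (frac_laplacian r' f)"
  show ?thesis unfolding c_def[symmetric] D_def[symmetric]
  proof (cases "D = \<infinity>")
    case True
    then show "dist_Lp_norm p (frac_laplacian r f) \<le> ennreal c * D + ennreal (2 * \<epsilon> powr (r / 2) * N)"
      using c by (simp add: ennreal_mult_top)
  next
    case False
    show "dist_Lp_norm p (frac_laplacian r f) \<le> ennreal c * D + ennreal (2 * \<epsilon> powr (r / 2) * N)"
    proof (rule ennreal_le_epsilon)
      fix d :: real assume d: "d > 0"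
      have "D < D + ennreal (d / c)" using False d c by (intro less_add_ennreal) auto
      then obtain g where g: "g \<in> Lp p" "represents g (frac_laplacian r' f)" "Lp_norm p g < D + ennreal (d / c)"
        unfolding D_def dist_Lp_norm_def INF_less_iff by blast
      obtain g' where g': "g' \<in> Lp p" "represents g' (frac_laplacian r f)"
        "Lp_norm p g' \<le> ennreal c * Lp_norm p g + ennreal (2 * \<epsilon> powr (r / 2)) * Lp_norm p f"
        using frac_laplacian_lower_order[OF p f r e g(1,2)] unfolding c_def by blast
      have "dist_Lp_norm p (frac_laplacian r f) \<le> Lp_norm p g'" by (rule dist_Lp_norm_le[OF g'(1,2)])
      also have "\<dots> \<le> ennreal c * (D + ennreal (d / c)) + ennreal (2 * \<epsilon> powr (r / 2)) * ennreal N"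
        using g'(3) by (rule order_trans) (intro add_mono mult_left_mono less_imp_le[OF g(3)] N; simp)
      also have "ennreal c * (D + ennreal (d / c)) = ennreal c * D + ennreal d"
        using c d by (simp add: distrib_left flip: ennreal_mult)
      also have "ennreal (2 * \<epsilon> powr (r / 2)) * ennreal N = ennreal (2 * \<epsilon> powr (r / 2) * N)"
        using N by (simp add: ennreal_mult)
      finally show "dist_Lp_norm p (frac_laplacian r f) \<le> ennreal c * D + ennreal (2 * \<epsilon> powr (r / 2) * N) + ennreal d"
        by (simp add: add_ac)
    qed
  qed
qed

lemma limsup_affine_mono:
  fixes x y :: "nat \<Rightarrow> ennreal"
  assumes c: "0 < c" and le: "\<And>k. x k \<le> ennreal c * y k + d"
  shows "limsup x \<le> ennreal c * limsup y + d"
proof (cases "limsup y = \<infinity>")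
  case True
  then show ?thesis using c by (simp add: ennreal_mult_top)
next
  case False
  show ?thesis
  proof (rule ennreal_le_epsilon)
    fix e :: real assume e: "e > 0"
    have "limsup y < limsup y + ennreal (e / c)" using False e c
      by (intro less_add_ennreal) auto
    then have "\<forall>\<^sub>F k in sequentially. y k < limsup y + ennreal (e / c)" by (rule Limsup_lessD)
    then have "\<forall>\<^sub>F k in sequentially. x k \<le> ennreal c * (limsup y + ennreal (e / c)) + d"
    proof eventually_elim
      case (elim k)
      show ?case using le[of k] by (rule order_trans) (intro add_right_mono mult_left_mono less_imp_le[OF elim]; simp)
    qed
    then have "limsup x \<le> ennreal c * (limsup y + ennreal (e / c)) + d" by (rule Limsup_bounded)
    also have "ennreal c * (limsup y + ennreal (e / c)) = ennreal c * limsup y + ennreal e"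
      using c e by (simp add: distrib_left flip: ennreal_mult)
    finally show "limsup x \<le> ennreal c * limsup y + d + ennreal e" by (simp add: add_ac)
  qed
qed

text \<open>
  Along values \<open>r'\<close> tending to \<open>t\<close> that nearly realize the lower limit
  \<open>l'\<close>, the hypothesis bounds \<open>G r\<close> by \<open>\<epsilon> powr (- (t -
  r) / 2) * l' + 2 * \<epsilon> powr (r / 2) * N\<close>. As \<open>r\<close> tends to
  \<open>t\<close> the first factor tends to \<open>1\<close>, so the upper limit exceeds the
  lower one by at most \<open>2 * \<epsilon> powr (t / 2) * N\<close>, for every
  \<open>\<epsilon> \<le> 1\<close>.
\<close>

lemma tendsto_at_left_of_almost_mono:
  fixes G :: "real \<Rightarrow> ennreal"
  assumes t: "0 < t" and N: "0 \<le> N"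
    and G: "\<And>r r' \<epsilon>. 0 < r \<Longrightarrow> r < r' \<Longrightarrow> r' < t \<Longrightarrow> 0 < \<epsilon> \<Longrightarrow>
        G r \<le> ennreal (\<epsilon> powr (- (r' - r) / 2)) * G r' + ennreal (2 * \<epsilon> powr (r / 2) * N)"
    and B: "\<And>r. 0 < r \<Longrightarrow> r < t \<Longrightarrow> G r \<le> ennreal B"
  shows "\<exists>L. (G \<longlongrightarrow> L) (at_left t) \<and> L \<le> ennreal B"
proof -
  have F: "at_left t \<noteq> bot" by simp
  have evt: "\<forall>\<^sub>F r in at_left t. r0 < r \<and> r < t" if "r0 < t" for r0
    using eventually_at_left_real[OF that] by eventually_elim auto
  have evB: "\<forall>\<^sub>F r in at_left t. G r \<le> ennreal B"
    using evt[OF t] by eventually_elim (auto intro: B)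
  define l where "l = Liminf (at_left t) G"
  have ls: "Limsup (at_left t) G \<le> ennreal B" using evB by (rule Limsup_bounded)
  have lil: "l \<le> Limsup (at_left t) G" unfolding l_def by (rule Liminf_le_Limsup[OF F])
  obtain l' where l': "l = ennreal l'" "0 \<le> l'"
    using order_trans[OF lil ls] by (rule ennreal_le_realE)
  have pw: "G r \<le> ennreal (\<epsilon> powr (- (t - r) / 2) * l' + 2 * \<epsilon> powr (r / 2) * N)"
    if r: "0 < r" "r < t" and e: "0 < \<epsilon>" "\<epsilon> \<le> 1" for r \<epsilon>
  proof (rule ennreal_le_epsilon)
    fix d :: real assume d: "d > 0"
    define c where "c = \<epsilon> powr (- (t - r) / 2)"
    have c: "c > 0" using e by (simp add: c_def)
    have "\<not> (\<forall>\<^sub>F r' in at_left t. ennreal (l' + d / c) \<le> G r')"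
    proof
      assume "\<forall>\<^sub>F r' in at_left t. ennreal (l' + d / c) \<le> G r'"
      then have "ennreal (l' + d / c) \<le> l" unfolding l_def by (rule Liminf_bounded)
      then show False using d c l' by simp
    qed
    then have "\<exists>\<^sub>F r' in at_left t. G r' < ennreal (l' + d / c)" by (simp add: frequently_def not_less)
    then have "\<exists>\<^sub>F r' in at_left t. G r' < ennreal (l' + d / c) \<and> (r < r' \<and> r' < t)"
      by (rule frequently_rev_mp) (use evt[OF r(2)] in eventually_elim, simp)
    then obtain r' where r': "G r' < ennreal (l' + d / c)" "r < r'" "r' < t" by (auto dest: frequently_ex)
    have "G r \<le> ennreal (\<epsilon> powr (- (r' - r) / 2)) * G r' + ennreal (2 * \<epsilon> powr (r / 2) * N)"
      by (rule G[OF r(1) r'(2,3) e(1)])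
    also have "\<dots> \<le> ennreal c * ennreal (l' + d / c) + ennreal (2 * \<epsilon> powr (r / 2) * N)"
    proof (intro add_right_mono mult_mono ennreal_leI less_imp_le[OF r'(1)])
      show "\<epsilon> powr (- (r' - r) / 2) \<le> c" unfolding c_def using e r' by (intro powr_mono') auto
    qed simp_all
    also have "\<dots> = ennreal (c * l' + 2 * \<epsilon> powr (r / 2) * N) + ennreal d"
      using c d l' N by (simp add: distrib_left flip: ennreal_mult ennreal_plus)
    finally show "G r \<le> ennreal (\<epsilon> powr (- (t - r) / 2) * l' + 2 * \<epsilon> powr (r / 2) * N) + ennreal d"
      unfolding c_def .
  qed
  have le: "Limsup (at_left t) G \<le> ennreal (l' + 2 * \<epsilon> powr (t / 2) * N)" if e: "0 < \<epsilon>" "\<epsilon> \<le> 1" for \<epsilon>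
  proof -
    define R where "R r = \<epsilon> powr (- (t - r) / 2) * l' + 2 * \<epsilon> powr (r / 2) * N" for r
    have "(R \<longlongrightarrow> \<epsilon> powr (- (t - t) / 2) * l' + 2 * \<epsilon> powr (t / 2) * N) (at_left t)"
      unfolding R_def[abs_def] using e by (intro tendsto_intros) auto
    then have "(R \<longlongrightarrow> l' + 2 * \<epsilon> powr (t / 2) * N) (at_left t)" using e by simp
    then have "((\<lambda>r. ennreal (R r)) \<longlongrightarrow> ennreal (l' + 2 * \<epsilon> powr (t / 2) * N)) (at_left t)" by (rule tendsto_ennrealI)
    from lim_imp_Limsup[OF F this]
    have "Limsup (at_left t) (\<lambda>r. ennreal (R r)) = ennreal (l' + 2 * \<epsilon> powr (t / 2) * N)" .
    moreover have "Limsup (at_left t) G \<le> Limsup (at_left t) (\<lambda>r. ennreal (R r))"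
      proof (rule Limsup_mono)
      show "\<forall>\<^sub>F r in at_left t. G r \<le> ennreal (R r)"
        using evt[OF t] unfolding R_def by eventually_elim (rule pw; use e in blast)
    qed
    ultimately show ?thesis by simp
  qed
  have "Limsup (at_left t) G \<le> l"
  proof (rule ennreal_le_epsilon)
    fix d :: real assume d: "d > 0"
    define \<delta> where "\<delta> = min 1 (d / (2 * (N + 1)))"
    have \<delta>: "\<delta> > 0" "\<delta> \<le> 1" "\<delta> \<le> d / (2 * (N + 1))" using d N by (auto simp: \<delta>_def)
    \<comment> \<open>Chosen such that \<open>\<epsilon> powr (t / 2) = \<delta>\<close>.\<close>
    define \<epsilon> where "\<epsilon> = \<delta> powr (2 / t)"
    have e: "0 < \<epsilon>" "\<epsilon> \<le> 1" using \<delta> t by (auto simp: \<epsilon>_def intro: powr_le1)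
    have "\<epsilon> powr (t / 2) = \<delta>" using t \<delta> by (simp add: \<epsilon>_def powr_powr)
    then have "2 * \<epsilon> powr (t / 2) * N \<le> 2 * (d / (2 * (N + 1))) * N"
      using \<delta> N by (intro mult_right_mono mult_left_mono) auto
    also have "\<dots> = d * (N / (N + 1))" by (simp only: times_divide_eq_right times_divide_eq_left mult_divide_mult_cancel_left_if) simp
    also have "\<dots> \<le> d * 1" using d N by (intro mult_left_mono) auto
    finally have "l' + 2 * \<epsilon> powr (t / 2) * N \<le> l' + d" by simp
    then have "Limsup (at_left t) G \<le> ennreal (l' + d)" using le[OF e] by (meson ennreal_leI order_trans)
    then show "Limsup (at_left t) G \<le> l + ennreal d" using l' d by simp
  qed
  then have "Limsup (at_left t) G = l" using lil by (rule antisym)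
  then have "(G \<longlongrightarrow> l) (at_left t)" using tendsto_iff_Liminf_eq_Limsup[OF F, of G l] by (simp add: l_def)
  moreover have "l \<le> ennreal B" using lil ls by (rule order_trans)
  ultimately show ?thesis by blast
qed

section \<open>Boundedness and limits as the order tends to the critical one\<close>

text \<open>
  Functions representing orders that increase to \<open>t\<close> are bounded in
  \<open>L\<^sup>p\<close>. Since \<open>frac_laplacian r f \<phi>\<close> is continuous in the
  order, their weak limit represents the order \<open>t\<close>.
\<close>

lemma H_space_of_bounded_orders:
  fixes f :: "real ^ 'n \<Rightarrow> complex"
  assumes p: "1 < p" and t: "0 < t" "t < 1" and f: "f \<in> Lp p" and M: "0 \<le> M"
    and v: "\<And>r. 0 < r \<Longrightarrow> r < t \<Longrightarrow> \<exists>v\<in>borel_measurable borel. power_integral p v \<le> ennreal M \<and> represents v (frac_laplacian r f)"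
  shows "f \<in> H_space t p"
proof -
  define r where "r j = t - t / 2 * inverse (real (Suc j))" for j
  have i: "inverse (real (Suc j)) > 0" "inverse (real (Suc j)) \<le> 1" for j by (auto simp: field_simps)
  have rj: "t / 2 \<le> r j" "r j < t" for j
  proof -
    have "t / 2 * inverse (real (Suc j)) \<le> t / 2 * 1" using i[of j] t by (intro mult_left_mono) auto
    then show "t / 2 \<le> r j" unfolding r_def by (simp add: field_simps)
    have "t / 2 * inverse (real (Suc j)) > 0" using i[of j] t by (intro mult_pos_pos) auto
    then show "r j < t" unfolding r_def by simp
  qed
  have "r \<longlonglongrightarrow> t - t / 2 * 0" unfolding r_def by (intro tendsto_intros LIMSEQ_inverse_real_of_nat)
  then have rt: "r \<longlonglongrightarrow> t" by simp
  have r0: "0 < r j" for j using rj(1)[of j] t by simp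
  have "\<forall>j. \<exists>v. v \<in> borel_measurable borel \<and> power_integral p v \<le> ennreal M \<and> represents v (frac_laplacian (r j) f)"
    using v[OF r0 rj(2)] by blast
  then obtain w where w: "\<And>j. w j \<in> borel_measurable borel" "\<And>j. power_integral p (w j) \<le> ennreal M"
    "\<And>j. represents (w j) (frac_laplacian (r j) f)" by metis
  have "\<exists>v\<in>borel_measurable borel. power_integral p v \<le> ennreal M \<and> (\<forall>\<phi>\<in>schwartz. frac_laplacian t f \<phi> = (\<integral>x. v x * \<phi> x \<partial>lborel))"
  proof (rule Lp_weak_limit[where g=w, OF p w(1,2) M])
    show "integrable lborel \<phi>" if "\<phi> \<in> schwartz" for \<phi> :: "real ^ 'n \<Rightarrow> complex" using that by (rule schwartz_integrable)
    show "\<exists>B. \<forall>x. norm (\<phi> x) \<le> B" if "\<phi> \<in> schwartz" for \<phi> :: "real ^ 'n \<Rightarrow> complex" using that by (rule schwartz_bounded)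
    show "(\<lambda>k. \<integral>x. w k x * \<phi> x \<partial>lborel) \<longlonglongrightarrow> frac_laplacian t f \<phi>" if \<phi>: "\<phi> \<in> schwartz" for \<phi>
    proof -
      have t2: "0 < t / 2" using t by simp
      have "(\<lambda>k. frac_laplacian (r k) f \<phi>) \<longlonglongrightarrow> frac_laplacian t f \<phi>"
        by (rule frac_laplacian_order_tendsto[OF p \<phi> f t rj(1) less_imp_le[OF rj(2)] t2 rt])
      then show ?thesis using w(3) \<phi> unfolding represents_def by simp
    qed
  qed
  then obtain g where g: "g \<in> borel_measurable borel" "power_integral p g \<le> ennreal M" "represents g (frac_laplacian t f)"
    unfolding represents_def by blast
  have "g \<in> Lp p" using g unfolding Lp_iff by (auto elim!: le_less_trans)
  then show ?thesis using f g(3) unfolding H_space_def by blast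
qed

theorem theorem3p2:
  fixes p t :: real
  assumes "1 < p" and "0 < t" and "t < 1"
  shows "\<exists>C::real. C > 0 \<and>
    (\<forall>(F :: nat \<Rightarrow> real ^ 'n \<Rightarrow> complex) (f :: real ^ 'n \<Rightarrow> complex) (s :: nat \<Rightarrow> real) (\<Lambda> :: ennreal).
       Lp_weakly_converges p F f \<longrightarrow>
       (\<forall>k. 0 < s k \<and> s k < t) \<longrightarrow> incseq s \<longrightarrow> s \<longlonglongrightarrow> t \<longrightarrow>
       \<Lambda> = (SUP k. Lp_norm p (F k)
                   + ennreal ((t - s k) powr (1 / p)) * Butzer_seminorm (s k) p t (F k)) \<longrightarrow>
       \<Lambda> < \<infinity> \<longrightarrow>
       f \<in> H_space t p \<and>
       (\<exists>L :: ennreal.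
          ((\<lambda>r. limsup (\<lambda>k. dist_Lp_norm p (frac_laplacian r (F k)))) \<longlongrightarrow> L) (at_left t) \<and>
          L \<le> ennreal C * \<Lambda>))"
proof -
  obtain C t0 where C: "C > 0" and t0: "t0 < t" "0 < t0"
    and est: "\<And>f r s L. f \<in> (Lp p :: (real ^ 'n \<Rightarrow> complex) set) \<Longrightarrow> 0 < r \<Longrightarrow> max t0 r < 2 * s - t \<Longrightarrow> s < t \<Longrightarrow> 0 \<le> L \<Longrightarrow>
      Lp_norm p f + ennreal ((t - s) powr (1 / p)) * Butzer_seminorm s p t f \<le> ennreal L \<Longrightarrow>
      \<exists>g\<in>Lp p. represents g (frac_laplacian r f) \<and> Lp_norm p g \<le> ennreal (C * L)"
    using lower_order_estimate[OF assms, where 'n='n] by blast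
  have "f \<in> H_space t p \<and>
     (\<exists>L. ((\<lambda>r. limsup (\<lambda>k. dist_Lp_norm p (frac_laplacian r (F k)))) \<longlongrightarrow> L) (at_left t) \<and> L \<le> ennreal C * \<Lambda>)"
    if weak: "Lp_weakly_converges p F f" and s: "\<forall>k. 0 < s k \<and> s k < t" and st: "s \<longlonglongrightarrow> t"
      and Lam: "\<Lambda> = (SUP k. Lp_norm p (F k) + ennreal ((t - s k) powr (1 / p)) * Butzer_seminorm (s k) p t (F k))"
      and fin: "\<Lambda> < \<infinity>"
    for F :: "nat \<Rightarrow> real ^ 'n \<Rightarrow> complex" and f s \<Lambda>
  proof -
    obtain L where L: "\<Lambda> = ennreal L" "0 \<le> L" using fin by (cases \<Lambda>) auto
    have FLp: "F k \<in> Lp p" and fLp: "f \<in> Lp p" for k using weak unfolding Lp_weakly_converges_def by auto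
    have bd: "Lp_norm p (F k) + ennreal ((t - s k) powr (1 / p)) * Butzer_seminorm (s k) p t (F k) \<le> ennreal L" for k
      unfolding L(1)[symmetric] Lam by (rule SUP_upper) simp
    have FN: "Lp_norm p (F k) \<le> ennreal L" for k using bd[of k] by (rule order_trans[rotated]) simp
    \<comment> \<open>The orders \<open>2 * s k - t\<close> tend to \<open>t\<close>, so each order below
      \<open>t\<close> is eventually below them.\<close>
    have rep: "\<exists>k0. \<forall>k\<ge>k0. \<exists>g\<in>Lp p. represents g (frac_laplacian r (F k)) \<and> Lp_norm p g \<le> ennreal (C * L)"
      if r: "0 < r" "r < t" for r
    proof -
      have "(\<lambda>k. 2 * s k - t) \<longlonglongrightarrow> 2 * t - t" by (intro tendsto_intros st)
      then have "\<forall>\<^sub>F k in sequentially. max t0 r < 2 * s k - t"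
        using t0 r by (intro order_tendstoD(1)[of _ "2 * t - t"]) auto
      then obtain k0 where "\<And>k. k \<ge> k0 \<Longrightarrow> max t0 r < 2 * s k - t" unfolding eventually_sequentially by blast
      then show ?thesis using est[OF FLp r(1) _ _ L(2) bd] s by blast
    qed
    have CL: "0 \<le> C * L" using C L by simp
    have p0: "0 < p" using assms by simp
    define G where "G r = limsup (\<lambda>k. dist_Lp_norm p (frac_laplacian r (F k)))" for r
    have "\<exists>L'. (G \<longlongrightarrow> L') (at_left t) \<and> L' \<le> ennreal (C * L)"
    proof (rule tendsto_at_left_of_almost_mono[OF assms(2) L(2)])
      show "G r \<le> ennreal (\<epsilon> powr (- (r' - r) / 2)) * G r' + ennreal (2 * \<epsilon> powr (r / 2) * L)"
        if "0 < r" "r < r'" "r' < t" "0 < \<epsilon>" for r r' \<epsilon>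
        unfolding G_def
        proof (rule limsup_affine_mono)
        show "0 < \<epsilon> powr (- (r' - r) / 2)" using that by simp
        have "r' < 1" using that assms by simp
        then show "dist_Lp_norm p (frac_laplacian r (F k)) \<le> ennreal (\<epsilon> powr (- (r' - r) / 2)) *
          dist_Lp_norm p (frac_laplacian r' (F k)) + ennreal (2 * \<epsilon> powr (r / 2) * L)" for k
          by (rule dist_Lp_norm_lower_order[OF assms(1) FLp that(1,2) _ that(4) L(2) FN])
      qed
      show "G r \<le> ennreal (C * L)" if r: "0 < r" "r < t" for r
      proof -
        obtain k0 where k0: "\<And>k. k \<ge> k0 \<Longrightarrow> \<exists>g\<in>Lp p. represents g (frac_laplacian r (F k)) \<and> Lp_norm p g \<le> ennreal (C * L)"
          using rep[OF r] by blast
        have "\<forall>\<^sub>F k in sequentially. dist_Lp_norm p (frac_laplacian r (F k)) \<le> ennreal (C * L)"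
          unfolding eventually_sequentially using k0 dist_Lp_norm_le order_trans by blast
        then show ?thesis unfolding G_def by (rule Limsup_bounded)
      qed
    qed
    moreover have "ennreal (C * L) = ennreal C * \<Lambda>" using C L by (simp add: ennreal_mult)
    moreover have "f \<in> H_space t p"
    proof (rule H_space_of_bounded_orders[OF assms fLp])
      show "0 \<le> (C * L) powr p" by simp
      fix r assume r: "0 < r" "r < t"
      then have r1: "r < 1" using assms by simp
      obtain k0 where k0: "\<And>k. k \<ge> k0 \<Longrightarrow> \<exists>g\<in>Lp p. represents g (frac_laplacian r (F k)) \<and> Lp_norm p g \<le> ennreal (C * L)"
        using rep[OF r] by blast
      have "\<forall>k. \<exists>g. g \<in> Lp p \<and> represents g (frac_laplacian r (F (k + k0))) \<and> Lp_norm p g \<le> ennreal (C * L)"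
        using k0 by (metis le_add2)
      \<comment> \<open>The shift by \<open>k0\<close> discards the terms for which no bound at the order
        \<open>r\<close> is known.\<close>
      then obtain g where g: "\<And>k. g k \<in> Lp p" "\<And>k. represents (g k) (frac_laplacian r (F (k + k0)))" "\<And>k. Lp_norm p (g k) \<le> ennreal (C * L)"
        by metis
      have gm: "g k \<in> borel_measurable borel" "power_integral p (g k) \<le> ennreal ((C * L) powr p)" for k
        using g(1)[of k] power_integral_leI[OF p0 CL g(3)] by (auto simp: Lp_iff)
      have "\<exists>v\<in>borel_measurable borel. power_integral p v \<le> ennreal ((C * L) powr p) \<and> (\<forall>\<phi>\<in>schwartz. frac_laplacian r f \<phi> = (\<integral>x. v x * \<phi> x \<partial>lborel))"
      proof (rule Lp_weak_limit[where g=g, OF assms(1) gm powr_ge_zero])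
        show "integrable lborel \<phi>" if "\<phi> \<in> schwartz" for \<phi> :: "real ^ 'n \<Rightarrow> complex" using that by (rule schwartz_integrable)
        show "\<exists>B. \<forall>x. norm (\<phi> x) \<le> B" if "\<phi> \<in> schwartz" for \<phi> :: "real ^ 'n \<Rightarrow> complex" using that by (rule schwartz_bounded)
        show "(\<lambda>k. \<integral>x. g k x * \<phi> x \<partial>lborel) \<longlonglongrightarrow> frac_laplacian r f \<phi>" if \<phi>: "\<phi> \<in> schwartz" for \<phi>
        proof -
          have "(\<lambda>k. frac_laplacian r (F k) \<phi>) \<longlonglongrightarrow> frac_laplacian r f \<phi>"
            using weak frac_laplacian_functional[OF assms(1) \<phi> r(1) r1] unfolding Lp_weakly_converges_def by blast
          then have "(\<lambda>k. frac_laplacian r (F (k + k0)) \<phi>) \<longlonglongrightarrow> frac_laplacian r f \<phi>" by (rule LIMSEQ_ignore_initial_segment)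
          then show ?thesis using g(2) \<phi> unfolding represents_def by simp
        qed
      qed
      then show "\<exists>v\<in>borel_measurable borel. power_integral p v \<le> ennreal ((C * L) powr p) \<and> represents v (frac_laplacian r f)"
        unfolding represents_def .
    qed
    ultimately show ?thesis unfolding G_def[abs_def] by simp
  qed
  then show ?thesis using C by (intro exI[of _ C]) blast
qed

end
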